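(* Consider the unspecified density experiments $\mathcal E^{(n)}_{\rm global}=\big(\mathbb R^{n\times d},\mathcal B^{n\times d},\{{\rm P}^{(n)}_{\boldsymbol\theta,f}:\boldsymbol\theta\in\mathbb R^k,f\in\mathcal F\}\big)$, with residuals $\mathbf Z^{(n)}_1(\boldsymbol\theta),\dots,\mathbf Z^{(n)}_n(\boldsymbol\theta)$. Assume that LAN holds, let $\mathcal E^{(n)}=\mathcal E^{(n)}_{\boldsymbol\theta_0,f_0}$ be the local experiments at $(\boldsymbol\theta_0,f_0)$ with local parameters $(\boldsymbol\tau,\eta)\in\mathbb R^k\times\Upsilon_{f_0}$, where $\Upsilon_{f_0}$ is assumed separable, and let $\mathcal E_{\rm drift}$ be their limiting Brownian drift experiment. Denote by $\mathbf F^{(n)}_\pm$ the empirical center-outward distribution function computed from $\mathbf Z^{(n)}_1(\boldsymbol\theta_0),\dots,\mathbf Z^{(n)}_n(\boldsymbol\theta_0)$ and let $$\mathcal B^{\ddagger(n)}_{\boldsymbol\theta_0}:=\sigma\big(\mathbf F^{(n)}_\pm(\mathbf Z^{(n)}_1(\boldsymbol\theta_0)),\dots,\mathbf F^{(n)}_\pm(\mathbf Z^{(n)}_n(\boldsymbol\theta_0))\big)$$ be the $\sigma$-field generated by the center-outward ranks and signs of the residuals. Then: (i) the sequence $\mathbf F^{(n)}_\pm(\mathbf Z^{(n)}_1(\boldsymbol\theta_0)),\dots,\mathbf F^{(n)}_\pm(\mathbf Z^{(n)}_n(\boldsymbol\theta_0))$, $n\in\mathbb N$, asymptotically $\mathcal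 E^{(n)}$-weakly generates $\mathcal B^{\ddagger}_{\boldsymbol\theta_0}:=\sigma\big(\{B_\eta(u):\eta\in\Upsilon_{f_0},\,u\in[0,1]\}\big)$, that is, $\mathcal B^{\ddagger(n)}_{\boldsymbol\theta_0}$ converges $\mathcal E^{(n)}$-weakly to $\mathcal B^{\ddagger}_{\boldsymbol\theta_0}$ as $n\to\infty$; (ii) the sequence $\mathcal B^{\ddagger(n)}_{\boldsymbol\theta_0}$ of $\sigma$-fields is strongly maximal ancillary.
   Context: Unspecified density experiments. The observation is $\mathbf X^{(n)}=(\mathbf X^{(n)}_1,\dots,\mathbf X^{(n)}_n)$ with $\mathbf X^{(n)}_i\in\mathbb R^d$; $\boldsymbol\theta\in\mathbb R^k$ is the parameter of interest; the nuisance $f$ ranges over a broad class $\mathcal F$ of Lebesgue densities on $\mathbb R^d$. There is a residual function $(\mathbf X^{(n)},\boldsymbol\theta)\mapsto\mathbf Z^{(n)}(\boldsymbol\theta)=(\mathbf Z^{(n)}_1(\boldsymbol\theta),\dots,\mathbf Z^{(n)}_n(\boldsymbol\theta))$ from $\mathbb R^{n\times d}\times\mathbb R^k$ to $\mathbb R^{n\times d}$ such that $\mathbf X^{(n)}\sim{\rm P}^{(n)}_{\boldsymbol\theta,f}$ if and only if $\mathbf Z^{(n)}_1(\boldsymbol\theta),\dots,\mathbf Z^{(n)}_n(\boldsymbol\theta)$ are i.i.d. with density $f$. Within each experiment all probability measures are mutually absolutely continuous. Local experiments. Fix $\boldsymbol\theta_0\in\mathbb R^k$, $f_0\in\mathcal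 F$; $\mu_d$ is Lebesgue measure on $\mathbb R^d$ and $\Upsilon_{f_0}=\{\eta:\mathbb R^d\to\mathbb R\mid\int\eta f_0\,\mathrm d\mu_d=0,\ \int\eta^2f_0\,\mathrm d\mu_d<\infty\}$. The local experiment is $\mathcal E^{(n)}_{\boldsymbol\theta_0,f_0}=\big(\mathbb R^{n\times d},\mathcal B^{n\times d},\{\mathbb P^{(n)}_{\boldsymbol\tau,\eta}\}\big)$ with $\mathbb P^{(n)}_{\boldsymbol\tau,\eta}={\rm P}^{(n)}_{\boldsymbol\theta_0+n^{-1/2}\boldsymbol\tau,\,(1+n^{-1/2}\eta)f_0}$; following the paper's convention, $\eta\mapsto(1+n^{-1/2}\eta)f_0$ parametrizes the nuisance class $\mathcal F$, so that the nuisance subexperiment $\mathcal E^{(n)}_{\mathbf 0}$ ($\boldsymbol\tau=\mathbf 0$) has family $\{\mathbb P^{(n)}_{\mathbf 0,\eta}\}=\{{\rm P}^{(n)}_{\boldsymbol\theta_0,f}:f\in\mathcal F\}$. LAN means that $\mathcal E^{(n)}_{\boldsymbol\theta_0,f_0}$ converges weakly in the Le Cam sense (finite-dimensional convergence in distribution of likelihood ratios with respect to $\mathbb P^{(n)}_{\mathbf 0,0}$) to a Gaussian shift experiment, or equivalently to the following Brownian drift experiment. Limiting Brownian drift experiment $\mathcal E_{\rm drift}$ (family $\{\mathbb P_{\boldsymbol\tau,\eta}\}$). The observation is a family of processes $\boldsymbol\Delta_{\rm int}(u)\in\mathbb R^k$ and $\Delta_{{\rm nuis},\eta}(u)\in\mathbb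 R$, $\eta\in\Upsilon_{f_0}$, $u\in[0,1]$, jointly Brownian motions with covariances at $u=1$ given by $\boldsymbol{\mathcal I}_{I,I}$ (for $\boldsymbol\Delta_{\rm int}$), $\boldsymbol{\mathcal I}_{I,\eta}$ (between $\boldsymbol\Delta_{\rm int}$ and $\Delta_{{\rm nuis},\eta}$) and $\mathcal I_{\eta\eta'}=\int\eta\eta'f_0\,\mathrm d\mu_d$, the information quantities of the LAN experiment; under $\mathbb P_{\mathbf 0,0}$ the drifts are zero, and under $\mathbb P_{\boldsymbol\tau,\eta}$ they are $\boldsymbol{\mathcal I}_{I,I}\boldsymbol\tau+\boldsymbol{\mathcal I}_{I,\eta}$ for $\boldsymbol\Delta_{\rm int}$ and $\boldsymbol{\mathcal I}_{I,\eta'}^\top\boldsymbol\tau+\mathcal I_{\eta\eta'}$ for $\Delta_{{\rm nuis},\eta'}$. Put $B_\eta(u)=\Delta_{{\rm nuis},\eta}(u)-u\,\Delta_{{\rm nuis},\eta}(1)$. Center-outward distribution function. Let $\mathbb S_d$ be the open unit ball of $\mathbb R^d$ and ${\rm U}_d$ the spherical uniform over $\mathbb S_d$ (product of the uniform over the unit sphere and the uniform over the distance to the origin). Factorize $n=n_Rn_S+n_0$ with $n_0<\min(n_R,n_S)$, and let the grid $\mathfrak G^{(n)}=\{\mathfrak g^{(n)}_1,\dots,\mathfrak g^{(n)}_n\}$ consist of the $n_Rn_S$ intersections of $n_S$ radii (unit vectors) of $\mathbb S_d$ with the spheres centered at the origin with radii $\frac{1}{n_R+1},\dots,\frac{n_R}{n_R+1}$,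 together with $n_0$ copies of the origin (with a tie-breaking device if $n_0>1$); the empirical distribution over $\mathfrak G^{(n)}$ converges weakly to ${\rm U}_d$ as $n\to\infty$. For $\mathbf Z_1,\dots,\mathbf Z_n$ in $\mathbb R^d$, $\mathbf F^{(n)}_\pm(\mathbf Z_i)=\mathfrak g^{(n)}_{\pi(i)}$, where $\pi$ minimizes $\sum_{i=1}^n\|\mathbf Z_i-\mathfrak g^{(n)}_{\pi(i)}\|^2$ over permutations of $\{1,\dots,n\}$. The center-outward ranks and signs are $(n_R+1)\|\mathbf F^{(n)}_\pm(\mathbf Z_i)\|$ and $\mathbf F^{(n)}_\pm(\mathbf Z_i)/\|\mathbf F^{(n)}_\pm(\mathbf Z_i)\|$. Weak convergence of $\sigma$-fields. A sequence $\xi_n$ of random variables on $\mathcal E^{(n)}$ converges $\mathcal E^{(n)}$-weakly to a random variable $\xi$ on $\mathcal E_{\rm drift}$ if, for every finite set $J$ of values $(\boldsymbol\tau,\eta)$, under $\mathbb P^{(n)}_{\mathbf 0,0}$, $\big((\mathrm d\mathbb P^{(n)}_{\boldsymbol\tau,\eta}/\mathrm d\mathbb P^{(n)}_{\mathbf 0,0})_{J},\xi_n\big)$ converges in distribution to $\big((\mathrm d\mathbb P_{\boldsymbol\tau,\eta}/\mathrm d\mathbb P_{\mathbf 0,0})_{J},\xi\big)$ considered under $\mathbb P_{\mathbf 0,0}$ (Radon-Nikodym derivatives of absolutely continuous parts). Sub-$\sigma$-fields $\mathcal A^{(n)}$ converge $\mathcal E^{(n)}$-weakly to $\mathcal A$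 if every $\mathcal A$-measurable $\xi$ is the $\mathcal E^{(n)}$-weak limit of a sequence of $\mathcal A^{(n)}$-measurable $\xi_n$. Strong maximal ancillarity. The sequence $\mathcal B^{\ddagger(n)}_{\boldsymbol\theta_0}$ is strongly maximal ancillary if (a) for each $n$, $\mathcal E^{(n)}_{\mathbf 0}$ admits a minimal sufficient and boundedly complete $\sigma$-field $\mathcal B^{(n)}_{\rm suff}$, and $\mathcal B^{\ddagger(n)}_{\boldsymbol\theta_0}$ is maximal ancillary in $\mathcal E^{(n)}_{\mathbf 0}$ (equivalently, is ancillary with $\sigma(\mathcal B^{(n)}_{\rm suff}\cup\mathcal B^{\ddagger(n)}_{\boldsymbol\theta_0})$ equal to the full $\sigma$-field); and (b) $\mathcal B^{\ddagger(n)}_{\boldsymbol\theta_0}$ converges $\mathcal E^{(n)}$-weakly to $\mathcal B^{\ddagger}_{\boldsymbol\theta_0}$. Ancillary: the probability of each event of the $\sigma$-field is the same under all measures of the experiment; maximal is meant for inclusion up to null sets. A $\sigma$-field is boundedly complete if a bounded random variable measurable with respect to it and having zero expectation under all measures of the experiment is a.s. zero under all of them. *)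

theory Defs
  imports "HOL-Probability.Probability"
begin

definition conv_in_dist ::
  "(nat \<Rightarrow> 'a measure) \<Rightarrow> (nat \<Rightarrow> 'a \<Rightarrow> 'b::topological_space) \<Rightarrow> 'c measure \<Rightarrow> ('c \<Rightarrow> 'b) \<Rightarrow> bool"
  where
  "conv_in_dist M X N Y \<longleftrightarrow>
     (\<forall>h :: 'b \<Rightarrow> real. continuous_on UNIV h \<and> bounded (range h) \<longrightarrow>
        (\<lambda>n. \<integral>x. h (X n x) \<partial>M n) \<longlonglongrightarrow> (\<integral>y. h (Y y) \<partial>N))"

definition generated_algebra ::
  "'a set \<Rightarrow> 'i set \<Rightarrow> ('i \<Rightarrow> 'a \<Rightarrow> 'b::topological_space) \<Rightarrow> 'a measure"
  where
  "generated_algebra \<Omega> I X = sigma \<Omega> (\<Union>i\<in>I. (\<lambda>A. X i -` A \<inter> \<Omega>) ` sets borel)"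


text \<open>
  A (sub-)\<open>\<sigma>\<close>-field is represented by a measure of which only the space and the measurable sets
  matter; the family of measures of an experiment is a set of measures with common measurable sets.
\<close>

definition null_included :: "'a measure set \<Rightarrow> 'a measure \<Rightarrow> 'a measure \<Rightarrow> bool" where
  "null_included \<P> A B \<longleftrightarrow>
     (\<forall>a\<in>sets A. \<exists>b\<in>sets B. \<forall>P\<in>\<P>. (a - b) \<union> (b - a) \<in> null_sets P)"

definition sufficient :: "'a measure set \<Rightarrow> 'a measure \<Rightarrow> bool" where
  "sufficient \<P> S \<longleftrightarrow>
     (\<forall>P\<in>\<P>. subalgebra P S) \<and>
     (\<forall>B \<in> (\<Inter>P\<in>\<P>. sets P). \<exists>g \<in> borel_measurable S.
        \<forall>P\<in>\<P>. AE x in P. real_cond_exp P S (indicator B) x = g x)"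

definition minimal_sufficient :: "'a measure set \<Rightarrow> 'a measure \<Rightarrow> bool" where
  "minimal_sufficient \<P> S \<longleftrightarrow>
     sufficient \<P> S \<and> (\<forall>S'. sufficient \<P> S' \<longrightarrow> null_included \<P> S S')"

definition boundedly_complete :: "'a measure set \<Rightarrow> 'a measure \<Rightarrow> bool" where
  "boundedly_complete \<P> S \<longleftrightarrow>
     (\<forall>P\<in>\<P>. subalgebra P S) \<and>
     (\<forall>g :: 'a \<Rightarrow> real. g \<in> borel_measurable S \<and> bounded (g ` space S) \<and>
          (\<forall>P\<in>\<P>. (\<integral>x. g x \<partial>P) = 0) \<longrightarrow>
        (\<forall>P\<in>\<P>. AE x in P. g x = 0))"

definition ancillary :: "'a measure set \<Rightarrow> 'a measure \<Rightarrow> bool" where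
  "ancillary \<P> A \<longleftrightarrow>
     (\<forall>P\<in>\<P>. subalgebra P A) \<and>
     (\<forall>a\<in>sets A. \<forall>P\<in>\<P>. \<forall>Q\<in>\<P>. measure P a = measure Q a)"

definition maximal_ancillary :: "'a measure set \<Rightarrow> 'a measure \<Rightarrow> bool" where
  "maximal_ancillary \<P> A \<longleftrightarrow>
     ancillary \<P> A \<and>
     (\<forall>A'. ancillary \<P> A' \<and> null_included \<P> A A' \<longrightarrow> null_included \<P> A' A)"


text \<open>
  A sequence of experiments is given by \<open>E n j\<close> for parameter values \<open>j \<in> \<Lambda> n\<close>, the limit experiment
  by \<open>D j\<close>, and \<open>j0\<close> is the reference parameter value. A finite vector of likelihood ratios
  indexed by \<open>J\<close> is encoded as a function which vanishes outside \<open>J\<close>. All measures considered are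
  dominated by the reference one, so that \<^const>\<open>RN_deriv\<close> is the derivative of the
  absolutely continuous part. Finite sets \<open>J\<close> consist of parameter values that belong to the
  \<open>n\<close>-th experiment for all large \<open>n\<close>; the finitely many other \<open>n\<close> do not affect the limits.
\<close>

definition lik_ratios :: "('j \<Rightarrow> 'a measure) \<Rightarrow> 'j \<Rightarrow> 'j set \<Rightarrow> 'a \<Rightarrow> 'j \<Rightarrow> real" where
  "lik_ratios E j0 J x = (\<lambda>j. if j \<in> J then enn2real (RN_deriv (E j0) (E j) x) else 0)"

definition eventual_params :: "(nat \<Rightarrow> 'j set) \<Rightarrow> 'j set" where
  "eventual_params \<Lambda> = {j. \<forall>\<^sub>F n in sequentially. j \<in> \<Lambda> n}"

definition experiments_converge ::
  "(nat \<Rightarrow> 'j \<Rightarrow> 'a measure) \<Rightarrow> (nat \<Rightarrow> 'j set) \<Rightarrow> 'j \<Rightarrow> ('j \<Rightarrow> 'b measure) \<Rightarrow> bool" where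
  "experiments_converge E \<Lambda> j0 D \<longleftrightarrow>
     (\<forall>J. finite J \<and> J \<subseteq> eventual_params \<Lambda> \<longrightarrow>
        conv_in_dist (\<lambda>n. E n j0) (\<lambda>n. lik_ratios (E n) j0 J) (D j0) (lik_ratios D j0 J))"

definition rv_weakly_converges ::
  "(nat \<Rightarrow> 'j \<Rightarrow> 'a measure) \<Rightarrow> (nat \<Rightarrow> 'j set) \<Rightarrow> 'j \<Rightarrow> ('j \<Rightarrow> 'b measure) \<Rightarrow>
     (nat \<Rightarrow> 'a \<Rightarrow> real) \<Rightarrow> ('b \<Rightarrow> real) \<Rightarrow> bool" where
  "rv_weakly_converges E \<Lambda> j0 D \<xi>n \<xi> \<longleftrightarrow>
     (\<forall>J. finite J \<and> J \<subseteq> eventual_params \<Lambda> \<longrightarrow>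
        conv_in_dist (\<lambda>n. E n j0) (\<lambda>n x. (lik_ratios (E n) j0 J x, \<xi>n n x))
          (D j0) (\<lambda>y. (lik_ratios D j0 J y, \<xi> y)))"

definition algebras_weakly_converge ::
  "(nat \<Rightarrow> 'j \<Rightarrow> 'a measure) \<Rightarrow> (nat \<Rightarrow> 'j set) \<Rightarrow> 'j \<Rightarrow> ('j \<Rightarrow> 'b measure) \<Rightarrow>
     (nat \<Rightarrow> 'a measure) \<Rightarrow> 'b measure \<Rightarrow> bool" where
  "algebras_weakly_converge E \<Lambda> j0 D An A \<longleftrightarrow>
     (\<forall>\<xi> :: 'b \<Rightarrow> real. \<xi> \<in> borel_measurable A \<longrightarrow>
        (\<exists>\<xi>n. (\<forall>n. \<xi>n n \<in> borel_measurable (An n)) \<and> rv_weakly_converges E \<Lambda> j0 D \<xi>n \<xi>))"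

text \<open>\<open>E0 n\<close> is the family of measures of the \<open>n\<close>-th nuisance subexperiment.\<close>

definition strongly_maximal_ancillary ::
  "(nat \<Rightarrow> 'a measure set) \<Rightarrow>
     (nat \<Rightarrow> 'j \<Rightarrow> 'a measure) \<Rightarrow> (nat \<Rightarrow> 'j set) \<Rightarrow> 'j \<Rightarrow> ('j \<Rightarrow> 'b measure) \<Rightarrow>
     (nat \<Rightarrow> 'a measure) \<Rightarrow> 'b measure \<Rightarrow> bool" where
  "strongly_maximal_ancillary E0 E \<Lambda> j0 D An A \<longleftrightarrow>
     (\<forall>n\<ge>1. (\<exists>S. minimal_sufficient (E0 n) S \<and> boundedly_complete (E0 n) S) \<and>
             maximal_ancillary (E0 n) (An n)) \<and>
     algebras_weakly_converge E \<Lambda> j0 D An A"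


text \<open>Observations and residuals in \<open>\<real>\<^sup>n\<^sup>\<times>\<^sup>d\<close> are functions on \<open>{..<n}\<close> with values in \<open>\<real>\<^sup>d\<close>.\<close>

abbreviation obs_space :: "nat \<Rightarrow> (nat \<Rightarrow> real ^ 'd) measure" where
  "obs_space n \<equiv> PiM {..<n} (\<lambda>_. borel)"

definition iid_with_density ::
  "nat \<Rightarrow> 'a measure \<Rightarrow> ('a \<Rightarrow> nat \<Rightarrow> real ^ 'd) \<Rightarrow> (real ^ 'd \<Rightarrow> real) \<Rightarrow> bool" where
  "iid_with_density n Q Z f \<longleftrightarrow>
     prob_space.indep_vars Q (\<lambda>_. borel) (\<lambda>i x. Z x i) {..<n} \<and>
     (\<forall>i<n. distributed Q lborel (\<lambda>x. Z x i) (\<lambda>y. ennreal (f y)))"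

definition unspecified_density_experiments ::
  "(nat \<Rightarrow> real ^ 'k \<Rightarrow> (real ^ 'd \<Rightarrow> real) \<Rightarrow> (nat \<Rightarrow> real ^ 'd) measure) \<Rightarrow>
     (nat \<Rightarrow> real ^ 'k \<Rightarrow> (nat \<Rightarrow> real ^ 'd) \<Rightarrow> nat \<Rightarrow> real ^ 'd) \<Rightarrow>
     (real ^ 'd \<Rightarrow> real) set \<Rightarrow> bool" where
  "unspecified_density_experiments P Z F \<longleftrightarrow>
     (\<forall>f\<in>F. f \<in> borel_measurable borel \<and> (\<forall>x. 0 \<le> f x) \<and> has_bochner_integral lborel f 1) \<and>
     (\<forall>n\<ge>1. \<forall>\<theta>. Z n \<theta> \<in> obs_space n \<rightarrow>\<^sub>M obs_space n) \<and>
     (\<forall>n\<ge>1. \<forall>\<theta>. \<forall>f\<in>F. prob_space (P n \<theta> f) \<and> sets (P n \<theta> f) = sets (obs_space n)) \<and>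
     (\<forall>n\<ge>1. \<forall>\<theta>. \<forall>f\<in>F. \<forall>Q. prob_space Q \<and> sets Q = sets (obs_space n) \<longrightarrow>
        (Q = P n \<theta> f \<longleftrightarrow> iid_with_density n Q (Z n \<theta>) f)) \<and>
     (\<forall>n\<ge>1. \<forall>\<theta> \<theta>'. \<forall>f\<in>F. \<forall>f'\<in>F. absolutely_continuous (P n \<theta> f) (P n \<theta>' f'))"

definition score_space :: "(real ^ 'd \<Rightarrow> real) \<Rightarrow> (real ^ 'd \<Rightarrow> real) set" where
  "score_space f0 =
     {\<eta> \<in> borel_measurable borel.
        has_bochner_integral lborel (\<lambda>x. \<eta> x * f0 x) 0 \<and>
        integrable lborel (\<lambda>x. (\<eta> x)\<^sup>2 * f0 x)}"

definition separable_scores :: "(real ^ 'd \<Rightarrow> real) \<Rightarrow> bool" where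
  "separable_scores f0 \<longleftrightarrow>
     (\<exists>C. countable C \<and> C \<subseteq> score_space f0 \<and>
        (\<forall>\<eta>\<in>score_space f0. \<forall>\<epsilon>>0. \<exists>\<eta>'\<in>C. (\<integral>x. (\<eta> x - \<eta>' x)\<^sup>2 * f0 x \<partial>lborel) < \<epsilon>))"

definition local_density ::
  "(real ^ 'd \<Rightarrow> real) \<Rightarrow> nat \<Rightarrow> (real ^ 'd \<Rightarrow> real) \<Rightarrow> real ^ 'd \<Rightarrow> real" where
  "local_density f0 n \<eta> x = (1 + \<eta> x / sqrt (real n)) * f0 x"

text \<open>
  For \<open>\<eta> \<in> \<Upsilon>\<close> unbounded from below, \<open>(1 + n\<^sup>-\<^sup>1\<^sup>/\<^sup>2 \<eta>) f0\<close> is not a density. The nuisance class is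
  parametrized by those \<open>\<eta>\<close> for which it is a density equivalent to \<open>f0\<close>, and contains all of these.
  The integral of \<open>(1 + n\<^sup>-\<^sup>1\<^sup>/\<^sup>2 \<eta>) f0\<close> is automatically 1. Elements of the class may
  differ from it on Lebesgue null sets.
\<close>

definition nuisance_parametrization ::
  "(real ^ 'd \<Rightarrow> real) set \<Rightarrow> (real ^ 'd \<Rightarrow> real) \<Rightarrow> bool" where
  "nuisance_parametrization F f0 \<longleftrightarrow>
     (\<forall>n\<ge>1.
        (\<forall>f\<in>F. \<exists>\<eta>\<in>score_space f0. AE x in lborel. f x = local_density f0 n \<eta> x) \<and>
        (\<forall>\<eta>\<in>score_space f0.
           (\<forall>x. 0 \<le> local_density f0 n \<eta> x) \<and>
           (AE x in lborel. 0 < f0 x \<longrightarrow> 0 < local_density f0 n \<eta> x) \<longrightarrow>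
           local_density f0 n \<eta> \<in> F))"

type_synonym ('k, 'd) param = "(real ^ 'k) \<times> (real ^ 'd \<Rightarrow> real)"

abbreviation origin_param :: "('k::finite, 'd::finite) param" where
  "origin_param \<equiv> (0, \<lambda>_. 0)"

definition local_experiment ::
  "(nat \<Rightarrow> real ^ 'k \<Rightarrow> (real ^ 'd \<Rightarrow> real) \<Rightarrow> (nat \<Rightarrow> real ^ 'd) measure) \<Rightarrow>
     real ^ 'k \<Rightarrow> (real ^ 'd \<Rightarrow> real) \<Rightarrow>
     nat \<Rightarrow> ('k, 'd) param \<Rightarrow> (nat \<Rightarrow> real ^ 'd) measure" where
  "local_experiment P \<theta>0 f0 n =
     (\<lambda>(\<tau>, \<eta>). P n (\<theta>0 + (1 / sqrt (real n)) *\<^sub>R \<tau>) (local_density f0 n \<eta>))"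

definition local_params ::
  "(real ^ 'd \<Rightarrow> real) set \<Rightarrow> (real ^ 'd \<Rightarrow> real) \<Rightarrow> nat \<Rightarrow> ('k, 'd) param set" where
  "local_params F f0 n = {(\<tau>, \<eta>). \<eta> \<in> score_space f0 \<and> local_density f0 n \<eta> \<in> F}"

definition nuisance_experiment ::
  "(nat \<Rightarrow> real ^ 'k \<Rightarrow> (real ^ 'd \<Rightarrow> real) \<Rightarrow> (nat \<Rightarrow> real ^ 'd) measure) \<Rightarrow>
     (real ^ 'd \<Rightarrow> real) set \<Rightarrow> real ^ 'k \<Rightarrow> (real ^ 'd \<Rightarrow> real) \<Rightarrow>
     nat \<Rightarrow> (nat \<Rightarrow> real ^ 'd) measure set" where
  "nuisance_experiment P F \<theta>0 f0 n =
     {local_experiment P \<theta>0 f0 n (0, \<eta>) | \<eta>. (0 :: real ^ 'k, \<eta>) \<in> local_params F f0 n}"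


text \<open>Normal laws with possibly vanishing variance.\<close>

definition normal_rv :: "'w measure \<Rightarrow> ('w \<Rightarrow> real) \<Rightarrow> real \<Rightarrow> real \<Rightarrow> bool" where
  "normal_rv M X m v \<longleftrightarrow>
     0 \<le> v \<and> X \<in> borel_measurable M \<and>
     distr M borel X = distr std_normal_distribution borel (\<lambda>x. m + sqrt v * x)"

text \<open>
  Any finite subfamily of \<open>(Y a)\<^sub>a\<^sub>\<in>\<^sub>I\<close> is a vector Brownian motion on \<open>[0,1]\<close> with drift
  \<open>(b a)\<close> and covariance matrix \<open>(C a a')\<close> at time 1; joint normality of increments is expressed
  by linear combinations.
\<close>

definition joint_brownian_motion ::
  "'w measure \<Rightarrow> 'i set \<Rightarrow> ('i \<Rightarrow> real \<Rightarrow> 'w \<Rightarrow> real) \<Rightarrow> ('i \<Rightarrow> real) \<Rightarrow> ('i \<Rightarrow> 'i \<Rightarrow> real) \<Rightarrow> bool"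
  where
  "joint_brownian_motion M I Y b C \<longleftrightarrow>
     (\<forall>a\<in>I. \<forall>a'\<in>I. C a a' = C a' a) \<and>
     (\<forall>a\<in>I. \<forall>u\<in>{0..1}. Y a u \<in> borel_measurable M) \<and>
     (\<forall>a\<in>I. AE w in M. Y a 0 w = 0 \<and> continuous_on {0..1} (\<lambda>u. Y a u w)) \<and>
     (\<forall>A c s t. finite A \<and> A \<subseteq> I \<and> 0 \<le> s \<and> s \<le> t \<and> t \<le> 1 \<longrightarrow>
        normal_rv M (\<lambda>w. \<Sum>a\<in>A. c a * (Y a t w - Y a s w))
          ((t - s) * (\<Sum>a\<in>A. c a * b a))
          ((t - s) * (\<Sum>a\<in>A. \<Sum>a'\<in>A. c a * c a' * C a a'))) \<and>
     (\<forall>A t (m::nat). finite A \<and> A \<subseteq> I \<and> mono_on {..m} t \<and> t ` {..m} \<subseteq> {0..1} \<longrightarrow>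
        prob_space.indep_vars M (\<lambda>_. PiM A (\<lambda>_. borel))
          (\<lambda>l w. \<lambda>a\<in>A. Y a (t (Suc l)) w - Y a (t l) w) {..<m})"

text \<open>
  The components of \<open>\<Delta>int\<close> and the processes \<open>\<Delta>nuis \<eta>\<close> form one family, indexed by \<open>Inl i\<close> and
  \<open>Inr \<eta>\<close>; \<open>III\<close> is the information matrix \<open>\<I>\<^sub>I\<^sub>,\<^sub>I\<close> and \<open>II \<eta>\<close> the vector \<open>\<I>\<^sub>I\<^sub>,\<^sub>\<eta>\<close>.
\<close>

definition drift_process ::
  "(real \<Rightarrow> 'w \<Rightarrow> real ^ 'k) \<Rightarrow> ((real ^ 'd \<Rightarrow> real) \<Rightarrow> real \<Rightarrow> 'w \<Rightarrow> real) \<Rightarrow>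
     'k + (real ^ 'd \<Rightarrow> real) \<Rightarrow> real \<Rightarrow> 'w \<Rightarrow> real" where
  "drift_process \<Delta>int \<Delta>nuis a u w =
     (case a of Inl i \<Rightarrow> \<Delta>int u w $ i | Inr \<eta> \<Rightarrow> \<Delta>nuis \<eta> u w)"

definition nuisance_info ::
  "(real ^ 'd \<Rightarrow> real) \<Rightarrow> (real ^ 'd \<Rightarrow> real) \<Rightarrow> (real ^ 'd \<Rightarrow> real) \<Rightarrow> real" where
  "nuisance_info f0 \<eta> \<eta>' = (\<integral>x. \<eta> x * \<eta>' x * f0 x \<partial>lborel)"

definition drift_cov ::
  "(real ^ 'd \<Rightarrow> real) \<Rightarrow> real ^ 'k ^ 'k \<Rightarrow> ((real ^ 'd \<Rightarrow> real) \<Rightarrow> real ^ 'k) \<Rightarrow>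
     'k + (real ^ 'd \<Rightarrow> real) \<Rightarrow> 'k + (real ^ 'd \<Rightarrow> real) \<Rightarrow> real" where
  "drift_cov f0 III II a a' =
     (case (a, a') of
        (Inl i, Inl i') \<Rightarrow> III $ i $ i'
      | (Inl i, Inr \<eta>') \<Rightarrow> II \<eta>' $ i
      | (Inr \<eta>, Inl i') \<Rightarrow> II \<eta> $ i'
      | (Inr \<eta>, Inr \<eta>') \<Rightarrow> nuisance_info f0 \<eta> \<eta>')"

definition drift_mean ::
  "(real ^ 'd \<Rightarrow> real) \<Rightarrow> real ^ 'k ^ 'k \<Rightarrow> ((real ^ 'd \<Rightarrow> real) \<Rightarrow> real ^ 'k) \<Rightarrow>
     ('k, 'd) param \<Rightarrow> 'k + (real ^ 'd \<Rightarrow> real) \<Rightarrow> real" where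
  "drift_mean f0 III II = (\<lambda>(\<tau>, \<eta>) a.
     (case a of
        Inl i \<Rightarrow> (III *v \<tau> + II \<eta>) $ i
      | Inr \<eta>' \<Rightarrow> II \<eta>' \<bullet> \<tau> + nuisance_info f0 \<eta> \<eta>'))"

text \<open>The \<open>\<sigma>\<close>-field of the drift experiment is the one generated by the observed processes.\<close>

definition brownian_drift_experiment ::
  "(real ^ 'd \<Rightarrow> real) \<Rightarrow> real ^ 'k ^ 'k \<Rightarrow> ((real ^ 'd \<Rightarrow> real) \<Rightarrow> real ^ 'k) \<Rightarrow> 'w set \<Rightarrow>
     (('k, 'd) param \<Rightarrow> 'w measure) \<Rightarrow>
     (real \<Rightarrow> 'w \<Rightarrow> real ^ 'k) \<Rightarrow> ((real ^ 'd \<Rightarrow> real) \<Rightarrow> real \<Rightarrow> 'w \<Rightarrow> real) \<Rightarrow> bool" where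
  "brownian_drift_experiment f0 III II \<Omega> D \<Delta>int \<Delta>nuis \<longleftrightarrow>
     (\<forall>\<tau>. \<forall>\<eta>\<in>score_space f0.
        prob_space (D (\<tau>, \<eta>)) \<and> space (D (\<tau>, \<eta>)) = \<Omega> \<and>
        sets (D (\<tau>, \<eta>)) =
          sets (generated_algebra \<Omega> ((UNIV <+> score_space f0) \<times> {0..1})
            (\<lambda>(a, u). drift_process \<Delta>int \<Delta>nuis a u)) \<and>
        joint_brownian_motion (D (\<tau>, \<eta>)) (UNIV <+> score_space f0) (drift_process \<Delta>int \<Delta>nuis)
          (drift_mean f0 III II (\<tau>, \<eta>)) (drift_cov f0 III II))"

definition bridge ::
  "((real ^ 'd \<Rightarrow> real) \<Rightarrow> real \<Rightarrow> 'w \<Rightarrow> real) \<Rightarrow> (real ^ 'd \<Rightarrow> real) \<Rightarrow> real \<Rightarrow> 'w \<Rightarrow> real" where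
  "bridge \<Delta>nuis \<eta> u w = \<Delta>nuis \<eta> u w - u * \<Delta>nuis \<eta> 1 w"

definition bridge_algebra ::
  "(real ^ 'd \<Rightarrow> real) \<Rightarrow> 'w set \<Rightarrow> ((real ^ 'd \<Rightarrow> real) \<Rightarrow> real \<Rightarrow> 'w \<Rightarrow> real) \<Rightarrow> 'w measure" where
  "bridge_algebra f0 \<Omega> \<Delta>nuis =
     generated_algebra \<Omega> (score_space f0 \<times> {0..1}) (\<lambda>(\<eta>, u). bridge \<Delta>nuis \<eta> u)"


text \<open>The direction of a uniform point of the ball is uniform over the unit sphere.\<close>

definition sphere_uniform :: "(real ^ 'd) measure" where
  "sphere_uniform = distr (uniform_measure lborel (ball 0 1)) borel sgn"

definition spherical_uniform :: "(real ^ 'd) measure" where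
  "spherical_uniform =
     distr (sphere_uniform \<Otimes>\<^sub>M uniform_measure lborel {0..1::real}) borel (\<lambda>(s, r). r *\<^sub>R s)"

text \<open>
  \<open>O0\<close> stands for the \<open>n0\<close> copies of the origin. If \<open>n0 > 1\<close>, ties are broken by
  replacing these copies by \<open>n0\<close> distinct points inside the innermost sphere, so that the grid always
  consists of \<open>n\<close> distinct points.
\<close>

definition center_outward_grid ::
  "nat \<Rightarrow> nat \<Rightarrow> nat \<Rightarrow> nat \<Rightarrow> (nat \<Rightarrow> real ^ 'd) \<Rightarrow> bool" where
  "center_outward_grid n nR nS n0 g \<longleftrightarrow>
     n = nR * nS + n0 \<and> n0 < min nR nS \<and>
     (\<exists>S O0. S \<subseteq> sphere 0 1 \<and> finite S \<and> card S = nS \<and>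
        O0 \<subseteq> ball 0 (1 / (real nR + 1)) \<and> finite O0 \<and> card O0 = n0 \<and> (n0 = 1 \<longrightarrow> O0 = {0}) \<and>
        bij_betw g {..<n}
          ({(real r / (real nR + 1)) *\<^sub>R s | r s. r \<in> {1..nR} \<and> s \<in> S} \<union> O0))"

text \<open>
  Minimizers are unique for almost all \<open>z\<close>; otherwise \<^const>\<open>arg_min\<close> chooses one of them, and the
  choice only depends on the (finite) set of minimizers, so that measurability is not affected.
\<close>

definition center_outward ::
  "nat \<Rightarrow> (nat \<Rightarrow> real ^ 'd) \<Rightarrow> (nat \<Rightarrow> real ^ 'd) \<Rightarrow> nat \<Rightarrow> real ^ 'd" where
  "center_outward n g z i =
     g (arg_min (\<lambda>\<pi>. \<Sum>j<n. (norm (z j - g (\<pi> j)))\<^sup>2) (\<lambda>\<pi>. \<pi> permutes {..<n}) i)"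

definition ranks_signs_algebra ::
  "(nat \<Rightarrow> real ^ 'k \<Rightarrow> (nat \<Rightarrow> real ^ 'd) \<Rightarrow> nat \<Rightarrow> real ^ 'd) \<Rightarrow> real ^ 'k \<Rightarrow>
     (nat \<Rightarrow> nat \<Rightarrow> real ^ 'd) \<Rightarrow> nat \<Rightarrow> (nat \<Rightarrow> real ^ 'd) measure" where
  "ranks_signs_algebra Z \<theta>0 g n =
     generated_algebra (space (obs_space n)) {..<n} (\<lambda>i x. center_outward n (g n) (Z n \<theta>0 x) i)"

end

theory Submission
  imports Defs
begin

text \<open>
  In the limit, the likelihood ratios are functions of the variables \<open>\<tau> \<bullet> \<Delta>int 1 + \<Delta>nuis \<eta> 1\<close>
  (Cameron--Martin), which are uncorrelated with the bridges. A random variable \<open>\<xi>\<close> of the bridge \<open>\<sigma>\<close>-field is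
  therefore independent of all likelihood ratios, and for weak convergence to \<open>\<xi>\<close> it suffices that \<open>\<xi>\<^sub>n\<close> is a function
  of the ranks and signs whose law tends to that of \<open>\<xi>\<close> and which is asymptotically independent of finitely
  many likelihood ratios at a time. The ranks and signs amount to a uniformly distributed permutation. Its \<open>n!\<close> values can
  be grouped, by a greedy choice, into classes over each of which the likelihood ratios are distributed almost as under the whole
  measure; \<open>\<xi>\<^sub>n\<close> maps the classes to quantiles of the law of \<open>\<xi>\<close>. By separability it is enough to treat countably many
  parameter values.

  For fixed \<open>n\<close>, a measure of the nuisance experiment is determined by the law of the residuals, so that events are
  functions of the residuals up to null sets, and the events symmetric in the residuals form a sufficient \<open>\<sigma>\<close>-field. It
  is boundedly complete, because the densities proportional to \<open>(1 + \<Sum>\<^sub>j\<^sub>\<in>\<^sub>T 1\<^bsub>A j\<^esub>) f0\<close> belong to the nuisance class and Ryser's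
  formula expresses the symmetrized indicator of a rectangle by their products. Basu's theorem then makes ancillary events
  independent of the symmetric ones; within \<open>{R = r}\<close>, where \<open>R\<close> is the optimal permutation, every event is symmetric, which
  leaves an ancillary \<open>\<sigma>\<close>-field finer than that of the ranks no freedom.
\<close>

section \<open>Measures determined by characteristic functions\<close>

text \<open>One sequence of statistics has to serve all finite sets of parameters at once, whereas a
  grouping of the n! permutations can respect only finitely many likelihood ratios, and these only
  after discretization. The number of ratios, the fineness of the discretization and the number of
  classes are therefore tied to a single integer, which grows so slowly with n that n! stays large
  enough for the greedy bound. Parameters outside the countable set are reached through continuity
  in probability of the limiting likelihood ratios; LAN carries the closeness over to all large n.

  The limit experiment lives on an abstract space with uncountably many coordinates. Its measures
  are recovered from finite-dimensional characteristic functions, because the observed processes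
  generate its \<sigma>-field.

  For maximality, Basu's theorem is applied to \<open>{R = r}\<close> and also to the intersection
  of an ancillary event with \<open>{R = r}\<close>. Together, the two applications make the
  conditional probability of the event given \<open>R = r\<close> equal to its own square, hence 0
  or 1.\<close>

lemma weighted_char_unique:
  fixes X :: "'a \<Rightarrow> real" and Y :: "'b \<Rightarrow> real" and u v K
  assumes M: "prob_space M" and N: "prob_space N"
    and [measurable]: "X \<in> borel_measurable M" "Y \<in> borel_measurable N"
      "u \<in> borel_measurable M" "v \<in> borel_measurable N"
    and u: "\<And>w. 0 \<le> u w" "\<And>w. u w \<le> K" and v: "\<And>w. 0 \<le> v w" "\<And>w. v w \<le> K"
    and eq: "\<And>s. (\<integral>w. complex_of_real (u w) * iexp (s * X w) \<partial>M)
                 = (\<integral>w. complex_of_real (v w) * iexp (s * Y w) \<partial>N)"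
    and B[measurable]: "B \<in> sets borel"
  shows "(\<integral>w. u w * indicator B (X w) \<partial>M) = (\<integral>w. v w * indicator B (Y w) \<partial>N)"
proof -
  interpret M: prob_space M by fact
  interpret N: prob_space N by fact
  have iu: "integrable M u" by (rule M.integrable_const_bound[of _ K]) (use u in auto)
  have iv: "integrable N v" by (rule N.integrable_const_bound[of _ K]) (use v in auto)
  \<comment> \<open>The common total mass of the two weights, read off from the hypothesis at
    \<open>s = 0\<close>. If it is positive, division by \<open>a\<close> makes the weights
    probability densities, and the uniqueness theorem applies to the laws of \<open>X\<close> and
    \<open>Y\<close> under them. If it is zero, both weights vanish almost everywhere.\<close>
  define a where "a = (\<integral>w. u w \<partial>M)"
  have "complex_of_real (\<integral>w. u w \<partial>M) = complex_of_real (\<integral>w. v w \<partial>N)"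
    using eq[of 0] by simp
  then have av: "a = (\<integral>w. v w \<partial>N)" by (simp add: a_def)
  have a0: "a \<ge> 0" by (simp add: a_def u)
  show ?thesis
  proof (cases "a = 0")
    case True
    have "AE w in M. u w = 0" using True iu u by (simp add: a_def integral_nonneg_eq_0_iff_AE)
    then have "(\<integral>w. u w * indicator B (X w) \<partial>M) = (\<integral>w. 0 \<partial>M)"
      by (intro integral_cong_AE) auto
    moreover have "AE w in N. v w = 0" using True iv v by (simp add: av integral_nonneg_eq_0_iff_AE)
    then have "(\<integral>w. v w * indicator B (Y w) \<partial>N) = (\<integral>w. 0 \<partial>N)"
      by (intro integral_cong_AE) auto
    ultimately show ?thesis by simp
  next
    case False
    with a0 have a: "a > 0" by simp
    have *: "real_distribution (distr (density L (\<lambda>w. ennreal (p w / a))) borel V) \<and>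
        (\<forall>s. char (distr (density L (\<lambda>w. ennreal (p w / a))) borel V) s
          = (\<integral>w. complex_of_real (p w) * iexp (s * V w) \<partial>L) / a) \<and>
        measure (distr (density L (\<lambda>w. ennreal (p w / a))) borel V) B = (\<integral>w. p w * indicator B (V w) \<partial>L) / a"
      if L: "prob_space L" and m[measurable]: "V \<in> borel_measurable L" "p \<in> borel_measurable L"
        and p: "\<And>w. 0 \<le> p w" "\<And>w. p w \<le> K" "(\<integral>w. p w \<partial>L) = a"
      for L :: "'c measure" and V :: "'c \<Rightarrow> real" and p
    proof -
      interpret L: prob_space L by fact
      have ip: "integrable L p" by (rule L.integrable_const_bound[of _ K]) (use p in auto)
      have "emeasure (density L (\<lambda>w. ennreal (p w / a))) (space (density L (\<lambda>w. ennreal (p w / a)))) = 1"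
        using a p ip by (simp add: emeasure_density nn_integral_eq_integral cong: nn_integral_cong)
      then have pr: "prob_space (density L (\<lambda>w. ennreal (p w / a)))" by (rule prob_spaceI)
      then interpret Q: prob_space "density L (\<lambda>w. ennreal (p w / a))" .
      have rd: "real_distribution (distr (density L (\<lambda>w. ennreal (p w / a))) borel V)"
        by (auto intro!: Q.real_distribution_distr)
      then interpret R: real_distribution "distr (density L (\<lambda>w. ennreal (p w / a))) borel V" .
      have ch: "char (distr (density L (\<lambda>w. ennreal (p w / a))) borel V) s
          = (\<integral>w. complex_of_real (p w) * iexp (s * V w) \<partial>L) / a" for s
      proof -
        have "char (distr (density L (\<lambda>w. ennreal (p w / a))) borel V) s
           = (\<integral>w. iexp (s * V w) \<partial>(density L (\<lambda>w. ennreal (p w / a))))"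
          unfolding char_def by (subst integral_distr) auto
        also have "\<dots> = (\<integral>w. (p w / a) *\<^sub>R iexp (s * V w) \<partial>L)"
          by (subst integral_density) (use a p in auto)
        also have "\<dots> = (\<integral>w. (complex_of_real (p w) * iexp (s * V w)) / a \<partial>L)"
          by (simp add: scaleR_conv_of_real)
        finally show ?thesis by simp
      qed
      have me: "measure (distr (density L (\<lambda>w. ennreal (p w / a))) borel V) B = (\<integral>w. p w * indicator B (V w) \<partial>L) / a"
      proof -
        have "measure (distr (density L (\<lambda>w. ennreal (p w / a))) borel V) B
           = (\<integral>x. indicator B x \<partial>(distr (density L (\<lambda>w. ennreal (p w / a))) borel V))" by simp
        also have "\<dots> = (\<integral>w. indicator B (V w) \<partial>(density L (\<lambda>w. ennreal (p w / a))))"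
          by (rule integral_distr) auto
        also have "\<dots> = (\<integral>w. (p w / a) *\<^sub>R indicator B (V w) \<partial>L)"
          by (subst integral_density) (use a p in auto)
        also have "\<dots> = (\<integral>w. (p w * indicator B (V w)) / a \<partial>L)" by simp
        finally show ?thesis by simp
      qed
      show ?thesis using rd ch me by blast
    qed
    have 1: "prob_space M" "X \<in> borel_measurable M" "u \<in> borel_measurable M" "(\<integral>w. u w \<partial>M) = a"
      using M a_def by auto
    have 2: "prob_space N" "Y \<in> borel_measurable N" "v \<in> borel_measurable N" "(\<integral>w. v w \<partial>N) = a"
      using N av by auto
    note m = *[OF 1(1-3) u 1(4)] and n = *[OF 2(1-3) v 2(4)]
    have "distr (density M (\<lambda>w. ennreal (u w / a))) borel X = distr (density N (\<lambda>w. ennreal (v w / a))) borel Y"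
      by (rule Levy_uniqueness) (use m n eq in auto)
    then show ?thesis using m n a by auto
  qed
qed

lemma integrable_weight_iexp:
  fixes u T :: "'a \<Rightarrow> real"
  assumes "prob_space M" "T \<in> borel_measurable M" "u \<in> borel_measurable M"
    "\<And>w. 0 \<le> u w" "\<And>w. u w \<le> K"
  shows "integrable M (\<lambda>w. complex_of_real (u w) * iexp (T w))"
proof -
  interpret prob_space M by fact
  note [measurable] = assms(2,3)
  show ?thesis
    by (rule integrable_const_bound[of _ K]) (use assms(4,5) in \<open>auto simp: norm_mult\<close>)
qed

text \<open>Induction on the index set: one coordinate is localised by the one-dimensional theorem, applied
  with the nonnegative weights \<open>2 + cos T\<close> and \<open>2 + sin T\<close>, where \<open>T\<close> is a linear combination of the
  remaining coordinates.\<close>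

lemma weighted_char_unique_finite:
  fixes X :: "'i \<Rightarrow> 'a \<Rightarrow> real" and Y :: "'i \<Rightarrow> 'b \<Rightarrow> real" and u v K
  assumes M: "prob_space M" and N: "prob_space N" and "finite A"
    and "\<And>a. a \<in> A \<Longrightarrow> X a \<in> borel_measurable M" "\<And>a. a \<in> A \<Longrightarrow> Y a \<in> borel_measurable N"
      "u \<in> borel_measurable M" "v \<in> borel_measurable N"
    and "\<And>w. 0 \<le> u w" "\<And>w. u w \<le> K" and "\<And>w. 0 \<le> v w" "\<And>w. v w \<le> K"
    and "\<And>c. (\<integral>w. complex_of_real (u w) * iexp (\<Sum>a\<in>A. c a * X a w) \<partial>M)
                 = (\<integral>w. complex_of_real (v w) * iexp (\<Sum>a\<in>A. c a * Y a w) \<partial>N)"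
    and "\<And>a. a \<in> A \<Longrightarrow> B a \<in> sets borel"
  shows "(\<integral>w. u w * (\<Prod>a\<in>A. indicator (B a) (X a w)) \<partial>M) = (\<integral>w. v w * (\<Prod>a\<in>A. indicator (B a) (Y a w)) \<partial>N)"
  using assms(3-)
proof (induction A arbitrary: u v K rule: finite_induct)
  case empty
  have "(\<integral>w. complex_of_real (u w) \<partial>M) = (\<integral>w. complex_of_real (v w) \<partial>N)"
    using empty.prems(9) by simp
  then have "complex_of_real (\<integral>w. u w \<partial>M) = complex_of_real (\<integral>w. v w \<partial>N)" by simp
  then show ?case by (simp del: of_real_eq_iff integral_complex_of_real add: of_real_eq_iff)
next
  case (insert a A)
  have XM[measurable]: "X b \<in> borel_measurable M" if "b \<in> insert a A" for b using insert.prems(1) that .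
  have YM[measurable]: "Y b \<in> borel_measurable N" if "b \<in> insert a A" for b using insert.prems(2) that .
  have [measurable]: "u \<in> borel_measurable M" "v \<in> borel_measurable N" using insert.prems by auto
  have [measurable]: "B a \<in> sets borel" using insert.prems by auto
  note bnd = insert.prems(5-8)
  have K0: "K \<ge> 0" using bnd(1)[of undefined] bnd(2)[of undefined] by linarith
  have F: "(\<integral>w. complex_of_real (u w) * iexp (s * X a w + (\<Sum>b\<in>A. c b * X b w)) \<partial>M)
      = (\<integral>w. complex_of_real (v w) * iexp (s * Y a w + (\<Sum>b\<in>A. c b * Y b w)) \<partial>N)" for s c
  proof -
    have s: "(\<Sum>b\<in>insert a A. (c(a:=s)) b * Z b) = s * Z a + (\<Sum>b\<in>A. c b * Z b)" for Z :: "'i \<Rightarrow> real"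
    proof -
      have "(\<Sum>b\<in>A. (c(a:=s)) b * Z b) = (\<Sum>b\<in>A. c b * Z b)"
        by (rule sum.cong) (use insert.hyps in auto)
      then show ?thesis using insert.hyps by simp
    qed
    show ?thesis using insert.prems(9)[of "c(a:=s)"] unfolding s .
  qed
  \<comment> \<open>The indicator of coordinate \<open>a\<close> is absorbed into the weight. The
    induction hypothesis quantifies over weights, so it then handles the remaining
    coordinates.\<close>
  define u' where "u' = (\<lambda>w. u w * indicator (B a) (X a w))"
  define v' where "v' = (\<lambda>w. v w * indicator (B a) (Y a w))"
  have [measurable]: "u' \<in> borel_measurable M" "v' \<in> borel_measurable N" unfolding u'_def v'_def by measurable
  have bnd': "0 \<le> u' w" "u' w \<le> K" "0 \<le> v' z" "v' z \<le> K" for w z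
    using bnd(1,2)[of w] bnd(3,4)[of z] K0 by (auto simp: u'_def v'_def indicator_def)
  have main: "(\<integral>w. complex_of_real (u' w) * iexp (\<Sum>b\<in>A. c b * X b w) \<partial>M)
      = (\<integral>w. complex_of_real (v' w) * iexp (\<Sum>b\<in>A. c b * Y b w) \<partial>N)" for c
  proof -
    define S where "S = (\<lambda>w. \<Sum>b\<in>A. c b * X b w)"
    define T where "T = (\<lambda>w. \<Sum>b\<in>A. c b * Y b w)"
    have [measurable]: "S \<in> borel_measurable M" "T \<in> borel_measurable N" unfolding S_def T_def by measurable
    have F1: "(\<integral>w. complex_of_real (u w) * iexp (s * X a w + r * S w) \<partial>M)
      = (\<integral>w. complex_of_real (v w) * iexp (s * Y a w + r * T w) \<partial>N)" for s r
      using F[of s "\<lambda>b. r * c b"] by (simp add: S_def T_def sum_distrib_left mult.assoc)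
    have intM: "integrable M (\<lambda>w. complex_of_real (u w) * iexp (s * X a w + r * S w))" for s r
      by (rule integrable_weight_iexp[OF M, of _ _ K]) (use bnd in auto)
    have intN: "integrable N (\<lambda>w. complex_of_real (v w) * iexp (s * Y a w + r * T w))" for s r
      by (rule integrable_weight_iexp[OF N, of _ _ K]) (use bnd in auto)
    \<comment> \<open>Since \<open>cos t\<close> is half the sum of \<open>iexp t\<close> and
      \<open>iexp (- t)\<close>, the weighted integrand is a combination of the integrands in
      \<open>F1\<close> with \<open>r = 0\<close>, \<open>r = 1\<close> and
      \<open>r = -1\<close>.\<close>
    have cosid: "complex_of_real (p * (2 + cos t)) * iexp x
        = 2 * (complex_of_real p * iexp (x + 0 * t)) + (complex_of_real p * iexp (x + 1 * t)
           + complex_of_real p * iexp (x + (-1) * t)) / 2" for p x t :: real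
      unfolding cis_conv_exp[symmetric]
      by (simp add: complex_eq_iff cos_add sin_add cos_diff sin_diff algebra_simps add_divide_distrib diff_divide_distrib)
    have sinid: "complex_of_real (p * (2 + sin t)) * iexp x
        = 2 * (complex_of_real p * iexp (x + 0 * t)) - \<i> * (complex_of_real p * iexp (x + 1 * t)
           - complex_of_real p * iexp (x + (-1) * t)) / 2" for p x t :: real
      unfolding cis_conv_exp[symmetric]
      by (simp add: complex_eq_iff cos_add sin_add cos_diff sin_diff algebra_simps add_divide_distrib diff_divide_distrib)
    have C: "(\<integral>w. (u w * (2 + cos (S w))) * indicator (B a) (X a w) \<partial>M)
           = (\<integral>w. (v w * (2 + cos (T w))) * indicator (B a) (Y a w) \<partial>N)"
    proof (rule weighted_char_unique[OF M N, where K="3 * K"])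
      fix s
      show "(\<integral>w. complex_of_real (u w * (2 + cos (S w))) * iexp (s * X a w) \<partial>M) =
            (\<integral>w. complex_of_real (v w * (2 + cos (T w))) * iexp (s * Y a w) \<partial>N)"
        unfolding cosid using intM intN by (simp only: Bochner_Integration.integral_add Bochner_Integration.integrable_add Bochner_Integration.integral_mult_right_zero Bochner_Integration.integral_divide_zero Bochner_Integration.integrable_mult_right Bochner_Integration.integrable_divide F1)
    next
      fix w show "0 \<le> u w * (2 + cos (S w))" using bnd(1)[of w] cos_ge_minus_one[of "S w"] by (intro mult_nonneg_nonneg) linarith+
      have "u w * (2 + cos (S w)) \<le> K * 3" using bnd(1,2)[of w] cos_le_one[of "S w"] cos_ge_minus_one[of "S w"] K0 by (intro mult_mono) linarith+
      then show "u w * (2 + cos (S w)) \<le> 3 * K" by simp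
    next
      fix w show "0 \<le> v w * (2 + cos (T w))" using bnd(3)[of w] cos_ge_minus_one[of "T w"] by (intro mult_nonneg_nonneg) linarith+
      have "v w * (2 + cos (T w)) \<le> K * 3" using bnd(3,4)[of w] cos_le_one[of "T w"] cos_ge_minus_one[of "T w"] K0 by (intro mult_mono) linarith+
      then show "v w * (2 + cos (T w)) \<le> 3 * K" by simp
    qed (auto intro!: borel_measurable_times XM YM)
    have Sn: "(\<integral>w. (u w * (2 + sin (S w))) * indicator (B a) (X a w) \<partial>M)
           = (\<integral>w. (v w * (2 + sin (T w))) * indicator (B a) (Y a w) \<partial>N)"
    proof (rule weighted_char_unique[OF M N, where K="3 * K"])
      fix s
      show "(\<integral>w. complex_of_real (u w * (2 + sin (S w))) * iexp (s * X a w) \<partial>M) =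
            (\<integral>w. complex_of_real (v w * (2 + sin (T w))) * iexp (s * Y a w) \<partial>N)"
        unfolding sinid using intM intN by (simp only: Bochner_Integration.integral_diff Bochner_Integration.integrable_diff Bochner_Integration.integral_mult_right_zero Bochner_Integration.integral_divide_zero Bochner_Integration.integrable_mult_right Bochner_Integration.integrable_divide F1)
    next
      fix w show "0 \<le> u w * (2 + sin (S w))" using bnd(1)[of w] sin_ge_minus_one[of "S w"] by (intro mult_nonneg_nonneg) linarith+
      have "u w * (2 + sin (S w)) \<le> K * 3" using bnd(1,2)[of w] sin_le_one[of "S w"] sin_ge_minus_one[of "S w"] K0 by (intro mult_mono) linarith+
      then show "u w * (2 + sin (S w)) \<le> 3 * K" by simp
    next
      fix w show "0 \<le> v w * (2 + sin (T w))" using bnd(3)[of w] sin_ge_minus_one[of "T w"] by (intro mult_nonneg_nonneg) linarith+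
      have "v w * (2 + sin (T w)) \<le> K * 3" using bnd(3,4)[of w] sin_le_one[of "T w"] sin_ge_minus_one[of "T w"] K0 by (intro mult_mono) linarith+
      then show "v w * (2 + sin (T w)) \<le> 3 * K" by simp
    qed (auto intro!: borel_measurable_times XM YM)
    have U: "(\<integral>w. u' w \<partial>M) = (\<integral>w. v' w \<partial>N)" unfolding u'_def v'_def
      by (rule weighted_char_unique[OF M N, where K=K]) (use bnd F1[of _ 0] in auto)
    interpret M: prob_space M by fact
    interpret N: prob_space N by fact
    have bh: "\<bar>p * q\<bar> \<le> K" if "0 \<le> p" "p \<le> K" "\<bar>q\<bar> \<le> 1" for p q :: real
      using mult_mono[of p K "\<bar>q\<bar>" 1] that K0 by (simp add: abs_mult)
    have iM: "integrable M (\<lambda>w. u' w * h (S w))" if [measurable]: "h \<in> borel_measurable borel" and "\<And>x. \<bar>h x\<bar> \<le> 1" for h :: "real \<Rightarrow> real"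
      by (rule M.integrable_const_bound[of _ K]) (use bh bnd' that in auto)
    have iN: "integrable N (\<lambda>w. v' w * h (T w))" if [measurable]: "h \<in> borel_measurable borel" and "\<And>x. \<bar>h x\<bar> \<le> 1" for h :: "real \<Rightarrow> real"
      by (rule N.integrable_const_bound[of _ K]) (use bh bnd' that in auto)
    have ics: "integrable M (\<lambda>w. u' w * cos (S w))" "integrable M (\<lambda>w. u' w * sin (S w))"
       "integrable N (\<lambda>w. v' w * cos (T w))" "integrable N (\<lambda>w. v' w * sin (T w))" "integrable M u'" "integrable N v'"
      using iM[of cos] iM[of sin] iN[of cos] iN[of sin] iM[of "\<lambda>_. 1"] iN[of "\<lambda>_. 1"] by auto
    \<comment> \<open>The constant 2 only made the weights nonnegative. Its contribution is removed
      by \<open>U\<close>, which leaves the real and the imaginary part of the required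
      identity.\<close>
    have "(\<integral>w. 2 * u' w + u' w * cos (S w) \<partial>M) = (\<integral>w. 2 * v' w + v' w * cos (T w) \<partial>N)"
      using C by (simp add: u'_def v'_def algebra_simps)
    then have CC: "(\<integral>w. u' w * cos (S w) \<partial>M) = (\<integral>w. v' w * cos (T w) \<partial>N)"
      using U ics by simp
    have "(\<integral>w. 2 * u' w + u' w * sin (S w) \<partial>M) = (\<integral>w. 2 * v' w + v' w * sin (T w) \<partial>N)"
      using Sn by (simp add: u'_def v'_def algebra_simps)
    then have SS: "(\<integral>w. u' w * sin (S w) \<partial>M) = (\<integral>w. v' w * sin (T w) \<partial>N)"
      using U ics by simp
    have e: "complex_of_real p * iexp t = complex_of_real (p * cos t) + \<i> * complex_of_real (p * sin t)" for p t :: real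
      unfolding cis_conv_exp[symmetric] by (simp add: complex_eq_iff)
    have "(\<integral>w. complex_of_real (u' w) * iexp (S w) \<partial>M) = complex_of_real (\<integral>w. u' w * cos (S w) \<partial>M) + \<i> * complex_of_real (\<integral>w. u' w * sin (S w) \<partial>M)"
      unfolding e using ics by (subst Bochner_Integration.integral_add) (auto simp del: of_real_mult)
    also have "\<dots> = (\<integral>w. complex_of_real (v' w) * iexp (T w) \<partial>N)"
      unfolding e CC SS using ics by (subst Bochner_Integration.integral_add) (auto simp del: of_real_mult)
    finally show ?thesis by (simp add: S_def T_def)
  qed
  have "(\<integral>w. u' w * (\<Prod>b\<in>A. indicator (B b) (X b w)) \<partial>M) = (\<integral>w. v' w * (\<Prod>b\<in>A. indicator (B b) (Y b w)) \<partial>N)"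
    by (rule insert.IH[where K=K]) (use main bnd' insert.prems in auto)
  then show ?case using insert.hyps by (simp add: u'_def v'_def mult.assoc)
qed

section \<open>Gaussian families\<close>

text \<open>Joint normality of a possibly infinite and degenerate family, encoded by the
  characteristic functions of its finite linear combinations. No covariance matrix has to be
  inverted, and linear images and tilts are computed in the exponent.\<close>

definition gaussian_family ::
  "'a measure \<Rightarrow> 'i set \<Rightarrow> ('i \<Rightarrow> 'a \<Rightarrow> real) \<Rightarrow> ('i \<Rightarrow> real) \<Rightarrow> ('i \<Rightarrow> 'i \<Rightarrow> real) \<Rightarrow> bool" where
  "gaussian_family M I X m K \<longleftrightarrow>
     (\<forall>a\<in>I. X a \<in> borel_measurable M) \<and>
     (\<forall>A c. finite A \<and> A \<subseteq> I \<longrightarrow>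
        (\<integral>w. iexp (\<Sum>a\<in>A. c a * X a w) \<partial>M)
          = exp (\<i> * complex_of_real (\<Sum>a\<in>A. c a * m a)
                 - complex_of_real ((\<Sum>a\<in>A. \<Sum>b\<in>A. c a * c b * K a b) / 2)))"

lemma normal_rv_iexp:
  assumes "normal_rv M X m v"
  shows "(\<integral>w. iexp (s * X w) \<partial>M) = exp (\<i> * complex_of_real (s * m) - complex_of_real (s\<^sup>2 * v / 2))"
proof -
  from assms have v: "0 \<le> v" and [measurable]: "X \<in> borel_measurable M"
    and d: "distr M borel X = distr std_normal_distribution borel (\<lambda>x. m + sqrt v * x)"
    by (auto simp: normal_rv_def)
  have "(\<integral>w. iexp (s * X w) \<partial>M) = (\<integral>x. iexp (s * x) \<partial>(distr M borel X))"
    by (subst integral_distr) auto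
  also have "\<dots> = (\<integral>x. iexp (s * (m + sqrt v * x)) \<partial>std_normal_distribution)"
    unfolding d by (subst integral_distr) auto
  also have "\<dots> = (\<integral>x. iexp (s * m) * iexp ((s * sqrt v) * x) \<partial>std_normal_distribution)"
    by (simp add: exp_add[symmetric] algebra_simps)
  also have "\<dots> = iexp (s * m) * (\<integral>x. iexp ((s * sqrt v) * x) \<partial>std_normal_distribution)"
    by (rule integral_mult_right_zero)
  also have "(\<integral>x. iexp ((s * sqrt v) * x) \<partial>std_normal_distribution) = char std_normal_distribution (s * sqrt v)"
    by (simp add: char_def)
  also have "\<dots> = complex_of_real (exp (- (s\<^sup>2 * v / 2)))"
    by (simp add: char_std_normal_distribution power_mult_distrib v)
  also have "iexp (s * m) * complex_of_real (exp (- (s\<^sup>2 * v / 2)))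
      = exp (\<i> * complex_of_real (s * m) + - complex_of_real (s\<^sup>2 * v / 2))"
    by (simp only: exp_add exp_of_real[symmetric] of_real_minus)
  finally show ?thesis by simp
qed

text \<open>Collects the coefficients of pairs with the same first component. A joint Brownian
  motion is defined with one coefficient per process, whereas a process may be evaluated at several
  times.\<close>

lemma sum_fibres_fst:
  fixes z :: "'i \<Rightarrow> real"
  assumes "finite P"
  shows "(\<Sum>a\<in>fst ` P. (\<Sum>p | p \<in> P \<and> fst p = a. e p) * z a) = (\<Sum>p\<in>P. e p * z (fst p))"
proof -
  have "(\<Sum>p\<in>P. e p * z (fst p)) = (\<Sum>a\<in>fst ` P. \<Sum>p | p \<in> P \<and> fst p = a. e p * z (fst p))"
    by (rule sum.image_gen[OF assms])
  also have "\<dots> = (\<Sum>a\<in>fst ` P. (\<Sum>p | p \<in> P \<and> fst p = a. e p) * z a)"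
    by (auto intro!: sum.cong simp: sum_distrib_right)
  finally show ?thesis by simp
qed

lemma joint_brownian_motion_normal_increment:
  assumes "joint_brownian_motion M I Y b C" "finite P" "fst ` P \<subseteq> I" "0 \<le> s" "s \<le> t" "t \<le> 1"
  shows "normal_rv M (\<lambda>w. \<Sum>p\<in>P. e p * (Y (fst p) t w - Y (fst p) s w))
           ((t - s) * (\<Sum>p\<in>P. e p * b (fst p)))
           ((t - s) * (\<Sum>p\<in>P. \<Sum>q\<in>P. e p * e q * C (fst p) (fst q)))"
proof -
  define d where "d a = (\<Sum>p | p \<in> P \<and> fst p = a. e p)" for a
  have "normal_rv M (\<lambda>w. \<Sum>a\<in>fst ` P. d a * (Y a t w - Y a s w))
          ((t - s) * (\<Sum>a\<in>fst ` P. d a * b a))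
          ((t - s) * (\<Sum>a\<in>fst ` P. \<Sum>a'\<in>fst ` P. d a * d a' * C a a'))"
    using assms unfolding joint_brownian_motion_def by (meson finite_imageI)
  moreover have "(\<Sum>a\<in>fst ` P. d a * (Y a t w - Y a s w)) = (\<Sum>p\<in>P. e p * (Y (fst p) t w - Y (fst p) s w))" for w
    unfolding d_def by (rule sum_fibres_fst[OF assms(2)])
  moreover have "(\<Sum>a\<in>fst ` P. d a * b a) = (\<Sum>p\<in>P. e p * b (fst p))"
    unfolding d_def by (rule sum_fibres_fst[OF assms(2)])
  moreover have "(\<Sum>a\<in>fst ` P. \<Sum>a'\<in>fst ` P. d a * d a' * C a a') = (\<Sum>p\<in>P. \<Sum>q\<in>P. e p * e q * C (fst p) (fst q))"
  proof -
    have "(\<Sum>a'\<in>fst ` P. d a * d a' * C a a') = d a * (\<Sum>q\<in>P. e q * C a (fst q))" for a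
    proof -
      have "(\<Sum>a'\<in>fst ` P. d a * d a' * C a a') = d a * (\<Sum>a'\<in>fst ` P. d a' * C a a')"
        by (simp add: sum_distrib_left mult.assoc)
      also have "(\<Sum>a'\<in>fst ` P. d a' * C a a') = (\<Sum>q\<in>P. e q * C a (fst q))"
        unfolding d_def by (rule sum_fibres_fst[OF assms(2)])
      finally show ?thesis .
    qed
    then have "(\<Sum>a\<in>fst ` P. \<Sum>a'\<in>fst ` P. d a * d a' * C a a') = (\<Sum>a\<in>fst ` P. d a * (\<Sum>q\<in>P. e q * C a (fst q)))" by simp
    also have "\<dots> = (\<Sum>p\<in>P. e p * (\<Sum>q\<in>P. e q * C (fst p) (fst q)))"
      unfolding d_def by (rule sum_fibres_fst[OF assms(2)])
    finally show ?thesis by (simp add: sum_distrib_left mult.assoc)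
  qed
  ultimately show ?thesis by simp
qed

text \<open>A telescoping sum. The restriction to early steps is written as an
  \<open>of_bool\<close> weight, so that all evaluation times share the index range
  \<open>l < m\<close> and sums over times and steps can be exchanged.\<close>

lemma sum_steps_below:
  fixes t :: "nat \<Rightarrow> real" and f :: "real \<Rightarrow> real"
  assumes "strict_mono_on {..m} t" "k \<le> m"
  shows "(\<Sum>l<m. of_bool (t l < t k) * (f (t (Suc l)) - f (t l))) = f (t k) - f (t 0)"
proof -
  have "(\<Sum>l<m. of_bool (t l < t k) * (f (t (Suc l)) - f (t l))) = (\<Sum>l<k. f (t (Suc l)) - f (t l))"
  proof (rule sum.mono_neutral_cong_right)
    show "\<forall>l\<in>{..<m} - {..<k}. of_bool (t l < t k) * (f (t (Suc l)) - f (t l)) = 0"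
    proof
      fix l assume l: "l \<in> {..<m} - {..<k}"
      then have "t k \<le> t l"
        using assms strict_mono_onD[OF assms(1), of k l] by (cases "k = l") auto
      then show "of_bool (t l < t k) * (f (t (Suc l)) - f (t l)) = 0" by simp
    qed
  next
    fix l assume "l \<in> {..<k}"
    then have "t l < t k" using assms by (auto intro!: strict_mono_onD[OF assms(1)])
    then show "of_bool (t l < t k) * (f (t (Suc l)) - f (t l)) = f (t (Suc l)) - f (t l)" by simp
  qed (use assms in auto)
  also have "\<dots> = f (t k) - f (t 0)" by (rule sum_lessThan_telescope)
  finally show ?thesis .
qed

text \<open>The value at finitely many times is a sum of independent normal increments.\<close>

lemma joint_brownian_motion_gaussian:
  fixes Y :: "'i \<Rightarrow> real \<Rightarrow> 'w \<Rightarrow> real"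
  assumes M: "prob_space M" and bm: "joint_brownian_motion M I Y b C"
  shows "gaussian_family M (I \<times> {0..1}) (\<lambda>(a, u). Y a u) (\<lambda>(a, u). u * b a)
           (\<lambda>(a, u) (a', u'). min u u' * C a a')"
  unfolding gaussian_family_def
proof (intro conjI allI impI ballI)
  fix p assume "p \<in> I \<times> {0..1::real}"
  then show "(case p of (a, u) \<Rightarrow> Y a u) \<in> borel_measurable M"
    using bm by (auto simp: joint_brownian_motion_def)
next
  fix P :: "('i \<times> real) set" and c
  assume P: "finite P \<and> P \<subseteq> I \<times> {0..1}"
  interpret M: prob_space M by fact
  \<comment> \<open>Time 0 is added so that the partition starts where the processes vanish almost
    surely.\<close>
  define T where "T = insert 0 (snd ` P)"
  have T: "finite T" "0 \<in> T" "T \<subseteq> {0..1}" using P by (auto simp: T_def)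
  define ts where "ts = sorted_list_of_set T"
  define m where "m = length ts - 1"
  define t where "t k = ts ! k" for k
  have len: "length ts = Suc m" proof -
    have "card T > 0" using T by (auto simp: card_gt_0_iff)
    then show ?thesis unfolding m_def ts_def by simp
  qed
  have sts: "set ts = T" using T by (simp add: ts_def)
  have sm: "strict_mono_on {..m} t"
    using len unfolding t_def
    by (intro strict_mono_onI) (auto intro!: sorted_wrt_nth_less[of "(<)"] simp: ts_def)
  have tT: "t ` {..m} = T"
    using len sts by (auto simp: t_def in_set_conv_nth image_iff less_Suc_eq_le)
  have t01: "t k \<in> {0..1}" if "k \<le> m" for k using tT T that by blast
  have t0: "t 0 = 0"
  proof -
    have "0 \<in> t ` {..m}" using T(2) tT by simp
    then obtain k where k: "k \<le> m" "t k = 0" by auto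
    have "t 0 \<le> t k" using k sm strict_mono_onD[OF sm, of 0 k] by (cases "k = 0") auto
    then show ?thesis using k t01[of 0] by auto
  qed
  have tk: "\<exists>k\<le>m. snd p = t k" if "p \<in> P" for p
  proof -
    have "snd p \<in> t ` {..m}" using that tT by (simp add: T_def)
    then show ?thesis by auto
  qed
  have tle: "t l \<le> t (Suc l)" if "l < m" for l
    using strict_mono_onD[OF sm, of l "Suc l"] that by auto
  have steps: "(\<Sum>l<m. of_bool (t l < u) * (f (t (Suc l)) - f (t l))) = f u - f 0"
    if "u \<in> T" for f :: "real \<Rightarrow> real" and u
  proof -
    have "u \<in> t ` {..m}" using that tT by simp
    then obtain k where "k \<le> m" "u = t k" by auto
    then show ?thesis using sum_steps_below[OF sm, of k f] by (simp add: t0)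
  qed
  have uT: "snd p \<in> T" if "p \<in> P" for p using that by (simp add: T_def)
  \<comment> \<open>Step \<open>l\<close> contributes to the value at time \<open>snd p\<close>
    exactly when it starts before that time.\<close>
  define e :: "nat \<Rightarrow> 'i \<times> real \<Rightarrow> real" where "e l p = c p * of_bool (t l < snd p)" for l :: nat and p :: "'i \<times> real"
  define X where "X l w = (\<Sum>p\<in>P. e l p * (Y (fst p) (t (Suc l)) w - Y (fst p) (t l) w))" for l w
  define mu where "mu l = (t (Suc l) - t l) * (\<Sum>p\<in>P. e l p * b (fst p))" for l
  define va where "va l = (t (Suc l) - t l) * (\<Sum>p\<in>P. \<Sum>q\<in>P. e l p * e l q * C (fst p) (fst q))" for l
  have FP: "fst ` P \<subseteq> I" "finite (fst ` P)" using P by auto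
  have nX: "normal_rv M (X l) (mu l) (va l)" if "l < m" for l
    unfolding X_def mu_def va_def
    using joint_brownian_motion_normal_increment[OF bm _ FP(1), of "t l" "t (Suc l)" "e l"]
      P tle[OF that] t01[of l] t01[of "Suc l"] that by auto
  have ind: "M.indep_vars (\<lambda>_. PiM (fst ` P) (\<lambda>_. borel))
          (\<lambda>l w. \<lambda>a\<in>fst ` P. Y a (t (Suc l)) w - Y a (t l) w) {..<m}"
  proof -
    have "\<forall>A t (m::nat). finite A \<and> A \<subseteq> I \<and> mono_on {..m} t \<and> t ` {..m} \<subseteq> {0..1} \<longrightarrow>
        M.indep_vars (\<lambda>_. PiM A (\<lambda>_. borel))
          (\<lambda>l w. \<lambda>a\<in>A. Y a (t (Suc l)) w - Y a (t l) w) {..<m}"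
      using bm unfolding joint_brownian_motion_def by (elim conjE)
    moreover have "mono_on {..m} t" using sm by (rule strict_mono_on_imp_mono_on)
    moreover have "t ` {..m} \<subseteq> {0..1}" using tT T by simp
    ultimately show ?thesis using FP by blast
  qed
  have indX: "M.indep_vars (\<lambda>_. borel) X {..<m}"
  proof -
    have "M.indep_vars (\<lambda>_. borel)
       (\<lambda>l. (\<lambda>v. \<Sum>p\<in>P. e l p * v (fst p)) \<circ> (\<lambda>w. \<lambda>a\<in>fst ` P. Y a (t (Suc l)) w - Y a (t l) w)) {..<m}"
      by (rule M.indep_vars_compose[OF ind]) (auto intro!: borel_measurable_sum borel_measurable_times measurable_component_singleton)
    moreover have "(\<lambda>v. \<Sum>p\<in>P. e l p * v (fst p)) \<circ> (\<lambda>w. \<lambda>a\<in>fst ` P. Y a (t (Suc l)) w - Y a (t l) w) = X l" for l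
      by (auto simp: X_def fun_eq_iff)
    ultimately show ?thesis by simp
  qed
  have Xm[measurable]: "X l \<in> borel_measurable M" if "l < m" for l
    using nX[OF that] by (auto simp: normal_rv_def)
  have Ym: "Y (fst p) u \<in> borel_measurable M" if "p \<in> P" "u \<in> {0..1}" for p u
    using bm P that by (auto simp: joint_brownian_motion_def)
  have AE0: "AE w in M. \<forall>p\<in>P. Y (fst p) 0 w = 0"
  proof (subst AE_finite_all)
    have "\<forall>a\<in>I. AE w in M. Y a 0 w = 0 \<and> continuous_on {0..1} (\<lambda>u. Y a u w)"
      using bm unfolding joint_brownian_motion_def by (elim conjE)
    then have "AE w in M. Y a 0 w = 0" if "a \<in> I" for a
      using that by (auto elim!: eventually_mono dest!: bspec)
    then show "\<forall>p\<in>P. AE w in M. Y (fst p) 0 w = 0" using FP by auto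
  qed (use P in auto)
  have tot: "AE w in M. (\<Sum>p\<in>P. c p * (case p of (a, u) \<Rightarrow> Y a u) w) = (\<Sum>l<m. X l w)"
    using AE0
  proof eventually_elim
    case (elim w)
    have "(\<Sum>l<m. X l w) = (\<Sum>p\<in>P. c p * (\<Sum>l<m. of_bool (t l < snd p) * (Y (fst p) (t (Suc l)) w - Y (fst p) (t l) w)))"
      unfolding X_def e_def by (subst sum.swap) (simp only: sum_distrib_left mult.assoc)
    also have "\<dots> = (\<Sum>p\<in>P. c p * (Y (fst p) (snd p) w - Y (fst p) 0 w))"
      by (intro sum.cong refl arg_cong2[where f="(*)"] steps[OF uT])
    also have "\<dots> = (\<Sum>p\<in>P. c p * (case p of (a, u) \<Rightarrow> Y a u) w)"
      using elim by (auto intro!: sum.cong split: prod.split)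
    finally show ?case by simp
  qed
  have smu: "(\<Sum>l<m. mu l) = (\<Sum>p\<in>P. c p * (case p of (a, u) \<Rightarrow> u * b a))"
  proof -
    have "(\<Sum>l<m. mu l) = (\<Sum>p\<in>P. c p * b (fst p) * (\<Sum>l<m. of_bool (t l < snd p) * (t (Suc l) - t l)))"
      unfolding mu_def e_def sum_distrib_left by (subst sum.swap) (simp only: sum_distrib_left mult_ac)
    also have "\<dots> = (\<Sum>p\<in>P. c p * b (fst p) * snd p)"
    proof (intro sum.cong refl arg_cong2[where f="(*)"])
      fix p assume "p \<in> P"
      from steps[OF uT[OF this], of "\<lambda>u. u"]
      show "(\<Sum>l<m. of_bool (t l < snd p) * (t (Suc l) - t l)) = snd p" by simp
    qed
    finally show ?thesis by (simp add: case_prod_beta mult_ac)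
  qed
  have sva: "(\<Sum>l<m. va l) = (\<Sum>p\<in>P. \<Sum>q\<in>P. c p * c q * (case p of (a, u) \<Rightarrow> \<lambda>(a', u'). min u u' * C a a') q)"
  proof -
    \<comment> \<open>Two evaluations share the steps before the smaller of their times. The lengths
      of these steps add up to the minimum, which is the Brownian covariance.\<close>
    have "(\<Sum>l<m. va l) = (\<Sum>p\<in>P. \<Sum>q\<in>P. c p * c q * C (fst p) (fst q) * (\<Sum>l<m. of_bool (t l < min (snd p) (snd q)) * (t (Suc l) - t l)))"
      unfolding va_def e_def sum_distrib_left
      by (subst sum.swap, intro sum.cong refl, subst sum.swap)
        (simp only: sum_distrib_left of_bool_conj mult_ac min_less_iff_conj)
    also have "\<dots> = (\<Sum>p\<in>P. \<Sum>q\<in>P. c p * c q * C (fst p) (fst q) * min (snd p) (snd q))"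
    proof (intro sum.cong refl)
      fix p q assume "p \<in> P" "q \<in> P"
      then have "min (snd p) (snd q) \<in> T" using uT[of p] uT[of q] by (simp add: min_def)
      from steps[OF this, of "\<lambda>u. u"]
      show "c p * c q * C (fst p) (fst q) * (\<Sum>l<m. of_bool (t l < min (snd p) (snd q)) * (t (Suc l) - t l)) =
           c p * c q * C (fst p) (fst q) * min (snd p) (snd q)" by simp
    qed
    finally show ?thesis by (simp add: case_prod_beta mult_ac)
  qed
  have "(\<integral>w. iexp (\<Sum>p\<in>P. c p * (case p of (a, u) \<Rightarrow> Y a u) w) \<partial>M) = (\<integral>w. iexp (\<Sum>l<m. X l w) \<partial>M)"
  proof (rule integral_cong_AE)
    show "(\<lambda>w. iexp (\<Sum>p\<in>P. c p * (case p of (a, u) \<Rightarrow> Y a u) w)) \<in> borel_measurable M"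
    proof -
      have "(\<lambda>w. \<Sum>p\<in>P. c p * (case p of (a, u) \<Rightarrow> Y a u) w) \<in> borel_measurable M"
        using Ym P by (auto simp: case_prod_beta intro!: borel_measurable_sum borel_measurable_times)
      then show ?thesis by measurable
    qed
    show "AE w in M. iexp (\<Sum>p\<in>P. c p * (case p of (a, u) \<Rightarrow> Y a u) w) = iexp (\<Sum>l<m. X l w)"
      using tot by eventually_elim simp
  qed measurable
  also have "\<dots> = char (distr M borel (\<lambda>w. \<Sum>l<m. X l w)) 1"
    unfolding char_def by (subst integral_distr) auto
  also have "\<dots> = (\<Prod>l<m. char (distr M borel (X l)) 1)"
    by (rule M.char_distr_sum[OF indX])
  also have "\<dots> = (\<Prod>l<m. exp (\<i> * complex_of_real (mu l) - complex_of_real (va l / 2)))"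
  proof (intro prod.cong refl)
    fix l assume "l \<in> {..<m}"
    then show "char (distr M borel (X l)) 1 = exp (\<i> * complex_of_real (mu l) - complex_of_real (va l / 2))"
      using normal_rv_iexp[OF nX[of l], of 1] unfolding char_def by (subst integral_distr) auto
  qed
  also have "\<dots> = exp (\<Sum>l<m. \<i> * complex_of_real (mu l) - complex_of_real (va l / 2))"
    by (simp add: exp_sum)
  also have "\<dots> = exp (\<i> * complex_of_real (\<Sum>l<m. mu l) - complex_of_real ((\<Sum>l<m. va l) / 2))"
    by (simp add: sum_subtractf sum_distrib_left sum_divide_distrib)
  finally show "(\<integral>w. iexp (\<Sum>p\<in>P. c p * (case p of (a, u) \<Rightarrow> Y a u) w) \<partial>M) =
     exp (\<i> * complex_of_real (\<Sum>p\<in>P. c p * (case p of (a, u) \<Rightarrow> u * b a))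
        - complex_of_real ((\<Sum>p\<in>P. \<Sum>q\<in>P. c p * c q * (case p of (a, u) \<Rightarrow> \<lambda>(a', u'). min u u' * C a a') q) / 2))"
    by (simp only: smu sva)
qed

text \<open>The index type may change. In this way the log-likelihoods, the observed processes and
  the bridges become members of one Gaussian family, being linear combinations of the same
  coordinates.\<close>

lemma gaussian_family_linear:
  assumes G: "gaussian_family M I X m K" and S: "\<And>j. j \<in> J \<Longrightarrow> finite (S j) \<and> S j \<subseteq> I"
  shows "gaussian_family M J (\<lambda>j w. \<Sum>a\<in>S j. l j a * X a w) (\<lambda>j. \<Sum>a\<in>S j. l j a * m a)
           (\<lambda>j j'. \<Sum>a\<in>S j. \<Sum>b\<in>S j'. l j a * l j' b * K a b)"
  unfolding gaussian_family_def
proof (intro conjI ballI allI impI)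
  fix j assume "j \<in> J"
  then show "(\<lambda>w. \<Sum>a\<in>S j. l j a * X a w) \<in> borel_measurable M"
    using S[of j] G by (auto simp: gaussian_family_def intro!: borel_measurable_sum borel_measurable_times)
next
  fix B c
  assume B: "finite B \<and> B \<subseteq> J"
  define A where "A = (\<Union>j\<in>B. S j)"
  have A: "finite A" "A \<subseteq> I" using B S by (auto simp: A_def)
  define d where "d a = (\<Sum>j\<in>B. c j * (if a \<in> S j then l j a else (0::real)))" for a
  have key: "(\<Sum>a\<in>A. d a * z a) = (\<Sum>j\<in>B. c j * (\<Sum>a\<in>S j. l j a * z a))" for z
  proof -
    have "(\<Sum>a\<in>A. d a * z a) = (\<Sum>j\<in>B. \<Sum>a\<in>A. c j * (if a \<in> S j then l j a else 0) * z a)"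
      unfolding d_def sum_distrib_right by (rule sum.swap)
    also have "\<dots> = (\<Sum>j\<in>B. c j * (\<Sum>a\<in>S j. l j a * z a))"
    proof (intro sum.cong refl)
      fix j assume j: "j \<in> B"
      have "(\<Sum>a\<in>A. c j * (if a \<in> S j then l j a else 0) * z a) = (\<Sum>a\<in>S j. c j * (l j a * z a))"
        by (rule sum.mono_neutral_cong_right) (use A j in \<open>auto simp: A_def\<close>)
      then show "(\<Sum>a\<in>A. c j * (if a \<in> S j then l j a else 0) * z a) = c j * (\<Sum>a\<in>S j. l j a * z a)"
        by (simp add: sum_distrib_left)
    qed
    finally show ?thesis .
  qed
  have k2: "(\<Sum>a\<in>A. \<Sum>b\<in>A. d a * d b * K a b)
      = (\<Sum>i\<in>B. \<Sum>j\<in>B. c i * c j * (\<Sum>a\<in>S i. \<Sum>b\<in>S j. l i a * l j b * K a b))"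
  proof -
    have "(\<Sum>a\<in>A. \<Sum>b\<in>A. d a * d b * K a b) = (\<Sum>a\<in>A. d a * (\<Sum>b\<in>A. d b * K a b))"
      by (simp only: sum_distrib_left mult.assoc)
    also have "\<dots> = (\<Sum>a\<in>A. d a * (\<Sum>j\<in>B. c j * (\<Sum>b\<in>S j. l j b * K a b)))" by (simp only: key)
    also have "\<dots> = (\<Sum>i\<in>B. c i * (\<Sum>a\<in>S i. l i a * (\<Sum>j\<in>B. c j * (\<Sum>b\<in>S j. l j b * K a b))))"
      by (rule key)
    also have "\<dots> = (\<Sum>i\<in>B. \<Sum>j\<in>B. c i * c j * (\<Sum>a\<in>S i. \<Sum>b\<in>S j. l i a * l j b * K a b))"
      by (simp only: sum_distrib_left mult_ac, intro sum.cong refl, subst sum.swap) (rule refl)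
    finally show ?thesis .
  qed
  have "(\<integral>w. iexp (\<Sum>a\<in>A. d a * X a w) \<partial>M)
          = exp (\<i> * complex_of_real (\<Sum>a\<in>A. d a * m a)
                 - complex_of_real ((\<Sum>a\<in>A. \<Sum>b\<in>A. d a * d b * K a b) / 2))"
    using G A unfolding gaussian_family_def by blast
  then show "(\<integral>w. iexp (\<Sum>j\<in>B. c j * (\<Sum>a\<in>S j. l j a * X a w)) \<partial>M) =
           exp (\<i> * complex_of_real (\<Sum>j\<in>B. c j * (\<Sum>a\<in>S j. l j a * m a)) -
              complex_of_real ((\<Sum>i\<in>B. \<Sum>j\<in>B. c i * c j * (\<Sum>a\<in>S i. \<Sum>b\<in>S j. l i a * l j b * K a b)) / 2))"
    by (simp only: key[of "\<lambda>a. X a _"] key[of m] k2)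
qed

section \<open>Cylinder sets and uniqueness of Gaussian laws\<close>

definition cylinders :: "'a set \<Rightarrow> 'i set \<Rightarrow> ('i \<Rightarrow> 'a \<Rightarrow> real) \<Rightarrow> 'a set set" where
  "cylinders \<Omega> I X = {\<Omega> \<inter> (\<Inter>a\<in>A. X a -` B a) | A B. finite A \<and> A \<subseteq> I \<and> (\<forall>a. B a \<in> sets borel)}"

lemma cylinders_subset: "cylinders \<Omega> I X \<subseteq> Pow \<Omega>"
  unfolding cylinders_def by blast

lemma space_in_cylinders: "\<Omega> \<in> cylinders \<Omega> I X"
  unfolding cylinders_def by (rule CollectI, rule exI[of _ "{}"], rule exI[of _ "\<lambda>_. UNIV"]) auto

lemma Int_stable_cylinders: "Int_stable (cylinders \<Omega> I X)"
proof (rule Int_stableI)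
  fix a b assume "a \<in> cylinders \<Omega> I X" "b \<in> cylinders \<Omega> I X"
  then obtain A B A' B' where a: "a = \<Omega> \<inter> (\<Inter>a\<in>A. X a -` B a)" "finite A" "A \<subseteq> I" "\<forall>a. B a \<in> sets borel"
    and b: "b = \<Omega> \<inter> (\<Inter>a\<in>A'. X a -` B' a)" "finite A'" "A' \<subseteq> I" "\<forall>a. B' a \<in> sets borel"
    unfolding cylinders_def by auto
  \<comment> \<open>Coordinates that only one of the two cylinders restricts are padded with
    \<open>UNIV\<close>.\<close>
  define B'' where "B'' = (\<lambda>i. (if i \<in> A then B i else UNIV) \<inter> (if i \<in> A' then B' i else UNIV))"
  have "a \<inter> b = \<Omega> \<inter> (\<Inter>i\<in>A \<union> A'. X i -` B'' i)"
    unfolding a(1) b(1) B''_def by (auto split: if_splits)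
  moreover have "\<forall>i. B'' i \<in> sets borel" using a b by (auto simp: B''_def)
  ultimately show "a \<inter> b \<in> cylinders \<Omega> I X"
    unfolding cylinders_def using a(2,3) b(2,3)
    by (intro CollectI exI[of _ "A \<union> A'"] exI[of _ B'']) simp
qed

lemma sets_generated_algebra:
  "sets (generated_algebra \<Omega> I X) = sigma_sets \<Omega> (\<Union>i\<in>I. (\<lambda>A. X i -` A \<inter> \<Omega>) ` sets borel)"
  unfolding generated_algebra_def by (rule sets_measure_of) auto

lemma space_generated_algebra [simp]: "space (generated_algebra \<Omega> I X) = \<Omega>"
  unfolding generated_algebra_def by (rule space_measure_of) auto

lemma sets_generated_algebra_cylinders:
  "sets (generated_algebra \<Omega> I X) = sigma_sets \<Omega> (cylinders \<Omega> I X)"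
  unfolding sets_generated_algebra
proof (rule sigma_sets_eqI)
  fix a assume "a \<in> (\<Union>i\<in>I. (\<lambda>A. X i -` A \<inter> \<Omega>) ` sets borel)"
  then obtain i A where "i \<in> I" "A \<in> sets borel" "a = X i -` A \<inter> \<Omega>" by auto
  then have "a \<in> cylinders \<Omega> I X"
    unfolding cylinders_def by (intro CollectI exI[of _ "{i}"] exI[of _ "\<lambda>_. A"]) auto
  then show "a \<in> sigma_sets \<Omega> (cylinders \<Omega> I X)" ..
next
  fix b assume "b \<in> cylinders \<Omega> I X"
  then obtain A B where b: "b = \<Omega> \<inter> (\<Inter>a\<in>A. X a -` B a)" "finite A" "A \<subseteq> I" "\<forall>a. B a \<in> sets borel"
    unfolding cylinders_def by auto
  show "b \<in> sigma_sets \<Omega> (\<Union>i\<in>I. (\<lambda>A. X i -` A \<inter> \<Omega>) ` sets borel)"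
  proof (cases "A = {}")
    case True then show ?thesis using b(1) by (simp add: sigma_sets_top)
  next
    case False
    have "b = (\<Inter>a\<in>A. X a -` B a \<inter> \<Omega>)" unfolding b(1) using False by auto
    also have "\<dots> \<in> sets (generated_algebra \<Omega> I X)"
    proof (rule sets.finite_INT)
      fix i assume "i \<in> A"
      then show "X i -` B i \<inter> \<Omega> \<in> sets (generated_algebra \<Omega> I X)"
        unfolding sets_generated_algebra using b(3,4) by (intro sigma_sets.Basic) blast
    qed (use b(2) False in auto)
    finally show ?thesis by (simp only: sets_generated_algebra)
  qed
qed

lemma measurable_generated_algebra:
  fixes X :: "'i \<Rightarrow> 'a \<Rightarrow> 'b::topological_space"
  assumes "i \<in> I" shows "X i \<in> borel_measurable (generated_algebra \<Omega> I X)"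
proof (rule measurableI)
  fix A :: "'b set" assume "A \<in> sets borel"
  then show "X i -` A \<inter> space (generated_algebra \<Omega> I X) \<in> sets (generated_algebra \<Omega> I X)"
    using assms unfolding sets_generated_algebra space_generated_algebra by (intro sigma_sets.Basic) blast
qed simp

lemma (in prob_space) prob_cylinder:
  fixes X :: "'i \<Rightarrow> 'a \<Rightarrow> real"
  assumes "finite A" "\<And>a. a \<in> A \<Longrightarrow> X a \<in> borel_measurable M" "\<And>a. a \<in> A \<Longrightarrow> B a \<in> sets borel"
  shows "space M \<inter> (\<Inter>a\<in>A. X a -` B a) \<in> sets M"
    "prob (space M \<inter> (\<Inter>a\<in>A. X a -` B a)) = (\<integral>w. (\<Prod>a\<in>A. indicator (B a) (X a w)) \<partial>M)"
proof -
  have "space M \<inter> (\<Inter>a\<in>A. X a -` B a) = {w \<in> space M. \<forall>a\<in>A. X a w \<in> B a}" by auto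
  also have "\<dots> \<in> sets M"
    using assms by (intro sets.sets_Collect_finite_All) (auto intro!: measurable_sets_Collect[of _ M borel])
  finally show *: "space M \<inter> (\<Inter>a\<in>A. X a -` B a) \<in> sets M" .
  have "prob (space M \<inter> (\<Inter>a\<in>A. X a -` B a)) = (\<integral>w. indicator (space M \<inter> (\<Inter>a\<in>A. X a -` B a)) w \<partial>M)"
    using * by simp
  also have "\<dots> = (\<integral>w. (\<Prod>a\<in>A. indicator (B a) (X a w)) \<partial>M)"
  proof (intro Bochner_Integration.integral_cong refl)
    fix w assume "w \<in> space M"
    then show "indicator (space M \<inter> (\<Inter>a\<in>A. X a -` B a)) w = (\<Prod>a\<in>A. indicator (B a) (X a w) :: real)"
      using assms(1) by (cases "\<forall>a\<in>A. X a w \<in> B a") (auto simp: indicator_def intro!: prod_zero[symmetric])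
  qed
  finally show "prob (space M \<inter> (\<Inter>a\<in>A. X a -` B a)) = (\<integral>w. (\<Prod>a\<in>A. indicator (B a) (X a w)) \<partial>M)" .
qed

text \<open>The characteristic functions determine the probabilities of finite-dimensional
  cylinders. These form an intersection-stable generator of the \<sigma>-field, even if the index
  set is uncountable.\<close>

lemma gaussian_family_unique:
  assumes M: "prob_space M" and N: "prob_space N" and sp: "space M = \<Omega>" "space N = \<Omega>"
    and sM: "sets M = sets (generated_algebra \<Omega> I X)" and sN: "sets N = sets (generated_algebra \<Omega> I X)"
    and GM: "gaussian_family M I X m K" and GN: "gaussian_family N I X m K"
  shows "M = N"
proof (rule measure_eqI_generator_eq[OF Int_stable_cylinders cylinders_subset])
  interpret M: prob_space M by fact
  interpret N: prob_space N by fact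
  fix a assume "a \<in> cylinders \<Omega> I X"
  then obtain A B where a: "a = \<Omega> \<inter> (\<Inter>a\<in>A. X a -` B a)" "finite A" "A \<subseteq> I" "\<forall>a. B a \<in> sets borel"
    unfolding cylinders_def by auto
  have mM: "X b \<in> borel_measurable M" if "b \<in> A" for b using GM a(3) that by (auto simp: gaussian_family_def)
  have mN: "X b \<in> borel_measurable N" if "b \<in> A" for b using GN a(3) that by (auto simp: gaussian_family_def)
  have "(\<integral>w. (1::real) * (\<Prod>a\<in>A. indicator (B a) (X a w)) \<partial>M) = (\<integral>w. 1 * (\<Prod>a\<in>A. indicator (B a) (X a w)) \<partial>N)"
  proof (rule weighted_char_unique_finite[OF M N a(2), where K=1 and u="\<lambda>_. 1" and v="\<lambda>_. 1"])
    fix c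
    show "(\<integral>w. complex_of_real 1 * iexp (\<Sum>a\<in>A. c a * X a w) \<partial>M) = (\<integral>w. complex_of_real 1 * iexp (\<Sum>a\<in>A. c a * X a w) \<partial>N)"
      using GM GN a(2,3) unfolding gaussian_family_def by simp
  qed (use mM mN a in auto)
  then have "M.prob a = N.prob a"
    using M.prob_cylinder(2)[OF a(2) mM, where B=B] N.prob_cylinder(2)[OF a(2) mN, where B=B] a sp by simp
  then show "emeasure M a = emeasure N a"
    by (simp add: M.emeasure_eq_measure N.emeasure_eq_measure)
next
  show "range (\<lambda>_. \<Omega>) \<subseteq> cylinders \<Omega> I X" using space_in_cylinders by auto
next
  fix i :: nat
  interpret M: prob_space M by fact
  show "emeasure M \<Omega> \<noteq> \<infinity>" by simp
qed (use sM sN in \<open>auto simp: sets_generated_algebra_cylinders\<close>)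

section \<open>Independence from factorizing characteristic functions\<close>

lemma integral_prod_pair:
  fixes f :: "'a \<Rightarrow> complex" and g :: "'b \<Rightarrow> complex"
  assumes "prob_space M" "prob_space N" and [measurable]: "f \<in> borel_measurable M" "g \<in> borel_measurable N"
    and "\<And>x. norm (f x) \<le> 1" "\<And>x. norm (g x) \<le> 1"
  shows "(\<integral>z. f (fst z) * g (snd z) \<partial>(M \<Otimes>\<^sub>M N)) = (\<integral>x. f x \<partial>M) * (\<integral>y. g y \<partial>N)"
proof -
  interpret M: prob_space M by fact
  interpret N: prob_space N by fact
  interpret pair_prob_space M N ..
  have "integrable (M \<Otimes>\<^sub>M N) (\<lambda>z. f (fst z) * g (snd z))"
    by (rule P.integrable_const_bound[of _ 1]) (use assms(5,6) in \<open>auto simp: norm_mult intro!: mult_le_one\<close>)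
  from integral_fst'[OF this] show ?thesis by simp
qed

text \<open>The pair of families under \<open>M\<close> is compared with the pair read off from the
  two coordinates of the product of \<open>M\<close> with itself, where independence holds by
  construction. Factorization says that both pairs have the same characteristic functions, hence the
  same probabilities of cylinders.\<close>

lemma indep_families_of_char:
  fixes X :: "'i \<Rightarrow> 'a \<Rightarrow> real" and Y :: "'j \<Rightarrow> 'a \<Rightarrow> real"
  assumes M: "prob_space M" and X: "\<And>a. a \<in> I \<Longrightarrow> X a \<in> borel_measurable M"
    and Y: "\<And>b. b \<in> J \<Longrightarrow> Y b \<in> borel_measurable M"
    and ch: "\<And>A B c d. finite A \<Longrightarrow> A \<subseteq> I \<Longrightarrow> finite B \<Longrightarrow> B \<subseteq> J \<Longrightarrow>
      (\<integral>w. iexp ((\<Sum>a\<in>A. c a * X a w) + (\<Sum>b\<in>B. d b * Y b w)) \<partial>M)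
       = (\<integral>w. iexp (\<Sum>a\<in>A. c a * X a w) \<partial>M) * (\<integral>w. iexp (\<Sum>b\<in>B. d b * Y b w) \<partial>M)"
  shows "prob_space.indep_set M (sets (generated_algebra (space M) I X)) (sets (generated_algebra (space M) J Y))"
proof -
  interpret M: prob_space M by fact
  interpret MM: pair_prob_space M M ..
  have "M.indep_set (cylinders (space M) I X) (cylinders (space M) J Y)"
  proof (rule M.indep_setI)
    show "cylinders (space M) I X \<subseteq> M.events"
      using X by (auto simp: cylinders_def intro!: M.prob_cylinder(1))
    show "cylinders (space M) J Y \<subseteq> M.events"
      using Y by (auto simp: cylinders_def intro!: M.prob_cylinder(1))
    fix a b assume "a \<in> cylinders (space M) I X" "b \<in> cylinders (space M) J Y"
    then obtain A B A' B' where a: "a = space M \<inter> (\<Inter>a\<in>A. X a -` B a)" "finite A" "A \<subseteq> I" "\<forall>a. B a \<in> sets borel"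
      and b: "b = space M \<inter> (\<Inter>a\<in>A'. Y a -` B' a)" "finite A'" "A' \<subseteq> J" "\<forall>a. B' a \<in> sets borel"
      unfolding cylinders_def by auto
    have mX[measurable]: "X i \<in> borel_measurable M" if "i \<in> A" for i using X a that by auto
    have mY[measurable]: "Y i \<in> borel_measurable M" if "i \<in> A'" for i using Y b that by auto
    define W where "W = case_sum X Y"
    define V where "V = case_sum (\<lambda>i z. X i (fst z)) (\<lambda>i z. Y i (snd z))"
    define BB where "BB = case_sum B B'"
    have fin: "finite (A <+> A')" using a b by simp
    have mW: "W i \<in> borel_measurable M" if "i \<in> A <+> A'" for i
      using that by (auto simp: W_def)
    have mV: "V i \<in> borel_measurable (M \<Otimes>\<^sub>M M)" if "i \<in> A <+> A'" for i
      using that by (auto simp: V_def)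
    have mB: "BB i \<in> sets borel" for i using a b by (auto simp: BB_def split: sum.split)
    have "(\<integral>w. (1::real) * (\<Prod>i\<in>A <+> A'. indicator (BB i) (W i w)) \<partial>M)
        = (\<integral>w. 1 * (\<Prod>i\<in>A <+> A'. indicator (BB i) (V i w)) \<partial>(M \<Otimes>\<^sub>M M))"
    proof (rule weighted_char_unique_finite[OF M MM.P.prob_space_axioms fin, where K=1 and u="\<lambda>_. 1" and v="\<lambda>_. 1"])
      fix c
      have "(\<integral>z. iexp ((\<Sum>a\<in>A. c (Inl a) * X a (fst z)) + (\<Sum>b\<in>A'. c (Inr b) * Y b (snd z))) \<partial>(M \<Otimes>\<^sub>M M))
         = (\<integral>z. iexp (\<Sum>a\<in>A. c (Inl a) * X a (fst z)) * iexp (\<Sum>b\<in>A'. c (Inr b) * Y b (snd z)) \<partial>(M \<Otimes>\<^sub>M M))"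
        by (simp only: of_real_add distrib_left exp_add)
      also have "\<dots> = (\<integral>w. iexp (\<Sum>a\<in>A. c (Inl a) * X a w) \<partial>M) * (\<integral>w. iexp (\<Sum>b\<in>A'. c (Inr b) * Y b w) \<partial>M)"
        by (rule integral_prod_pair[OF M M]) (use norm_exp_i_times in auto)
      also have "\<dots> = (\<integral>w. iexp ((\<Sum>a\<in>A. c (Inl a) * X a w) + (\<Sum>b\<in>A'. c (Inr b) * Y b w)) \<partial>M)"
        by (rule ch[symmetric]) (use a b in auto)
      finally show "(\<integral>w. complex_of_real 1 * iexp (\<Sum>a\<in>A <+> A'. c a * W a w) \<partial>M)
        = (\<integral>w. complex_of_real 1 * iexp (\<Sum>a\<in>A <+> A'. c a * V a w) \<partial>(M \<Otimes>\<^sub>M M))"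
        using a b by (simp add: sum.Plus W_def V_def)
    qed (use mW mV mB in auto)
    then have e: "(\<integral>w. (\<Prod>i\<in>A. indicator (B i) (X i w)) * (\<Prod>i\<in>A'. indicator (B' i) (Y i w)) \<partial>M)
        = (\<integral>z. (\<Prod>i\<in>A. indicator (B i) (X i (fst z))) * (\<Prod>i\<in>A'. indicator (B' i) (Y i (snd z))) \<partial>(M \<Otimes>\<^sub>M M) :: real)"
      using a b by (simp add: prod.Plus W_def V_def BB_def)
    have ab: "a \<inter> b = space M \<inter> (\<Inter>i\<in>A <+> A'. W i -` BB i)"
      unfolding a b W_def BB_def by (auto simp: Plus_def ball_Un)
    have [measurable]: "B i \<in> sets borel" "B' j \<in> sets borel" for i j using a b by auto
    have "M.prob (a \<inter> b) = (\<integral>w. (\<Prod>i\<in>A <+> A'. indicator (BB i) (W i w)) \<partial>M)"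
      unfolding ab by (rule M.prob_cylinder(2)[OF fin mW mB])
    also have "\<dots> = (\<integral>z. (\<Prod>i\<in>A. indicator (B i) (X i (fst z))) * (\<Prod>i\<in>A'. indicator (B' i) (Y i (snd z))) \<partial>(M \<Otimes>\<^sub>M M) :: real)"
      unfolding e[symmetric] using a b by (simp add: prod.Plus W_def BB_def)
    also have "\<dots> = Re (\<integral>z. complex_of_real (\<Prod>i\<in>A. indicator (B i) (X i (fst z))) * complex_of_real (\<Prod>i\<in>A'. indicator (B' i) (Y i (snd z))) \<partial>(M \<Otimes>\<^sub>M M))"
      by (simp only: of_real_mult[symmetric] integral_complex_of_real Re_complex_of_real)
    also have "\<dots> = Re ((\<integral>w. complex_of_real (\<Prod>i\<in>A. indicator (B i) (X i w)) \<partial>M) * (\<integral>w. complex_of_real (\<Prod>i\<in>A'. indicator (B' i) (Y i w)) \<partial>M))"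
    proof (subst integral_prod_pair[OF M M])
      have "\<bar>\<Prod>i\<in>C. indicator (E i) (g i)\<bar> \<le> (1::real)" for C and E :: "'k \<Rightarrow> real set" and g
        unfolding abs_prod by (rule prod_le_1) (auto simp: indicator_def)
      then show "cmod (complex_of_real (\<Prod>i\<in>A. indicator (B i) (X i x))) \<le> 1"
        "cmod (complex_of_real (\<Prod>i\<in>A'. indicator (B' i) (Y i x))) \<le> 1" for x
        by (simp_all only: norm_of_real)
      show "(\<lambda>w. complex_of_real (\<Prod>i\<in>A. indicator (B i) (X i w))) \<in> borel_measurable M"
        by measurable
      show "(\<lambda>w. complex_of_real (\<Prod>i\<in>A'. indicator (B' i) (Y i w))) \<in> borel_measurable M"
        by measurable
    qed (rule refl)
    also have "\<dots> = (\<integral>w. (\<Prod>i\<in>A. indicator (B i) (X i w)) \<partial>M) * (\<integral>w. (\<Prod>i\<in>A'. indicator (B' i) (Y i w)) \<partial>M)"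
      by (simp only: integral_complex_of_real of_real_mult[symmetric] Re_complex_of_real)
    also have "\<dots> = M.prob a * M.prob b"
      unfolding a(1) b(1) by (subst (1 2) M.prob_cylinder(2)) (use a b in auto)
    finally show "M.prob (a \<inter> b) = M.prob a * M.prob b" .
  qed
  then show ?thesis
    unfolding sets_generated_algebra_cylinders
    by (rule M.indep_set_sigma_sets) (rule Int_stable_cylinders)+
qed

section \<open>Exponential tilts and centred Gaussian families\<close>

lemma gaussian_familyD:
  assumes "gaussian_family M I X m K" "finite A" "A \<subseteq> I"
  shows "(\<integral>w. iexp (\<Sum>a\<in>A. c a * X a w) \<partial>M)
    = exp (\<i> * complex_of_real (\<Sum>a\<in>A. c a * m a)
           - complex_of_real ((\<Sum>a\<in>A. \<Sum>b\<in>A. c a * c b * K a b) / 2))"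
  using assms unfolding gaussian_family_def by (elim conjE) (simp only: simp_thms)

text \<open>Completing the square: multiplied by the weight, the standard normal density becomes the
  one shifted by \<open>sqrt v\<close>.\<close>

lemma normal_exponential_tilt:
  assumes "v \<ge> 0"
  shows "integrable std_normal_distribution (\<lambda>y. exp (sqrt v * y - v / 2))"
    "(\<integral>y. complex_of_real (exp (sqrt v * y - v / 2)) * iexp (k * (sqrt v * y)) \<partial>std_normal_distribution)
       = exp (\<i> * complex_of_real (k * v) - complex_of_real (k\<^sup>2 * v / 2))"
proof -
  \<comment> \<open>The shape \<open>- sqrt v + 1 * y\<close> is the one of an affine substitution
    \<open>t + c * y\<close> in a Lebesgue integral.\<close>
  have sq: "std_normal_density y * exp (sqrt v * y - v / 2) = std_normal_density (- sqrt v + 1 * y)" for y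
  proof -
    have "- y\<^sup>2 / 2 + (sqrt v * y - v / 2) = - (- sqrt v + y)\<^sup>2 / 2"
      using assms by (simp add: power2_eq_square field_simps)
    then show ?thesis by (simp add: std_normal_density_def mult.assoc flip: exp_add)
  qed
  have "integrable lborel (\<lambda>y. std_normal_density (- sqrt v + 1 * y))"
    by (rule lborel_integrable_real_affine) auto
  then show "integrable std_normal_distribution (\<lambda>y. exp (sqrt v * y - v / 2))"
    by (subst integrable_density) (auto simp: sq simp del: mult_1_left)
  have "(\<integral>y. complex_of_real (exp (sqrt v * y - v / 2)) * iexp (k * (sqrt v * y)) \<partial>std_normal_distribution)
     = (\<integral>y. std_normal_density y *\<^sub>R (complex_of_real (exp (sqrt v * y - v / 2)) * iexp (k * (sqrt v * y))) \<partial>lborel)"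
    by (subst integral_density) auto
  also have "\<dots> = (\<integral>y. std_normal_density (- sqrt v + 1 * y) *\<^sub>R iexp (k * (sqrt v * y)) \<partial>lborel)"
    by (simp only: sq[symmetric] scaleR_conv_of_real of_real_mult mult.assoc)
  also have "\<dots> = (\<integral>y. std_normal_density (- sqrt v + 1 * (sqrt v + 1 * y)) *\<^sub>R iexp (k * (sqrt v * (sqrt v + 1 * y))) \<partial>lborel)"
    by (subst lborel_integral_real_affine[where c=1 and t="sqrt v"]) auto
  also have "\<dots> = (\<integral>y. std_normal_density y *\<^sub>R (iexp (k * v) * iexp ((k * sqrt v) * y)) \<partial>lborel)"
    using assms by (intro Bochner_Integration.integral_cong refl) (simp add: algebra_simps flip: exp_add of_real_mult)
  also have "\<dots> = (\<integral>y. iexp (k * v) * iexp ((k * sqrt v) * y) \<partial>std_normal_distribution)"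
    by (subst integral_density) auto
  also have "\<dots> = iexp (k * v) * char std_normal_distribution (k * sqrt v)"
    unfolding char_def by (rule integral_mult_right_zero)
  also have "\<dots> = iexp (k * v) * complex_of_real (exp (- (k\<^sup>2 * v / 2)))"
    using assms by (simp add: char_std_normal_distribution power_mult_distrib)
  also have "\<dots> = exp (\<i> * complex_of_real (k * v) + - complex_of_real (k\<^sup>2 * v / 2))"
    by (simp only: exp_add exp_of_real[symmetric] of_real_minus)
  finally show "(\<integral>y. complex_of_real (exp (sqrt v * y - v / 2)) * iexp (k * (sqrt v * y)) \<partial>std_normal_distribution)
       = exp (\<i> * complex_of_real (k * v) - complex_of_real (k\<^sup>2 * v / 2))" by simp
qed

text \<open>The hypothesis identifies the law of \<open>X\<close> as that of \<open>sqrt v\<close>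
  times a standard normal variable, also for \<open>v = 0\<close>, which reduces the claim to the
  computation on the real line.\<close>

lemma (in prob_space) exponential_tilt:
  fixes X :: "'a \<Rightarrow> real"
  assumes [measurable]: "X \<in> borel_measurable M" and v: "v \<ge> 0"
    and ch: "\<And>s. (\<integral>w. iexp (s * X w) \<partial>M) = complex_of_real (exp (- (s\<^sup>2 * v / 2)))"
  shows "integrable M (\<lambda>w. exp (X w - v / 2))"
    "(\<integral>w. complex_of_real (exp (X w - v / 2)) * iexp (k * X w) \<partial>M)
       = exp (\<i> * complex_of_real (k * v) - complex_of_real (k\<^sup>2 * v / 2))"
proof -
  interpret S: prob_space std_normal_distribution by (rule prob_space_normal_density) simp
  have d: "distr M borel X = distr std_normal_distribution borel (\<lambda>y. sqrt v * y)"
  proof (rule Levy_uniqueness)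
    show "real_distribution (distr M borel X)" by (rule real_distribution_distr) simp
    show "real_distribution (distr std_normal_distribution borel (\<lambda>y. sqrt v * y))"
      by (rule S.real_distribution_distr) simp
    show "char (distr M borel X) = char (distr std_normal_distribution borel (\<lambda>y. sqrt v * y))"
    proof
      fix s
      have "char (distr M borel X) s = complex_of_real (exp (- (s\<^sup>2 * v / 2)))"
        unfolding char_def ch[symmetric] by (subst integral_distr) auto
      also have "\<dots> = char std_normal_distribution (s * sqrt v)"
        using v by (simp add: char_std_normal_distribution power_mult_distrib)
      also have "\<dots> = char (distr std_normal_distribution borel (\<lambda>y. sqrt v * y)) s"
        unfolding char_def by (subst integral_distr) (auto simp: mult.assoc)
      finally show "char (distr M borel X) s = char (distr std_normal_distribution borel (\<lambda>y. sqrt v * y)) s" .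
    qed
  qed
  have "integrable (distr std_normal_distribution borel (\<lambda>y. sqrt v * y)) (\<lambda>x. exp (x - v / 2))"
    using normal_exponential_tilt(1)[OF v] by (subst integrable_distr_eq) auto
  then have "integrable (distr M borel X) (\<lambda>x. exp (x - v / 2))" by (simp only: d)
  then show "integrable M (\<lambda>w. exp (X w - v / 2))"
    by (subst (asm) integrable_distr_eq) auto
  have "(\<integral>w. complex_of_real (exp (X w - v / 2)) * iexp (k * X w) \<partial>M)
     = (\<integral>x. complex_of_real (exp (x - v / 2)) * iexp (k * x) \<partial>(distr M borel X))"
    by (subst integral_distr) auto
  also have "\<dots> = (\<integral>y. complex_of_real (exp (sqrt v * y - v / 2)) * iexp (k * (sqrt v * y)) \<partial>std_normal_distribution)"
    unfolding d by (subst integral_distr) auto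
  finally show "(\<integral>w. complex_of_real (exp (X w - v / 2)) * iexp (k * X w) \<partial>M)
       = exp (\<i> * complex_of_real (k * v) - complex_of_real (k\<^sup>2 * v / 2))"
    using normal_exponential_tilt(2)[OF v] by simp
qed

lemma (in prob_space) indep_var_of_char:
  fixes X Y :: "'a \<Rightarrow> real"
  assumes [measurable]: "X \<in> borel_measurable M" "Y \<in> borel_measurable M"
    and ch: "\<And>s t. (\<integral>w. iexp (s * X w + t * Y w) \<partial>M) = (\<integral>w. iexp (s * X w) \<partial>M) * (\<integral>w. iexp (t * Y w) \<partial>M)"
  shows "indep_var borel X borel Y"
proof -
  have "indep_set (sets (generated_algebra (space M) {()} (\<lambda>_. X))) (sets (generated_algebra (space M) {()} (\<lambda>_. Y)))"
  proof (rule indep_families_of_char[OF prob_space_axioms])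
    fix A B :: "unit set" and c d :: "unit \<Rightarrow> real"
    have A: "A = {} \<or> A = {()}" and B: "B = {} \<or> B = {()}" by auto
    have e: "(\<Sum>a\<in>A. c a * X w) = (if A = {} then 0 else c ()) * X w"
      "(\<Sum>a\<in>B. d a * Y w) = (if B = {} then 0 else d ()) * Y w" for w
      using A B by auto
    show "(CLINT w|M. iexp ((\<Sum>a\<in>A. c a * X w) + (\<Sum>b\<in>B. d b * Y w))) =
       (CLINT w|M. iexp (\<Sum>a\<in>A. c a * X w)) * (CLINT w|M. iexp (\<Sum>b\<in>B. d b * Y w))"
      unfolding e by (rule ch)
  qed simp_all
  moreover have "(\<Union>i\<in>{()}. (\<lambda>A. Z -` A \<inter> space M) ` sets borel) = {Z -` A \<inter> space M | A. A \<in> sets borel}" for Z :: "'a \<Rightarrow> real"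
    by auto
  ultimately show ?thesis
    by (simp add: indep_var_eq sets_generated_algebra)
qed

text \<open>Symmetry is a separate assumption, because the characteristic functions determine only
  the symmetric part of \<open>K\<close>.\<close>

locale centred_gaussian = prob_space M for M :: "'a measure" +
  fixes I :: "'i set" and X :: "'i \<Rightarrow> 'a \<Rightarrow> real" and K :: "'i \<Rightarrow> 'i \<Rightarrow> real"
  assumes gaussian: "gaussian_family M I X (\<lambda>_. 0) K"
    and sym: "\<And>a b. a \<in> I \<Longrightarrow> b \<in> I \<Longrightarrow> K a b = K b a"
begin

lemma measurable_X [measurable]: "a \<in> I \<Longrightarrow> X a \<in> borel_measurable M"
  using gaussian by (auto simp: gaussian_family_def)

lemma char_sum:
  assumes "finite A" "A \<subseteq> I"
  shows "(\<integral>w. iexp (\<Sum>a\<in>A. c a * X a w) \<partial>M)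
    = complex_of_real (exp (- ((\<Sum>a\<in>A. \<Sum>b\<in>A. c a * c b * K a b) / 2)))"
  using gaussian_familyD[OF gaussian assms]
  by (simp flip: exp_of_real)

text \<open>The index \<open>x\<close> may itself belong to \<open>A\<close>. The two summands are
  therefore treated as a derived Gaussian family over \<open>bool\<close>, with \<open>X x\<close>
  at \<open>True\<close> and the linear combination at \<open>False\<close>.\<close>

lemma char_pair:
  assumes A: "finite A" "A \<subseteq> I" and x: "x \<in> I"
  shows "(\<integral>w. iexp (s * X x w + r * (\<Sum>a\<in>A. c a * X a w)) \<partial>M)
    = complex_of_real (exp (- ((s\<^sup>2 * K x x + 2 * s * r * (\<Sum>a\<in>A. c a * K x a)
         + r\<^sup>2 * (\<Sum>a\<in>A. \<Sum>b\<in>A. c a * c b * K a b)) / 2)))"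
proof -
  define S where "S b = (if b then {x} else A)" for b
  define l where "l b = (if b then (\<lambda>_. 1) else c)" for b
  define d where "d b = (if b then s else r)" for b
  have "gaussian_family M (UNIV :: bool set) (\<lambda>j w. \<Sum>a\<in>S j. l j a * X a w) (\<lambda>j. \<Sum>a\<in>S j. l j a * 0)
           (\<lambda>j j'. \<Sum>a\<in>S j. \<Sum>b\<in>S j'. l j a * l j' b * K a b)"
    by (rule gaussian_family_linear[OF gaussian]) (use A x in \<open>auto simp: S_def\<close>)
  then have "(\<integral>w. iexp (\<Sum>j\<in>UNIV. d j * (\<Sum>a\<in>S j. l j a * X a w)) \<partial>M)
          = exp (\<i> * complex_of_real (\<Sum>j\<in>UNIV. d j * (\<Sum>a\<in>S j. l j a * 0))
                 - complex_of_real ((\<Sum>i\<in>UNIV. \<Sum>j\<in>UNIV. d i * d j * (\<Sum>a\<in>S i. \<Sum>b\<in>S j. l i a * l j b * K a b)) / 2))"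
    by (rule gaussian_familyD) auto
  moreover have "(\<Sum>j\<in>UNIV. d j * (\<Sum>a\<in>S j. l j a * X a w)) = s * X x w + r * (\<Sum>a\<in>A. c a * X a w)" for w
    by (simp add: UNIV_bool d_def S_def l_def)
  moreover have "(\<Sum>a\<in>A. c a * K a x) = (\<Sum>a\<in>A. c a * K x a)"
    by (intro sum.cong refl) (use A x sym in auto)
  then have "(\<Sum>i\<in>UNIV. \<Sum>j\<in>UNIV. d i * d j * (\<Sum>a\<in>S i. \<Sum>b\<in>S j. l i a * l j b * K a b))
    = s\<^sup>2 * K x x + 2 * s * r * (\<Sum>a\<in>A. c a * K x a) + r\<^sup>2 * (\<Sum>a\<in>A. \<Sum>b\<in>A. c a * c b * K a b)"
    by (simp add: UNIV_bool d_def S_def l_def power2_eq_square)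
  ultimately show ?thesis by (simp flip: exp_of_real)
qed

text \<open>A characteristic function has modulus at most 1. For a Gaussian one this forces the
  quadratic form in the exponent to be nonnegative.\<close>

lemma quadratic_nonneg:
  assumes A: "finite A" "A \<subseteq> I" and x: "x \<in> I"
  shows "s\<^sup>2 * K x x + 2 * s * r * (\<Sum>a\<in>A. c a * K x a) + r\<^sup>2 * (\<Sum>a\<in>A. \<Sum>b\<in>A. c a * c b * K a b) \<ge> 0"
proof -
  have "norm (\<integral>w. iexp (s * X x w + r * (\<Sum>a\<in>A. c a * X a w)) \<partial>M) \<le> (\<integral>w. norm (iexp (s * X x w + r * (\<Sum>a\<in>A. c a * X a w))) \<partial>M)"
    by (rule integral_norm_bound)
  also have "\<dots> = 1" by (simp only: norm_exp_i_times) (simp add: prob_space)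
  finally show ?thesis unfolding char_pair[OF assms] by (simp only: norm_of_real) simp
qed

lemma variance_nonneg: "x \<in> I \<Longrightarrow> K x x \<ge> 0"
  using quadratic_nonneg[of "{}" x 1 0] by simp

lemma cov_eq_0:
  assumes A: "finite A" "A \<subseteq> I" and x: "x \<in> I" and "K x x = 0"
  shows "(\<Sum>a\<in>A. c a * K x a) = 0"
proof (rule ccontr)
  define p where "p = (\<Sum>a\<in>A. c a * K x a)"
  define q where "q = (\<Sum>a\<in>A. \<Sum>b\<in>A. c a * c b * K a b)"
  assume "(\<Sum>a\<in>A. c a * K x a) \<noteq> 0"
  then have p: "p \<noteq> 0" by (simp add: p_def)
  \<comment> \<open>With \<open>K x x = 0\<close> the form is affine in the coefficient of
    \<open>X x\<close>, and for this coefficient it takes the value -1.\<close>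
  have "0 \<le> (- (q + 1) / (2 * p))\<^sup>2 * K x x + 2 * (- (q + 1) / (2 * p)) * 1 * p + 1\<^sup>2 * q"
    unfolding p_def q_def by (rule quadratic_nonneg[OF A x])
  then show False using p assms(4) by (simp add: field_simps)
qed

text \<open>Cameron--Martin: write a linear combination of the family as a multiple of \<open>X x\<close> plus a
  remainder uncorrelated with, hence independent of, \<open>X x\<close>.\<close>

lemma exponential_tilt_sum:
  assumes A: "finite A" "A \<subseteq> I" and x: "x \<in> I"
  shows "integrable M (\<lambda>w. exp (X x w - K x x / 2))"
    "(\<integral>w. complex_of_real (exp (X x w - K x x / 2)) * iexp (\<Sum>a\<in>A. c a * X a w) \<partial>M)
     = exp (\<i> * complex_of_real (\<Sum>a\<in>A. c a * K x a)
            - complex_of_real ((\<Sum>a\<in>A. \<Sum>b\<in>A. c a * c b * K a b) / 2))"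
proof -
  define v where "v = K x x"
  define p where "p = (\<Sum>a\<in>A. c a * K x a)"
  define q where "q = (\<Sum>a\<in>A. \<Sum>b\<in>A. c a * c b * K a b)"
  define T where "T w = (\<Sum>a\<in>A. c a * X a w)" for w
  \<comment> \<open>The regression coefficient of \<open>T\<close> on \<open>X x\<close>. If
    \<open>v = 0\<close> then also \<open>p = 0\<close> by \<open>cov_eq_0\<close>, so
    \<open>k * v = p\<close> holds in both cases.\<close>
  define k where "k = (if v = 0 then 0 else p / v)"
  define R where "R w = T w - k * X x w" for w
  have v: "v \<ge> 0" using variance_nonneg[OF x] by (simp add: v_def)
  have kv: "k * v = p" using cov_eq_0[OF A x] by (simp add: k_def v_def p_def)
  have [measurable]: "X x \<in> borel_measurable M" using x by simp
  have [measurable]: "T \<in> borel_measurable M" unfolding T_def using A by (auto intro!: borel_measurable_sum borel_measurable_times)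
  have [measurable]: "R \<in> borel_measurable M" unfolding R_def by measurable
  have cp: "(\<integral>w. iexp (s * X x w + r * T w) \<partial>M) = complex_of_real (exp (- ((s\<^sup>2 * v + 2 * s * r * p + r\<^sup>2 * q) / 2)))" for s r
    using char_pair[OF A x] by (simp only: T_def v_def p_def q_def)
  have cR: "(\<integral>w. iexp (s * X x w + r * R w) \<partial>M) = complex_of_real (exp (- (s\<^sup>2 * v / 2))) * complex_of_real (exp (- (r\<^sup>2 * (q - k\<^sup>2 * v) / 2)))" for s r
  proof -
    have "s * X x w + r * R w = (s - r * k) * X x w + r * T w" for w by (simp add: R_def algebra_simps)
    moreover have "(s - r * k)\<^sup>2 * v + 2 * (s - r * k) * r * p + r\<^sup>2 * q = s\<^sup>2 * v + r\<^sup>2 * (q - k\<^sup>2 * v)"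
      unfolding kv[symmetric] by (simp add: power2_eq_square algebra_simps)
    ultimately show ?thesis using cp[of "s - r * k" r]
      by (simp add: add_divide_distrib flip: of_real_mult exp_add)
  qed
  have cX: "(\<integral>w. iexp (s * X x w) \<partial>M) = complex_of_real (exp (- (s\<^sup>2 * v / 2)))" for s
    using cR[of s 0] by simp
  have cR1: "(\<integral>w. iexp (r * R w) \<partial>M) = complex_of_real (exp (- (r\<^sup>2 * (q - k\<^sup>2 * v) / 2)))" for r
    using cR[of 0 r] by simp
  have ind: "indep_var borel (X x) borel R"
    by (rule indep_var_of_char) (auto simp: cR cX cR1 simp del: of_real_mult of_real_add)
  note tilt = exponential_tilt[of "X x", OF _ v cX]
  show "integrable M (\<lambda>w. exp (X x w - K x x / 2))" using tilt(1) by (simp add: v_def)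
  define f where "f y = complex_of_real (exp (y - v / 2)) * iexp (k * y)" for y
  have [measurable]: "f \<in> borel_measurable borel" unfolding f_def by measurable
  have [measurable]: "(\<lambda>y. iexp y) \<in> borel_measurable borel" by measurable
  have "indep_var borel (f \<circ> X x) borel ((\<lambda>y. iexp y) \<circ> R)"
    by (rule indep_var_compose[OF ind]) measurable
  then have ind2: "indep_var borel (\<lambda>w. f (X x w)) borel (\<lambda>w. iexp (R w))" by (simp add: comp_def)
  have if_: "integrable M (\<lambda>w. f (X x w))"
    by (rule Bochner_Integration.integrable_bound[OF tilt(1)]) (auto simp: f_def norm_mult)
  have iR: "integrable M (\<lambda>w. iexp (R w))" by (rule integrable_const_bound[of _ 1]) auto
  have "complex_of_real (exp (X x w - K x x / 2)) * iexp (\<Sum>a\<in>A. c a * X a w) = f (X x w) * iexp (R w)" for w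
  proof -
    have "(\<Sum>a\<in>A. c a * X a w) = k * X x w + R w" by (simp add: R_def T_def)
    then show ?thesis by (simp add: f_def v_def distrib_left exp_add)
  qed
  then have "(\<integral>w. complex_of_real (exp (X x w - K x x / 2)) * iexp (\<Sum>a\<in>A. c a * X a w) \<partial>M) = (\<integral>w. f (X x w) * iexp (R w) \<partial>M)"
    by simp
  also have "\<dots> = (\<integral>w. f (X x w) \<partial>M) * (\<integral>w. iexp (R w) \<partial>M)"
    by (rule indep_var_lebesgue_integral[OF ind2 if_ iR])
  also have "(\<integral>w. f (X x w) \<partial>M) = exp (\<i> * complex_of_real (k * v) - complex_of_real (k\<^sup>2 * v / 2))"
    unfolding f_def by (rule tilt(2)) simp
  also have "(\<integral>w. iexp (R w) \<partial>M) = exp (- complex_of_real ((q - k\<^sup>2 * v) / 2))"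
    using cR1[of 1] by (simp flip: exp_of_real)
  also have "exp (\<i> * complex_of_real (k * v) - complex_of_real (k\<^sup>2 * v / 2)) * exp (- complex_of_real ((q - k\<^sup>2 * v) / 2))
      = exp (\<i> * complex_of_real p - complex_of_real (q / 2))"
    unfolding kv exp_add[symmetric] by (simp add: diff_divide_distrib)
  finally show "(\<integral>w. complex_of_real (exp (X x w - K x x / 2)) * iexp (\<Sum>a\<in>A. c a * X a w) \<partial>M)
     = exp (\<i> * complex_of_real (\<Sum>a\<in>A. c a * K x a)
            - complex_of_real ((\<Sum>a\<in>A. \<Sum>b\<in>A. c a * c b * K a b) / 2))"
    by (simp add: p_def q_def)
qed

lemma expectation_exp:
  assumes "x \<in> I"
  shows "(\<integral>w. exp (X x w - K x x / 2) \<partial>M) = 1"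
proof -
  have "complex_of_real (\<integral>w. exp (X x w - K x x / 2) \<partial>M) = 1"
    using exponential_tilt_sum(2)[of "{}" x] assms by simp
  then show ?thesis by simp
qed

text \<open>This is what turns a drift into a likelihood ratio: the exponent of
  \<open>exponential_tilt_sum\<close> is that of a Gaussian family whose means are the covariances
  with \<open>X x\<close>.\<close>

lemma gaussian_family_tilted:
  assumes x: "x \<in> I"
  defines "Q \<equiv> density M (\<lambda>w. ennreal (exp (X x w - K x x / 2)))"
  shows "prob_space Q" "gaussian_family Q I X (K x) K"
proof -
  have [measurable]: "X x \<in> borel_measurable M" using x by simp
  show "prob_space Q"
  proof (rule prob_spaceI)
    show "emeasure Q (space Q) = 1"
      unfolding Q_def using expectation_exp[OF x] exponential_tilt_sum(1)[of "{}" x] x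
      by (simp add: emeasure_density nn_integral_eq_integral cong: nn_integral_cong)
  qed
  show "gaussian_family Q I X (K x) K"
    unfolding gaussian_family_def
  proof (intro conjI ballI allI impI)
    fix a assume "a \<in> I" then show "X a \<in> borel_measurable Q" by (simp add: Q_def)
  next
    fix A and c :: "'i \<Rightarrow> real" assume A: "finite A \<and> A \<subseteq> I"
    have [measurable]: "X a \<in> borel_measurable M" if "a \<in> A" for a using A that by auto
    have "(\<integral>w. iexp (\<Sum>a\<in>A. c a * X a w) \<partial>Q) = (\<integral>w. exp (X x w - K x x / 2) *\<^sub>R iexp (\<Sum>a\<in>A. c a * X a w) \<partial>M)"
      unfolding Q_def by (subst integral_density) auto
    also have "\<dots> = (\<integral>w. complex_of_real (exp (X x w - K x x / 2)) * iexp (\<Sum>a\<in>A. c a * X a w) \<partial>M)"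
      by (simp only: scaleR_conv_of_real)
    finally show "(\<integral>w. iexp (\<Sum>a\<in>A. c a * X a w) \<partial>Q) = exp (\<i> * complex_of_real (\<Sum>a\<in>A. c a * K x a)
            - complex_of_real ((\<Sum>a\<in>A. \<Sum>b\<in>A. c a * c b * K a b) / 2))"
      using exponential_tilt_sum(2)[of A x c] A x by simp
  qed
qed

text \<open>Vanishing cross covariances split the quadratic form in the exponent into two parts, so
  the characteristic function of the joint family factorizes.\<close>

lemma indep_uncorrelated:
  assumes I1: "I1 \<subseteq> I" and I2: "I2 \<subseteq> I" and disj: "I1 \<inter> I2 = {}"
    and K0: "\<And>a b. a \<in> I1 \<Longrightarrow> b \<in> I2 \<Longrightarrow> K a b = 0"
  shows "indep_set (sets (generated_algebra (space M) I1 X)) (sets (generated_algebra (space M) I2 X))"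
proof (rule indep_families_of_char[OF prob_space_axioms])
  fix A B and c d :: "'i \<Rightarrow> real" assume A: "finite A" "A \<subseteq> I1" and B: "finite B" "B \<subseteq> I2"
  have AB: "A \<inter> B = {}" "finite (A \<union> B)" "A \<union> B \<subseteq> I" using A B disj I1 I2 by auto
  define e where "e a = (if a \<in> A then c a else d a)" for a
  have eA: "e a = c a" if "a \<in> A" for a using that by (simp add: e_def)
  have eB: "e a = d a" if "a \<in> B" for a using that AB by (auto simp: e_def)
  have s: "(\<Sum>a\<in>A \<union> B. e a * z a) = (\<Sum>a\<in>A. c a * z a) + (\<Sum>b\<in>B. d b * z b)" for z
    using A B AB by (subst sum.union_disjoint) (auto simp: eA eB intro!: arg_cong2[where f="(+)"] sum.cong)
  have KAB: "K a b = 0" if "a \<in> A" "b \<in> B" for a b using K0 A B that by blast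
  have KBA: "K b a = 0" if "a \<in> A" "b \<in> B" for a b using KAB[OF that] sym[of a b] AB that by auto
  have "(\<Sum>a\<in>A \<union> B. \<Sum>b\<in>A \<union> B. e a * e b * K a b)
      = (\<Sum>a\<in>A \<union> B. e a * (\<Sum>b\<in>A \<union> B. e b * K a b))" by (simp only: sum_distrib_left mult.assoc)
  also have "\<dots> = (\<Sum>a\<in>A. c a * (\<Sum>b\<in>A. c b * K a b)) + (\<Sum>a\<in>B. d a * (\<Sum>b\<in>B. d b * K a b))"
    unfolding s by (intro arg_cong2[where f="(+)"] sum.cong refl) (simp_all add: KAB KBA)
  finally have q: "(\<Sum>a\<in>A \<union> B. \<Sum>b\<in>A \<union> B. e a * e b * K a b)
     = (\<Sum>a\<in>A. \<Sum>b\<in>A. c a * c b * K a b) + (\<Sum>a\<in>B. \<Sum>b\<in>B. d a * d b * K a b)"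
    by (simp only: sum_distrib_left mult.assoc)
  have "(\<integral>w. iexp ((\<Sum>a\<in>A. c a * X a w) + (\<Sum>b\<in>B. d b * X b w)) \<partial>M) = (\<integral>w. iexp (\<Sum>a\<in>A \<union> B. e a * X a w) \<partial>M)"
    by (simp only: s)
  also have "\<dots> = (\<integral>w. iexp (\<Sum>a\<in>A. c a * X a w) \<partial>M) * (\<integral>w. iexp (\<Sum>b\<in>B. d b * X b w) \<partial>M)"
    unfolding char_sum[OF AB(2,3)] q char_sum[OF A(1) order.trans[OF A(2) I1]] char_sum[OF B(1) order.trans[OF B(2) I2]]
    by (simp add: add_divide_distrib flip: of_real_mult exp_add)
  finally show "(\<integral>w. iexp ((\<Sum>a\<in>A. c a * X a w) + (\<Sum>b\<in>B. d b * X b w)) \<partial>M)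
     = (\<integral>w. iexp (\<Sum>a\<in>A. c a * X a w) \<partial>M) * (\<integral>w. iexp (\<Sum>b\<in>B. d b * X b w) \<partial>M)" .
qed (use I1 I2 in auto)

section \<open>Moments and continuity of Gaussian likelihood ratios\<close>

definition lik :: "'i \<Rightarrow> 'a \<Rightarrow> real" where
  "lik x w = exp (X x w - K x x / 2)"

lemma measurable_lik [measurable]: "x \<in> I \<Longrightarrow> lik x \<in> borel_measurable M"
  unfolding lik_def by measurable

text \<open>\<open>X x + X y\<close> is again centred Gaussian, with variance
  \<open>K x x + K y y + 2 * K x y\<close>. The product is \<open>exp (K x y)\<close> times the tilt
  by this sum, and the tilt has mean 1.\<close>

lemma lik_product:
  assumes x: "x \<in> I" and y: "y \<in> I"
  shows "integrable M (\<lambda>w. lik x w * lik y w)" "(\<integral>w. lik x w * lik y w \<partial>M) = exp (K x y)"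
proof -
  \<comment> \<open>For \<open>x = y\<close> the set \<open>{x, y}\<close> is a singleton, and the
    factor 2 keeps the sum over it equal to \<open>z x + z y\<close>.\<close>
  define l where "l = (if x = y then 2 else 1 :: real)"
  have l: "(\<Sum>a\<in>{x, y}. l * z a) = z x + z y" for z by (simp add: l_def)
  have G: "gaussian_family M (UNIV :: unit set) (\<lambda>_ w. \<Sum>a\<in>{x, y}. l * X a w) (\<lambda>_. \<Sum>a\<in>{x, y}. l * 0)
     (\<lambda>_ _. \<Sum>a\<in>{x, y}. \<Sum>b\<in>{x, y}. l * l * K a b)"
    by (rule gaussian_family_linear[OF gaussian]) (use x y in auto)
  have q: "(\<Sum>a\<in>{x, y}. \<Sum>b\<in>{x, y}. l * l * K a b) = K x x + K y y + 2 * K x y"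
    using sym[OF x y] by (simp add: l_def)
  interpret P: centred_gaussian M "UNIV :: unit set" "\<lambda>_ w. X x w + X y w" "\<lambda>_ _. K x x + K y y + 2 * K x y"
    by standard (use G in \<open>simp_all add: l q\<close>)
  have e: "lik x w * lik y w = exp (K x y) * exp (X x w + X y w - (K x x + K y y + 2 * K x y) / 2)" for w
    by (simp add: lik_def field_simps flip: exp_add)
  show "integrable M (\<lambda>w. lik x w * lik y w)"
    unfolding e using P.exponential_tilt_sum(1)[of "{}" "()"] by simp
  show "(\<integral>w. lik x w * lik y w \<partial>M) = exp (K x y)"
    unfolding e using P.expectation_exp[of "()"] by simp
qed

text \<open>A number \<open>d \<ge> 0\<close> is at most
  \<open>\<epsilon> + d * d / \<epsilon>\<close>: either \<open>d \<le> \<epsilon>\<close>, or the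
  quotient exceeds \<open>d\<close>. The second moment of the difference is explicit by
  \<open>lik_product\<close>.\<close>

lemma lik_distance:
  assumes x: "x \<in> I" and y: "y \<in> I" and \<epsilon>: "\<epsilon> > 0"
  shows "(\<integral>w. min 1 \<bar>lik x w - lik y w\<bar> \<partial>M) \<le> \<epsilon> + (exp (K x x) + exp (K y y) - 2 * exp (K x y)) / \<epsilon>"
proof -
  have i: "integrable M (\<lambda>w. \<epsilon> + (lik x w * lik x w + lik y w * lik y w - 2 * (lik x w * lik y w)) / \<epsilon>)"
    using lik_product[OF x x] lik_product[OF y y] lik_product[OF x y] by auto
  have "(\<integral>w. min 1 \<bar>lik x w - lik y w\<bar> \<partial>M) \<le> (\<integral>w. \<epsilon> + (lik x w * lik x w + lik y w * lik y w - 2 * (lik x w * lik y w)) / \<epsilon> \<partial>M)"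
  proof (rule integral_mono[OF _ i])
    show "integrable M (\<lambda>w. min 1 \<bar>lik x w - lik y w\<bar>)"
      by (rule integrable_const_bound[of _ 1]) (use x y in auto)
    fix w
    define d where "d = \<bar>lik x w - lik y w\<bar>"
    have "d \<le> \<epsilon> + d * d / \<epsilon>"
    proof (cases "d \<le> \<epsilon>")
      case True then show ?thesis using \<epsilon> by (smt (verit) zero_le_divide_iff zero_le_square)
    next
      case False
      then have "d * \<epsilon> \<le> d * d" using \<epsilon> by (intro mult_left_mono) auto
      then show ?thesis using \<epsilon> by (simp add: field_simps) (smt (verit) mult_pos_pos)
    qed
    moreover have "d * d = lik x w * lik x w + lik y w * lik y w - 2 * (lik x w * lik y w)"
      by (simp add: d_def abs_mult_self_eq algebra_simps)
    ultimately show "min 1 \<bar>lik x w - lik y w\<bar> \<le> \<epsilon> + (lik x w * lik x w + lik y w * lik y w - 2 * (lik x w * lik y w)) / \<epsilon>"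
      by (simp add: d_def)
  qed
  also have "\<dots> = \<epsilon> + (exp (K x x) + exp (K y y) - 2 * exp (K x y)) / \<epsilon>"
    using lik_product[OF x x] lik_product[OF y y] lik_product[OF x y] by (simp add: prob_space)
  finally show ?thesis .
qed

text \<open>The variance of \<open>X x - X y\<close>. It is the square of a pseudometric, which
  explains the factors 2 in its triangle inequality.\<close>

definition vdist :: "'i \<Rightarrow> 'i \<Rightarrow> real" where
  "vdist x y = K x x + K y y - 2 * K x y"

lemma quadratic_form_nonneg:
  assumes "finite A" "A \<subseteq> I"
  shows "(\<Sum>a\<in>A. \<Sum>b\<in>A. c a * c b * K a b) \<ge> 0"
proof (cases "A = {}")
  case False
  then obtain x where "x \<in> A" by auto
  then show ?thesis using quadratic_nonneg[OF assms, of x 0 1 c] assms by auto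
qed simp

lemma gaussian_family_three:
  assumes "x \<in> I" "y \<in> I" "z \<in> I"
  shows "r\<^sup>2 * K x x + s\<^sup>2 * K y y + t\<^sup>2 * K z z + 2 * r * s * K x y + 2 * r * t * K x z + 2 * s * t * K y z \<ge> 0"
proof -
  \<comment> \<open>The three indices may coincide, in which case their coefficients add up.\<close>
  define d where "d a = (if a = x then r else 0) + (if a = y then s else 0) + (if a = z then t else 0)" for a
  have k: "(\<Sum>a\<in>{x,y,z}. d a * g a) = r * g x + s * g y + t * g z" for g
  proof -
    have "(\<Sum>a\<in>{x,y,z}. (if a = p then q else 0) * g a) = q * g p" if "p \<in> {x,y,z}" for p q
    proof -
      have "(\<Sum>a\<in>{x,y,z}. (if a = p then q else 0) * g a) = (\<Sum>a\<in>{x,y,z}. if a = p then q * g a else 0)"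
        by (intro sum.cong refl) simp
      also have "\<dots> = q * g p" using that by (subst sum.delta) auto
      finally show ?thesis .
    qed
    then show ?thesis by (simp only: d_def distrib_right sum.distrib) simp
  qed
  have "(\<Sum>a\<in>{x,y,z}. \<Sum>b\<in>{x,y,z}. d a * d b * K a b) = (\<Sum>a\<in>{x,y,z}. d a * (\<Sum>b\<in>{x,y,z}. d b * K a b))"
    by (simp only: sum_distrib_left mult.assoc)
  also have "\<dots> = r\<^sup>2 * K x x + s\<^sup>2 * K y y + t\<^sup>2 * K z z + 2 * r * s * K x y + 2 * r * t * K x z + 2 * s * t * K y z"
    unfolding k using sym[of x y] sym[of x z] sym[of y z] assms by (simp add: algebra_simps power2_eq_square)
  finally show ?thesis using quadratic_form_nonneg[of "{x,y,z}" d] assms by simp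
qed

text \<open>The parallelogram law for \<open>X x - X y\<close> and \<open>X y - X z\<close>: the
  right-hand side exceeds the left-hand side by the variance of
  \<open>X x - 2 * X y + X z\<close>.\<close>

lemma vdist_triangle:
  assumes "x \<in> I" "y \<in> I" "z \<in> I"
  shows "vdist x z \<le> 2 * vdist x y + 2 * vdist y z"
  using gaussian_family_three[OF assms, of 1 "-2" 1] by (simp add: vdist_def algebra_simps)

text \<open>The Cauchy-Schwarz inequality for \<open>X x\<close> and \<open>X y - X x\<close>, whose
  covariance is \<open>b\<close>; the variance of \<open>s * X x + (X y - X x)\<close> is minimized
  over \<open>s\<close>.\<close>

lemma cov_cauchy_schwarz:
  assumes x: "x \<in> I" and y: "y \<in> I"
  shows "(K x y - K x x)\<^sup>2 \<le> K x x * vdist x y"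
proof -
  define b where "b = K x y - K x x"
  have q: "0 \<le> s\<^sup>2 * K x x + 2 * s * b + vdist x y" for s
    using gaussian_family_three[OF x y x, of "s - 1" 1 0] by (simp add: vdist_def b_def power2_eq_square algebra_simps)
  show ?thesis
  proof (cases "K x x = 0")
    case True
    have "b = 0" using cov_eq_0[of "{y}" x "\<lambda>_. 1"] x y True by (simp add: b_def)
    then show ?thesis using True by (simp add: b_def)
  next
    case False
    then have p: "K x x > 0" using variance_nonneg[OF x] by simp
    have "0 \<le> K x x * ((- b / K x x)\<^sup>2 * K x x + 2 * (- b / K x x) * b + vdist x y)"
      by (rule mult_nonneg_nonneg[OF less_imp_le[OF p] q])
    also have "\<dots> = - b\<^sup>2 + K x x * vdist x y" using p by (simp add: field_simps power2_eq_square)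
    finally show ?thesis by (simp add: b_def)
  qed
qed

text \<open>If \<open>vdist x y\<close> is small, Cauchy-Schwarz brings \<open>K x y\<close> close
  to \<open>K x x\<close>. An upper bound for \<open>K y y\<close> follows, and then the second
  moment in \<open>lik_distance\<close> is small.\<close>

lemma lik_continuous:
  assumes x: "x \<in> I" and e: "e > 0"
  shows "\<exists>\<delta>>0. \<forall>y\<in>I. vdist x y < \<delta> \<longrightarrow> (\<integral>w. min 1 \<bar>lik x w - lik y w\<bar> \<partial>M) < e"
proof -
  define a where "a = K x x"
  have a: "a \<ge> 0" using variance_nonneg[OF x] by (simp add: a_def)
  have "((\<lambda>r. exp a + exp (a + 3 * r) - 2 * exp (a - r)) \<longlongrightarrow> exp a + exp (a + 3 * 0) - 2 * exp (a - 0)) (at_right (0::real))"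
    by (intro tendsto_intros)
  then have "\<forall>\<^sub>F r in at_right (0::real). exp a + exp (a + 3 * r) - 2 * exp (a - r) < (e / 2)\<^sup>2"
    using e by (intro order_tendstoD(2)) auto
  then obtain r where r: "r > 0" "exp a + exp (a + 3 * r) - 2 * exp (a - r) < (e / 2)\<^sup>2"
    using eventually_happens[of "\<lambda>r. r > 0 \<and> exp a + exp (a + 3 * r) - 2 * exp (a - r) < (e / 2)\<^sup>2" "at_right (0::real)"]
      eventually_at_right_less[of "0::real"] by (auto simp: eventually_conj_iff)
  \<comment> \<open>The first entry bounds the summand \<open>vdist x y\<close> of
    \<open>K y y\<close>, the second gives \<open>a * vdist x y \<le> r * r\<close> for
    Cauchy-Schwarz. The denominator is \<open>a + 1\<close> because \<open>a\<close> may
    vanish.\<close>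
  define \<delta> where "\<delta> = min r (r\<^sup>2 / (a + 1))"
  have d: "\<delta> > 0" using r a by (simp add: \<delta>_def)
  have "(\<integral>w. min 1 \<bar>lik x w - lik y w\<bar> \<partial>M) < e" if y: "y \<in> I" and v: "vdist x y < \<delta>" for y
  proof -
    have "(K x y - a)\<^sup>2 \<le> a * vdist x y" using cov_cauchy_schwarz[OF x y] by (simp add: a_def)
    also have "\<dots> \<le> a * (r\<^sup>2 / (a + 1))" using v a by (intro mult_left_mono) (auto simp: \<delta>_def)
    also have "\<dots> \<le> r\<^sup>2" using a r by (simp add: divide_le_eq mult.commute)
    finally have "\<bar>K x y - a\<bar> \<le> r" using r by (metis abs_le_square_iff abs_of_pos)
    then have c: "K x y \<ge> a - r" "K x y \<le> a + r" by auto
    have "K y y = vdist x y - a + 2 * K x y" by (simp add: vdist_def a_def)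
    then have "K y y \<le> a + 3 * r" using c v by (simp add: \<delta>_def)
    then have "exp (K x x) + exp (K y y) - 2 * exp (K x y) \<le> exp a + exp (a + 3 * r) - 2 * exp (a - r)"
      using c by (intro diff_mono add_mono) (auto simp: a_def)
    also have "\<dots> < (e / 2)\<^sup>2" by (rule r)
    finally have "(exp (K x x) + exp (K y y) - 2 * exp (K x y)) / (e / 2) < (e / 2)\<^sup>2 / (e / 2)"
      using e by (intro divide_strict_right_mono) auto
    also have "\<dots> = e / 2" using e by (simp add: power2_eq_square)
    finally have *: "(exp (K x x) + exp (K y y) - 2 * exp (K x y)) / (e / 2) < e / 2" .
    have "e / 2 > 0" using e by simp
    from lik_distance[OF x y this] * show ?thesis by linarith
  qed
  then show ?thesis using d by blast
qed

end

text \<open>Independence makes the joint law of \<open>V\<close> and \<open>\<xi>\<close> a product,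
  and Fubini's theorem integrates over \<open>V\<close> first. The inner integral is then a limit of
  expectations at a fixed value of \<open>\<xi>\<close>, which is what LAN provides.\<close>

lemma (in prob_space) indep_set_integral:
  fixes V :: "'a \<Rightarrow> 'b::second_countable_topology" and \<xi> :: "'a \<Rightarrow> real" and H :: "'b \<times> real \<Rightarrow> real"
  assumes ind: "indep_set (sets F) (sets G)" and F: "subalgebra M F" and G: "subalgebra M G"
    and V: "V \<in> borel_measurable F" and \<xi>: "\<xi> \<in> borel_measurable G"
    and H: "H \<in> borel_measurable borel" and bnd: "\<And>z. \<bar>H z\<bar> \<le> C"
  shows "(\<integral>w. H (V w, \<xi> w) \<partial>M) = (\<integral>x. (\<integral>w. H (V w, x) \<partial>M) \<partial>(distr M borel \<xi>))"
proof -
  have Vm[measurable]: "V \<in> borel_measurable M" by (rule measurable_from_subalg[OF F V])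
  have xm[measurable]: "\<xi> \<in> borel_measurable M" by (rule measurable_from_subalg[OF G \<xi>])
  have Hm[measurable]: "H \<in> borel_measurable (borel \<Otimes>\<^sub>M borel)" using H by (simp only: borel_prod)
  interpret A: prob_space "distr M borel V" by (rule prob_space_distr) simp
  interpret B: prob_space "distr M borel \<xi>" by (rule prob_space_distr) simp
  have d: "distr M borel V \<Otimes>\<^sub>M distr M borel \<xi> = distr M (borel \<Otimes>\<^sub>M borel) (\<lambda>x. (V x, \<xi> x))"
  proof (rule pair_measure_eqI[OF A.sigma_finite_measure_axioms B.sigma_finite_measure_axioms])
    fix a b assume "a \<in> sets (distr M borel V)" "b \<in> sets (distr M borel \<xi>)"
    then have [measurable]: "a \<in> sets borel" "b \<in> sets borel" by auto
    have "V -` a \<inter> space M \<in> sets F" "\<xi> -` b \<inter> space M \<in> sets G"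
      using measurable_sets[OF V, of a] measurable_sets[OF \<xi>, of b] F G by (auto simp: subalgebra_def)
    then have "prob ((V -` a \<inter> space M) \<inter> (\<xi> -` b \<inter> space M)) = prob (V -` a \<inter> space M) * prob (\<xi> -` b \<inter> space M)"
      by (rule indep_setD[OF ind])
    moreover have "(V -` a \<inter> space M) \<inter> (\<xi> -` b \<inter> space M) = (\<lambda>x. (V x, \<xi> x)) -` (a \<times> b) \<inter> space M" by auto
    ultimately show "emeasure (distr M borel V) a * emeasure (distr M borel \<xi>) b
        = emeasure (distr M (borel \<Otimes>\<^sub>M borel) (\<lambda>x. (V x, \<xi> x))) (a \<times> b)"
      by (simp add: emeasure_distr emeasure_eq_measure ennreal_mult'')
  qed simp
  interpret AB: pair_prob_space "distr M borel V" "distr M borel \<xi>" ..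
  have i: "integrable (distr M borel V \<Otimes>\<^sub>M distr M borel \<xi>) (\<lambda>(x, y). H (x, y))"
    by (rule AB.P.integrable_const_bound[of _ C]) (use bnd in auto)
  have "(\<integral>w. H (V w, \<xi> w) \<partial>M) = (\<integral>z. H z \<partial>(distr M (borel \<Otimes>\<^sub>M borel) (\<lambda>x. (V x, \<xi> x))))"
    by (subst integral_distr) auto
  also have "\<dots> = (\<integral>z. H z \<partial>(distr M borel V \<Otimes>\<^sub>M distr M borel \<xi>))" by (simp only: d)
  also have "\<dots> = (\<integral>x. (\<integral>v. H (v, x) \<partial>(distr M borel V)) \<partial>(distr M borel \<xi>))"
    using AB.integral_snd[OF i] by simp
  also have "\<dots> = (\<integral>x. (\<integral>w. H (V w, x) \<partial>M) \<partial>(distr M borel \<xi>))"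
    by (subst integral_distr) auto
  finally show ?thesis .
qed

section \<open>The Brownian drift experiment\<close>

lemma generated_algebra_reindex:
  assumes "\<And>i. i \<in> I \<Longrightarrow> X (h i) = Y i"
  shows "sets (generated_algebra \<Omega> (h ` I) X) = sets (generated_algebra \<Omega> I Y)"
  using assms unfolding sets_generated_algebra by simp

lemma generated_algebra_subset:
  assumes "\<And>i. i \<in> I \<Longrightarrow> X i \<in> borel_measurable M" and "space M = \<Omega>"
  shows "sets (generated_algebra \<Omega> I X) \<subseteq> sets M"
  unfolding sets_generated_algebra assms(2)[symmetric]
  by (rule sets.sigma_sets_subset) (use assms in \<open>auto intro: measurable_sets\<close>)

lemma gaussian_family_cong:
  assumes "gaussian_family M I X m K"
    and "\<And>a. a \<in> I \<Longrightarrow> X a = X' a" "\<And>a. a \<in> I \<Longrightarrow> m a = m' a" "\<And>a b. a \<in> I \<Longrightarrow> b \<in> I \<Longrightarrow> K a b = K' a b"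
  shows "gaussian_family M I X' m' K'"
  unfolding gaussian_family_def
proof (intro conjI ballI allI impI)
  fix a assume "a \<in> I" then show "X' a \<in> borel_measurable M"
    using assms(1,2) by (auto simp: gaussian_family_def)
next
  fix A c assume A: "finite A \<and> A \<subseteq> I"
  have "(\<Sum>a\<in>A. c a * X a w) = (\<Sum>a\<in>A. c a * X' a w)" for w using A assms(2) by (intro sum.cong refl) (metis subsetD)
  moreover have "(\<Sum>a\<in>A. c a * m a) = (\<Sum>a\<in>A. c a * m' a)" using A assms(3) by (intro sum.cong refl) (metis subsetD)
  moreover have "(\<Sum>a\<in>A. \<Sum>b\<in>A. c a * c b * K a b) = (\<Sum>a\<in>A. \<Sum>b\<in>A. c a * c b * K' a b)"
    using A assms(4) by (intro sum.cong refl) (metis subsetD)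
  ultimately show "(\<integral>w. iexp (\<Sum>a\<in>A. c a * X' a w) \<partial>M) = exp (\<i> * complex_of_real (\<Sum>a\<in>A. c a * m' a)
           - complex_of_real ((\<Sum>a\<in>A. \<Sum>b\<in>A. c a * c b * K' a b) / 2))"
    using gaussian_familyD[OF assms(1), of A c] A by simp
qed

lemma zero_score: "(\<lambda>_. 0) \<in> score_space f0"
  by (auto simp: score_space_def intro!: has_bochner_integral_zero)

locale drift_experiment =
  fixes f0 :: "real ^ 'd \<Rightarrow> real" and III :: "real ^ 'k ^ 'k" and II :: "(real ^ 'd \<Rightarrow> real) \<Rightarrow> real ^ 'k"
    and \<Omega> :: "'w set" and D :: "('k, 'd) param \<Rightarrow> 'w measure"
    and \<Delta>int :: "real \<Rightarrow> 'w \<Rightarrow> real ^ 'k" and \<Delta>nuis :: "(real ^ 'd \<Rightarrow> real) \<Rightarrow> real \<Rightarrow> 'w \<Rightarrow> real"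
  assumes drift: "brownian_drift_experiment f0 III II \<Omega> D \<Delta>int \<Delta>nuis"
    and f0_measurable: "f0 \<in> borel_measurable borel" and f0_nonneg: "\<And>x. 0 \<le> f0 x"
begin

abbreviation "scores \<equiv> score_space f0"
abbreviation "base \<equiv> ((UNIV :: 'k set) <+> scores) \<times> {0..1::real}"
abbreviation "Y \<equiv> (\<lambda>(a, u). drift_process \<Delta>int \<Delta>nuis a u) :: ('k + (real ^ 'd \<Rightarrow> real)) \<times> real \<Rightarrow> 'w \<Rightarrow> real"
abbreviation "C \<equiv> drift_cov f0 III II"
abbreviation "D0 \<equiv> D origin_param"

lemma
  assumes "\<eta> \<in> scores"
  shows D_prob: "prob_space (D (\<tau>, \<eta>))" and D_space: "space (D (\<tau>, \<eta>)) = \<Omega>"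
    and D_sets: "sets (D (\<tau>, \<eta>)) = sets (generated_algebra \<Omega> base Y)"
    and D_bm: "joint_brownian_motion (D (\<tau>, \<eta>)) (UNIV <+> scores) (drift_process \<Delta>int \<Delta>nuis)
          (drift_mean f0 III II (\<tau>, \<eta>)) C"
  using drift assms unfolding brownian_drift_experiment_def by auto

lemma cov_sym: "a \<in> UNIV <+> scores \<Longrightarrow> b \<in> UNIV <+> scores \<Longrightarrow> C a b = C b a"
  using D_bm[OF zero_score, of 0] unfolding joint_brownian_motion_def by auto

lemma D_gaussian:
  assumes "\<eta> \<in> scores"
  shows "gaussian_family (D (\<tau>, \<eta>)) base Y (\<lambda>(a, u). u * drift_mean f0 III II (\<tau>, \<eta>) a)
           (\<lambda>(a, u) (a', u'). min u u' * C a a')"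
  by (rule joint_brownian_motion_gaussian[OF D_prob[OF assms] D_bm[OF assms]])

text \<open>The score 0 has variance 0, so a nonzero covariance with a component of
  \<open>\<Delta>int\<close> would give some linear combination a negative variance. The fact makes
  the family centred at the origin, whose drift contains \<open>II\<close> at the score 0.\<close>

lemma II_zero: "II (\<lambda>_. 0) $ i = 0"
proof (rule ccontr)
  define p where "p = II (\<lambda>_. 0) $ i"
  assume "II (\<lambda>_. 0) $ i \<noteq> 0"
  then have p: "p \<noteq> 0" by (simp add: p_def)
  define q where "q = III $ i $ i"
  \<comment> \<open>The coefficient of the score 0 is chosen such that the variance of the
    combination would be -1.\<close>
  define c where "c a = (case a of Inl _ \<Rightarrow> 1 | Inr _ \<Rightarrow> - (q + 1) / (2 * p))" for a :: "'k + (real ^ 'd \<Rightarrow> real)"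
  have all: "\<forall>A c s t. finite A \<and> A \<subseteq> UNIV <+> scores \<and> 0 \<le> s \<and> s \<le> t \<and> t \<le> 1 \<longrightarrow>
        normal_rv D0 (\<lambda>w. \<Sum>a\<in>A. c a * (drift_process \<Delta>int \<Delta>nuis a t w - drift_process \<Delta>int \<Delta>nuis a s w))
          ((t - s) * (\<Sum>a\<in>A. c a * drift_mean f0 III II origin_param a))
          ((t - s) * (\<Sum>a\<in>A. \<Sum>a'\<in>A. c a * c a' * C a a'))"
    using D_bm[OF zero_score, of 0] unfolding joint_brownian_motion_def by (elim conjE)
  have A: "{Inl i, Inr (\<lambda>_. 0)} \<subseteq> UNIV <+> scores" using zero_score by auto
  have "0 \<le> (\<Sum>a\<in>{Inl i, Inr (\<lambda>_. 0)}. \<Sum>a'\<in>{Inl i, Inr (\<lambda>_. 0)}. c a * c a' * C a a')"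
    using all[rule_format, of "{Inl i, Inr (\<lambda>_. 0)}" 0 1 c] A by (simp add: normal_rv_def)
  also have "\<dots> = q + 2 * (- (q + 1) / (2 * p)) * p"
    by (simp add: c_def drift_cov_def nuisance_info_def p_def q_def)
  finally show False using p by (simp add: field_simps)
qed

lemma drift_mean_origin: "drift_mean f0 III II origin_param a = 0"
  using II_zero by (auto simp: drift_mean_def nuisance_info_def split: sum.split)

text \<open>The index \<open>Inl (\<tau>, \<eta>)\<close> stands for \<open>\<tau> \<bullet> \<Delta>int 1 + \<Delta>nuis \<eta> 1\<close>, the logarithm of the likelihood ratio up to a
  constant, \<open>Inr (Inl _)\<close> for the observed processes and \<open>Inr (Inr _)\<close> for the bridges.\<close>

definition supp :: "('k, 'd) param + (('k + (real ^ 'd \<Rightarrow> real)) \<times> real + (real ^ 'd \<Rightarrow> real) \<times> real)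
     \<Rightarrow> (('k + (real ^ 'd \<Rightarrow> real)) \<times> real) set" where
  "supp j = (case j of Inl (\<tau>, \<eta>) \<Rightarrow> insert (Inr \<eta>, 1) (range (\<lambda>i. (Inl i, 1)))
     | Inr (Inl q) \<Rightarrow> {q} | Inr (Inr (\<eta>, u)) \<Rightarrow> {(Inr \<eta>, u), (Inr \<eta>, 1)})"

text \<open>For \<open>u = 1\<close> the two points in the support of a bridge coincide and the
  coefficient is \<open>1 - 1 = 0\<close>, as it must be at the right end of a bridge.\<close>

definition coef :: "('k, 'd) param + (('k + (real ^ 'd \<Rightarrow> real)) \<times> real + (real ^ 'd \<Rightarrow> real) \<times> real)
     \<Rightarrow> ('k + (real ^ 'd \<Rightarrow> real)) \<times> real \<Rightarrow> real" where
  "coef j b = (case j of Inl (\<tau>, \<eta>) \<Rightarrow> (case fst b of Inl i \<Rightarrow> \<tau> $ i | Inr _ \<Rightarrow> 1)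
     | Inr (Inl q) \<Rightarrow> 1 | Inr (Inr (\<eta>, u)) \<Rightarrow> of_bool (snd b = u) - of_bool (snd b = 1) * u)"

definition lin :: "('k, 'd) param + (('k + (real ^ 'd \<Rightarrow> real)) \<times> real + (real ^ 'd \<Rightarrow> real) \<times> real)
     \<Rightarrow> (('k + (real ^ 'd \<Rightarrow> real)) \<times> real \<Rightarrow> real) \<Rightarrow> real" where
  "lin j z = (\<Sum>a\<in>supp j. coef j a * z a)"

abbreviation "params \<equiv> (UNIV :: (real ^ 'k) set) \<times> scores"
abbreviation "ext \<equiv> params <+> (base <+> (scores \<times> {0..1::real}))"

definition "X j w = lin j (\<lambda>a. Y a w)"
definition "K j j' = lin j (\<lambda>(a, u). lin j' (\<lambda>(a', u'). min u u' * C a a'))"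

lemma lin_simps:
  "lin (Inl (\<tau>, \<eta>)) z = (\<Sum>i\<in>UNIV. \<tau> $ i * z (Inl i, 1)) + z (Inr \<eta>, 1)"
  "lin (Inr (Inl q)) z = z q"
  "lin (Inr (Inr (\<eta>, u))) z = z (Inr \<eta>, u) - u * z (Inr \<eta>, 1)"
proof -
  have "inj (\<lambda>i::'k. (Inl i :: 'k + (real ^ 'd \<Rightarrow> real), 1::real))" by (auto intro: injI)
  then show "lin (Inl (\<tau>, \<eta>)) z = (\<Sum>i\<in>UNIV. \<tau> $ i * z (Inl i, 1)) + z (Inr \<eta>, 1)"
    by (simp add: lin_def supp_def coef_def sum.reindex image_iff)
  show "lin (Inr (Inl q)) z = z q" by (simp add: lin_def supp_def coef_def)
  show "lin (Inr (Inr (\<eta>, u))) z = z (Inr \<eta>, u) - u * z (Inr \<eta>, 1)"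
    by (cases "u = 1") (simp_all add: lin_def supp_def coef_def)
qed

lemma ext_gaussian: "gaussian_family D0 ext X (\<lambda>_. 0) K"
proof -
  have "gaussian_family D0 ext (\<lambda>j w. \<Sum>a\<in>supp j. coef j a * Y a w)
     (\<lambda>j. \<Sum>a\<in>supp j. coef j a * (case a of (a, u) \<Rightarrow> u * drift_mean f0 III II origin_param a))
     (\<lambda>j j'. \<Sum>a\<in>supp j. \<Sum>b\<in>supp j'. coef j a * coef j' b * (case a of (a, u) \<Rightarrow> \<lambda>(a', u'). min u u' * C a a') b)"
    by (rule gaussian_family_linear[OF D_gaussian[OF zero_score]]) (auto simp: supp_def split: sum.splits)
  then show ?thesis
    by (rule gaussian_family_cong)
       (simp_all add: X_def K_def lin_def drift_mean_origin case_prod_beta sum_distrib_left mult.assoc fun_eq_iff)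
qed

lemma K_double_sum: "K j j' = (\<Sum>a\<in>supp j. \<Sum>b\<in>supp j'. coef j a * coef j' b * (case a of (a, u) \<Rightarrow> \<lambda>(a', u'). min u u' * C a a') b)"
  by (simp add: K_def lin_def case_prod_beta sum_distrib_left mult.assoc)

lemma supp_subset: "j \<in> ext \<Longrightarrow> supp j \<subseteq> base"
  by (auto simp: supp_def split: sum.splits)

sublocale G: centred_gaussian D0 ext X K
proof (intro centred_gaussian.intro centred_gaussian_axioms.intro)
  show "prob_space D0" by (rule D_prob[OF zero_score])
  show "gaussian_family D0 ext X (\<lambda>_. 0) K" by (rule ext_gaussian)
  fix j j' assume j: "j \<in> ext" "j' \<in> ext"
  show "K j j' = K j' j"
    unfolding K_double_sum
  proof (subst sum.swap, intro sum.cong refl)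
    fix b a assume "b \<in> supp j'" "a \<in> supp j"
    then have "fst a \<in> UNIV <+> scores" "fst b \<in> UNIV <+> scores"
      using subsetD[OF supp_subset[OF j(1)], of a] subsetD[OF supp_subset[OF j(2)], of b]
      by (auto simp only: mem_Times_iff)
    from cov_sym[OF this]
    show "coef j a * coef j' b * (case a of (a, u) \<Rightarrow> \<lambda>(a', u'). min u u' * C a a') b =
       coef j' b * coef j a * (case b of (a, u) \<Rightarrow> \<lambda>(a', u'). min u u' * C a a') a"
      by (simp add: case_prod_beta min.commute)
  qed
qed

text \<open>The shift of the means caused by the tilt with exponent
  \<open>Inl (\<tau>, \<eta>)\<close> is the drift that the experiment prescribes for this
  parameter; hence the tilt of \<open>D0\<close> can be recognized as
  \<open>D (\<tau>, \<eta>)\<close>.\<close>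

lemma K_base:
  assumes p: "(\<tau>, \<eta>) \<in> params" and q: "(a, u) \<in> base"
  shows "K (Inl (\<tau>, \<eta>)) (Inr (Inl (a, u))) = u * drift_mean f0 III II (\<tau>, \<eta>) a"
proof -
  have u: "min 1 u = u" using q by auto
  have "K (Inl (\<tau>, \<eta>)) (Inr (Inl (a, u))) = u * ((\<Sum>i\<in>UNIV. \<tau> $ i * C (Inl i) a) + C (Inr \<eta>) a)"
    unfolding K_def lin_simps by (simp add: u distrib_left sum_distrib_left mult_ac)
  also have "(\<Sum>i\<in>UNIV. \<tau> $ i * C (Inl i) a) + C (Inr \<eta>) a = drift_mean f0 III II (\<tau>, \<eta>) a"
  proof (cases a)
    case (Inl i)
    have "C (Inl j) a = C a (Inl j)" for j using q by (intro cov_sym) auto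
    then have "(\<Sum>j\<in>UNIV. \<tau> $ j * C (Inl j) a) = (\<Sum>j\<in>UNIV. \<tau> $ j * III $ i $ j)"
      by (simp add: Inl drift_cov_def)
    then show ?thesis
      by (simp add: Inl drift_cov_def drift_mean_def matrix_vector_mult_def mult.commute)
  next
    case (Inr \<eta>')
    then show ?thesis by (simp add: drift_cov_def drift_mean_def inner_vec_def mult.commute)
  qed
  finally show ?thesis .
qed

text \<open>The covariance of a Brownian value at time 1 with one at time \<open>u\<close> is linear
  in \<open>u\<close>, because \<open>min 1 u = u\<close>. A bridge subtracts precisely this linear
  part.\<close>

lemma K_bridge:
  assumes p: "(\<tau>, \<eta>) \<in> params" and q: "(\<eta>', u) \<in> scores \<times> {0..1}"
  shows "K (Inl (\<tau>, \<eta>)) (Inr (Inr (\<eta>', u))) = 0"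
proof -
  have u: "min 1 u = u" using q by auto
  show ?thesis unfolding K_def lin_simps by (simp add: u)
qed

lemma K_param:
  "K (Inl (\<tau>, \<eta>)) (Inl (\<tau>', \<eta>')) = \<tau> \<bullet> (III *v \<tau>') + \<tau> \<bullet> II \<eta>' + \<tau>' \<bullet> II \<eta> + nuisance_info f0 \<eta> \<eta>'"
  unfolding K_def lin_simps
  by (simp add: drift_cov_def inner_vec_def matrix_vector_mult_def sum.distrib distrib_left sum_distrib_left mult_ac)

lemma X_base: "X (Inr (Inl q)) = Y q"
  by (simp add: X_def lin_simps fun_eq_iff)

lemma X_bridge: "X (Inr (Inr (\<eta>, u))) = bridge \<Delta>nuis \<eta> u"
  by (simp add: X_def lin_simps bridge_def drift_process_def fun_eq_iff)

text \<open>Both measures are Gaussian on the observed processes with the same means and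
  covariances, and the observed processes generate the \<sigma>-field. The log-likelihood itself is
  available only in the extended family, in which the tilt is performed.\<close>

lemma D_density:
  assumes p: "(\<tau>, \<eta>) \<in> params"
  shows "D (\<tau>, \<eta>) = density D0 (\<lambda>w. ennreal (G.lik (Inl (\<tau>, \<eta>)) w))"
proof -
  let ?p = "Inl (\<tau>, \<eta>) :: ('k, 'd) param + (('k + (real ^ 'd \<Rightarrow> real)) \<times> real + (real ^ 'd \<Rightarrow> real) \<times> real)"
  have \<eta>: "\<eta> \<in> scores" using p by auto
  have pe: "?p \<in> ext" using p by auto
  define Q where "Q = density D0 (\<lambda>w. ennreal (exp (X ?p w - K ?p ?p / 2)))"
  have Q: "prob_space Q" "gaussian_family Q ext X (K ?p) K"
    unfolding Q_def by (rule G.gaussian_family_tilted[OF pe])+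
  have "gaussian_family Q base (\<lambda>q w. \<Sum>a\<in>{Inr (Inl q)}. 1 * X a w) (\<lambda>q. \<Sum>a\<in>{Inr (Inl q)}. 1 * K ?p a)
     (\<lambda>q q'. \<Sum>a\<in>{Inr (Inl q)}. \<Sum>b\<in>{Inr (Inl q')}. 1 * 1 * K a b)"
    by (rule gaussian_family_linear[OF Q(2)]) auto
  then have GQ: "gaussian_family Q base Y (\<lambda>(a, u). u * drift_mean f0 III II (\<tau>, \<eta>) a)
           (\<lambda>(a, u) (a', u'). min u u' * C a a')"
  proof (rule gaussian_family_cong)
    fix q assume q: "q \<in> base"
    show "(\<lambda>w. \<Sum>a\<in>{Inr (Inl q)}. 1 * X a w) = Y q" by (simp add: X_base)
    obtain a u where "q = (a, u)" by (cases q)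
    with K_base[OF p, of a u] q
    show "(\<Sum>a\<in>{Inr (Inl q)}. 1 * K ?p a) = (case q of (a, u) \<Rightarrow> u * drift_mean f0 III II (\<tau>, \<eta>) a)"
      by simp
  qed (simp add: K_def lin_simps case_prod_beta)
  have "Q = D (\<tau>, \<eta>)"
    by (rule gaussian_family_unique[OF Q(1) D_prob[OF \<eta>] _ D_space[OF \<eta>] _ D_sets[OF \<eta>] GQ D_gaussian[OF \<eta>]])
      (simp_all add: Q_def D_space[OF zero_score] D_sets[OF zero_score])
  then show ?thesis by (simp add: Q_def G.lik_def)
qed

section \<open>Likelihood ratios of the drift experiment and the bridges\<close>

definition "limlik p w = enn2real (RN_deriv D0 (D p) w)"

lemma measurable_limlik [measurable]: "limlik p \<in> borel_measurable D0"
  unfolding limlik_def by measurable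

lemma AE_limlik:
  assumes p: "p \<in> params"
  shows "AE w in D0. limlik p w = G.lik (Inl p) w"
proof -
  obtain \<tau> \<eta> where t: "p = (\<tau>, \<eta>)" by (cases p)
  have "AE w in D0. ennreal (G.lik (Inl p) w) = RN_deriv D0 (D p) w"
  proof (rule G.RN_deriv_unique)
    have "Inl p \<in> ext" using p by auto
    from G.measurable_lik[OF this]
    show "(\<lambda>w. ennreal (G.lik (Inl p) w)) \<in> borel_measurable D0" by measurable
    show "density D0 (\<lambda>w. ennreal (G.lik (Inl p) w)) = D p"
      using D_density[of \<tau> \<eta>] p by (simp add: t)
  qed
  then show ?thesis
  proof eventually_elim
    case (elim w)
    then show ?case unfolding limlik_def elim[symmetric] by (simp add: G.lik_def)
  qed
qed

lemma bridge_algebra_sets: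
  "sets (bridge_algebra f0 \<Omega> \<Delta>nuis) = sets (generated_algebra (space D0) (Inr ` Inr ` (scores \<times> {0..1})) X)"
proof -
  have "sets (generated_algebra \<Omega> ((\<lambda>x. Inr (Inr x)) ` (scores \<times> {0..1})) X) = sets (generated_algebra \<Omega> (scores \<times> {0..1}) (\<lambda>(\<eta>, u). bridge \<Delta>nuis \<eta> u))"
    by (rule generated_algebra_reindex) (auto simp: X_bridge)
  then show ?thesis by (simp add: bridge_algebra_def D_space[OF zero_score] image_image)
qed

lemma bridge_subalgebra: "subalgebra D0 (bridge_algebra f0 \<Omega> \<Delta>nuis)"
proof -
  have "sets (generated_algebra (space D0) (Inr ` Inr ` (scores \<times> {0..1})) X) \<subseteq> sets D0"
    by (rule generated_algebra_subset) (auto intro: G.measurable_X)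
  moreover have "space (bridge_algebra f0 \<Omega> \<Delta>nuis) = space D0"
    by (simp add: bridge_algebra_def D_space[OF zero_score])
  ultimately show ?thesis
    by (simp add: subalgebra_def bridge_algebra_sets)
qed

text \<open>Up to null sets the ratios are functions of the variables \<open>X (Inl p)\<close>,
  which are uncorrelated with the bridges and hence independent of \<open>\<xi>\<close>. Coordinates
  from \<open>m\<close> on are set to 0, so that vectors of every length live in one sequence
  space.\<close>

lemma limit_integral:
  assumes js: "\<And>i. i < m \<Longrightarrow> js i \<in> params" and \<xi>: "\<xi> \<in> borel_measurable (bridge_algebra f0 \<Omega> \<Delta>nuis)"
    and H: "H \<in> borel_measurable (borel :: ((nat \<Rightarrow> real) \<times> real) measure)" and bnd: "\<And>z. \<bar>H z\<bar> \<le> (c::real)"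
  shows "(\<integral>w. H (\<lambda>i. if i < m then limlik (js i) w else 0, \<xi> w) \<partial>D0)
    = (\<integral>x. (\<integral>w. H (\<lambda>i. if i < m then limlik (js i) w else 0, x) \<partial>D0) \<partial>(distr D0 borel \<xi>))"
proof -
  define V where "V w = (\<lambda>i. if i < m then G.lik (Inl (js i)) w else 0)" for w
  define V' where "V' w = (\<lambda>i. if i < m then limlik (js i) w else 0)" for w
  let ?F = "generated_algebra (space D0) (Inl ` params) X"
  let ?G = "bridge_algebra f0 \<Omega> \<Delta>nuis"
  have "G.indep_set (sets ?F) (sets (generated_algebra (space D0) (Inr ` Inr ` (scores \<times> {0..1})) X))"
    by (rule G.indep_uncorrelated) (auto intro!: K_bridge)
  then have ind: "G.indep_set (sets ?F) (sets ?G)" by (simp add: bridge_algebra_sets)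
  have "sets ?F \<subseteq> sets D0"
    by (rule generated_algebra_subset) (auto intro: G.measurable_X)
  then have F: "subalgebra D0 ?F" by (simp add: subalgebra_def)
  have "G.lik (Inl (js i)) \<in> borel_measurable ?F" if "i < m" for i
  proof -
    have [measurable]: "X (Inl (js i)) \<in> borel_measurable ?F"
      by (rule measurable_generated_algebra) (use js[OF that] in auto)
    show ?thesis unfolding G.lik_def by measurable
  qed
  then have V: "V \<in> borel_measurable ?F"
    unfolding V_def by (intro measurable_coordinatewise_then_product) (case_tac "i < m"; simp)
  have Vm[measurable]: "V \<in> borel_measurable D0" by (rule measurable_from_subalg[OF F V])
  have Vm'[measurable]: "V' \<in> borel_measurable D0"
    unfolding V'_def by (intro measurable_coordinatewise_then_product) auto
  have xm[measurable]: "\<xi> \<in> borel_measurable D0" by (rule measurable_from_subalg[OF bridge_subalgebra \<xi>])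
  have Hm[measurable]: "H \<in> borel_measurable (borel \<Otimes>\<^sub>M borel)" using H by (simp only: borel_prod)
  have "AE w in D0. \<forall>i\<in>{..<m}. limlik (js i) w = G.lik (Inl (js i)) w"
    using js by (subst AE_finite_all) (auto intro: AE_limlik)
  then have AV: "AE w in D0. V' w = V w"
    by eventually_elim (auto simp: V_def V'_def)
  have "(\<integral>w. H (V' w, \<xi> w) \<partial>D0) = (\<integral>w. H (V w, \<xi> w) \<partial>D0)"
    by (rule integral_cong_AE) (use AV in auto)
  also have "\<dots> = (\<integral>x. (\<integral>w. H (V w, x) \<partial>D0) \<partial>(distr D0 borel \<xi>))"
    by (rule G.indep_set_integral[OF ind F bridge_subalgebra V \<xi> H bnd])
  also have "\<dots> = (\<integral>x. (\<integral>w. H (V' w, x) \<partial>D0) \<partial>(distr D0 borel \<xi>))"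
    by (intro Bochner_Integration.integral_cong refl integral_cong_AE) (use AV in auto)
  finally show ?thesis by (simp add: V'_def)
qed

section \<open>Continuity in the parameter and a countable dense set\<close>

definition "score_dist \<eta> \<eta>' = (\<integral>x. (\<eta> x - \<eta>' x)\<^sup>2 * f0 x \<partial>lborel)"

lemma integrable_score_product:
  assumes "\<eta> \<in> scores" "\<eta>' \<in> scores"
  shows "integrable lborel (\<lambda>x. \<eta> x * \<eta>' x * f0 x)"
proof (rule Bochner_Integration.integrable_bound)
  note [measurable] = f0_measurable
  have [measurable]: "\<eta> \<in> borel_measurable borel" "\<eta>' \<in> borel_measurable borel" using assms by (auto simp: score_space_def)
  show "integrable lborel (\<lambda>x. (\<eta> x)\<^sup>2 * f0 x + (\<eta>' x)\<^sup>2 * f0 x)"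
    using assms by (auto simp: score_space_def)
  show "(\<lambda>x. \<eta> x * \<eta>' x * f0 x) \<in> borel_measurable lborel" by measurable
  have "\<bar>a * b\<bar> \<le> a\<^sup>2 + b\<^sup>2" for a b :: real
  proof -
    have "2 * (\<bar>a\<bar> * \<bar>b\<bar>) \<le> a\<^sup>2 + b\<^sup>2" using sum_squares_bound[of "\<bar>a\<bar>" "\<bar>b\<bar>"] by simp
    moreover have "0 \<le> \<bar>a\<bar> * \<bar>b\<bar>" by simp
    ultimately show ?thesis unfolding abs_mult by linarith
  qed
  then have "\<bar>\<eta> x * \<eta>' x\<bar> * f0 x \<le> ((\<eta> x)\<^sup>2 + (\<eta>' x)\<^sup>2) * f0 x" for x
    by (intro mult_right_mono f0_nonneg)
  then show "AE x in lborel. norm (\<eta> x * \<eta>' x * f0 x) \<le> norm ((\<eta> x)\<^sup>2 * f0 x + (\<eta>' x)\<^sup>2 * f0 x)"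
    using f0_nonneg by (intro AE_I2) (simp add: abs_mult distrib_right)
qed

lemma vdist_score:
  assumes "\<eta> \<in> scores" "\<eta>' \<in> scores"
  shows "G.vdist (Inl (\<tau>, \<eta>)) (Inl (\<tau>, \<eta>')) = score_dist \<eta> \<eta>'"
proof -
  have "score_dist \<eta> \<eta>' = (\<integral>x. \<eta> x * \<eta> x * f0 x + \<eta>' x * \<eta>' x * f0 x - 2 * (\<eta> x * \<eta>' x * f0 x) \<partial>lborel)"
    unfolding score_dist_def by (simp add: power2_eq_square algebra_simps)
  also have "\<dots> = nuisance_info f0 \<eta> \<eta> + nuisance_info f0 \<eta>' \<eta>' - 2 * nuisance_info f0 \<eta> \<eta>'"
    unfolding nuisance_info_def using integrable_score_product assms by (simp add: Bochner_Integration.integrable_add)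
  finally show ?thesis by (simp add: G.vdist_def K_param)
qed

lemma vdist_shift:
  "G.vdist (Inl (\<tau>, \<eta>)) (Inl (\<tau>', \<eta>)) = (\<tau> - \<tau>') \<bullet> (III *v (\<tau> - \<tau>'))"
proof -
  have s: "III $ i $ j = III $ j $ i" for i j
    using cov_sym[of "Inl i" "Inl j"] by (auto simp: drift_cov_def)
  have "\<tau>' \<bullet> (III *v \<tau>) = \<tau> \<bullet> (III *v \<tau>')"
    unfolding inner_vec_def matrix_vector_mult_def
    by (simp add: sum_distrib_left, subst sum.swap) (simp add: s mult_ac)
  then show ?thesis
    by (simp add: G.vdist_def K_param matrix_vector_mult_diff_distrib inner_diff_left inner_diff_right)
qed

lemma vdist_shift_le:
  "G.vdist (Inl (\<tau>, \<eta>)) (Inl (\<tau>', \<eta>)) \<le> onorm ((*v) III) * (norm (\<tau> - \<tau>'))\<^sup>2"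
proof -
  have "(\<tau> - \<tau>') \<bullet> (III *v (\<tau> - \<tau>')) \<le> norm (\<tau> - \<tau>') * norm (III *v (\<tau> - \<tau>'))"
    by (rule norm_cauchy_schwarz)
  also have "\<dots> \<le> norm (\<tau> - \<tau>') * (onorm ((*v) III) * norm (\<tau> - \<tau>'))"
    by (intro mult_left_mono onorm matrix_vector_mul_bounded_linear) auto
  finally show ?thesis by (simp add: vdist_shift power2_eq_square mult_ac)
qed

text \<open>The approximating parameters have to lie in \<open>E\<close>, which countable dense sets
  of directions and scores need not meet. For each pair of centres and each radius, one point of
  \<open>E\<close> is therefore picked in the corresponding neighbourhood, provided there is
  one.\<close>

lemma limit_separable:
  assumes sep: "separable_scores f0" and E: "E \<subseteq> params"
  shows "\<exists>J. countable J \<and> J \<subseteq> E \<and> (\<forall>p\<in>E. \<forall>\<epsilon>>0. \<exists>p'\<in>J. (\<integral>w. min 1 \<bar>limlik p w - limlik p' w\<bar> \<partial>D0) < \<epsilon>)"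
proof -
  obtain S where S: "countable S" "S \<subseteq> scores" "\<And>\<eta> \<epsilon>. \<eta> \<in> scores \<Longrightarrow> \<epsilon> > 0 \<Longrightarrow> \<exists>\<eta>'\<in>S. score_dist \<eta> \<eta>' < \<epsilon>"
    using sep unfolding separable_scores_def score_dist_def by blast
  obtain T :: "(real ^ 'k) set" where T: "countable T" "\<And>U. open U \<Longrightarrow> U \<noteq> {} \<Longrightarrow> \<exists>d\<in>T. d \<in> U"
    using countable_dense_setE by blast
  define near where "near q c r p \<longleftrightarrow> p \<in> E \<and> dist (fst p) q < r \<and> score_dist (snd p) c < r\<^sup>2" for q c r p
  define pick where "pick = (\<lambda>(q, c, k). SOME p. near q c (1 / real (Suc k)) p)"
  \<comment> \<open>If a neighbourhood misses \<open>E\<close>, \<open>pick\<close> returns an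
    arbitrary value, which the intersection with \<open>E\<close> discards.\<close>
  define J where "J = pick ` (T \<times> S \<times> UNIV) \<inter> E"
  have "countable J" unfolding J_def using T S by auto
  moreover have "\<exists>p'\<in>J. (\<integral>w. min 1 \<bar>limlik p w - limlik p' w\<bar> \<partial>D0) < \<epsilon>" if p: "p \<in> E" and \<epsilon>: "\<epsilon> > 0" for p \<epsilon>
  proof -
    obtain \<tau> \<eta> where pt: "p = (\<tau>, \<eta>)" by (cases p)
    have \<eta>: "\<eta> \<in> scores" using p E pt by auto
    have pp: "p \<in> params" using p E by auto
    then have pe: "Inl p \<in> ext" by auto
    obtain \<delta> where \<delta>: "\<delta> > 0" "\<And>y. y \<in> ext \<Longrightarrow> G.vdist (Inl p) y < \<delta> \<Longrightarrow> (\<integral>w. min 1 \<bar>G.lik (Inl p) w - G.lik y w\<bar> \<partial>D0) < \<epsilon>"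
      using G.lik_continuous[OF pe \<epsilon>] by blast
    define L where "L = onorm ((*v) III)"
    have L: "L \<ge> 0" unfolding L_def by (intro onorm_pos_le matrix_vector_mul_bounded_linear)
    \<comment> \<open>Both parameters lie within \<open>r\<close> of the centre in the direction and
      within \<open>r * r\<close> in \<open>score_dist\<close>. The triangle inequalities give
      \<open>2 * L * (2 * r) * (2 * r) + 2 * 4 * r * r\<close>, whence the factor
      \<open>8 * L + 8\<close>.\<close>
    obtain k where k: "(8 * L + 8) * (1 / real (Suc k))\<^sup>2 < \<delta>"
    proof -
      have "(\<lambda>k. (8 * L + 8) * (1 / real (Suc k))\<^sup>2) \<longlonglongrightarrow> (8 * L + 8) * 0\<^sup>2"
        by (intro tendsto_intros LIMSEQ_Suc lim_1_over_n)
      then have "\<forall>\<^sub>F k in sequentially. (8 * L + 8) * (1 / real (Suc k))\<^sup>2 < \<delta>"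
        using \<delta> by (intro order_tendstoD(2)) auto
      then show ?thesis using that by (auto simp: eventually_sequentially)
    qed
    define r where "r = 1 / real (Suc k)"
    have r: "r > 0" by (simp add: r_def)
    obtain q where q: "q \<in> T" "dist \<tau> q < r" using T(2)[of "ball \<tau> r"] r by auto
    obtain c where c: "c \<in> S" "score_dist \<eta> c < r\<^sup>2" using S(3)[OF \<eta>, of "r\<^sup>2"] r by auto
    have "near q c r p" using p q c by (simp add: near_def pt)
    then have nn: "near q c r (pick (q, c, k))" unfolding pick_def r_def prod.case by (rule someI)
    then obtain \<tau>' \<eta>' where pk: "pick (q, c, k) = (\<tau>', \<eta>')" "(\<tau>', \<eta>') \<in> E" "dist \<tau>' q < r" "score_dist \<eta>' c < r\<^sup>2"
      by (cases "pick (q, c, k)") (auto simp: near_def)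
    have \<eta>': "\<eta>' \<in> scores" using pk E by auto
    have cs: "c \<in> scores" using c S by auto
    have J: "(\<tau>', \<eta>') \<in> J" unfolding J_def using pk q c by (auto intro!: image_eqI[of _ _ "(q, c, k)"])
    have ext: "Inl (\<tau>', \<eta>') \<in> ext" "Inl (\<tau>', \<eta>) \<in> ext" "Inl (\<tau>', c) \<in> ext" using \<eta> \<eta>' cs by auto
    have "norm (\<tau> - \<tau>') \<le> 2 * r"
      using q(2) pk(3) dist_triangle2[of \<tau> \<tau>' q] by (simp add: dist_norm)
    then have "(norm (\<tau> - \<tau>'))\<^sup>2 \<le> (2 * r)\<^sup>2" by (intro power_mono) auto
    then have a: "G.vdist (Inl p) (Inl (\<tau>', \<eta>)) \<le> L * (2 * r)\<^sup>2"
      using vdist_shift_le[of \<tau> \<eta> \<tau>'] mult_left_mono[of "(norm (\<tau> - \<tau>'))\<^sup>2" "(2 * r)\<^sup>2" L] L by (simp add: pt L_def)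
    have cd: "score_dist c \<eta>' = score_dist \<eta>' c" by (simp add: score_dist_def power2_commute)
    have b: "G.vdist (Inl (\<tau>', \<eta>)) (Inl (\<tau>', \<eta>')) \<le> 4 * r\<^sup>2"
      using G.vdist_triangle[OF ext(2) ext(3) ext(1)] pk(4) c(2)
      by (simp add: vdist_score \<eta> \<eta>' cs cd)
    have "G.vdist (Inl p) (Inl (\<tau>', \<eta>')) \<le> 2 * (L * (2 * r)\<^sup>2) + 2 * (4 * r\<^sup>2)"
      using G.vdist_triangle[OF pe ext(2) ext(1)] a b by linarith
    also have "\<dots> = (8 * L + 8) * r\<^sup>2" by (simp add: algebra_simps power2_eq_square)
    also have "\<dots> < \<delta>" using k by (simp add: r_def)
    finally have "(\<integral>w. min 1 \<bar>G.lik (Inl p) w - G.lik (Inl (\<tau>', \<eta>')) w\<bar> \<partial>D0) < \<epsilon>"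
      by (intro \<delta>(2) ext)
    also have "(\<integral>w. min 1 \<bar>G.lik (Inl p) w - G.lik (Inl (\<tau>', \<eta>')) w\<bar> \<partial>D0) = (\<integral>w. min 1 \<bar>limlik p w - limlik (\<tau>', \<eta>') w\<bar> \<partial>D0)"
    proof (rule integral_cong_AE)
      have "AE w in D0. limlik (\<tau>', \<eta>') w = G.lik (Inl (\<tau>', \<eta>')) w" using \<eta>' by (intro AE_limlik) auto
      with AE_limlik[OF pp] show "AE w in D0. min 1 \<bar>G.lik (Inl p) w - G.lik (Inl (\<tau>', \<eta>')) w\<bar> = min 1 \<bar>limlik p w - limlik (\<tau>', \<eta>') w\<bar>"
        by eventually_elim simp
    qed (use pe ext in measurable)
    finally show ?thesis using J by blast
  qed
  ultimately show ?thesis unfolding J_def by blast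
qed

end

section \<open>Convergence in distribution and equidistributed classes\<close>

text \<open>A bounded continuous function is the increasing limit of the Lipschitz functions
  \<open>x \<mapsto> INF z. h z + k * dist x z\<close>.\<close>

lemma lipschitz_approx:
  fixes h :: "'b::metric_space \<Rightarrow> real"
  assumes h: "continuous_on UNIV h" and B: "\<And>x. \<bar>h x\<bar> \<le> B"
  obtains hk :: "nat \<Rightarrow> 'b \<Rightarrow> real" where "\<And>k x. \<bar>hk k x\<bar> \<le> B" "\<And>k x. hk k x \<le> h x"
    "\<And>k x y. \<bar>hk k x - hk k y\<bar> \<le> real k * dist x y" "\<And>x. (\<lambda>k. hk k x) \<longlonglongrightarrow> h x"
proof -
  define hk where "hk k x = (INF z. h z + real k * dist x z)" for k :: nat and x
  have lb: "- B \<le> h z + real k * dist x z" for k x z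
  proof -
    have "0 \<le> real k * dist x z" by simp
    then show ?thesis using B[of z] by linarith
  qed
  then have bdd: "bdd_below (range (\<lambda>z. h z + real k * dist x z))" for k x by (intro bdd_belowI[of _ "- B"]) auto
  have le: "hk k x \<le> h x" for k x
    unfolding hk_def using cINF_lower[OF bdd, of x k x] by simp
  have ge: "- B \<le> hk k x" for k x unfolding hk_def by (rule cINF_greatest) (use lb in auto)
  have 1: "\<bar>hk k x\<bar> \<le> B" for k x using le[of k x] ge[of k x] B[of x] by auto
  have lip1: "hk k x \<le> hk k y + real k * dist x y" for k x y
  proof -
    have "hk k x - real k * dist x y \<le> hk k y"
      unfolding hk_def[of k y]
    proof (rule cINF_greatest)
      fix z
      have "hk k x \<le> h z + real k * dist x z" unfolding hk_def by (rule cINF_lower[OF bdd]) simp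
      also have "real k * dist x z \<le> real k * (dist x y + dist y z)"
        by (intro mult_left_mono dist_triangle) simp
      finally show "hk k x - real k * dist x y \<le> h z + real k * dist y z" by (simp add: distrib_left)
    qed simp
    then show ?thesis by simp
  qed
  have 3: "\<bar>hk k x - hk k y\<bar> \<le> real k * dist x y" for k x y
    using lip1[of k x y] lip1[of k y x] by (simp add: dist_commute abs_le_iff)
  have 4: "(\<lambda>k. hk k x) \<longlonglongrightarrow> h x" for x
  proof (rule LIMSEQ_I)
    fix r :: real assume r: "0 < r"
    obtain d where d: "d > 0" "\<And>z. dist z x < d \<Longrightarrow> dist (h z) (h x) < r / 2"
      using h r unfolding continuous_on_iff by (metis UNIV_I half_gt_zero)
    \<comment> \<open>For points at distance at least \<open>d\<close> the penalty alone exceeds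
      \<open>2 * B\<close>, which bounds the oscillation of \<open>h\<close>.\<close>
    obtain k0 :: nat where k0: "real k0 > 2 * B / d" using reals_Archimedean2 by blast
    have "norm (hk k x - h x) < r" if k: "k \<ge> k0" for k
    proof -
      have "h x - r / 2 \<le> hk k x"
        unfolding hk_def
      proof (rule cINF_greatest)
        fix z
        show "h x - r / 2 \<le> h z + real k * dist x z"
        proof (cases "dist z x < d")
          case True
          then have "h x - r / 2 \<le> h z" using d(2)[OF True] unfolding dist_real_def by linarith
          moreover have "0 \<le> real k * dist x z" by simp
          ultimately show ?thesis by linarith
        next
          case False
          have "2 * B \<le> real k0 * d" using k0 d(1) by (simp add: pos_divide_less_eq less_imp_le)
          also have "\<dots> \<le> real k * dist x z" using False k d(1) by (intro mult_mono) (auto simp: dist_commute)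
          finally show ?thesis using B[of x] B[of z] r by (simp add: abs_le_iff)
        qed
      qed simp
      then show ?thesis using le[of k x] r by simp
    qed
    then show "\<exists>no. \<forall>k\<ge>no. norm (hk k x - h x) < r" by blast
  qed
  show ?thesis by (rule that[of hk, OF 1 le 3 4])
qed

text \<open>Lipschitz approximation from below gives an asymptotic lower bound for the integrals of
  \<open>h\<close>. The same bound for \<open>- h\<close> is the upper one.\<close>

lemma conv_in_dist_lipschitz:
  fixes T :: "nat \<Rightarrow> 'a \<Rightarrow> 'b::metric_space" and Y :: "'c \<Rightarrow> 'b"
  assumes M: "\<forall>\<^sub>F n in sequentially. prob_space (M n) \<and> T n \<in> borel_measurable (M n)"
    and N: "prob_space N" and Y: "Y \<in> borel_measurable N"
    and lip: "\<And>H B C. (\<And>x. \<bar>H x\<bar> \<le> B) \<Longrightarrow> (\<And>x y. \<bar>H x - H y\<bar> \<le> C * dist x y) \<Longrightarrow>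
       (\<lambda>n. \<integral>x. H (T n x) \<partial>M n) \<longlonglongrightarrow> (\<integral>y. H (Y y) \<partial>N :: real)"
  shows "conv_in_dist M T N Y"
  unfolding conv_in_dist_def
proof (intro allI impI)
  interpret N: prob_space N by fact
  note [measurable] = Y
  have lower: "\<forall>\<^sub>F n in sequentially. (\<integral>y. h (Y y) \<partial>N) - e < (\<integral>x. h (T n x) \<partial>M n)"
    if h: "continuous_on UNIV h" and B: "\<And>x. \<bar>h x\<bar> \<le> B" and e: "e > 0" for h :: "'b \<Rightarrow> real" and B e
  proof -
    obtain hk :: "nat \<Rightarrow> 'b \<Rightarrow> real" where hk: "\<And>k x. \<bar>hk k x\<bar> \<le> B" "\<And>k x. hk k x \<le> h x"
      "\<And>k x y. \<bar>hk k x - hk k y\<bar> \<le> real k * dist x y" "\<And>x. (\<lambda>k. hk k x) \<longlonglongrightarrow> h x"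
      using lipschitz_approx[OF h B] by metis
    have [measurable]: "h \<in> borel_measurable borel" using h by (rule borel_measurable_continuous_onI)
    have cont: "continuous_on UNIV (hk k)" for k
      unfolding continuous_on_iff
    proof (intro ballI allI impI)
      fix x e assume "(0::real) < e"
      then have "\<forall>y. dist y x < e / (real k + 1) \<longrightarrow> dist (hk k y) (hk k x) < e"
      proof (intro allI impI)
        fix y assume "dist y x < e / (real k + 1)"
        then have "(real k + 1) * dist y x < e" by (simp add: pos_less_divide_eq mult.commute)
        moreover have "real k * dist y x \<le> (real k + 1) * dist y x" by (intro mult_right_mono) auto
        ultimately show "dist (hk k y) (hk k x) < e" using hk(3)[of k y x] by (simp add: dist_real_def)
      qed
      then show "\<exists>d>0. \<forall>x'\<in>UNIV. dist x' x < d \<longrightarrow> dist (hk k x') (hk k x) < e"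
        using \<open>0 < e\<close> by (intro exI[of _ "e / (real k + 1)"]) auto
    qed
    have [measurable]: "hk k \<in> borel_measurable borel" for k using cont by (rule borel_measurable_continuous_onI)
    have "(\<lambda>k. \<integral>y. hk k (Y y) \<partial>N) \<longlonglongrightarrow> (\<integral>y. h (Y y) \<partial>N)"
      by (rule integral_dominated_convergence[where w="\<lambda>_. B"]) (use hk in auto)
    then have "\<forall>\<^sub>F k in sequentially. (\<integral>y. h (Y y) \<partial>N) - e / 2 < (\<integral>y. hk k (Y y) \<partial>N)"
      using e by (intro order_tendstoD(1)) auto
    then obtain k where k: "(\<integral>y. h (Y y) \<partial>N) - e / 2 < (\<integral>y. hk k (Y y) \<partial>N)"
      by (auto simp: eventually_sequentially)
    have "(\<lambda>n. \<integral>x. hk k (T n x) \<partial>M n) \<longlonglongrightarrow> (\<integral>y. hk k (Y y) \<partial>N)"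
      by (rule lip[OF hk(1) hk(3)])
    then have "\<forall>\<^sub>F n in sequentially. (\<integral>y. hk k (Y y) \<partial>N) - e / 2 < (\<integral>x. hk k (T n x) \<partial>M n)"
      using e by (intro order_tendstoD(1)) auto
    with M show ?thesis
    proof eventually_elim
      case (elim n)
      interpret P: prob_space "M n" using elim by simp
      have [measurable]: "T n \<in> borel_measurable (M n)" using elim by simp
      have "(\<integral>x. hk k (T n x) \<partial>M n) \<le> (\<integral>x. h (T n x) \<partial>M n)"
        by (intro integral_mono P.integrable_const_bound[of _ B]) (use hk B in auto)
      then show ?case using elim k by linarith
    qed
  qed
  fix h :: "'b \<Rightarrow> real" assume "continuous_on UNIV h \<and> bounded (range h)"
  then obtain B where h: "continuous_on UNIV h" and B: "\<And>x. \<bar>h x\<bar> \<le> B"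
    by (auto simp: bounded_iff)
  show "(\<lambda>n. \<integral>x. h (T n x) \<partial>M n) \<longlonglongrightarrow> (\<integral>y. h (Y y) \<partial>N)"
  proof (rule LIMSEQ_I)
    fix r :: real assume r: "0 < r"
    have "\<forall>\<^sub>F n in sequentially. (\<integral>y. - h (Y y) \<partial>N) - r < (\<integral>x. - h (T n x) \<partial>M n)"
      by (rule lower[of "\<lambda>x. - h x" B r]) (use h B r in \<open>auto intro: continuous_intros\<close>)
    with lower[OF h B r] have "\<forall>\<^sub>F n in sequentially. norm ((\<integral>x. h (T n x) \<partial>M n) - (\<integral>y. h (Y y) \<partial>N)) < r"
      by eventually_elim (simp add: abs_less_iff)
    then show "\<exists>no. \<forall>n\<ge>no. norm ((\<integral>x. h (T n x) \<partial>M n) - (\<integral>y. h (Y y) \<partial>N)) < r"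
      by (simp add: eventually_sequentially)
  qed
qed

text \<open>Row \<open>N\<close> of \<open>x\<close> holds \<open>N\<close> points whose empirical
  law approximates \<open>\<mu>\<close>. The test functions may change with \<open>n\<close> under
  common bounds, and the sequence of row numbers is left free, because the number of classes is
  fixed only later.\<close>

definition samples :: "(nat \<Rightarrow> nat \<Rightarrow> real) \<Rightarrow> real measure \<Rightarrow> bool" where
  "samples x \<mu> \<longleftrightarrow> (\<forall>\<phi>n \<phi> B L N.
     (\<forall>n y. \<bar>\<phi>n n y\<bar> \<le> B) \<and> (\<forall>n y y'. \<bar>\<phi>n n y - \<phi>n n y'\<bar> \<le> L * \<bar>y - y'\<bar>) \<and>
     (\<forall>y. (\<lambda>n. \<phi>n n y) \<longlonglongrightarrow> \<phi> y) \<and> \<phi> \<in> borel_measurable borel \<and> filterlim N at_top sequentially \<longrightarrow>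
     (\<lambda>n. (\<Sum>m<N n. \<phi>n n (x (N n) m)) / real (N n)) \<longlonglongrightarrow> (\<integral>y. \<phi> y \<partial>\<mu>))"

lemma samplesD:
  assumes "samples x \<mu>" "\<And>n y. \<bar>\<phi>n n y\<bar> \<le> B" "\<And>n y y'. \<bar>\<phi>n n y - \<phi>n n y'\<bar> \<le> L * \<bar>y - y'\<bar>"
    "\<And>y. (\<lambda>n. \<phi>n n y) \<longlonglongrightarrow> \<phi> y" "\<phi> \<in> borel_measurable borel" "filterlim N at_top sequentially"
  shows "(\<lambda>n. (\<Sum>m<N n. \<phi>n n (x (N n) m)) / real (N n)) \<longlonglongrightarrow> (\<integral>y. \<phi> y \<partial>\<mu>)"
  using assms(1)[unfolded samples_def, rule_format, of \<phi>n B L \<phi> N] assms(2-) by blast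

text \<open>The quantile function transports the uniform law on the unit interval to
  \<open>\<mu>\<close>. It is monotone, so it is continuous outside a countable set, and at its
  points of continuity the quantiles at nearby levels converge.\<close>

lemma quantile_points:
  fixes \<mu> :: "real measure"
  assumes mu: "real_distribution \<mu>"
  shows "\<exists>x. samples x \<mu>"
proof -
  interpret M: cdf_distribution \<mu> unfolding cdf_distribution_def by (rule mu)
  define I where "I = M.I"
  \<comment> \<open>Midpoints keep the levels strictly between 0 and 1, where the quantile function
    is controlled.\<close>
  define x where "x N m = I ((real m + 1 / 2) / real N)" for N m :: nat
  have Id: "distr (restrict_space lborel {0<..<1::real}) borel I = \<mu>" unfolding I_def by (rule M.distr_I_eq_M)
  have Im[measurable]: "I \<in> borel_measurable (restrict_space borel {0<..<1})" unfolding I_def by (rule M.measurable_CI)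
  have cnt: "countable {u\<in>{0<..<1}. \<not> isCont I u}"
    unfolding I_def by (rule mono_on_ctble_discont_open[OF _ M.mono_I]) simp
  have "{u\<in>{0<..<1}. \<not> isCont I u} \<in> null_sets lborel" by (rule countable_imp_null_set_lborel[OF cnt])
  then have AEc: "AE u in lborel. u \<in> {0<..<1} \<longrightarrow> isCont I u"
    by (rule AE_I') auto
  have "(\<lambda>n. (\<Sum>m<N n. \<phi>n n (x (N n) m)) / real (N n)) \<longlonglongrightarrow> (\<integral>y. \<phi> y \<partial>\<mu>)"
    if bnd: "\<And>n y. \<bar>\<phi>n n y\<bar> \<le> B" and lip: "\<And>n y y'. \<bar>\<phi>n n y - \<phi>n n y'\<bar> \<le> L * \<bar>y - y'\<bar>"
      and lim: "\<And>y. (\<lambda>n. \<phi>n n y) \<longlonglongrightarrow> \<phi> y" and [measurable]: "\<phi> \<in> borel_measurable borel"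
      and N: "filterlim N at_top sequentially"
    for \<phi>n :: "nat \<Rightarrow> real \<Rightarrow> real" and \<phi> B L N
  proof -
    \<comment> \<open>A step function on \<open>N n\<close> intervals of equal length, whose
      integral is the empirical mean; the claim becomes one of dominated convergence.\<close>
    define G where "G n u = (\<Sum>m<N n. indicator {real m / real (N n)..<(real m + 1) / real (N n)} u * \<phi>n n (x (N n) m))" for n u
    have Geq: "G n u = (if 0 \<le> u \<and> u < 1 then \<phi>n n (I ((real (nat \<lfloor>u * real (N n)\<rfloor>) + 1 / 2) / real (N n))) else 0)"
      if Np: "N n > 0" for n u
    proof -
      have ind: "(u \<in> {real m / real (N n)..<(real m + 1) / real (N n)}) \<longleftrightarrow> (0 \<le> u \<and> m = nat \<lfloor>u * real (N n)\<rfloor>)" for m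
      proof -
        have "(u \<in> {real m / real (N n)..<(real m + 1) / real (N n)}) \<longleftrightarrow> real m \<le> u * real (N n) \<and> u * real (N n) < real m + 1"
          using Np by (simp add: pos_divide_le_eq pos_less_divide_eq)
        also have "\<dots> \<longleftrightarrow> \<lfloor>u * real (N n)\<rfloor> = int m" by (simp add: floor_eq_iff)
        also have "\<dots> \<longleftrightarrow> 0 \<le> u \<and> m = nat \<lfloor>u * real (N n)\<rfloor>"
        proof
          assume f: "\<lfloor>u * real (N n)\<rfloor> = int m"
          then have "0 \<le> u * real (N n)" by (metis of_nat_0_le_iff zero_le_floor)
          then show "0 \<le> u \<and> m = nat \<lfloor>u * real (N n)\<rfloor>" using f Np by (simp add: zero_le_mult_iff)
        next
          assume "0 \<le> u \<and> m = nat \<lfloor>u * real (N n)\<rfloor>"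
          then show "\<lfloor>u * real (N n)\<rfloor> = int m" by simp
        qed
        finally show ?thesis .
      qed
      have "G n u = (\<Sum>m<N n. if m = nat \<lfloor>u * real (N n)\<rfloor> then (if 0 \<le> u then \<phi>n n (x (N n) m) else 0) else 0)"
        unfolding G_def by (intro sum.cong refl) (simp add: indicator_def ind del: atLeastLessThan_iff)
      also have "\<dots> = (if nat \<lfloor>u * real (N n)\<rfloor> < N n then (if 0 \<le> u then \<phi>n n (x (N n) (nat \<lfloor>u * real (N n)\<rfloor>)) else 0) else 0)"
        by (subst sum.delta) auto
      also have "\<dots> = (if 0 \<le> u \<and> u < 1 then \<phi>n n (x (N n) (nat \<lfloor>u * real (N n)\<rfloor>)) else 0)"
      proof -
        have "nat \<lfloor>u * real (N n)\<rfloor> < N n \<longleftrightarrow> u < 1" if "0 \<le> u"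
        proof -
          have "nat \<lfloor>u * real (N n)\<rfloor> < N n \<longleftrightarrow> \<lfloor>u * real (N n)\<rfloor> < int (N n)" using that by (simp add: nat_less_iff)
          also have "\<dots> \<longleftrightarrow> u * real (N n) < real (N n)" by (simp add: floor_less_iff)
          also have "\<dots> \<longleftrightarrow> u < 1" using Np by simp
          finally show ?thesis .
        qed
        then show ?thesis by auto
      qed
      finally show ?thesis by (simp add: x_def)
    qed
    have Npos: "\<forall>\<^sub>F n in sequentially. N n > 0" using N unfolding filterlim_at_top by (auto elim!: allE[of _ 1] eventually_mono)
    have int: "(\<integral>u. G n u \<partial>lborel) = (\<Sum>m<N n. \<phi>n n (x (N n) m)) / real (N n)" if "N n > 0" for n
    proof -
      have m: "integrable lborel (indicator {real m / real (N n)..<(real m + 1) / real (N n)} :: real \<Rightarrow> real)"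
         "(\<integral>u. indicator {real m / real (N n)..<(real m + 1) / real (N n)} u \<partial>lborel) = 1 / real (N n)" for m
        using that by (auto simp: divide_right_mono diff_divide_distrib[symmetric])
      show ?thesis unfolding G_def using m by (subst Bochner_Integration.integral_sum) (auto simp: sum_divide_distrib)
    qed
    have "(\<lambda>n. \<integral>u. G n u \<partial>lborel) \<longlonglongrightarrow> (\<integral>u. indicator {0<..<1} u * \<phi> (I u) \<partial>lborel)"
    proof (rule integral_dominated_convergence[where w="\<lambda>u. B * indicator {0..1} u"])
      have "(\<lambda>u. indicator {0<..<1} u *\<^sub>R \<phi> (I u)) \<in> borel_measurable borel"
        by (subst borel_measurable_restrict_space_iff[symmetric]) auto
      then show "(\<lambda>u. indicator {0<..<1} u * \<phi> (I u)) \<in> borel_measurable lborel" by simp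
      show "G n \<in> borel_measurable lborel" for n unfolding G_def by measurable
      show "integrable lborel (\<lambda>u. B * indicator {0..1::real} u)" by simp
      have B0: "B \<ge> 0" using bnd[of 0 0] by auto
      show "AE u in lborel. norm (G n u) \<le> B * indicator {0..1} u" for n
      proof (cases "N n > 0")
        case True then show ?thesis using bnd B0 by (intro AE_I2) (auto simp: Geq indicator_def)
      next
        case False then show ?thesis using B0 by (auto simp: G_def)
      qed
      show "AE u in lborel. (\<lambda>n. G n u) \<longlonglongrightarrow> indicator {0<..<1} u * \<phi> (I u)"
        using AEc AE_lborel_singleton[of 0]
      proof eventually_elim
        case (elim u)
        show ?case
        proof (cases "0 < u \<and> u < 1")
          case False
          then have "\<forall>\<^sub>F n in sequentially. G n u = 0"
            using Npos elim(2) by (auto elim!: eventually_mono simp: Geq)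
          then show ?thesis using False by (auto intro: tendsto_eventually)
        next
          case True
          then have cont: "isCont I u" using elim by auto
          define t where "t n = (real (nat \<lfloor>u * real (N n)\<rfloor>) + 1 / 2) / real (N n)" for n
          have tt: "t \<longlonglongrightarrow> u"
          proof (rule Lim_null[THEN iffD2], rule Lim_null_comparison)
            show "\<forall>\<^sub>F n in sequentially. norm (t n - u) \<le> 1 / real (N n)"
              using Npos
            proof eventually_elim
              case (elim n)
              have "real (nat \<lfloor>u * real (N n)\<rfloor>) = of_int \<lfloor>u * real (N n)\<rfloor>" using True by simp
              then have "\<bar>(real (nat \<lfloor>u * real (N n)\<rfloor>) + 1 / 2) - u * real (N n)\<bar> \<le> 1" by linarith
              moreover have "t n - u = ((real (nat \<lfloor>u * real (N n)\<rfloor>) + 1 / 2) - u * real (N n)) / real (N n)"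
                using elim by (simp add: t_def field_simps)
              ultimately show ?case using elim by (simp add: divide_right_mono)
            qed
            show "(\<lambda>n. 1 / real (N n)) \<longlonglongrightarrow> 0"
              using filterlim_compose[OF lim_1_over_n N] by simp
          qed
          have It: "(\<lambda>n. I (t n)) \<longlonglongrightarrow> I u" using cont tt by (rule isCont_tendsto_compose)
          \<comment> \<open>Function and argument vary together. The common Lipschitz constant lets
            the argument be frozen first.\<close>
          have "(\<lambda>n. \<phi>n n (I (t n)) - \<phi>n n (I u)) \<longlonglongrightarrow> 0"
          proof (rule Lim_null_comparison)
            show "\<forall>\<^sub>F n in sequentially. norm (\<phi>n n (I (t n)) - \<phi>n n (I u)) \<le> L * \<bar>I (t n) - I u\<bar>"
              using lip by simp
            have "(\<lambda>n. L * \<bar>I (t n) - I u\<bar>) \<longlonglongrightarrow> L * \<bar>I u - I u\<bar>" using It by (intro tendsto_intros)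
            then show "(\<lambda>n. L * \<bar>I (t n) - I u\<bar>) \<longlonglongrightarrow> 0" by simp
          qed
          from tendsto_add[OF this lim[of "I u"]] have "(\<lambda>n. \<phi>n n (I (t n))) \<longlonglongrightarrow> \<phi> (I u)" by simp
          moreover have "\<forall>\<^sub>F n in sequentially. \<phi>n n (I (t n)) = G n u"
            using Npos by eventually_elim (use True in \<open>simp add: Geq t_def\<close>)
          ultimately show ?thesis using True by (auto intro: Lim_transform_eventually)
        qed
      qed
    qed
    moreover have "(\<integral>u. indicator {0<..<1} u * \<phi> (I u) \<partial>lborel) = (\<integral>y. \<phi> y \<partial>\<mu>)"
    proof -
      have "(\<integral>y. \<phi> y \<partial>\<mu>) = (\<integral>u. \<phi> (I u) \<partial>(restrict_space lborel {0<..<1::real}))"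
        unfolding Id[symmetric] by (rule integral_distr) (auto simp: measurable_restrict_space1)
      also have "\<dots> = (\<integral>u. indicator {0<..<1} u *\<^sub>R \<phi> (I u) \<partial>lborel)"
        by (rule integral_restrict_space) auto
      finally show ?thesis by simp
    qed
    moreover have "\<forall>\<^sub>F n in sequentially. (\<integral>u. G n u \<partial>lborel) = (\<Sum>m<N n. \<phi>n n (x (N n) m)) / real (N n)"
      using Npos by eventually_elim (rule int)
    ultimately show ?thesis by (auto intro: Lim_transform_eventually)
  qed
  then have "samples x \<mu>" unfolding samples_def by blast
  then show ?thesis by blast
qed

text \<open>Points are assigned to the classes one after the other. Averaged over the classes, the cross terms
  vanish, so some class increases the discrepancy by at most the average of the squares.\<close>

lemma equidistributed_classes:
  fixes g :: "'l \<Rightarrow> 'r \<Rightarrow> real"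
  assumes "finite A" "finite Cl" "N > 0" "\<And>l a. \<bar>g l a\<bar> \<le> 1"
  shows "\<exists>b. (\<forall>a. b a < N) \<and>
     (\<Sum>l\<in>Cl. \<Sum>m<N. (\<Sum>a\<in>A. g l a * (of_bool (b a = m) - 1 / real N))\<^sup>2) \<le> real (card A * card Cl * N)"
  using assms(1)
proof (induction A rule: finite_induct)
  case empty
  then show ?case using assms(3) by auto
next
  case (insert x A)
  then obtain b where b: "\<And>a. b a < N"
    "(\<Sum>l\<in>Cl. \<Sum>m<N. (\<Sum>a\<in>A. g l a * (of_bool (b a = m) - 1 / real N))\<^sup>2) \<le> real (card A * card Cl * N)" by blast
  define S where "S l m = (\<Sum>a\<in>A. g l a * (of_bool (b a = m) - 1 / real N))" for l m
  define d where "d k m = of_bool (k = m) - 1 / real N" for k m :: nat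
  define F where "F k = (\<Sum>l\<in>Cl. \<Sum>m<N. (S l m + g l x * d k m)\<^sup>2)" for k
  have d0: "(\<Sum>k<N. d k m) = 0" if "m < N" for m
    using that assms(3) by (simp add: d_def sum_subtractf of_bool_def)
  have d1: "(d k m)\<^sup>2 \<le> 1" for k m
  proof -
    have "\<bar>d k m\<bar> \<le> 1" using assms(3) by (auto simp: d_def of_bool_def abs_le_iff field_simps)
    then show ?thesis by (simp add: abs_square_le_1)
  qed
  have "(\<Sum>k<N. F k) = (\<Sum>l\<in>Cl. \<Sum>m<N. \<Sum>k<N. (S l m + g l x * d k m)\<^sup>2)"
    unfolding F_def by (subst sum.swap) (intro sum.cong refl sum.swap)
  also have "\<dots> \<le> (\<Sum>l\<in>Cl. \<Sum>m<N. real N * (S l m)\<^sup>2 + real N)"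
  proof (intro sum_mono)
    fix l m assume m: "m \<in> {..<N}"
    have "(\<Sum>k<N. (S l m + g l x * d k m)\<^sup>2) = (\<Sum>k<N. (S l m)\<^sup>2 + 2 * S l m * g l x * d k m + (g l x * d k m)\<^sup>2)"
      by (simp add: power2_eq_square algebra_simps)
    also have "\<dots> = real N * (S l m)\<^sup>2 + 2 * S l m * g l x * (\<Sum>k<N. d k m) + (\<Sum>k<N. (g l x * d k m)\<^sup>2)"
      by (simp add: sum.distrib sum_distrib_left)
    also have "(\<Sum>k<N. (g l x * d k m)\<^sup>2) \<le> (\<Sum>k<N. 1)"
    proof (intro sum_mono)
      fix k
      have "(g l x)\<^sup>2 \<le> 1" using assms(4) by (simp add: abs_square_le_1)
      then show "(g l x * d k m)\<^sup>2 \<le> 1" using d1[of k m] by (simp add: power_mult_distrib mult_le_one)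
    qed
    finally show "(\<Sum>k<N. (S l m + g l x * d k m)\<^sup>2) \<le> real N * (S l m)\<^sup>2 + real N"
      using d0 m by simp
  qed
  also have "\<dots> = real N * ((\<Sum>l\<in>Cl. \<Sum>m<N. (S l m)\<^sup>2) + real (card Cl * N))"
    by (simp add: sum.distrib sum_distrib_left distrib_left)
  also have "\<dots> \<le> real N * (real (card A * card Cl * N) + real (card Cl * N))"
    using b(2) unfolding S_def by (intro mult_left_mono add_right_mono) auto
  finally have le: "(\<Sum>k<N. F k) \<le> real N * real (card (insert x A) * card Cl * N)"
    using insert.hyps by (simp add: algebra_simps)
  have "\<exists>k<N. F k \<le> real (card (insert x A) * card Cl * N)"
  proof (rule ccontr)
    assume "\<not> (\<exists>k<N. F k \<le> real (card (insert x A) * card Cl * N))"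
    then have "(\<Sum>k<N. real (card (insert x A) * card Cl * N)) < (\<Sum>k<N. F k)"
      using assms(3) by (intro sum_strict_mono) auto
    then show False using le by simp
  qed
  then obtain k where k: "k < N" "F k \<le> real (card (insert x A) * card Cl * N)" by blast
  define b' where "b' = b(x := k)"
  have "(\<Sum>a\<in>insert x A. g l a * (of_bool (b' a = m) - 1 / real N)) = S l m + g l x * d k m" for l m
  proof -
    have "(\<Sum>a\<in>A. g l a * (of_bool (b' a = m) - 1 / real N)) = S l m"
      unfolding S_def b'_def by (intro sum.cong refl) (use insert.hyps in auto)
    then show ?thesis using insert.hyps by (simp add: b'_def d_def)
  qed
  then have "(\<Sum>l\<in>Cl. \<Sum>m<N. (\<Sum>a\<in>insert x A. g l a * (of_bool (b' a = m) - 1 / real N))\<^sup>2) = F k"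
    by (simp add: F_def)
  moreover have "b' a < N" for a using b(1) k(1) by (simp add: b'_def)
  ultimately show ?case using k(2) by (intro exI[of _ b']) auto
qed

section \<open>Limits realized by uniform finite-valued statistics\<close>

text \<open>The metric on functions from a countable type weights the coordinates by powers of 1/2,
  and the weights sum to 2.\<close>

lemma dist_fun_le_sum:
  fixes f g :: "nat \<Rightarrow> real"
  assumes "\<And>i. i \<ge> m \<Longrightarrow> f i = g i"
  shows "dist f g \<le> 2 * (\<Sum>i<m. \<bar>f i - g i\<bar>)"
proof -
  define S where "S = (\<Sum>i<m. \<bar>f i - g i\<bar>)"
  have le: "\<bar>f i - g i\<bar> \<le> S" for i
  proof (cases "i < m")
    case True then show ?thesis unfolding S_def by (intro member_le_sum) auto
  next
    case False then show ?thesis using assms[of i] by (simp add: S_def sum_nonneg)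
  qed
  have s: "summable (\<lambda>n. (1/2 :: real) ^ n * S)" by (intro summable_mult2 summable_geometric) simp
  have t: "(1/2) ^ n * min (dist (f (from_nat n)) (g (from_nat n))) 1 \<le> (1/2) ^ n * S" for n
    using le[of "from_nat n"] by (intro mult_left_mono) (auto simp: dist_real_def)
  have "dist f g = (\<Sum>n. (1/2) ^ n * min (dist (f (from_nat n)) (g (from_nat n))) 1)" by (rule dist_fun_def)
  also have "\<dots> \<le> (\<Sum>n. (1/2) ^ n * S)"
  proof (rule suminf_le[OF t _ s])
    show "summable (\<lambda>n. (1/2) ^ n * min (dist (f (from_nat n)) (g (from_nat n))) 1)"
      by (rule summable_comparison_test[OF _ s]) (use t in \<open>auto intro!: exI[of _ 0]\<close>)
  qed
  also have "\<dots> = 2 * S" by (simp add: suminf_mult2[symmetric] suminf_geometric)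
  finally show ?thesis by (simp add: S_def)
qed

lemma lipschitz_continuous:
  fixes H :: "'b::metric_space \<Rightarrow> real"
  assumes "\<And>x y. \<bar>H x - H y\<bar> \<le> C * dist x y"
  shows "continuous_on UNIV H"
proof (rule lipschitz_on_continuous_on)
  show "(max 0 C)-lipschitz_on UNIV H"
  proof (rule lipschitz_onI)
    fix x y :: 'b
    have "C * dist x y \<le> max 0 C * dist x y" by (intro mult_right_mono) auto
    then show "dist (H x) (H y) \<le> max 0 C * dist x y" using assms[of x y] by (simp add: dist_real_def)
  qed simp
qed

lemma ennreal_enn2real_le: "ennreal (enn2real x) \<le> x"
  by (cases x) auto

text \<open>Only a statistic that is uniform on finite sets of growing size is assumed. The
  properties of the measures are required for all large \<open>n\<close>, since a parameter belongs
  to the \<open>n\<close>-th experiment only eventually.\<close>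

locale rank_realization =
  fixes E :: "nat \<Rightarrow> 'j \<Rightarrow> 'a measure" and \<Lambda> :: "nat \<Rightarrow> 'j set" and j0 :: 'j and D :: "'j \<Rightarrow> 'b measure"
    and A :: "nat \<Rightarrow> 'r set" and R :: "nat \<Rightarrow> 'a \<Rightarrow> 'r"
  assumes j0: "j0 \<in> eventual_params \<Lambda>"
    and E_prob: "\<And>j. j \<in> eventual_params \<Lambda> \<Longrightarrow> \<forall>\<^sub>F n in sequentially. prob_space (E n j)"
    and E_ac: "\<And>j. j \<in> eventual_params \<Lambda> \<Longrightarrow> \<forall>\<^sub>F n in sequentially. absolutely_continuous (E n j0) (E n j) \<and> sets (E n j) = sets (E n j0)"
    and LAN: "experiments_converge E \<Lambda> j0 D"
    and D_prob: "prob_space (D j0)"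
    and R: "\<forall>\<^sub>F n in sequentially. finite (A n) \<and> R n \<in> measurable (E n j0) (count_space (A n)) \<and>
        (\<forall>a\<in>A n. measure (E n j0) {w\<in>space (E n j0). R n w = a} = 1 / real (card (A n)))"
    and cardA: "filterlim (\<lambda>n. card (A n)) at_top sequentially"
begin

definition "lrn n j w = enn2real (RN_deriv (E n j0) (E n j) w)"
definition "lr j w = enn2real (RN_deriv (D j0) (D j) w)"
definition "Vn m js n w = (\<lambda>i::nat. if i < (m::nat) then lrn n (js i) w else 0)"
definition "V m js w = (\<lambda>i::nat. if i < (m::nat) then lr (js i) w else 0)"

lemma measurable_lrn [measurable]: "lrn n j \<in> borel_measurable (E n j0)"
  unfolding lrn_def by measurable

lemma measurable_lr [measurable]: "lr j \<in> borel_measurable (D j0)"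
  unfolding lr_def by measurable

lemma measurable_Vn [measurable]: "Vn m js n \<in> borel_measurable (E n j0)"
  unfolding Vn_def by (intro measurable_coordinatewise_then_product) auto

lemma measurable_V [measurable]: "V m js \<in> borel_measurable (D j0)"
  unfolding V_def by (intro measurable_coordinatewise_then_product) auto

lemma lrn_nonneg: "lrn n j w \<ge> 0"
  by (simp add: lrn_def)

text \<open>A likelihood ratio has mean at most 1. The quantifier over \<open>K\<close> stands
  inside, because the level of truncation will depend on \<open>n\<close>.\<close>

lemma lrn_markov:
  assumes "j \<in> eventual_params \<Lambda>"
  shows "\<forall>\<^sub>F n in sequentially. \<forall>K>0. measure (E n j0) {w\<in>space (E n j0). K \<le> lrn n j w} \<le> 1 / K"
  using E_prob[OF assms] E_ac[OF assms] E_prob[OF j0]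
proof eventually_elim
  case (elim n)
  interpret P: prob_space "E n j0" using elim by simp
  interpret Q: prob_space "E n j" using elim by simp
  have sp: "space (E n j) = space (E n j0)" using elim by (intro sets_eq_imp_space_eq) simp
  have d: "density (E n j0) (RN_deriv (E n j0) (E n j)) = E n j"
    by (rule P.density_RN_deriv) (use elim in auto)
  have "(\<integral>\<^sup>+w. RN_deriv (E n j0) (E n j) w \<partial>E n j0) = emeasure (density (E n j0) (RN_deriv (E n j0) (E n j))) (space (E n j0))"
    by (subst emeasure_density) (auto cong: nn_integral_cong)
  also have "\<dots> = 1" unfolding d sp[symmetric] by (rule Q.emeasure_space_1)
  finally have nn: "(\<integral>\<^sup>+w. RN_deriv (E n j0) (E n j) w \<partial>E n j0) = 1" .
  have "(\<integral>\<^sup>+w. ennreal (lrn n j w) \<partial>E n j0) \<le> (\<integral>\<^sup>+w. RN_deriv (E n j0) (E n j) w \<partial>E n j0)"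
    unfolding lrn_def by (intro nn_integral_mono ennreal_enn2real_le)
  then have le: "(\<integral>\<^sup>+w. ennreal (lrn n j w) \<partial>E n j0) \<le> 1" by (simp add: nn)
  have int: "integrable (E n j0) (lrn n j)"
  proof (rule integrableI_nonneg)
    show "(\<integral>\<^sup>+w. ennreal (lrn n j w) \<partial>E n j0) < \<infinity>" by (rule le_less_trans[OF le]) simp
  qed (simp_all add: lrn_nonneg)
  have "ennreal (\<integral>w. lrn n j w \<partial>E n j0) \<le> 1"
    using le nn_integral_eq_integral[OF int] lrn_nonneg by simp
  then have le1: "(\<integral>w. lrn n j w \<partial>E n j0) \<le> 1" by simp
  show ?case
  proof (intro allI impI)
    fix K :: real assume K: "K > 0"
    have "measure (E n j0) {w\<in>space (E n j0). K \<le> lrn n j w} \<le> (\<integral>w. lrn n j w \<partial>E n j0) / K"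
      by (rule integral_Markov_inequality_measure[OF int sets.top]) (use K lrn_nonneg in auto)
    also have "\<dots> \<le> 1 / K" using K le1 by (intro divide_right_mono) auto
    finally show "measure (E n j0) {w\<in>space (E n j0). K \<le> lrn n j w} \<le> 1 / K" .
  qed
qed

text \<open>Rephrases LAN for ratios indexed by positions instead of parameters; repetitions in
  \<open>js\<close> are allowed.\<close>

lemma Vn_conv:
  fixes H :: "(nat \<Rightarrow> real) \<Rightarrow> real"
  assumes js: "\<And>i. i < m \<Longrightarrow> js i \<in> eventual_params \<Lambda>" and H: "continuous_on UNIV H" "\<And>v. \<bar>H v\<bar> \<le> B"
  shows "(\<lambda>n. \<integral>w. H (Vn m js n w) \<partial>E n j0) \<longlonglongrightarrow> (\<integral>w. H (V m js w) \<partial>D j0)"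
proof -
  define p where "p l = (\<lambda>i. if i < m then l (js i) else 0)" for l :: "'j \<Rightarrow> real"
  have "continuous_on UNIV (\<lambda>l. p l i)" for i
    unfolding p_def by (cases "i < m") (auto intro: continuous_on_product_coordinates)
  then have "continuous_on UNIV p" by (intro continuous_on_coordinatewise_then_product)
  then have c: "continuous_on UNIV (\<lambda>l. H (p l))" using H(1) by (intro continuous_on_compose2[OF H(1)]) auto
  have "conv_in_dist (\<lambda>n. E n j0) (\<lambda>n. lik_ratios (E n) j0 (js ` {..<m})) (D j0) (lik_ratios D j0 (js ` {..<m}))"
    using LAN js unfolding experiments_converge_def by blast
  then have "(\<lambda>n. \<integral>w. H (p (lik_ratios (E n) j0 (js ` {..<m}) w)) \<partial>E n j0) \<longlonglongrightarrow> (\<integral>w. H (p (lik_ratios D j0 (js ` {..<m}) w)) \<partial>D j0)"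
    unfolding conv_in_dist_def using c H(2) by (auto simp: bounded_iff)
  moreover have "p (lik_ratios (E n) j0 (js ` {..<m}) w) = Vn m js n w" for n w
    by (auto simp: p_def lik_ratios_def Vn_def lrn_def fun_eq_iff)
  moreover have "p (lik_ratios D j0 (js ` {..<m}) w) = V m js w" for w
    by (auto simp: p_def lik_ratios_def V_def lr_def fun_eq_iff)
  ultimately show ?thesis by simp
qed

lemma lrn_dist_conv:
  assumes "j \<in> eventual_params \<Lambda>" "j' \<in> eventual_params \<Lambda>"
  shows "(\<lambda>n. \<integral>w. min 1 \<bar>lrn n j w - lrn n j' w\<bar> \<partial>E n j0) \<longlonglongrightarrow> (\<integral>w. min 1 \<bar>lr j w - lr j' w\<bar> \<partial>D j0)"
proof -
  have c: "continuous_on UNIV (\<lambda>v :: nat \<Rightarrow> real. min 1 \<bar>v 0 - v 1\<bar>)"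
    by (intro continuous_intros continuous_on_product_coordinates)
  have "(\<lambda>n. \<integral>w. (\<lambda>v. min 1 \<bar>v 0 - v 1\<bar>) (Vn 2 (\<lambda>i. if i = 0 then j else j') n w) \<partial>E n j0) \<longlonglongrightarrow>
     (\<integral>w. (\<lambda>v. min 1 \<bar>v 0 - v 1\<bar>) (V 2 (\<lambda>i. if i = 0 then j else j') w) \<partial>D j0)"
    by (rule Vn_conv[where B=1]) (use assms c in auto)
  then show ?thesis by (simp add: Vn_def V_def)
qed

end

section \<open>Spreading a uniform statistic evenly over a finite partition\<close>

context prob_space begin

lemma prob_partition:
  assumes A: "finite A" and R: "R \<in> measurable M (count_space A)" and S: "S \<in> events"
  shows "(\<Sum>a\<in>A. of_bool (Q a) * prob {w\<in>S. R w = a}) = prob {w\<in>S. Q (R w)}"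
proof -
  have m: "{w\<in>S. R w = a} \<in> events" if "a \<in> A" for a
  proof -
    have "{w\<in>S. R w = a} = S \<inter> (R -` {a} \<inter> space M)" using sets.sets_into_space[OF S] by auto
    then show ?thesis using S measurable_sets[OF R, of "{a}"] that by auto
  qed
  have RA: "R w \<in> A" if "w \<in> S" for w using measurable_space[OF R] sets.sets_into_space[OF S] that by auto
  have "(\<Sum>a\<in>A. of_bool (Q a) * prob {w\<in>S. R w = a}) = (\<Sum>a\<in>{a\<in>A. Q a}. prob {w\<in>S. R w = a})"
    unfolding sum.inter_filter[OF A] by (intro sum.cong refl) simp
  also have "\<dots> = prob (\<Union>a\<in>{a\<in>A. Q a}. {w\<in>S. R w = a})"
    by (rule finite_measure_finite_Union[symmetric]) (use A m in \<open>auto simp: disjoint_family_on_def\<close>)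
  also have "(\<Union>a\<in>{a\<in>A. Q a}. {w\<in>S. R w = a}) = {w\<in>S. Q (R w)}" using RA by auto
  finally show ?thesis .
qed

text \<open>The greedy classes control a sum of squares by \<open>card A * card Cl * N\<close>.
  After division by the square of \<open>card A\<close>, each single discrepancy is at most
  \<open>\<delta>\<close> under the stated size condition.\<close>

lemma equidistributed_function:
  assumes A: "finite A" and R: "R \<in> measurable M (count_space A)"
    and unif: "\<And>a. a \<in> A \<Longrightarrow> prob {w\<in>space M. R w = a} = 1 / real (card A)"
    and Cl: "finite Cl" and c: "c \<in> measurable M (count_space Cl)"
    and N: "N > 0" and \<delta>: "\<delta> > 0" "real (card Cl * N) \<le> real (card A) * \<delta>\<^sup>2"
  shows "\<exists>b. (\<forall>a. b a < N) \<and> (\<forall>l\<in>Cl. \<forall>m<N.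
     \<bar>prob {w\<in>space M. c w = l \<and> b (R w) = m} - prob {w\<in>space M. c w = l} / real N\<bar> \<le> \<delta>)"
proof -
  have cl: "{w\<in>space M. c w = l} \<in> events" if "l \<in> Cl" for l
    using measurable_sets[OF c, of "{l}"] that by (simp add: vimage_def Int_def conj_commute)
  have Ane: "A \<noteq> {}" using not_empty measurable_space[OF R] by auto
  then have cA: "real (card A) > 0" using A by (simp add: card_gt_0_iff)
  \<comment> \<open>The conditional probability of \<open>c = l\<close> given \<open>R = a\<close>;
    by uniformity of \<open>R\<close> it is the joint probability times
    \<open>card A\<close>.\<close>
  define g where "g l a = (if a \<in> A then real (card A) * prob {w\<in>space M. c w = l \<and> R w = a} else 0)" for l a
  have g1: "\<bar>g l a\<bar> \<le> 1" for l a
  proof (cases "a \<in> A")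
    case True
    have "{w\<in>space M. R w = a} \<in> events"
      using measurable_sets[OF R, of "{a}"] True by (simp add: vimage_def Int_def conj_commute)
    then have "prob {w\<in>space M. c w = l \<and> R w = a} \<le> 1 / real (card A)"
      unfolding unif[OF True, symmetric] by (intro finite_measure_mono) auto
    then show ?thesis using True cA by (simp add: g_def abs_mult field_simps)
  qed (simp add: g_def)
  obtain b where b: "\<And>a. b a < N"
    and le: "(\<Sum>l\<in>Cl. \<Sum>m<N. (\<Sum>a\<in>A. g l a * (of_bool (b a = m) - 1 / real N))\<^sup>2) \<le> real (card A * card Cl * N)"
    using equidistributed_classes[where g=g, OF A Cl N g1] by blast
  have "\<bar>prob {w\<in>space M. c w = l \<and> b (R w) = m} - prob {w\<in>space M. c w = l} / real N\<bar> \<le> \<delta>"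
    if l: "l \<in> Cl" and m: "m < N" for l m
  proof -
    define X where "X = prob {w\<in>space M. c w = l \<and> b (R w) = m} - prob {w\<in>space M. c w = l} / real N"
    have "(\<Sum>a\<in>A. of_bool (b a = m) * prob {w\<in>{w\<in>space M. c w = l}. R w = a}) = prob {w\<in>{w\<in>space M. c w = l}. b (R w) = m}"
      by (rule prob_partition[OF A R cl[OF l]])
    then have s1: "(\<Sum>a\<in>A. of_bool (b a = m) * prob {w\<in>space M. c w = l \<and> R w = a}) = prob {w\<in>space M. c w = l \<and> b (R w) = m}"
      by (simp add: conj_assoc)
    have "(\<Sum>a\<in>A. of_bool True * prob {w\<in>{w\<in>space M. c w = l}. R w = a}) = prob {w\<in>{w\<in>space M. c w = l}. True}"
      by (rule prob_partition[OF A R cl[OF l]])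
    then have s2: "(\<Sum>a\<in>A. prob {w\<in>space M. c w = l \<and> R w = a}) = prob {w\<in>space M. c w = l}"
      by (simp add: conj_assoc)
    have "(\<Sum>a\<in>A. g l a * (of_bool (b a = m) - 1 / real N))
        = (\<Sum>a\<in>A. real (card A) * (of_bool (b a = m) * prob {w\<in>space M. c w = l \<and> R w = a}) - real (card A) / real N * prob {w\<in>space M. c w = l \<and> R w = a})"
      by (intro sum.cong refl) (simp add: g_def algebra_simps)
    also have "\<dots> = real (card A) * X"
      by (simp only: sum_subtractf sum_distrib_left[symmetric] s1 s2 X_def) (simp add: algebra_simps)
    finally have "(real (card A) * X)\<^sup>2 = (\<Sum>a\<in>A. g l a * (of_bool (b a = m) - 1 / real N))\<^sup>2" by simp
    also have "\<dots> \<le> (\<Sum>m<N. (\<Sum>a\<in>A. g l a * (of_bool (b a = m) - 1 / real N))\<^sup>2)"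
      using m by (intro member_le_sum) auto
    also have "\<dots> \<le> (\<Sum>l\<in>Cl. \<Sum>m<N. (\<Sum>a\<in>A. g l a * (of_bool (b a = m) - 1 / real N))\<^sup>2)"
      using l Cl by (intro member_le_sum[of l Cl "\<lambda>l. \<Sum>m<N. (\<Sum>a\<in>A. g l a * (of_bool (b a = m) - 1 / real N))\<^sup>2"]) (auto intro: sum_nonneg)
    also have "\<dots> \<le> real (card A) * real (card Cl * N)" using le by (simp add: mult.assoc)
    also have "\<dots> \<le> real (card A) * (real (card A) * \<delta>\<^sup>2)" using \<delta>(2) by (intro mult_left_mono) auto
    also have "\<dots> = (real (card A) * \<delta>)\<^sup>2" by (simp add: power2_eq_square)
    finally have "X\<^sup>2 \<le> \<delta>\<^sup>2" using cA by (simp add: power_mult_distrib)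
    then show ?thesis using \<delta>(1) abs_le_square_iff[of X \<delta>] by (simp add: X_def)
  qed
  then show ?thesis using b by blast
qed

lemma expectation_finite_values:
  fixes F :: "'l \<Rightarrow> real"
  assumes Cl: "finite Cl" and c: "c \<in> measurable M (count_space Cl)"
  shows "(\<integral>w. F (c w) \<partial>M) = (\<Sum>l\<in>Cl. F l * prob {w\<in>space M. c w = l})"
proof -
  have cl[measurable]: "{w\<in>space M. c w = l} \<in> events" if "l \<in> Cl" for l
    using measurable_sets[OF c, of "{l}"] that by (simp add: vimage_def Int_def conj_commute)
  have "(\<integral>w. F (c w) \<partial>M) = (\<integral>w. (\<Sum>l\<in>Cl. F l * indicator {w\<in>space M. c w = l} w) \<partial>M)"
  proof (intro Bochner_Integration.integral_cong refl)
    fix w assume w: "w \<in> space M"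
    then have "c w \<in> Cl" using measurable_space[OF c] by auto
    moreover have "(\<Sum>l\<in>Cl. F l * indicator {w\<in>space M. c w = l} w) = (\<Sum>l\<in>Cl. if l = c w then F l else 0)"
      using w by (intro sum.cong refl) (auto simp: indicator_def)
    ultimately show "F (c w) = (\<Sum>l\<in>Cl. F l * indicator {w\<in>space M. c w = l} w)"
      using Cl by simp
  qed
  also have "\<dots> = (\<Sum>l\<in>Cl. F l * prob {w\<in>space M. c w = l})"
    using cl by (subst Bochner_Integration.integral_sum) (auto intro!: integrable_real_indicator simp: emeasure_eq_measure)
  finally show ?thesis .
qed

text \<open>The class \<open>b\<close> acts as if it were uniform and independent of
  \<open>c\<close>, up to an error of at most \<open>B * \<delta>\<close> in each of the
  \<open>card Cl * N\<close> cells.\<close>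

lemma equidistributed_expectation:
  fixes F :: "'l \<Rightarrow> nat \<Rightarrow> real"
  assumes Cl: "finite Cl" and c: "c \<in> measurable M (count_space Cl)"
    and b: "b \<in> measurable M (count_space {..<N})" and \<delta>: "\<delta> \<ge> 0"
    and d: "\<And>l m. l \<in> Cl \<Longrightarrow> m < N \<Longrightarrow> \<bar>prob {w\<in>space M. c w = l \<and> b w = m} - prob {w\<in>space M. c w = l} / real N\<bar> \<le> \<delta>"
    and F: "\<And>l m. \<bar>F l m\<bar> \<le> B"
  shows "\<bar>(\<integral>w. F (c w) (b w) \<partial>M) - (\<Sum>m<N. (\<integral>w. F (c w) m \<partial>M)) / real N\<bar> \<le> B * \<delta> * real (card Cl * N)"
proof -
  have B: "B \<ge> 0" using F[of undefined undefined] by linarith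
  have cb: "(\<lambda>w. (c w, b w)) \<in> measurable M (count_space (Cl \<times> {..<N}))"
    using measurable_Pair[OF c b] Cl by (simp add: pair_measure_countable countable_finite)
  have "(\<integral>w. (\<lambda>(l, m). F l m) (c w, b w) \<partial>M) = (\<Sum>z\<in>Cl \<times> {..<N}. (\<lambda>(l, m). F l m) z * prob {w\<in>space M. (c w, b w) = z})"
    by (rule expectation_finite_values[OF _ cb]) (use Cl in auto)
  also have "\<dots> = (\<Sum>l\<in>Cl. \<Sum>m<N. F l m * prob {w\<in>space M. c w = l \<and> b w = m})"
    by (simp add: sum.cartesian_product case_prod_beta prod_eq_iff)
  finally have e1: "(\<integral>w. F (c w) (b w) \<partial>M) = (\<Sum>l\<in>Cl. \<Sum>m<N. F l m * prob {w\<in>space M. c w = l \<and> b w = m})" by simp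
  have "(\<Sum>m<N. (\<integral>w. F (c w) m \<partial>M)) = (\<Sum>m<N. \<Sum>l\<in>Cl. F l m * prob {w\<in>space M. c w = l})"
    by (intro sum.cong refl expectation_finite_values[OF Cl c])
  also have "\<dots> = (\<Sum>l\<in>Cl. \<Sum>m<N. F l m * prob {w\<in>space M. c w = l})" by (rule sum.swap)
  finally have e2: "(\<Sum>m<N. (\<integral>w. F (c w) m \<partial>M)) / real N = (\<Sum>l\<in>Cl. \<Sum>m<N. F l m * (prob {w\<in>space M. c w = l} / real N))"
    by (simp add: sum_divide_distrib)
  have "\<bar>(\<integral>w. F (c w) (b w) \<partial>M) - (\<Sum>m<N. (\<integral>w. F (c w) m \<partial>M)) / real N\<bar>
     = \<bar>\<Sum>l\<in>Cl. \<Sum>m<N. F l m * (prob {w\<in>space M. c w = l \<and> b w = m} - prob {w\<in>space M. c w = l} / real N)\<bar>"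
    unfolding e1 e2 by (simp add: sum_subtractf[symmetric] right_diff_distrib)
  also have "\<dots> \<le> (\<Sum>l\<in>Cl. \<Sum>m<N. B * \<delta>)"
    by (intro order.trans[OF sum_abs] sum_mono) (use d F B \<delta> in \<open>auto simp: abs_mult intro!: mult_mono\<close>)
  also have "\<dots> = B * \<delta> * real (card Cl * N)" by simp
  finally show ?thesis .
qed

end

section \<open>Discretized likelihood ratios\<close>

context rank_realization begin

definition boxes :: "nat \<Rightarrow> (nat \<Rightarrow> nat) set" where
  "boxes N = PiE {..<N} (\<lambda>_. {..N * N})"

text \<open>The first \<open>N\<close> ratios, rounded down to multiples of \<open>1 / N\<close> and
  truncated at \<open>N\<close>. Scaled by \<open>N\<close> they are integers between 0 and
  \<open>N * N\<close>.\<close>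

definition box :: "(nat \<Rightarrow> 'j) \<Rightarrow> nat \<Rightarrow> nat \<Rightarrow> 'a \<Rightarrow> nat \<Rightarrow> nat" where
  "box e N n w = (\<lambda>i\<in>{..<N}. min (N * N) (nat \<lfloor>real N * lrn n (e i) w\<rfloor>))"

lemma finite_boxes: "finite (boxes N)"
  unfolding boxes_def by (rule finite_PiE) auto

lemma boxes_nonempty: "card (boxes N) > 0"
proof -
  have "(\<lambda>i\<in>{..<N}. 0) \<in> boxes N" unfolding boxes_def by simp
  then show ?thesis using finite_boxes[of N] by (metis card_gt_0_iff empty_iff)
qed

lemma measurable_box: "box e N n \<in> measurable (E n j0) (count_space (boxes N))"
  unfolding measurable_count_space_eq2[OF finite_boxes]
proof (intro conjI ballI)
  show "box e N n \<in> space (E n j0) \<rightarrow> boxes N"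
    by (auto simp: box_def boxes_def)
  fix l assume l: "l \<in> boxes N"
  have "box e N n w = l \<longleftrightarrow> (\<forall>i\<in>{..<N}. min (N * N) (nat \<lfloor>real N * lrn n (e i) w\<rfloor>) = l i)" for w
  proof
    assume r: "\<forall>i\<in>{..<N}. min (N * N) (nat \<lfloor>real N * lrn n (e i) w\<rfloor>) = l i"
    show "box e N n w = l"
    proof
      fix i show "box e N n w i = l i"
      proof (cases "i < N")
        case True then show ?thesis using r by (simp add: box_def)
      next
        case False
        then have "l i = undefined" using l unfolding boxes_def by (intro PiE_arb[of l "{..<N}"]) auto
        then show ?thesis using False by (simp add: box_def)
      qed
    qed
  qed (auto simp: box_def)
  then have "box e N n -` {l} \<inter> space (E n j0) = {w\<in>space (E n j0). \<forall>i\<in>{..<N}. min (N * N) (nat \<lfloor>real N * lrn n (e i) w\<rfloor>) = l i}"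
    by auto
  also have "\<dots> \<in> sets (E n j0)" by measurable
  finally show "box e N n -` {l} \<inter> space (E n j0) \<in> sets (E n j0)" .
qed

text \<open>Reads the vector of ratios back from a box; \<open>\<kappa> i\<close> is the place of
  the \<open>i\<close>-th parameter in the enumeration that defines the boxes.\<close>

definition rep :: "nat \<Rightarrow> (nat \<Rightarrow> nat) \<Rightarrow> nat \<Rightarrow> (nat \<Rightarrow> nat) \<Rightarrow> nat \<Rightarrow> real" where
  "rep N \<kappa> m l i = (if i < m then real (l (\<kappa> i)) / real N else 0)"

text \<open>Unless a ratio reaches the truncation level, rounding moves each coordinate by at most
  \<open>1 / N\<close>, and \<open>dist_fun_le_sum\<close> contributes the factor 2. The exceptional
  event has probability at most \<open>m / N\<close> by Markov's inequality and costs at most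
  \<open>2 * B\<close>.\<close>

lemma rep_error:
  fixes H :: "(nat \<Rightarrow> real) \<times> real \<Rightarrow> real"
  assumes P: "prob_space (E n j0)" and N: "N > 0" and \<kappa>: "\<And>i. i < m \<Longrightarrow> \<kappa> i < N \<and> js i = e (\<kappa> i)"
    and mk: "\<And>i K. i < m \<Longrightarrow> K > 0 \<Longrightarrow> measure (E n j0) {w\<in>space (E n j0). K \<le> lrn n (js i) w} \<le> 1 / K"
    and B: "\<And>z. \<bar>H z\<bar> \<le> B" and C: "C \<ge> 0" "\<And>z z'. \<bar>H z - H z'\<bar> \<le> C * dist z z'"
    and [measurable]: "y \<in> borel_measurable (E n j0)"
  shows "\<bar>(\<integral>w. H (Vn m js n w, y w) \<partial>E n j0) - (\<integral>w. H (rep N \<kappa> m (box e N n w), y w) \<partial>E n j0)\<bar>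
     \<le> (2 * C * real m + 2 * B * real m) / real N"
proof -
  interpret P: prob_space "E n j0" by fact
  have B0: "B \<ge> 0" using B[of undefined] by linarith
  have [measurable]: "H \<in> borel_measurable (borel \<Otimes>\<^sub>M borel)"
    unfolding borel_prod by (rule borel_measurable_continuous_onI[OF lipschitz_continuous[OF C(2)]])
  have rm[measurable]: "(\<lambda>w. rep N \<kappa> m (box e N n w)) \<in> borel_measurable (E n j0)"
  proof (rule measurable_coordinatewise_then_product)
    fix i show "(\<lambda>w. rep N \<kappa> m (box e N n w) i) \<in> borel_measurable (E n j0)"
      by (rule measurable_compose[OF measurable_box]) simp
  qed
  have i1: "integrable (E n j0) (\<lambda>w. H (Vn m js n w, y w))" "integrable (E n j0) (\<lambda>w. H (rep N \<kappa> m (box e N n w), y w))"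
    by (rule P.integrable_const_bound[of _ B]; use B in auto)+
  have ev[measurable]: "{w\<in>space (E n j0). real N \<le> lrn n (js i) w} \<in> P.events" for i by measurable
  define bad where "bad w = (\<Sum>i<m. indicator {w\<in>space (E n j0). real N \<le> lrn n (js i) w} w :: real)" for w
  have bad0: "bad w \<ge> 0" for w by (simp add: bad_def sum_nonneg)
  have i2: "integrable (E n j0) bad"
    unfolding bad_def by (intro Bochner_Integration.integrable_sum integrable_real_indicator) (auto simp: P.emeasure_eq_measure)
  have pw: "\<bar>H (Vn m js n w, y w) - H (rep N \<kappa> m (box e N n w), y w)\<bar> \<le> 2 * C * real m / real N + 2 * B * bad w"
    if w: "w \<in> space (E n j0)" for w
  proof (cases "\<exists>i<m. real N \<le> lrn n (js i) w")
    case True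
    then obtain i where i: "i < m" "real N \<le> lrn n (js i) w" by blast
    have "1 = (indicator {w\<in>space (E n j0). real N \<le> lrn n (js i) w} w :: real)" using w i by simp
    also have "\<dots> \<le> bad w" unfolding bad_def using i by (intro member_le_sum) auto
    finally have "2 * B * 1 \<le> 2 * B * bad w" using B0 by (intro mult_left_mono) auto
    moreover have "\<bar>H (Vn m js n w, y w) - H (rep N \<kappa> m (box e N n w), y w)\<bar> \<le> 2 * B"
      using B[of "(Vn m js n w, y w)"] B[of "(rep N \<kappa> m (box e N n w), y w)"] by linarith
    moreover have "0 \<le> 2 * C * real m / real N" using C(1) by simp
    ultimately show ?thesis by linarith
  next
    case False
    have close: "\<bar>Vn m js n w i - rep N \<kappa> m (box e N n w) i\<bar> \<le> 1 / real N" if "i < m" for i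
    proof -
      define t where "t = lrn n (js i) w"
      have t: "t \<ge> 0" "t < real N" using False that by (auto simp: t_def lrn_nonneg not_le)
      have "real N * t < real N * real N" using t N by (intro mult_strict_left_mono) auto
      then have "real N * t < real (N * N)" by simp
      then have "nat \<lfloor>real N * t\<rfloor> < N * N" using t by (simp add: nat_less_iff floor_less_iff)
      then have bx: "box e N n w (\<kappa> i) = nat \<lfloor>real N * t\<rfloor>" using \<kappa>[OF that] by (simp add: box_def t_def)
      have "\<bar>real N * t - real (nat \<lfloor>real N * t\<rfloor>)\<bar> \<le> 1"
      proof -
        have "real (nat \<lfloor>real N * t\<rfloor>) = of_int \<lfloor>real N * t\<rfloor>" using t by simp
        then show ?thesis by linarith
      qed
      moreover have "t - real (nat \<lfloor>real N * t\<rfloor>) / real N = (real N * t - real (nat \<lfloor>real N * t\<rfloor>)) / real N"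
        using N by (simp add: field_simps)
      ultimately have "\<bar>t - real (nat \<lfloor>real N * t\<rfloor>) / real N\<bar> \<le> 1 / real N"
        using N by (simp add: divide_right_mono)
      then show ?thesis using that by (simp add: Vn_def rep_def bx t_def)
    qed
    have "dist (Vn m js n w) (rep N \<kappa> m (box e N n w)) \<le> 2 * (\<Sum>i<m. \<bar>Vn m js n w i - rep N \<kappa> m (box e N n w) i\<bar>)"
      by (rule dist_fun_le_sum) (simp add: Vn_def rep_def)
    also have "\<dots> \<le> 2 * (\<Sum>i<m. 1 / real N)" using close by (intro mult_left_mono sum_mono) auto
    finally have "C * dist (Vn m js n w) (rep N \<kappa> m (box e N n w)) \<le> C * (2 * (real m / real N))"
      using C(1) by (intro mult_left_mono) auto
    moreover have "\<bar>H (Vn m js n w, y w) - H (rep N \<kappa> m (box e N n w), y w)\<bar> \<le> C * dist (Vn m js n w) (rep N \<kappa> m (box e N n w))"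
      using C(2)[of "(Vn m js n w, y w)" "(rep N \<kappa> m (box e N n w), y w)"] by (simp add: dist_Pair_Pair)
    moreover have "0 \<le> 2 * B * bad w" using B0 bad0 by simp
    ultimately show ?thesis by (simp add: mult_ac)
  qed
  have "\<bar>(\<integral>w. H (Vn m js n w, y w) \<partial>E n j0) - (\<integral>w. H (rep N \<kappa> m (box e N n w), y w) \<partial>E n j0)\<bar>
     = \<bar>\<integral>w. H (Vn m js n w, y w) - H (rep N \<kappa> m (box e N n w), y w) \<partial>E n j0\<bar>"
    using i1 by simp
  also have "\<dots> \<le> (\<integral>w. \<bar>H (Vn m js n w, y w) - H (rep N \<kappa> m (box e N n w), y w)\<bar> \<partial>E n j0)" by (rule integral_abs_bound)
  also have "\<dots> \<le> (\<integral>w. 2 * C * real m / real N + 2 * B * bad w \<partial>E n j0)"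
    by (rule integral_mono) (use i1 i2 pw in auto)
  also have "\<dots> = 2 * C * real m / real N + 2 * B * (\<integral>w. bad w \<partial>E n j0)"
    using i2 by (simp add: P.prob_space)
  also have "(\<integral>w. bad w \<partial>E n j0) = (\<Sum>i<m. P.prob {w\<in>space (E n j0). real N \<le> lrn n (js i) w})"
    unfolding bad_def by (subst Bochner_Integration.integral_sum) (auto intro!: integrable_real_indicator simp: P.emeasure_eq_measure)
  also have "2 * B * \<dots> \<le> 2 * B * (\<Sum>i<m. 1 / real N)"
    using mk N B0 by (intro mult_left_mono sum_mono) auto
  finally show ?thesis by (simp add: add_divide_distrib)
qed

text \<open>If there are at least \<open>thr N\<close> atoms, the greedy choice splits every box evenly among \<open>N\<close> classes, up to
  an error \<open>mesh N\<close> in probability. For the finitely many \<open>n\<close> with \<open>level n = 0\<close>, the classes are arbitrary.\<close>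

definition "mesh N = 1 / (real (N * N) * real (card (boxes N)))"
definition "thr N = card (boxes N) * N * (N * N * card (boxes N))\<^sup>2"
definition "level n = Max {N. N \<le> n \<and> thr N \<le> card (A n)}"

lemma level: "thr (level n) \<le> card (A n)"
proof -
  \<comment> \<open>The set contains 0, because \<open>thr 0 = 0\<close>, and it is finite by the
    bound \<open>N \<le> n\<close>.\<close>
  have "level n \<in> {N. N \<le> n \<and> thr N \<le> card (A n)}"
    unfolding level_def by (rule Max_in) (auto intro!: exI[of _ 0] simp: thr_def)
  then show ?thesis by simp
qed

lemma level_at_top: "filterlim level at_top sequentially"
  unfolding filterlim_at_top
proof
  fix K
  have "\<forall>\<^sub>F n in sequentially. thr K \<le> card (A n)" using cardA unfolding filterlim_at_top by blast
  with eventually_ge_at_top[of K] show "\<forall>\<^sub>F n in sequentially. K \<le> level n"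
    by eventually_elim (auto simp: level_def intro!: Max_ge)
qed

text \<open>\<open>mesh N\<close> is such that errors summed over the
  \<open>card (boxes N) * N\<close> cells amount to \<open>1 / N\<close>. For positive
  \<open>N\<close>, \<open>thr N\<close> is the least number of atoms that satisfies the size
  condition of \<open>equidistributed_function\<close>.\<close>

lemma mesh: "N > 0 \<Longrightarrow> mesh N > 0" "N > 0 \<Longrightarrow> thr N \<le> k \<Longrightarrow> real (card (boxes N) * N) \<le> real k * (mesh N)\<^sup>2"
proof -
  assume N: "N > 0"
  have c: "real (N * N) * real (card (boxes N)) > 0" using N boxes_nonempty[of N] by simp
  then show "mesh N > 0" by (simp add: mesh_def)
  assume "thr N \<le> k"
  then have "real (thr N) \<le> real k" by simp
  then have "real (card (boxes N) * N) * (real (N * N) * real (card (boxes N)))\<^sup>2 \<le> real k"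
    by (simp add: thr_def)
  then have "real (card (boxes N) * N) \<le> real k / (real (N * N) * real (card (boxes N)))\<^sup>2"
    using zero_less_power[OF c, of 2] by (simp only: pos_le_divide_eq)
  then show "real (card (boxes N) * N) \<le> real k * (mesh N)\<^sup>2"
    by (simp only: mesh_def power_divide power_one times_divide_eq_right mult_1_right)
qed

definition "good e n b \<longleftrightarrow> (\<forall>a. b a < level n) \<and> (\<forall>l\<in>boxes (level n). \<forall>m<level n.
   \<bar>measure (E n j0) {w\<in>space (E n j0). box e (level n) n w = l \<and> b (R n w) = m}
     - measure (E n j0) {w\<in>space (E n j0). box e (level n) n w = l} / real (level n)\<bar> \<le> mesh (level n))"

definition "classes e n = (SOME b. good e n b)"

lemma level_pos: "\<forall>\<^sub>F n in sequentially. level n > 0"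
  using level_at_top unfolding filterlim_at_top by (auto elim!: allE[of _ 1] eventually_mono)

lemma classes_good: "\<forall>\<^sub>F n in sequentially. good e n (classes e n)"
  using R E_prob[OF j0] level_pos
proof eventually_elim
  case (elim n)
  interpret P: prob_space "E n j0" using elim by simp
  have "\<exists>b. good e n b"
    unfolding good_def
  proof (rule P.equidistributed_function[of "A n"])
    show "real (card (boxes (level n)) * level n) \<le> real (card (A n)) * (mesh (level n))\<^sup>2"
      by (rule mesh(2)[OF _ level]) (use elim in simp)
  qed (use elim finite_boxes measurable_box mesh(1) in auto)
  then show ?case unfolding classes_def by (rule someI_ex)
qed

end

section \<open>Convergence along a dense sequence and then for all parameters\<close>

lemma (in prob_space) abs_expectation_le:
  fixes f :: "'a \<Rightarrow> real"
  assumes [measurable]: "f \<in> borel_measurable M" and B: "\<And>w. \<bar>f w\<bar> \<le> B"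
  shows "\<bar>\<integral>w. f w \<partial>M\<bar> \<le> B"
proof -
  have "\<bar>\<integral>w. f w \<partial>M\<bar> \<le> (\<integral>w. \<bar>f w\<bar> \<partial>M)" by (rule integral_abs_bound)
  also have "\<dots> \<le> (\<integral>w. B \<partial>M)"
    by (intro integral_mono integrable_const_bound[of _ B]) (use B order.trans[OF abs_ge_zero B[of undefined]] in auto)
  finally show ?thesis by (simp add: prob_space)
qed

context rank_realization begin

text \<open>The ratios are replaced by their boxes, the class is then decoupled from the box, and
  afterwards the boxes are replaced by the ratios again. What remains is an average of
  \<open>\<phi>n\<close> over the quantiles, whose limit \<open>samples\<close> provides.\<close>

lemma realization_dense:
  fixes H :: "(nat \<Rightarrow> real) \<times> real \<Rightarrow> real" and x :: "nat \<Rightarrow> nat \<Rightarrow> real"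
  assumes x: "samples x \<mu>"
    and e: "\<And>k. e k \<in> eventual_params \<Lambda>" and js: "\<And>i. i < m \<Longrightarrow> js i \<in> range e"
    and B: "\<And>z. \<bar>H z\<bar> \<le> B" and C: "C \<ge> 0" "\<And>z z'. \<bar>H z - H z'\<bar> \<le> C * dist z z'"
  shows "(\<lambda>n. \<integral>w. H (Vn m js n w, x (level n) (classes e n (R n w))) \<partial>E n j0) \<longlonglongrightarrow> (\<integral>y. (\<integral>w. H (V m js w, y) \<partial>D j0) \<partial>\<mu>)"
proof -
  have B0: "B \<ge> 0" using B[of undefined] by linarith
  have contH: "continuous_on UNIV H" by (rule lipschitz_continuous[OF C(2)])
  have Hm[measurable]: "H \<in> borel_measurable (borel \<Otimes>\<^sub>M borel)"
    unfolding borel_prod by (rule borel_measurable_continuous_onI[OF contH])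
  interpret D: prob_space "D j0" by (rule D_prob)
  define \<kappa> where "\<kappa> i = (SOME k. js i = e k)" for i
  have \<kappa>: "js i = e (\<kappa> i)" if "i < m" for i
    unfolding \<kappa>_def by (rule someI_ex) (use js[OF that] in auto)
  \<comment> \<open>The default 0 keeps the bounds valid for every \<open>n\<close>, as
    \<open>samples\<close> demands, although the measures are probability measures only
    eventually.\<close>
  define \<phi>n where "\<phi>n n y = (if prob_space (E n j0) then \<integral>w. H (Vn m js n w, y) \<partial>E n j0 else 0)" for n y
  define \<phi> where "\<phi> y = (\<integral>w. H (V m js w, y) \<partial>D j0)" for y
  have dP: "dist (v, y) (v, y') = \<bar>y - y'\<bar>" for v :: "nat \<Rightarrow> real" and y y' :: real
    by (simp add: dist_Pair_Pair dist_real_def)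
  have HL: "\<bar>H (v, y) - H (v, y')\<bar> \<le> C * \<bar>y - y'\<bar>" for v y y'
    using C(2)[of "(v, y)" "(v, y')"] by (simp only: dP)
  have lim2: "(\<lambda>n. (\<Sum>k<level n. \<phi>n n (x (level n) k)) / real (level n)) \<longlonglongrightarrow> (\<integral>y. \<phi> y \<partial>\<mu>)"
  proof (rule samplesD[OF x, where B=B and L=C])
    show "\<bar>\<phi>n n y\<bar> \<le> B" for n y
    proof (cases "prob_space (E n j0)")
      case True
      then interpret P: prob_space "E n j0" .
      have "\<bar>\<integral>w. H (Vn m js n w, y) \<partial>E n j0\<bar> \<le> B"
        by (rule P.abs_expectation_le) (use B in auto)
      then show ?thesis using True by (simp add: \<phi>n_def)
    qed (simp add: \<phi>n_def B0)
    show "\<bar>\<phi>n n y - \<phi>n n y'\<bar> \<le> C * \<bar>y - y'\<bar>" for n y y'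
    proof (cases "prob_space (E n j0)")
      case True
      then interpret P: prob_space "E n j0" .
      have i: "integrable (E n j0) (\<lambda>w. H (Vn m js n w, y))" for y
        by (rule P.integrable_const_bound[of _ B]) (use B in auto)
      have "\<bar>\<phi>n n y - \<phi>n n y'\<bar> = \<bar>\<integral>w. H (Vn m js n w, y) - H (Vn m js n w, y') \<partial>E n j0\<bar>"
        using True i by (simp add: \<phi>n_def)
      also have "\<dots> \<le> C * \<bar>y - y'\<bar>"
        by (rule P.abs_expectation_le) (use HL in auto)
      finally show ?thesis .
    qed (simp add: \<phi>n_def C)
    show "(\<lambda>n. \<phi>n n y) \<longlonglongrightarrow> \<phi> y" for y
    proof -
      have "(\<lambda>n. \<integral>w. (\<lambda>v. H (v, y)) (Vn m js n w) \<partial>E n j0) \<longlonglongrightarrow> (\<integral>w. (\<lambda>v. H (v, y)) (V m js w) \<partial>D j0)"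
      proof (rule Vn_conv)
        show "js i \<in> eventual_params \<Lambda>" if "i < m" for i using \<kappa>[OF that] e by simp
        show "continuous_on UNIV (\<lambda>v. H (v, y))"
          by (intro continuous_on_compose2[OF contH] continuous_intros) auto
      qed (rule B)
      moreover have "\<forall>\<^sub>F n in sequentially. (\<integral>w. H (Vn m js n w, y) \<partial>E n j0) = \<phi>n n y"
        using E_prob[OF j0] by eventually_elim (simp add: \<phi>n_def)
      ultimately show ?thesis unfolding \<phi>_def by (auto intro: Lim_transform_eventually)
    qed
    have "continuous_on UNIV \<phi>"
    proof (rule lipschitz_continuous)
      fix y y'
      have i: "integrable (D j0) (\<lambda>w. H (V m js w, y))" for y
        by (rule D.integrable_const_bound[of _ B]) (use B in auto)
      have "\<bar>\<phi> y - \<phi> y'\<bar> = \<bar>\<integral>w. H (V m js w, y) - H (V m js w, y') \<partial>D j0\<bar>"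
        using i by (simp add: \<phi>_def)
      also have "\<dots> \<le> C * \<bar>y - y'\<bar>"
        by (rule D.abs_expectation_le) (use HL in auto)
      finally show "\<bar>\<phi> y - \<phi> y'\<bar> \<le> C * dist y y'" by (simp add: dist_real_def)
    qed
    then show "\<phi> \<in> borel_measurable borel" by (rule borel_measurable_continuous_onI)
  qed (rule level_at_top)
  \<comment> \<open>The box error is incurred twice, for the statistic and for the average over
    classes, and the decoupling adds \<open>B\<close>; all are divided by the level.\<close>
  define err where "err = 2 * (2 * C * real m + 2 * B * real m) + B"
  have mk: "\<forall>\<^sub>F n in sequentially. \<forall>i\<in>{..<m}. \<forall>K>0. measure (E n j0) {w\<in>space (E n j0). K \<le> lrn n (js i) w} \<le> 1 / K"
    by (rule eventually_ball_finite) (use lrn_markov e \<kappa> in auto)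
  \<comment> \<open>Eventually all parameters in question are among those that the boxes
    record.\<close>
  have big: "\<forall>\<^sub>F n in sequentially. \<forall>i\<in>{..<m}. \<kappa> i < level n"
  proof (rule eventually_ball_finite)
    show "\<forall>i\<in>{..<m}. \<forall>\<^sub>F n in sequentially. \<kappa> i < level n"
    proof
      fix i
      have "\<forall>\<^sub>F n in sequentially. Suc (\<kappa> i) \<le> level n"
        using level_at_top unfolding filterlim_at_top by blast
      then show "\<forall>\<^sub>F n in sequentially. \<kappa> i < level n" by eventually_elim simp
    qed
  qed simp
  have "\<forall>\<^sub>F n in sequentially. norm ((\<integral>w. H (Vn m js n w, x (level n) (classes e n (R n w))) \<partial>E n j0)
      - (\<Sum>k<level n. \<phi>n n (x (level n) k)) / real (level n)) \<le> err * (1 / real (level n))"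
    using mk big E_prob[OF j0] R level_pos classes_good[of e]
  proof eventually_elim
    case (elim n)
    interpret P: prob_space "E n j0" using elim by simp
    define N where "N = level n"
    define b where "b w = classes e n (R n w)" for w
    have N: "N > 0" using elim by (simp add: N_def)
    have RM: "R n \<in> measurable (E n j0) (count_space (A n))" using elim by simp
    have bM: "b \<in> measurable (E n j0) (count_space {..<N})"
      unfolding b_def using elim by (intro measurable_compose[OF RM]) (auto simp: good_def N_def)
    have ym[measurable]: "(\<lambda>w. x N (b w)) \<in> borel_measurable (E n j0)"
      by (rule measurable_compose[OF bM]) simp
    have k: "\<kappa> i < N \<and> js i = e (\<kappa> i)" if "i < m" for i using elim \<kappa> that by (simp add: N_def)
    have mk': "measure (E n j0) {w\<in>space (E n j0). K \<le> lrn n (js i) w} \<le> 1 / K" if "i < m" "K > 0" for i K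
      using elim that by auto
    let ?r = "(2 * C * real m + 2 * B * real m) / real N"
    have re: "\<bar>(\<integral>w. H (Vn m js n w, y w) \<partial>E n j0) - (\<integral>w. H (rep N \<kappa> m (box e N n w), y w) \<partial>E n j0)\<bar> \<le> ?r"
      if "y \<in> borel_measurable (E n j0)" for y
      by (rule rep_error[where js=js and \<kappa>=\<kappa> and m=m and N=N and H=H and e=e]) (use P.prob_space_axioms N k mk' B C that in auto)
    have e1: "\<bar>(\<integral>w. H (Vn m js n w, x N (b w)) \<partial>E n j0) - (\<integral>w. H (rep N \<kappa> m (box e N n w), x N (b w)) \<partial>E n j0)\<bar> \<le> ?r"
      by (rule re[OF ym])
    have e3: "\<bar>\<phi>n n (x N k) - (\<integral>w. H (rep N \<kappa> m (box e N n w), x N k) \<partial>E n j0)\<bar> \<le> ?r" for k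
      unfolding \<phi>n_def using re[of "\<lambda>_. x N k"] P.prob_space_axioms by simp
    have e2: "\<bar>(\<integral>w. H (rep N \<kappa> m (box e N n w), x N (b w)) \<partial>E n j0)
        - (\<Sum>k<N. (\<integral>w. H (rep N \<kappa> m (box e N n w), x N k) \<partial>E n j0)) / real N\<bar> \<le> B * mesh N * real (card (boxes N) * N)"
      by (rule P.equidistributed_expectation[OF finite_boxes measurable_box bM, where F="\<lambda>l k. H (rep N \<kappa> m l, x N k)"])
        (use elim B mesh(1)[OF N] in \<open>auto simp: good_def b_def N_def\<close>)
    have me: "mesh N * real (card (boxes N) * N) = 1 / real N"
      using N boxes_nonempty[of N] by (simp add: mesh_def)
    have "\<bar>(\<Sum>k<N. \<phi>n n (x N k)) / real N - (\<Sum>k<N. (\<integral>w. H (rep N \<kappa> m (box e N n w), x N k) \<partial>E n j0)) / real N\<bar>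
       = \<bar>\<Sum>k<N. \<phi>n n (x N k) - (\<integral>w. H (rep N \<kappa> m (box e N n w), x N k) \<partial>E n j0)\<bar> / real N"
      by (simp add: sum_subtractf diff_divide_distrib[symmetric])
    also have "\<dots> \<le> (\<Sum>k<N. ?r) / real N"
      by (intro divide_right_mono order.trans[OF sum_abs] sum_mono e3) auto
    also have "\<dots> = ?r" using N by simp
    finally have e4: "\<bar>(\<Sum>k<N. \<phi>n n (x N k)) / real N - (\<Sum>k<N. (\<integral>w. H (rep N \<kappa> m (box e N n w), x N k) \<partial>E n j0)) / real N\<bar> \<le> ?r" .
    have "B * mesh N * real (card (boxes N) * N) = B / real N"
      unfolding mult.assoc[of B] me by simp
    then have "\<bar>(\<integral>w. H (Vn m js n w, x N (b w)) \<partial>E n j0) - (\<Sum>k<N. \<phi>n n (x N k)) / real N\<bar> \<le> ?r + B / real N + ?r"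
      using e1 e2 e4 by linarith
    also have "\<dots> = err * (1 / real N)" by (simp add: err_def add_divide_distrib)
    finally show ?case by (simp add: N_def b_def)
  qed
  moreover have "(\<lambda>n. err * (1 / real (level n))) \<longlonglongrightarrow> 0"
    using tendsto_mult_left[OF filterlim_compose[OF lim_1_over_n level_at_top], of err] by simp
  ultimately have "(\<lambda>n. (\<integral>w. H (Vn m js n w, x (level n) (classes e n (R n w))) \<partial>E n j0)
      - (\<Sum>k<level n. \<phi>n n (x (level n) k)) / real (level n)) \<longlonglongrightarrow> 0"
    by (rule Lim_null_comparison)
  from tendsto_add[OF this lim2] show ?thesis by (simp add: \<phi>_def)
qed

text \<open>Boundedness takes care of coordinates that differ by at least 1, the Lipschitz property
  of the rest. The truncated difference is a bounded continuous function of the ratios, so its mean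
  converges under LAN.\<close>

lemma lipschitz_coordinates:
  fixes H :: "(nat \<Rightarrow> real) \<times> real \<Rightarrow> real"
  assumes B: "\<And>z. \<bar>H z\<bar> \<le> B" and C: "C \<ge> 0" "\<And>z z'. \<bar>H z - H z'\<bar> \<le> C * dist z z'"
    and eq: "\<And>i. i \<ge> m \<Longrightarrow> v i = v' i"
  shows "\<bar>H (v, y) - H (v', y)\<bar> \<le> (2 * B + 2 * C) * (\<Sum>i<m. min 1 \<bar>v i - v' i\<bar>)"
proof -
  define S where "S = (\<Sum>i<m. min 1 \<bar>v i - v' i\<bar>)"
  have B0: "B \<ge> 0" using B[of undefined] by linarith
  have S0: "S \<ge> 0" by (simp add: S_def sum_nonneg)
  have "\<bar>H (v, y) - H (v', y)\<bar> \<le> (2 * B + 2 * C) * S"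
  proof (cases "\<exists>i<m. 1 \<le> \<bar>v i - v' i\<bar>")
    case True
    then obtain i where i: "i < m" "1 \<le> \<bar>v i - v' i\<bar>" by blast
    have "1 = min 1 \<bar>v i - v' i\<bar>" using i by simp
    also have "\<dots> \<le> S" unfolding S_def using i by (intro member_le_sum) auto
    finally have "2 * B * 1 \<le> 2 * B * S" using B0 by (intro mult_left_mono) auto
    moreover have "\<bar>H (v, y) - H (v', y)\<bar> \<le> 2 * B" using B[of "(v, y)"] B[of "(v', y)"] by linarith
    moreover have "0 \<le> 2 * C * S" using C(1) S0 by simp
    ultimately show ?thesis by (simp add: distrib_right)
  next
    case False
    then have "S = (\<Sum>i<m. \<bar>v i - v' i\<bar>)" unfolding S_def by (intro sum.cong refl) (auto simp: min_def)
    then have "dist v v' \<le> 2 * S" using dist_fun_le_sum[of m v v'] eq by simp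
    then have "C * dist v v' \<le> C * (2 * S)" using C(1) by (intro mult_left_mono)
    moreover have "\<bar>H (v, y) - H (v', y)\<bar> \<le> C * dist v v'"
      using C(2)[of "(v, y)" "(v', y)"] by (simp add: dist_Pair_Pair)
    moreover have "0 \<le> 2 * B * S" using B0 S0 by simp
    ultimately show ?thesis by (simp add: distrib_right)
  qed
  then show ?thesis by (simp add: S_def)
qed

text \<open>Every parameter is replaced by a member of the dense sequence. Closeness in the limit
  experiment passes to all large \<open>n\<close> by \<open>lrn_dist_conv\<close>, and the classes
  are not affected by the replacement.\<close>

lemma realization_lim:
  fixes H :: "(nat \<Rightarrow> real) \<times> real \<Rightarrow> real" and x :: "nat \<Rightarrow> nat \<Rightarrow> real"
  assumes x: "samples x \<mu>"
    and mu: "prob_space \<mu>" "sets \<mu> = sets borel"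
    and e: "\<And>k. e k \<in> eventual_params \<Lambda>"
    and dense: "\<And>j \<epsilon>. j \<in> eventual_params \<Lambda> \<Longrightarrow> \<epsilon> > 0 \<Longrightarrow> \<exists>k. (\<integral>w. min 1 \<bar>lr j w - lr (e k) w\<bar> \<partial>D j0) < \<epsilon>"
    and js: "\<And>i. i < m \<Longrightarrow> js i \<in> eventual_params \<Lambda>"
    and B: "\<And>z. \<bar>H z\<bar> \<le> B" and C: "C \<ge> 0" "\<And>z z'. \<bar>H z - H z'\<bar> \<le> C * dist z z'"
  shows "(\<lambda>n. \<integral>w. H (Vn m js n w, x (level n) (classes e n (R n w))) \<partial>E n j0) \<longlonglongrightarrow> (\<integral>y. (\<integral>w. H (V m js w, y) \<partial>D j0) \<partial>\<mu>)"
proof (rule LIMSEQ_I)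
  fix r :: real assume r: "0 < r"
  have B0: "B \<ge> 0" using B[of undefined] by linarith
  have Hm[measurable]: "H \<in> borel_measurable (borel \<Otimes>\<^sub>M borel)"
    unfolding borel_prod by (rule borel_measurable_continuous_onI[OF lipschitz_continuous[OF C(2)]])
  interpret D: prob_space "D j0" by (rule D_prob)
  interpret mu: prob_space \<mu> by (rule mu)
  have [measurable_cong]: "sets \<mu> = sets borel" by (rule mu)
  define c where "c = 2 * B + 2 * C"
  have c: "c \<ge> 0" using B0 C by (simp add: c_def)
  \<comment> \<open>Makes each replacement cost at most \<open>r / 4\<close>. The replacement at
    stage \<open>n\<close>, the convergence for the new parameters and the replacement in the limit
    then add up to less than \<open>r\<close>; the added ones exclude division by zero.\<close>
  define \<epsilon> where "\<epsilon> = r / (4 * (real m + 1) * (c + 1))"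
  have \<epsilon>: "\<epsilon> > 0" using r c by (simp add: \<epsilon>_def)
  have cm: "c * (real m * \<epsilon>) < r / 4"
  proof -
    have "c * (real m * \<epsilon>) = (c * real m) * \<epsilon>" by simp
    also have "\<dots> < ((c + 1) * (real m + 1)) * \<epsilon>"
      using \<epsilon> c by (intro mult_strict_right_mono) (auto simp: algebra_simps intro: add_nonneg_pos)
    also have "\<dots> = r / 4"
    proof -
      have "a * b * (r / (4 * b * a)) = r / 4" if "a > 0" "b > 0" for a b :: real
        using that by (simp add: field_simps)
      from this[of "c + 1" "real m + 1"] show ?thesis using c by (simp add: \<epsilon>_def)
    qed
    finally show ?thesis .
  qed
  define \<kappa> where "\<kappa> i = (SOME k. (\<integral>w. min 1 \<bar>lr (js i) w - lr (e k) w\<bar> \<partial>D j0) < \<epsilon>)" for i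
  define js' where "js' i = e (\<kappa> i)" for i
  have near: "(\<integral>w. min 1 \<bar>lr (js i) w - lr (js' i) w\<bar> \<partial>D j0) < \<epsilon>" if "i < m" for i
    unfolding js'_def \<kappa>_def by (rule someI_ex) (rule dense[OF js[OF that] \<epsilon>])
  have nearn: "\<forall>\<^sub>F n in sequentially. \<forall>i\<in>{..<m}. (\<integral>w. min 1 \<bar>lrn n (js i) w - lrn n (js' i) w\<bar> \<partial>E n j0) < \<epsilon>"
  proof (rule eventually_ball_finite)
    show "\<forall>i\<in>{..<m}. \<forall>\<^sub>F n in sequentially. (\<integral>w. min 1 \<bar>lrn n (js i) w - lrn n (js' i) w\<bar> \<partial>E n j0) < \<epsilon>"
      using near js e by (auto intro!: order_tendstoD(2)[OF lrn_dist_conv] simp: js'_def)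
  qed simp
  have lim': "(\<lambda>n. \<integral>w. H (Vn m js' n w, x (level n) (classes e n (R n w))) \<partial>E n j0) \<longlonglongrightarrow> (\<integral>y. (\<integral>w. H (V m js' w, y) \<partial>D j0) \<partial>\<mu>)"
    by (rule realization_dense[OF x e _ B C]) (auto simp: js'_def)
  then have close': "\<forall>\<^sub>F n in sequentially. dist (\<integral>w. H (Vn m js' n w, x (level n) (classes e n (R n w))) \<partial>E n j0) (\<integral>y. (\<integral>w. H (V m js' w, y) \<partial>D j0) \<partial>\<mu>) < r / 4"
    using r by (intro tendstoD) auto
  have D1: "\<bar>(\<integral>w. H (V m js w, y) \<partial>D j0) - (\<integral>w. H (V m js' w, y) \<partial>D j0)\<bar> \<le> r / 4" for y
  proof -
    have i: "integrable (D j0) (\<lambda>w. H (V m js w, y))" for js by (rule D.integrable_const_bound[of _ B]) (use B in auto)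
    have i2: "integrable (D j0) (\<lambda>w. min 1 \<bar>lr j w - lr j' w\<bar>)" for j j' by (rule D.integrable_const_bound[of _ 1]) auto
    have "\<bar>(\<integral>w. H (V m js w, y) \<partial>D j0) - (\<integral>w. H (V m js' w, y) \<partial>D j0)\<bar> = \<bar>\<integral>w. H (V m js w, y) - H (V m js' w, y) \<partial>D j0\<bar>"
      using i by simp
    also have "\<dots> \<le> (\<integral>w. \<bar>H (V m js w, y) - H (V m js' w, y)\<bar> \<partial>D j0)" by (rule integral_abs_bound)
    also have "\<dots> \<le> (\<integral>w. c * (\<Sum>i<m. min 1 \<bar>lr (js i) w - lr (js' i) w\<bar>) \<partial>D j0)"
    proof (rule integral_mono)
      fix w
      have "\<bar>H (V m js w, y) - H (V m js' w, y)\<bar> \<le> c * (\<Sum>i<m. min 1 \<bar>V m js w i - V m js' w i\<bar>)"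
        unfolding c_def by (rule lipschitz_coordinates[OF B C]) (simp add: V_def)
      then show "\<bar>H (V m js w, y) - H (V m js' w, y)\<bar> \<le> c * (\<Sum>i<m. min 1 \<bar>lr (js i) w - lr (js' i) w\<bar>)"
        by (simp add: V_def)
    qed (use i i2 in auto)
    also have "\<dots> = c * (\<Sum>i<m. \<integral>w. min 1 \<bar>lr (js i) w - lr (js' i) w\<bar> \<partial>D j0)"
      using i2 by simp
    also have "\<dots> \<le> c * (\<Sum>i<m. \<epsilon>)" using near c by (intro mult_left_mono sum_mono) (auto intro: less_imp_le)
    also have "\<dots> \<le> r / 4" using cm by simp
    finally show ?thesis .
  qed
  have contV: "(\<lambda>y. \<integral>w. H (V m js w, y) \<partial>D j0) \<in> borel_measurable borel" for js by measurable
  have iV: "integrable \<mu> (\<lambda>y. \<integral>w. H (V m js w, y) \<partial>D j0)" for js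
    by (rule mu.integrable_const_bound[of _ B]) (use B contV in \<open>auto intro!: D.abs_expectation_le\<close>)
  have "\<bar>(\<integral>y. (\<integral>w. H (V m js w, y) \<partial>D j0) \<partial>\<mu>) - (\<integral>y. (\<integral>w. H (V m js' w, y) \<partial>D j0) \<partial>\<mu>)\<bar>
     = \<bar>\<integral>y. (\<integral>w. H (V m js w, y) \<partial>D j0) - (\<integral>w. H (V m js' w, y) \<partial>D j0) \<partial>\<mu>\<bar>"
    using iV by simp
  also have "\<dots> \<le> r / 4" by (rule mu.abs_expectation_le) (use D1 in auto)
  finally have limd: "\<bar>(\<integral>y. (\<integral>w. H (V m js w, y) \<partial>D j0) \<partial>\<mu>) - (\<integral>y. (\<integral>w. H (V m js' w, y) \<partial>D j0) \<partial>\<mu>)\<bar> \<le> r / 4" .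
  have "\<forall>\<^sub>F n in sequentially. norm ((\<integral>w. H (Vn m js n w, x (level n) (classes e n (R n w))) \<partial>E n j0) - (\<integral>y. (\<integral>w. H (V m js w, y) \<partial>D j0) \<partial>\<mu>)) < r"
    using nearn close' E_prob[OF j0] R
  proof eventually_elim
    case (elim n)
    interpret P: prob_space "E n j0" using elim by simp
    have RM: "R n \<in> measurable (E n j0) (count_space (A n))" using elim by simp
    define y where "y w = x (level n) (classes e n (R n w))" for w
    have [measurable]: "y \<in> borel_measurable (E n j0)"
      unfolding y_def by (rule measurable_compose[OF RM]) simp
    have i: "integrable (E n j0) (\<lambda>w. H (Vn m js n w, y w))" for js by (rule P.integrable_const_bound[of _ B]) (use B in auto)
    have i2: "integrable (E n j0) (\<lambda>w. min 1 \<bar>lrn n j w - lrn n j' w\<bar>)" for j j' by (rule P.integrable_const_bound[of _ 1]) auto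
    have "\<bar>(\<integral>w. H (Vn m js n w, y w) \<partial>E n j0) - (\<integral>w. H (Vn m js' n w, y w) \<partial>E n j0)\<bar> = \<bar>\<integral>w. H (Vn m js n w, y w) - H (Vn m js' n w, y w) \<partial>E n j0\<bar>"
      using i by simp
    also have "\<dots> \<le> (\<integral>w. \<bar>H (Vn m js n w, y w) - H (Vn m js' n w, y w)\<bar> \<partial>E n j0)" by (rule integral_abs_bound)
    also have "\<dots> \<le> (\<integral>w. c * (\<Sum>i<m. min 1 \<bar>lrn n (js i) w - lrn n (js' i) w\<bar>) \<partial>E n j0)"
    proof (rule integral_mono)
      fix w
      have "\<bar>H (Vn m js n w, y w) - H (Vn m js' n w, y w)\<bar> \<le> c * (\<Sum>i<m. min 1 \<bar>Vn m js n w i - Vn m js' n w i\<bar>)"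
        unfolding c_def by (rule lipschitz_coordinates[OF B C]) (simp add: Vn_def)
      then show "\<bar>H (Vn m js n w, y w) - H (Vn m js' n w, y w)\<bar> \<le> c * (\<Sum>i<m. min 1 \<bar>lrn n (js i) w - lrn n (js' i) w\<bar>)"
        by (simp add: Vn_def)
    qed (use i i2 in auto)
    also have "\<dots> = c * (\<Sum>i<m. \<integral>w. min 1 \<bar>lrn n (js i) w - lrn n (js' i) w\<bar> \<partial>E n j0)"
      using i2 by simp
    also have "\<dots> \<le> c * (\<Sum>i<m. \<epsilon>)" using elim(1) c by (intro mult_left_mono sum_mono) (auto intro: less_imp_le)
    also have "\<dots> \<le> r / 4" using cm by simp
    finally have "\<bar>(\<integral>w. H (Vn m js n w, y w) \<partial>E n j0) - (\<integral>w. H (Vn m js' n w, y w) \<partial>E n j0)\<bar> \<le> r / 4" .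
    moreover have "\<bar>(\<integral>w. H (Vn m js' n w, y w) \<partial>E n j0) - (\<integral>y. (\<integral>w. H (V m js' w, y) \<partial>D j0) \<partial>\<mu>)\<bar> < r / 4"
      using elim(2) by (simp add: dist_real_def y_def)
    ultimately have "\<bar>(\<integral>w. H (Vn m js n w, y w) \<partial>E n j0) - (\<integral>y. (\<integral>w. H (V m js w, y) \<partial>D j0) \<partial>\<mu>)\<bar> < r"
      using limd r by linarith
    then show ?case by (simp add: y_def)
  qed
  then show "\<exists>no. \<forall>n\<ge>no. norm ((\<integral>w. H (Vn m js n w, x (level n) (classes e n (R n w))) \<partial>E n j0) - (\<integral>y. (\<integral>w. H (V m js w, y) \<partial>D j0) \<partial>\<mu>)) < r"
    by (simp add: eventually_sequentially)
qed

text \<open>The constructed \<open>\<phi>\<close> depends on the enumeration of \<open>J\<close> and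
  on the law of \<open>\<xi>\<close>, but not on a finite set of parameters, so that the same
  sequence is tested against all of them.\<close>

theorem realization:
  assumes J: "countable J" "J \<subseteq> eventual_params \<Lambda>"
    and dense: "\<And>j \<epsilon>. j \<in> eventual_params \<Lambda> \<Longrightarrow> \<epsilon> > 0 \<Longrightarrow> \<exists>j'\<in>J. (\<integral>w. min 1 \<bar>lr j w - lr j' w\<bar> \<partial>D j0) < \<epsilon>"
    and \<xi>[measurable]: "\<xi> \<in> borel_measurable (D j0)"
    and indep: "\<And>m js H c. (\<And>i. i < m \<Longrightarrow> js i \<in> eventual_params \<Lambda>) \<Longrightarrow>
        H \<in> borel_measurable (borel :: ((nat \<Rightarrow> real) \<times> real) measure) \<Longrightarrow> (\<And>z. \<bar>H z\<bar> \<le> (c::real)) \<Longrightarrow>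
        (\<integral>w. H (V m js w, \<xi> w) \<partial>D j0) = (\<integral>y. (\<integral>w. H (V m js w, y) \<partial>D j0) \<partial>(distr (D j0) borel \<xi>))"
  shows "\<exists>\<phi>. rv_weakly_converges E \<Lambda> j0 D (\<lambda>n w. \<phi> n (R n w)) \<xi>"
proof -
  interpret D: prob_space "D j0" by (rule D_prob)
  define \<mu> where "\<mu> = distr (D j0) borel \<xi>"
  have rd: "real_distribution \<mu>" unfolding \<mu>_def by (rule D.real_distribution_distr) simp
  interpret mu: real_distribution \<mu> by (rule rd)
  define e where "e = from_nat_into J"
  have "J \<noteq> {}" using dense[OF j0, of 1] by auto
  then have eJ: "range e = J" unfolding e_def using J(1) by (rule range_from_nat_into)
  then have e: "e k \<in> eventual_params \<Lambda>" for k using J(2) by auto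
  have de: "\<exists>k. (\<integral>w. min 1 \<bar>lr j w - lr (e k) w\<bar> \<partial>D j0) < \<epsilon>" if "j \<in> eventual_params \<Lambda>" "\<epsilon> > 0" for j \<epsilon>
    using dense[OF that] unfolding eJ[symmetric] by auto
  obtain x :: "nat \<Rightarrow> nat \<Rightarrow> real" where x: "samples x \<mu>"
    using quantile_points[OF rd] by blast
  define \<phi> where "\<phi> n a = x (level n) (classes e n a)" for n a
  have main: "conv_in_dist (\<lambda>n. E n j0) (\<lambda>n w. (Vn m js n w, \<phi> n (R n w))) (D j0) (\<lambda>w. (V m js w, \<xi> w))"
    if js: "\<And>i. i < m \<Longrightarrow> js i \<in> eventual_params \<Lambda>" for m js
  proof (rule conv_in_dist_lipschitz[OF _ D_prob])
    show "\<forall>\<^sub>F n in sequentially. prob_space (E n j0) \<and> (\<lambda>w. (Vn m js n w, \<phi> n (R n w))) \<in> borel_measurable (E n j0)"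
      using E_prob[OF j0] R
    proof eventually_elim
      case (elim n)
      have RM: "R n \<in> measurable (E n j0) (count_space (A n))" using elim by simp
      have [measurable]: "(\<lambda>w. \<phi> n (R n w)) \<in> borel_measurable (E n j0)"
        by (rule measurable_compose[OF RM]) simp
      show ?case using elim by (simp add: borel_prod[symmetric])
    qed
    show "(\<lambda>w. (V m js w, \<xi> w)) \<in> borel_measurable (D j0)" by (simp add: borel_prod[symmetric])
    fix H :: "(nat \<Rightarrow> real) \<times> real \<Rightarrow> real" and B C
    assume B: "\<And>z. \<bar>H z\<bar> \<le> B" and C: "\<And>z z'. \<bar>H z - H z'\<bar> \<le> C * dist z z'"
    have C': "\<bar>H z - H z'\<bar> \<le> \<bar>C\<bar> * dist z z'" for z z'
      by (rule order.trans[OF C mult_right_mono[OF abs_ge_self]]) simp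
    have "(\<lambda>n. \<integral>w. H (Vn m js n w, x (level n) (classes e n (R n w))) \<partial>E n j0) \<longlonglongrightarrow> (\<integral>y. (\<integral>w. H (V m js w, y) \<partial>D j0) \<partial>\<mu>)"
      by (rule realization_lim[where B=B and C="\<bar>C\<bar>"]) (use x mu.prob_space_axioms mu.events_eq_borel e de js B C' in auto)
    moreover have "(\<integral>w. H (V m js w, \<xi> w) \<partial>D j0) = (\<integral>y. (\<integral>w. H (V m js w, y) \<partial>D j0) \<partial>\<mu>)"
      unfolding \<mu>_def
      by (rule indep[where c=B]) (use js borel_measurable_continuous_onI[OF lipschitz_continuous[OF C]] B in auto)
    ultimately show "(\<lambda>n. \<integral>w. H (Vn m js n w, \<phi> n (R n w)) \<partial>E n j0) \<longlonglongrightarrow> (\<integral>w. H (V m js w, \<xi> w) \<partial>D j0)"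
      by (simp add: \<phi>_def)
  qed
  have "rv_weakly_converges E \<Lambda> j0 D (\<lambda>n w. \<phi> n (R n w)) \<xi>"
    unfolding rv_weakly_converges_def
  proof (intro allI impI)
    fix S assume S: "finite S \<and> S \<subseteq> eventual_params \<Lambda>"
    then obtain js where js: "bij_betw js {..<card S} S" using ex_bij_betw_nat_finite[of S] by (auto simp: atLeast0LessThan)
    define m where "m = card S"
    have jsS: "js i \<in> eventual_params \<Lambda>" if "i < m" for i using js S that by (auto simp: bij_betw_def m_def)
    define ix where "ix j = the_inv_into {..<m} js j" for j
    have ix: "ix j < m" "js (ix j) = j" if "j \<in> S" for j
      using js that the_inv_into_into[of js "{..<m}" j "{..<m}"] f_the_inv_into_f[of js "{..<m}" j]
      by (auto simp: bij_betw_def m_def ix_def)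
    \<comment> \<open>Leads from vectors indexed by positions back to ratios indexed by parameters.
      It is continuous, so test functions can be pulled back.\<close>
    define emb where "emb v = (\<lambda>j. if j \<in> S then v (ix j) else 0)" for v :: "nat \<Rightarrow> real"
    have cemb: "continuous_on UNIV emb"
      unfolding emb_def
    proof (rule continuous_on_coordinatewise_then_product)
      fix j show "continuous_on UNIV (\<lambda>v::nat \<Rightarrow> real. if j \<in> S then v (ix j) else 0)"
        by (cases "j \<in> S") auto
    qed
    have en: "emb (Vn m js n w) = lik_ratios (E n) j0 S w" for n w
      using ix by (auto simp: emb_def Vn_def lik_ratios_def lrn_def fun_eq_iff)
    have el: "emb (V m js w) = lik_ratios D j0 S w" for w
      using ix by (auto simp: emb_def V_def lik_ratios_def lr_def fun_eq_iff)
    show "conv_in_dist (\<lambda>n. E n j0) (\<lambda>n x. (lik_ratios (E n) j0 S x, \<phi> n (R n x))) (D j0) (\<lambda>y. (lik_ratios D j0 S y, \<xi> y))"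
      unfolding conv_in_dist_def
    proof (intro allI impI)
      fix h :: "('j \<Rightarrow> real) \<times> real \<Rightarrow> real" assume h: "continuous_on UNIV h \<and> bounded (range h)"
      have "continuous_on UNIV (\<lambda>z. (emb (fst z), snd z :: real))"
        by (intro continuous_intros continuous_on_compose2[OF cemb]) auto
      then have "continuous_on UNIV (\<lambda>z. h (emb (fst z), snd z))"
        using h by (intro continuous_on_compose2[of UNIV h UNIV "\<lambda>z. (emb (fst z), snd z)"]) auto
      moreover have "bounded (range (\<lambda>z. h (emb (fst z), snd z)))"
        using h by (auto simp: bounded_iff)
      ultimately have "(\<lambda>n. \<integral>w. (\<lambda>z. h (emb (fst z), snd z)) (Vn m js n w, \<phi> n (R n w)) \<partial>E n j0) \<longlonglongrightarrow> (\<integral>w. (\<lambda>z. h (emb (fst z), snd z)) (V m js w, \<xi> w) \<partial>D j0)"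
        by (intro main[OF jsS, unfolded conv_in_dist_def, rule_format] conjI)
      then show "(\<lambda>n. \<integral>x. h (lik_ratios (E n) j0 S x, \<phi> n (R n x)) \<partial>E n j0) \<longlonglongrightarrow> (\<integral>y. h (lik_ratios D j0 S y, \<xi> y) \<partial>D j0)"
        by (simp add: en el)
    qed
  qed
  then show ?thesis by blast
qed

end

section \<open>Optimal assignments\<close>

lemma null_sets_hyperplane:
  fixes a :: "'a::euclidean_space"
  assumes "a \<noteq> 0"
  shows "{x. a \<bullet> x = b} \<in> null_sets lborel"
proof -
  have "{x. a \<bullet> x = b} \<in> sets borel" by (intro borel_closed closed_hyperplane)
  moreover have "{x. a \<bullet> x = b} \<in> null_sets lebesgue"
    using negligible_hyperplane[of a b] assms by (simp add: negligible_iff_null_sets)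
  ultimately show ?thesis by (simp add: null_sets_def)
qed

definition cost :: "nat \<Rightarrow> (nat \<Rightarrow> 'a::real_inner) \<Rightarrow> (nat \<Rightarrow> 'a) \<Rightarrow> (nat \<Rightarrow> nat) \<Rightarrow> real" where
  "cost n g z \<pi> = (\<Sum>j<n. (norm (z j - g (\<pi> j)))\<^sup>2)"

definition assignment :: "nat \<Rightarrow> (nat \<Rightarrow> 'a::real_inner) \<Rightarrow> (nat \<Rightarrow> 'a) \<Rightarrow> nat \<Rightarrow> nat" where
  "assignment n g z = arg_min (cost n g z) (\<lambda>\<pi>. \<pi> permutes {..<n})"

abbreviation perms :: "nat \<Rightarrow> (nat \<Rightarrow> nat) set" where
  "perms n \<equiv> {\<pi>. \<pi> permutes {..<n}}"

text \<open>Stronger than uniqueness of the minimizer. This form is evidently compatible with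
  permutations of the points, and its failure is a finite union of ties between two
  assignments.\<close>

definition untied :: "nat \<Rightarrow> (nat \<Rightarrow> 'a::real_inner) \<Rightarrow> (nat \<Rightarrow> 'a) \<Rightarrow> bool" where
  "untied n g z \<longleftrightarrow> inj_on (cost n g z) (perms n)"

lemma center_outward_assignment: "center_outward n g z i = g (assignment n g z i)"
  unfolding center_outward_def assignment_def cost_def ..

lemma finite_perms: "finite (perms n)"
  by (rule finite_permutations) simp

lemma card_perms: "card (perms n) = fact n"
  by (rule card_permutations) auto

lemma id_perms: "id \<in> perms n"
  by (simp add: permutes_id)

lemma assignment_is_arg_min: "is_arg_min (cost n g z) (\<lambda>\<pi>. \<pi> permutes {..<n}) (assignment n g z)"
proof -
  have "\<exists>\<pi>. is_arg_min (cost n g z) (\<lambda>\<pi>. \<pi> \<in> perms n) \<pi>"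
    by (rule ex_is_arg_min_if_finite[OF finite_perms]) (use id_perms in blast)
  then show ?thesis unfolding assignment_def arg_min_def mem_Collect_eq by (rule someI_ex)
qed

lemma assignment_perms: "assignment n g z permutes {..<n}"
  using assignment_is_arg_min[of n g z] by (simp add: is_arg_min_def)

lemma assignment_le: "\<pi> permutes {..<n} \<Longrightarrow> cost n g z (assignment n g z) \<le> cost n g z \<pi>"
  using assignment_is_arg_min[of n g z] by (auto simp: is_arg_min_def not_less)

lemma assignment_eqI:
  assumes "untied n g z" "\<pi> permutes {..<n}" "\<And>\<pi>'. \<pi>' permutes {..<n} \<Longrightarrow> cost n g z \<pi> \<le> cost n g z \<pi>'"
  shows "assignment n g z = \<pi>"
proof (rule inj_onD[OF assms(1)[unfolded untied_def]])
  show "cost n g z (assignment n g z) = cost n g z \<pi>"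
    using assignment_le[OF assms(2), of g z] assms(3)[OF assignment_perms[of n g z]] by simp
qed (use assms assignment_perms in auto)

lemma cost_permute:
  assumes "\<sigma> permutes {..<n}"
  shows "cost n g (z \<circ> \<sigma>) (\<pi> \<circ> \<sigma>) = cost n g z \<pi>"
  unfolding cost_def using sum.permute[OF assms, of "\<lambda>j. (norm (z j - g (\<pi> j)))\<^sup>2"] by (simp add: comp_def)

lemma cost_permute':
  assumes "\<sigma> permutes {..<n}"
  shows "cost n g (z \<circ> \<sigma>) \<pi> = cost n g z (\<pi> \<circ> inv \<sigma>)"
  using cost_permute[OF assms, of g z "\<pi> \<circ> inv \<sigma>"] permutes_inv_o(2)[OF assms] by (simp add: comp_assoc)

lemma untied_permute:
  assumes s: "\<sigma> permutes {..<n}" and u: "untied n g z"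
  shows "untied n g (z \<circ> \<sigma>)"
  unfolding untied_def
proof (rule inj_onI)
  fix \<pi> \<pi>' assume p: "\<pi> \<in> perms n" "\<pi>' \<in> perms n" "cost n g (z \<circ> \<sigma>) \<pi> = cost n g (z \<circ> \<sigma>) \<pi>'"
  have "\<pi> \<circ> inv \<sigma> \<in> perms n" "\<pi>' \<circ> inv \<sigma> \<in> perms n"
    using p s by (auto intro: permutes_compose permutes_inv)
  then have "\<pi> \<circ> inv \<sigma> = \<pi>' \<circ> inv \<sigma>"
    using u p(3) unfolding untied_def cost_permute'[OF s] by (auto dest: inj_onD)
  then have "(\<pi> \<circ> inv \<sigma>) \<circ> \<sigma> = (\<pi>' \<circ> inv \<sigma>) \<circ> \<sigma>" by simp
  then show "\<pi> = \<pi>'" using permutes_inv_o(2)[OF s] by (simp add: comp_assoc)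
qed

text \<open>Relabelling the points relabels the costs. Without ties the minimizer is unique, so the
  choice inside \<open>arg_min\<close> does not interfere.\<close>

lemma assignment_permute:
  assumes s: "\<sigma> permutes {..<n}" and u: "untied n g z"
  shows "assignment n g (z \<circ> \<sigma>) = assignment n g z \<circ> \<sigma>"
proof (rule assignment_eqI[OF untied_permute[OF s u]])
  show "assignment n g z \<circ> \<sigma> permutes {..<n}" by (rule permutes_compose[OF s assignment_perms])
  fix \<pi>' assume p: "\<pi>' permutes {..<n}"
  have "cost n g z (assignment n g z) \<le> cost n g z (\<pi>' \<circ> inv \<sigma>)"
    by (rule assignment_le) (rule permutes_compose[OF permutes_inv[OF s] p])
  then show "cost n g (z \<circ> \<sigma>) (assignment n g z \<circ> \<sigma>) \<le> cost n g (z \<circ> \<sigma>) \<pi>'"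
    by (subst cost_permute[OF s], subst cost_permute'[OF s])
qed

lemma measurable_cost [measurable]: "\<pi> permutes {..<n} \<Longrightarrow> (\<lambda>z. cost n g z \<pi>) \<in> borel_measurable (PiM {..<n} (\<lambda>_. borel :: (real ^ 'd) measure))"
  unfolding cost_def by measurable

text \<open>\<open>arg_min\<close> sees \<open>z\<close> only through the set \<open>Mn z\<close> of
  minimizers, on which it is a fixed choice. This set takes finitely many values, each on an event
  described by finitely many inequalities.\<close>

lemma measurable_assignment:
  "assignment n g \<in> measurable (obs_space n) (count_space (perms n))"
proof -
  define Mn where "Mn z = {\<pi>\<in>perms n. \<forall>\<pi>'\<in>perms n. cost n g z \<pi> \<le> cost n g z \<pi>'}" for z
  define ch where "ch A = (SOME \<pi> :: nat \<Rightarrow> nat. \<pi> \<in> A)" for A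
  have Mn: "Mn z \<in> Pow (perms n)" for z by (auto simp: Mn_def)
  have eq: "assignment n g z = ch (Mn z)" for z
  proof -
    have "is_arg_min (cost n g z) (\<lambda>\<pi>. \<pi> permutes {..<n}) = (\<lambda>\<pi>. \<pi> \<in> Mn z)"
      by (auto simp: is_arg_min_def Mn_def fun_eq_iff not_less)
    then show ?thesis by (simp add: assignment_def arg_min_def ch_def)
  qed
  have "Mn \<in> measurable (obs_space n) (count_space (Pow (perms n)))"
    unfolding measurable_count_space_eq2[OF finite_Pow_iff[THEN iffD2, OF finite_perms]]
  proof (intro conjI ballI)
    show "Mn \<in> space (obs_space n) \<rightarrow> Pow (perms n)" using Mn by auto
    fix A assume A: "A \<in> Pow (perms n)"
    have "Mn -` {A} \<inter> space (obs_space n) = {z \<in> space (obs_space n). \<forall>\<pi>\<in>perms n. (\<forall>\<pi>'\<in>perms n. cost n g z \<pi> \<le> cost n g z \<pi>') \<longleftrightarrow> \<pi> \<in> A}"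
    proof -
      have "Mn z = A \<longleftrightarrow> (\<forall>\<pi>\<in>perms n. (\<forall>\<pi>'\<in>perms n. cost n g z \<pi> \<le> cost n g z \<pi>') \<longleftrightarrow> \<pi> \<in> A)" for z
        unfolding Mn_def using A by blast
      then show ?thesis by auto
    qed
    also have "\<dots> \<in> sets (obs_space n)"
    proof (intro sets.sets_Collect_finite_All finite_perms)
      fix \<pi> assume "\<pi> \<in> perms n"
      have "{z \<in> space (obs_space n). \<forall>\<pi>'\<in>perms n. cost n g z \<pi> \<le> cost n g z \<pi>'} \<in> sets (obs_space n)"
        using \<open>\<pi> \<in> perms n\<close> by (intro sets.sets_Collect_finite_All finite_perms borel_measurable_le measurable_cost) auto
      from this sets.sets_Collect_neg[OF this]
      show "{z \<in> space (obs_space n). (\<forall>\<pi>'\<in>perms n. cost n g z \<pi> \<le> cost n g z \<pi>') \<longleftrightarrow> \<pi> \<in> A} \<in> sets (obs_space n)"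
        by (cases "\<pi> \<in> A") (simp_all only: simp_thms)
    qed
    finally show "Mn -` {A} \<inter> space (obs_space n) \<in> sets (obs_space n)" .
  qed
  then have "(\<lambda>z. ch (Mn z)) \<in> measurable (obs_space n) (count_space UNIV)" by (rule measurable_compose) simp
  moreover have "(\<lambda>z. ch (Mn z)) = assignment n g" using eq by (simp add: fun_eq_iff)
  ultimately have "assignment n g \<in> measurable (obs_space n) (count_space UNIV)" by simp
  then show ?thesis
    by (rule measurable_count_space_extend[rotated 2]) (use assignment_perms in auto)
qed

text \<open>Two different assignments differ at some point \<open>i\<close>. With the other points
  fixed, the squared norm of this point cancels, and a tie is a linear equation for it; the equation
  is nontrivial because the grid points are distinct, so a null hyperplane results.\<close>

lemma untied_AE:
  fixes g :: "nat \<Rightarrow> real ^ 'd" and \<nu> :: "(real ^ 'd) measure"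
  assumes g: "inj_on g {..<n}" and \<nu>: "prob_space \<nu>" "sets \<nu> = sets borel"
    and ac: "\<And>A. A \<in> null_sets lborel \<Longrightarrow> emeasure \<nu> A = 0"
  shows "AE z in PiM {..<n} (\<lambda>_. \<nu>). untied n g z"
proof -
  interpret \<nu>: prob_space \<nu> by fact
  interpret product_prob_space "\<lambda>_::nat. \<nu>" UNIV ..
  have sO[measurable_cong]: "sets (PiM {..<n} (\<lambda>_. \<nu>)) = sets (obs_space n)" by (rule sets_PiM_cong) (auto simp: \<nu>)
  have [measurable_cong]: "sets \<nu> = sets borel" by (rule \<nu>)
  have tie: "AE z in PiM {..<n} (\<lambda>_. \<nu>). cost n g z \<pi> \<noteq> cost n g z \<pi>'"
    if p: "\<pi> permutes {..<n}" "\<pi>' permutes {..<n}" "\<pi> \<noteq> \<pi>'" for \<pi> \<pi>'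
  proof -
    obtain i where i: "\<pi> i \<noteq> \<pi>' i" using p(3) by auto
    then have il: "i < n" using p(1,2) by (metis lessThan_iff permutes_def)
    have "\<pi> i < n" "\<pi>' i < n" using p il permutes_in_image by fastforce+
    then have w: "g (\<pi> i) - g (\<pi>' i) \<noteq> 0" using g i by (auto dest: inj_onD)
    define I where "I = {..<n} - {i}"
    have I: "finite I" "i \<notin> I" "insert i I = {..<n}" using il by (auto simp: I_def)
    define B where "B = {z \<in> space (obs_space n). cost n g z \<pi> = cost n g z \<pi>'}"
    have Bm: "B \<in> sets (obs_space n)" unfolding B_def using p by measurable
    have inner0: "(\<integral>\<^sup>+y. indicator B (x(i := y)) \<partial>\<nu>) = 0" for x
    proof -
      define c where "c = ((\<Sum>j\<in>I. (norm (x j - g (\<pi> j)))\<^sup>2 - (norm (x j - g (\<pi>' j)))\<^sup>2) + (norm (g (\<pi> i)))\<^sup>2 - (norm (g (\<pi>' i)))\<^sup>2) / 2"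
      have sub: "x(i := y) \<in> B \<Longrightarrow> y \<in> {y. (g (\<pi> i) - g (\<pi>' i)) \<bullet> y = c}" for y
      proof -
        assume "x(i := y) \<in> B"
        then have "cost n g (x(i := y)) \<pi> - cost n g (x(i := y)) \<pi>' = 0" by (simp add: B_def)
        moreover have "cost n g (x(i := y)) \<rho> = (norm (y - g (\<rho> i)))\<^sup>2 + (\<Sum>j\<in>I. (norm (x j - g (\<rho> j)))\<^sup>2)" for \<rho>
        proof -
          have "cost n g (x(i := y)) \<rho> = (\<Sum>j\<in>insert i I. (norm ((x(i := y)) j - g (\<rho> j)))\<^sup>2)" by (simp add: cost_def I)
          also have "\<dots> = (norm (y - g (\<rho> i)))\<^sup>2 + (\<Sum>j\<in>I. (norm ((x(i := y)) j - g (\<rho> j)))\<^sup>2)"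
            by (simp only: sum.insert[OF I(1,2)] fun_upd_same)
          also have "(\<Sum>j\<in>I. (norm ((x(i := y)) j - g (\<rho> j)))\<^sup>2) = (\<Sum>j\<in>I. (norm (x j - g (\<rho> j)))\<^sup>2)"
            by (intro sum.cong refl) (use I in auto)
          finally show ?thesis .
        qed
        ultimately have "(norm (y - g (\<pi> i)))\<^sup>2 - (norm (y - g (\<pi>' i)))\<^sup>2 + (\<Sum>j\<in>I. (norm (x j - g (\<pi> j)))\<^sup>2 - (norm (x j - g (\<pi>' j)))\<^sup>2) = 0"
          by (simp add: sum_subtractf)
        then show "y \<in> {y. (g (\<pi> i) - g (\<pi>' i)) \<bullet> y = c}"
          by (simp add: c_def power2_norm_eq_inner inner_diff_left inner_diff_right inner_commute)
      qed
      have "(\<integral>\<^sup>+y. indicator B (x(i := y)) \<partial>\<nu>) \<le> (\<integral>\<^sup>+y. indicator {y. (g (\<pi> i) - g (\<pi>' i)) \<bullet> y = c} y \<partial>\<nu>)"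
        using sub by (intro nn_integral_mono) (auto simp: indicator_def)
      also have "\<dots> = emeasure \<nu> {y. (g (\<pi> i) - g (\<pi>' i)) \<bullet> y = c}"
        by (rule nn_integral_indicator) (simp add: \<nu> borel_closed closed_hyperplane)
      also have "\<dots> = 0" by (rule ac[OF null_sets_hyperplane[OF w]])
      finally show ?thesis by simp
    qed
    have "emeasure (PiM (insert i I) (\<lambda>_. \<nu>)) B = (\<integral>\<^sup>+z. indicator B z \<partial>PiM (insert i I) (\<lambda>_. \<nu>))"
      using Bm sO I by simp
    also have "\<dots> = (\<integral>\<^sup>+x. (\<integral>\<^sup>+y. indicator B (x(i := y)) \<partial>\<nu>) \<partial>PiM I (\<lambda>_. \<nu>))"
      using Bm sO I by (intro product_nn_integral_insert) auto
    also have "\<dots> = 0" by (simp add: inner0)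
    finally have "B \<in> null_sets (PiM {..<n} (\<lambda>_. \<nu>))" using Bm sO I by (simp add: null_sets_def)
    then show ?thesis
      by (rule AE_I') (use sets_eq_imp_space_eq[OF sO] in \<open>auto simp: B_def\<close>)
  qed
  have "AE z in PiM {..<n} (\<lambda>_. \<nu>). \<forall>\<pi>\<in>perms n. \<forall>\<pi>'\<in>perms n. \<pi> \<noteq> \<pi>' \<longrightarrow> cost n g z \<pi> \<noteq> cost n g z \<pi>'"
    using tie by (intro AE_finite_allI finite_perms) (auto intro: AE_I2)
  then show ?thesis
    by eventually_elim (auto simp: untied_def inj_on_def)
qed

lemma distr_PiM_permute:
  assumes \<nu>: "prob_space \<nu>" and s: "\<sigma> permutes {..<n}"
  shows "distr (PiM {..<n} (\<lambda>_. \<nu>)) (PiM {..<n} (\<lambda>_. \<nu>)) (\<lambda>z. z \<circ> \<sigma>) = PiM {..<n} (\<lambda>_. \<nu>)"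
proof -
  have "distr (PiM {..<n} (\<lambda>_. \<nu>)) (PiM {..<n} (\<lambda>i. \<nu>)) (\<lambda>z. \<lambda>i\<in>{..<n}. z (\<sigma> i)) = PiM {..<n} (\<lambda>i. \<nu>)"
    by (rule distr_PiM_reindex[where M="\<lambda>_. \<nu>" and K="{..<n}" and f=\<sigma> and I="{..<n}"])
      (use \<nu> s permutes_inj_on[OF s] permutes_in_image[OF s] in auto)
  moreover have "z \<circ> \<sigma> = (\<lambda>i\<in>{..<n}. z (\<sigma> i))" if "z \<in> space (PiM {..<n} (\<lambda>_. \<nu>))" for z
  proof
    fix i show "(z \<circ> \<sigma>) i = (\<lambda>i\<in>{..<n}. z (\<sigma> i)) i"
    proof (cases "i < n")
      case False
      then have "\<sigma> i = i" using s by (simp add: permutes_def)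
      then show ?thesis using that False by (auto simp: space_PiM PiE_def extensional_def)
    qed simp
  qed
  then have "distr (PiM {..<n} (\<lambda>_. \<nu>)) (PiM {..<n} (\<lambda>_. \<nu>)) (\<lambda>z. z \<circ> \<sigma>)
     = distr (PiM {..<n} (\<lambda>_. \<nu>)) (PiM {..<n} (\<lambda>_. \<nu>)) (\<lambda>z. \<lambda>i\<in>{..<n}. z (\<sigma> i))"
    by (intro distr_cong refl)
  ultimately show ?thesis by simp
qed

lemma measurable_permute:
  assumes s: "\<sigma> permutes {..<n}"
  shows "(\<lambda>z. z \<circ> \<sigma>) \<in> measurable (PiM {..<n} (\<lambda>_. M)) (PiM {..<n} (\<lambda>_. M))"
proof (rule measurable_PiM_single')
  fix i assume i: "i \<in> {..<n}"
  then have "\<sigma> i \<in> {..<n}" using permutes_in_image[OF s] by auto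
  then show "(\<lambda>z. (z \<circ> \<sigma>) i) \<in> measurable (PiM {..<n} (\<lambda>_. M)) M"
    by (simp add: measurable_component_singleton)
next
  show "(\<lambda>z. z \<circ> \<sigma>) \<in> space (PiM {..<n} (\<lambda>_. M)) \<rightarrow> {..<n} \<rightarrow>\<^sub>E space M"
  proof
    fix z assume z: "z \<in> space (PiM {..<n} (\<lambda>_. M))"
    show "z \<circ> \<sigma> \<in> {..<n} \<rightarrow>\<^sub>E space M"
    proof (rule PiE_I)
      fix i assume "i \<in> {..<n}"
      then have "\<sigma> i \<in> {..<n}" using permutes_in_image[OF s] by auto
      then show "(z \<circ> \<sigma>) i \<in> space M" using z by (auto simp: space_PiM)
    next
      fix i assume "i \<notin> {..<n}"
      then have "\<sigma> i = i" using s by (simp add: permutes_def)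
      then show "(z \<circ> \<sigma>) i = undefined" using z \<open>i \<notin> {..<n}\<close> by (auto simp: space_PiM PiE_def extensional_def)
    qed
  qed
qed

section \<open>Experiments of independent residuals\<close>

text \<open>The nuisance experiment at a fixed sample size. The map \<open>Z\<close> need not be
  injective; in its place, \<open>uniq\<close> says that the law of the residuals determines the
  measure. The tilts that completeness needs are supplied by \<open>rich\<close>.\<close>

locale residual_experiment =
  fixes n :: nat and g :: "nat \<Rightarrow> real ^ 'd" and M0 :: "'a measure" and Z :: "'a \<Rightarrow> nat \<Rightarrow> real ^ 'd"
    and \<P> :: "'a measure set" and P0 :: "'a measure"
  assumes P0: "P0 \<in> \<P>"
    and prob: "P \<in> \<P> \<Longrightarrow> prob_space P" and sets: "P \<in> \<P> \<Longrightarrow> sets P = sets M0"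
    and Z[measurable]: "Z \<in> measurable M0 (obs_space n)"
    and g: "inj_on g {..<n}"
    and law: "P \<in> \<P> \<Longrightarrow> \<exists>\<nu>. prob_space \<nu> \<and> sets \<nu> = sets borel \<and> (\<forall>A\<in>null_sets lborel. emeasure \<nu> A = 0) \<and>
       distr P (obs_space n) Z = PiM {..<n} (\<lambda>_. \<nu>)"
    and uniq: "P \<in> \<P> \<Longrightarrow> prob_space Q \<Longrightarrow> sets Q = sets P \<Longrightarrow> distr Q (obs_space n) Z = distr P (obs_space n) Z \<Longrightarrow> Q = P"
    and equiv: "P \<in> \<P> \<Longrightarrow> Q \<in> \<P> \<Longrightarrow> null_sets P \<subseteq> null_sets Q"
    and rich: "(\<And>j. A j \<in> sets borel) \<Longrightarrow> T \<subseteq> {..<n} \<Longrightarrow>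
       \<exists>c>0. density P0 (\<lambda>x. ennreal ((\<Prod>i<n. 1 + (\<Sum>j\<in>T. indicator (A j) (Z x i))) / c)) \<in> \<P>"
begin

definition "pre W = Z -` W \<inter> space M0"

lemma space_P: "P \<in> \<P> \<Longrightarrow> space P = space M0"
  using sets by (rule sets_eq_imp_space_eq)

lemma measurable_P: "P \<in> \<P> \<Longrightarrow> measurable P N = measurable M0 N"
  by (rule measurable_cong_sets[OF sets refl])

lemma pre_sets [intro]: "W \<in> sets (obs_space n) \<Longrightarrow> pre W \<in> sets M0"
  unfolding pre_def by (rule measurable_sets[OF Z])

lemma Z_space: "x \<in> space M0 \<Longrightarrow> Z x \<in> space (obs_space n)"
  by (rule measurable_space[OF Z])

lemma AE_transfer:
  assumes "P \<in> \<P>" "Q \<in> \<P>" "AE x in P. \<phi> x"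
  shows "AE x in Q. \<phi> x"
proof -
  obtain N where "N \<in> null_sets P" "{x\<in>space P. \<not> \<phi> x} \<subseteq> N" using assms(3) by (auto simp: eventually_ae_filter)
  then show ?thesis using equiv[OF assms(1,2)] space_P[OF assms(1)] space_P[OF assms(2)] by (intro AE_I'[of N]) auto
qed

lemma prob_permute:
  assumes P: "P \<in> \<P>" and s: "\<sigma> permutes {..<n}" and A: "A \<in> sets (obs_space n)"
  shows "measure P {x\<in>space M0. Z x \<circ> \<sigma> \<in> A} = measure P (pre A)"
proof -
  obtain \<nu> where \<nu>: "prob_space \<nu>" "sets \<nu> = sets borel" and d: "distr P (obs_space n) Z = PiM {..<n} (\<lambda>_. \<nu>)"
    using law[OF P] by blast
  have sO: "sets (PiM {..<n} (\<lambda>_. \<nu>)) = sets (obs_space n)" by (rule sets_PiM_cong) (auto simp: \<nu>)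
  have Zm: "Z \<in> measurable P (obs_space n)" unfolding measurable_P[OF P] by (rule Z)
  have sm: "(\<lambda>z. z \<circ> \<sigma>) \<in> measurable (obs_space n) (obs_space n)" by (rule measurable_permute[OF s])
  have "measure P {x\<in>space M0. Z x \<circ> \<sigma> \<in> A} = measure (distr P (obs_space n) Z) ((\<lambda>z. z \<circ> \<sigma>) -` A \<inter> space (obs_space n))"
    using measurable_sets[OF sm A] Zm
    by (subst measure_distr) (auto simp: space_P[OF P] intro!: arg_cong[where f="measure P"] Z_space)
  also have "\<dots> = measure (distr (PiM {..<n} (\<lambda>_. \<nu>)) (PiM {..<n} (\<lambda>_. \<nu>)) (\<lambda>z. z \<circ> \<sigma>)) A"
    unfolding d using A sO sets_eq_imp_space_eq[OF sO] by (subst measure_distr) (auto intro: measurable_permute[OF s])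
  also have "\<dots> = measure (distr P (obs_space n) Z) A" unfolding distr_PiM_permute[OF \<nu>(1) s] d ..
  also have "\<dots> = measure P (pre A)"
    using Zm A by (subst measure_distr) (auto simp: pre_def space_P[OF P])
  finally show ?thesis .
qed

text \<open>\<open>P\<close> is the only measure with its law of residuals, so that \<open>(1 + f - E [f | Z]) P = P\<close>.\<close>

lemma function_of_residuals:
  assumes f[measurable]: "f \<in> borel_measurable M0" and f01: "\<And>x. 0 \<le> f x" "\<And>x. f x \<le> (1::real)"
  shows "\<exists>\<psi>\<in>borel_measurable (obs_space n). (\<forall>z. 0 \<le> \<psi> z \<and> \<psi> z \<le> 1) \<and> (\<forall>P\<in>\<P>. AE x in P. f x = \<psi> (Z x))"
proof -
  interpret P: prob_space P0 by (rule prob[OF P0])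
  have [measurable_cong]: "sets P0 = sets M0" by (rule sets[OF P0])
  have [simp]: "space P0 = space M0" by (rule space_P[OF P0])
  define lam where "lam = distr P0 (obs_space n) Z"
  \<comment> \<open>The law of the residuals under the measure with density \<open>f\<close>. Its
    density \<open>\<phi>\<close> with respect to \<open>lam\<close> is the conditional expectation
    of \<open>f\<close> given \<open>Z\<close>, as a function of the residuals.\<close>
  define lamf where "lamf = distr (density P0 (\<lambda>x. ennreal (f x))) (obs_space n) Z"
  have [measurable_cong]: "sets lam = sets (obs_space n)" by (simp add: lam_def)
  interpret lam: prob_space lam unfolding lam_def by (rule P.prob_space_distr) simp
  have el: "emeasure lam W = emeasure P0 (pre W)" if "W \<in> sets (obs_space n)" for W
    using that by (simp add: lam_def emeasure_distr pre_def)
  have elf: "emeasure lamf W = (\<integral>\<^sup>+x. ennreal (f x) * indicator (pre W) x \<partial>P0)" if "W \<in> sets (obs_space n)" for W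
    using that pre_sets[OF that] by (simp add: lamf_def emeasure_distr pre_def emeasure_density)
  have "absolutely_continuous lam lamf"
    unfolding absolutely_continuous_def
  proof
    fix W assume W: "W \<in> null_sets lam"
    then have Ws: "W \<in> sets (obs_space n)" by (simp add: null_sets_def lam_def)
    have "emeasure P0 (pre W) = 0" using W el[OF Ws] by (simp add: null_sets_def)
    then have "AE x in P0. x \<notin> pre W" using pre_sets[OF Ws] by (intro AE_not_in) auto
    then have "(\<integral>\<^sup>+x. ennreal (f x) * indicator (pre W) x \<partial>P0) = (\<integral>\<^sup>+x. 0 \<partial>P0)" by (intro nn_integral_cong_AE) auto
    then show "W \<in> null_sets lamf" using elf[OF Ws] Ws by (simp add: null_sets_def lamf_def)
  qed
  then obtain \<phi> where \<phi>[measurable]: "\<phi> \<in> borel_measurable lam" and dphi: "density lam \<phi> = lamf"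
    using lam.Radon_Nikodym[of lamf] by (auto simp: lamf_def lam_def)
  have \<phi>m[measurable]: "\<phi> \<in> borel_measurable (obs_space n)" using \<phi> by (simp add: lam_def)
  have key: "(\<integral>\<^sup>+z. \<phi> z * indicator W z \<partial>lam) = (\<integral>\<^sup>+x. ennreal (f x) * indicator (pre W) x \<partial>P0)"
    if W[measurable]: "W \<in> sets (obs_space n)" for W
    unfolding elf[OF W, symmetric] dphi[symmetric] by (subst emeasure_density) auto
  have le1: "AE z in lam. \<phi> z \<le> 1"
  proof -
    define W where "W = {z\<in>space (obs_space n). 1 < \<phi> z}"
    have W[measurable]: "W \<in> sets (obs_space n)" unfolding W_def by measurable
    have "(\<integral>\<^sup>+z. \<phi> z * indicator W z \<partial>lam) \<le> (\<integral>\<^sup>+x. indicator (pre W) x \<partial>P0)"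
      unfolding key[OF W] using f01 by (intro nn_integral_mono) (auto simp: indicator_def)
    also have "\<dots> = emeasure lam W" using pre_sets[OF W] by (simp add: el)
    finally have le: "(\<integral>\<^sup>+z. \<phi> z * indicator W z \<partial>lam) \<le> emeasure lam W" .
    have "(\<integral>\<^sup>+z. (\<phi> z - 1) * indicator W z \<partial>lam) = (\<integral>\<^sup>+z. \<phi> z * indicator W z - indicator W z \<partial>lam)"
      by (intro nn_integral_cong) (auto simp: indicator_def)
    also have "\<dots> = (\<integral>\<^sup>+z. \<phi> z * indicator W z \<partial>lam) - (\<integral>\<^sup>+z. indicator W z \<partial>lam)"
    proof (rule nn_integral_diff)
      show "(\<integral>\<^sup>+z. indicator W z \<partial>lam) \<noteq> \<infinity>" by (simp add: lam.emeasure_eq_measure)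
      show "AE z in lam. indicator W z \<le> \<phi> z * indicator W z"
        by (intro AE_I2) (auto simp: W_def indicator_def intro: less_imp_le)
    qed measurable
    also have "\<dots> = 0" using le le_less_trans[OF le, of top] by (simp add: diff_eq_0_iff_ennreal lam.emeasure_eq_measure)
    finally have "AE z in lam. (\<phi> z - 1) * indicator W z = 0" by (subst (asm) nn_integral_0_iff_AE) auto
    then show ?thesis
    proof (rule AE_mp, intro AE_I2 impI)
      fix z assume z: "z \<in> space lam" "(\<phi> z - 1) * indicator W z = 0"
      show "\<phi> z \<le> 1"
      proof (rule ccontr)
        assume n: "\<not> \<phi> z \<le> 1"
        then have "z \<in> W" using z by (auto simp: W_def lam_def)
        then have "\<phi> z - 1 = 0" using z by simp
        then show False using n by (simp add: diff_eq_0_iff_ennreal)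
      qed
    qed
  qed
  \<comment> \<open>The truncation changes \<open>\<phi>\<close> on a null set only and yields
    bounds that hold everywhere.\<close>
  define \<psi> where "\<psi> z = enn2real (min 1 (\<phi> z))" for z
  have \<psi>01: "0 \<le> \<psi> z" "\<psi> z \<le> 1" for z
    unfolding \<psi>_def by (auto intro!: enn2real_leI)
  have [measurable]: "\<psi> \<in> borel_measurable (obs_space n)" unfolding \<psi>_def by measurable
  have e\<psi>: "ennreal (\<psi> z) = min 1 (\<phi> z)" for z
    unfolding \<psi>_def by (intro ennreal_enn2real) (simp add: min_less_iff_disj)
  have "AE x in P0. \<phi> (Z x) \<le> 1"
    using le1 unfolding lam_def by (subst (asm) AE_distr_iff) (auto simp: \<phi>m)
  then have eq: "AE x in P0. ennreal (\<psi> (Z x)) = \<phi> (Z x)"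
    by eventually_elim (simp add: e\<psi> min_def)
  have i: "integrable P0 (\<lambda>x. f x * indicator (pre W) x)" "integrable P0 (\<lambda>x. \<psi> (Z x) * indicator (pre W) x)"
    if "W \<in> sets (obs_space n)" for W
    using pre_sets[OF that] f01 \<psi>01 by (auto intro!: P.integrable_const_bound[of _ 1] simp: indicator_def)
  have same: "(\<integral>x. f x * indicator (pre W) x \<partial>P0) = (\<integral>x. \<psi> (Z x) * indicator (pre W) x \<partial>P0)"
    if W[measurable]: "W \<in> sets (obs_space n)" for W
  proof -
    have [measurable]: "pre W \<in> sets M0" by (rule pre_sets[OF W])
    have "ennreal (\<integral>x. \<psi> (Z x) * indicator (pre W) x \<partial>P0) = (\<integral>\<^sup>+x. ennreal (\<psi> (Z x) * indicator (pre W) x) \<partial>P0)"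
      using i(2)[OF W] \<psi>01 by (intro nn_integral_eq_integral[symmetric]) auto
    also have "\<dots> = (\<integral>\<^sup>+x. \<phi> (Z x) * indicator W (Z x) \<partial>P0)"
    proof (rule nn_integral_cong_AE)
      show "AE x in P0. ennreal (\<psi> (Z x) * indicator (pre W) x) = \<phi> (Z x) * indicator W (Z x)"
        using eq AE_space[of P0] by eventually_elim (auto simp: pre_def indicator_def)
    qed
    also have "\<dots> = (\<integral>\<^sup>+z. \<phi> z * indicator W z \<partial>lam)"
      unfolding lam_def by (subst nn_integral_distr) auto
    also have "\<dots> = (\<integral>\<^sup>+x. ennreal (f x * indicator (pre W) x) \<partial>P0)"
      unfolding key[OF W] by (intro nn_integral_cong) (auto simp: indicator_def)
    also have "\<dots> = ennreal (\<integral>x. f x * indicator (pre W) x \<partial>P0)"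
      using i(1)[OF W] f01 by (intro nn_integral_eq_integral) auto
    finally show ?thesis using f01 \<psi>01 by (subst (asm) ennreal_inj) (auto intro!: integral_nonneg_AE AE_I2)
  qed
  \<comment> \<open>Nonnegative because \<open>f\<close> and \<open>\<psi>\<close> take values
    between 0 and 1, and of the same integral as 1 over every event of the residuals.\<close>
  define h where "h x = 1 + f x - \<psi> (Z x)" for x
  have h0: "0 \<le> h x" for x using f01[of x] \<psi>01[of "Z x"] by (simp add: h_def)
  have [measurable]: "h \<in> borel_measurable M0" unfolding h_def by measurable
  define Q where "Q = density P0 (\<lambda>x. ennreal (h x))"
  have eQ: "emeasure Q (pre W) = emeasure P0 (pre W)" if W: "W \<in> sets (obs_space n)" for W
  proof -
    have [measurable]: "pre W \<in> sets M0" by (rule pre_sets[OF W])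
    have ih: "integrable P0 (\<lambda>x. h x * indicator (pre W) x)"
      unfolding h_def left_diff_distrib distrib_right using i[OF W] by (auto intro!: integrable_real_indicator simp: P.emeasure_eq_measure)
    have "emeasure Q (pre W) = (\<integral>\<^sup>+x. ennreal (h x * indicator (pre W) x) \<partial>P0)"
      unfolding Q_def by (subst emeasure_density) (auto simp: indicator_def intro!: nn_integral_cong)
    also have "\<dots> = ennreal (\<integral>x. h x * indicator (pre W) x \<partial>P0)"
      using ih h0 by (intro nn_integral_eq_integral) auto
    also have "(\<integral>x. h x * indicator (pre W) x \<partial>P0) = (\<integral>x. indicator (pre W) x + f x * indicator (pre W) x - \<psi> (Z x) * indicator (pre W) x \<partial>P0)"
      by (simp add: h_def left_diff_distrib distrib_right)
    also have "\<dots> = P.prob (pre W)"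
      using i[OF W] same[OF W] by (subst Bochner_Integration.integral_diff) (auto simp: P.emeasure_eq_measure)
    finally show ?thesis by (simp add: P.emeasure_eq_measure)
  qed
  have "pre (space (obs_space n)) = space M0" using Z_space by (auto simp: pre_def)
  then have pQ: "prob_space Q"
    using eQ[of "space (obs_space n)"] P.emeasure_space_1 by (intro prob_spaceI) (simp add: Q_def)
  have "distr Q (obs_space n) Z = distr P0 (obs_space n) Z"
  proof (rule measure_eqI)
    fix W assume "W \<in> sets (distr Q (obs_space n) Z)"
    then have W: "W \<in> sets (obs_space n)" by simp
    show "emeasure (distr Q (obs_space n) Z) W = emeasure (distr P0 (obs_space n) Z) W"
      using eQ[OF W] W by (simp add: emeasure_distr pre_def Q_def)
  qed simp
  then have "Q = P0" by (intro uniq[OF P0 pQ]) (simp add: Q_def)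
  then have "AE x in P0. ennreal (h x) = RN_deriv P0 P0 x"
    unfolding Q_def by (intro P.RN_deriv_unique) auto
  moreover have "AE x in P0. 1 = RN_deriv P0 P0 x"
    by (intro P.RN_deriv_unique) (auto simp: density_1)
  ultimately have "AE x in P0. f x = \<psi> (Z x)"
  proof eventually_elim
    case (elim x)
    then have "ennreal (h x) = 1" by simp
    then have "h x = 1" using h0[of x] by (simp add: ennreal_eq_1)
    then show ?case by (simp add: h_def)
  qed
  then have "\<forall>P\<in>\<P>. AE x in P. f x = \<psi> (Z x)" using AE_transfer[OF P0] by blast
  then show ?thesis using \<psi>01 by (intro bexI[of _ \<psi>]) auto
qed

end

text \<open>The sum is the expansion of the product of the factors \<open>-1 + 1\<close> over
  \<open>N - U\<close>, which vanishes unless the product is empty.\<close>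

lemma sum_sign_supersets:
  assumes "finite N" "U \<subseteq> N"
  shows "(\<Sum>T\<in>Pow N. if U \<subseteq> T then (-1) ^ card (N - T) else 0) = (if U = N then 1 else 0 :: real)"
proof -
  have "(\<Sum>T\<in>Pow N. if U \<subseteq> T then (-1) ^ card (N - T) else 0) = (\<Sum>T\<in>{T\<in>Pow N. U \<subseteq> T}. (-1) ^ card (N - T) :: real)"
    using assms by (intro sum.inter_filter[symmetric]) auto
  also have "\<dots> = (\<Sum>R\<in>Pow (N - U). (-1) ^ card R)"
    by (rule sum.reindex_bij_witness[where i="\<lambda>R. N - R" and j="\<lambda>T. N - T"])
      (use assms in \<open>auto simp: double_diff\<close>)
  also have "\<dots> = (\<Sum>R\<in>Pow (N - U). (\<Prod>x\<in>R. -1) * (\<Prod>x\<in>(N - U) - R. 1))" by simp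
  also have "\<dots> = (\<Prod>x\<in>N - U. -1 + 1)"
    by (rule prod_add[symmetric]) (use assms in \<open>auto intro: finite_subset\<close>)
  also have "\<dots> = (if U = N then 1 else 0)"
    using assms by (auto simp: prod_zero_iff)
  finally show ?thesis .
qed

text \<open>The value \<open>n\<close> stands for the additional row in Ryser's formula. A map on
  \<open>{..<n}\<close> whose image covers \<open>{..<n}\<close> never takes this value, by
  counting.\<close>

lemma bij_betw_permutes_restrict:
  "bij_betw (\<lambda>\<sigma>. restrict \<sigma> {..<n}) (perms n) {\<phi> \<in> {..<n} \<rightarrow>\<^sub>E {..n}. \<phi> ` {..<n} - {n} = {..<n::nat}}"
proof (rule bij_betwI[where g="\<lambda>\<phi> i. if i < n then \<phi> i else i"])
  show "(\<lambda>\<sigma>. restrict \<sigma> {..<n}) \<in> perms n \<rightarrow> {\<phi> \<in> {..<n} \<rightarrow>\<^sub>E {..n}. \<phi> ` {..<n} - {n} = {..<n}}"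
  proof
    fix \<sigma> assume "\<sigma> \<in> perms n"
    then have s: "\<sigma> permutes {..<n}" by simp
    have im: "\<sigma> ` {..<n} = {..<n}" by (rule permutes_image[OF s])
    have "restrict \<sigma> {..<n} ` {..<n} = {..<n}" using im by auto
    moreover have "\<sigma> i \<le> n" if "i < n" for i using permutes_in_image[OF s, of i] that by auto
    ultimately show "restrict \<sigma> {..<n} \<in> {\<phi> \<in> {..<n} \<rightarrow>\<^sub>E {..n}. \<phi> ` {..<n} - {n} = {..<n}}" by auto
  qed
  show "(\<lambda>\<phi> i. if i < n then \<phi> i else i) \<in> {\<phi> \<in> {..<n} \<rightarrow>\<^sub>E {..n}. \<phi> ` {..<n} - {n} = {..<n}} \<rightarrow> perms n"
  proof
    fix \<phi> assume p: "\<phi> \<in> {\<phi> \<in> {..<n} \<rightarrow>\<^sub>E {..n}. \<phi> ` {..<n} - {n} = {..<n}}"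
    have "{..<n} \<subseteq> \<phi> ` {..<n}" using p by blast
    then have "\<phi> ` {..<n} = {..<n}"
      by (metis card_image_le card_lessThan card_seteq finite_imageI finite_lessThan)
    then have "inj_on \<phi> {..<n}" "\<phi> ` {..<n} = {..<n}" by (auto intro: eq_card_imp_inj_on)
    then have "bij_betw (\<lambda>i. if i < n then \<phi> i else i) {..<n} {..<n}"
      by (auto simp: bij_betw_def inj_on_def)
    then show "(\<lambda>i. if i < n then \<phi> i else i) \<in> perms n"
      unfolding mem_Collect_eq by (rule bij_imp_permutes) auto
  qed
  show "(\<lambda>i. if i < n then restrict \<sigma> {..<n} i else i) = \<sigma>" if "\<sigma> \<in> perms n" for \<sigma>
    using that by (auto simp: fun_eq_iff permutes_def)
  show "restrict (\<lambda>i. if i < n then \<phi> i else i) {..<n} = \<phi>"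
    if "\<phi> \<in> {\<phi> \<in> {..<n} \<rightarrow>\<^sub>E {..n}. \<phi> ` {..<n} - {n} = {..<n}}" for \<phi>
    using that by (auto simp: fun_eq_iff PiE_def extensional_def)
qed

text \<open>Ryser's formula for the permanent. The summand \<open>1\<close> is a further row of the matrix, numbered \<open>n\<close> in the proof; it
  cancels, since the only maps that contribute hit all the other \<open>n\<close> rows.\<close>

lemma permanent_ryser:
  fixes a :: "nat \<Rightarrow> nat \<Rightarrow> real"
  shows "(\<Sum>T\<in>Pow {..<n}. (-1) ^ card ({..<n} - T) * (\<Prod>i<n. 1 + (\<Sum>j\<in>T. a j i)))
    = (\<Sum>\<sigma>\<in>perms n. \<Prod>i<n. a (\<sigma> i) i)"
proof -
  define b where "b j i = (if j = n then 1 else a j i)" for j i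
  have fT: "finite T" "n \<notin> T" if "T \<in> Pow {..<n}" for T using that by (auto intro: finite_subset)
  have step: "(\<Prod>i<n. 1 + (\<Sum>j\<in>T. a j i)) = (\<Sum>\<phi>\<in>{..<n} \<rightarrow>\<^sub>E {..n}. if \<phi> ` {..<n} - {n} \<subseteq> T then \<Prod>i<n. b (\<phi> i) i else 0)"
    if T: "T \<in> Pow {..<n}" for T
  proof -
    have "1 + (\<Sum>j\<in>T. a j i) = (\<Sum>j\<in>insert n T. b j i)" for i
    proof -
      have "(\<Sum>j\<in>T. b j i) = (\<Sum>j\<in>T. a j i)" using fT[OF T] by (intro sum.cong refl) (auto simp: b_def)
      then show ?thesis using fT[OF T] by (simp add: b_def)
    qed
    then have "(\<Prod>i<n. 1 + (\<Sum>j\<in>T. a j i)) = (\<Prod>i<n. \<Sum>j\<in>insert n T. b j i)" by simp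
    also have "\<dots> = (\<Sum>\<phi>\<in>{..<n} \<rightarrow>\<^sub>E insert n T. \<Prod>i<n. b (\<phi> i) i)"
      using fT[OF T] by (subst prod_sum_PiE) auto
    also have "{..<n} \<rightarrow>\<^sub>E insert n T = {\<phi> \<in> {..<n} \<rightarrow>\<^sub>E {..n}. \<phi> ` {..<n} - {n} \<subseteq> T}"
    proof (intro equalityI subsetI)
      fix \<phi> assume p: "\<phi> \<in> {..<n} \<rightarrow>\<^sub>E insert n T"
      have "\<phi> \<in> {..<n} \<rightarrow>\<^sub>E {..n}" by (rule subsetD[OF PiE_mono p]) (use T in auto)
      moreover have "\<phi> ` {..<n} - {n} \<subseteq> T" using p by (auto dest: PiE_mem)
      ultimately show "\<phi> \<in> {\<phi> \<in> {..<n} \<rightarrow>\<^sub>E {..n}. \<phi> ` {..<n} - {n} \<subseteq> T}" by simp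
    next
      fix \<phi> assume p: "\<phi> \<in> {\<phi> \<in> {..<n} \<rightarrow>\<^sub>E {..n}. \<phi> ` {..<n} - {n} \<subseteq> T}"
      show "\<phi> \<in> {..<n} \<rightarrow>\<^sub>E insert n T"
      proof (rule PiE_I)
        fix i assume "i \<in> {..<n}"
        then have "\<phi> i \<in> \<phi> ` {..<n}" by (rule imageI)
        then show "\<phi> i \<in> insert n T" using p by blast
      qed (use p in \<open>auto dest: PiE_arb\<close>)
    qed
    also have "(\<Sum>\<phi>\<in>{\<phi> \<in> {..<n} \<rightarrow>\<^sub>E {..n}. \<phi> ` {..<n} - {n} \<subseteq> T}. \<Prod>i<n. b (\<phi> i) i)
        = (\<Sum>\<phi>\<in>{..<n} \<rightarrow>\<^sub>E {..n}. if \<phi> ` {..<n} - {n} \<subseteq> T then \<Prod>i<n. b (\<phi> i) i else 0)"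
      by (rule sum.inter_filter) (auto intro!: finite_PiE)
    finally show ?thesis .
  qed
  have "(\<Sum>T\<in>Pow {..<n}. (-1) ^ card ({..<n} - T) * (\<Prod>i<n. 1 + (\<Sum>j\<in>T. a j i)))
     = (\<Sum>T\<in>Pow {..<n}. \<Sum>\<phi>\<in>{..<n} \<rightarrow>\<^sub>E {..n}. (\<Prod>i<n. b (\<phi> i) i) * (if \<phi> ` {..<n} - {n} \<subseteq> T then (-1) ^ card ({..<n} - T) else 0))"
    by (intro sum.cong refl) (simp only: step sum_distrib_left, intro sum.cong refl, simp)
  also have "\<dots> = (\<Sum>\<phi>\<in>{..<n} \<rightarrow>\<^sub>E {..n}. (\<Prod>i<n. b (\<phi> i) i) * (\<Sum>T\<in>Pow {..<n}. if \<phi> ` {..<n} - {n} \<subseteq> T then (-1) ^ card ({..<n} - T) else 0))"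
    by (subst sum.swap) (simp only: sum_distrib_left)
  also have "\<dots> = (\<Sum>\<phi>\<in>{..<n} \<rightarrow>\<^sub>E {..n}. if \<phi> ` {..<n} - {n} = {..<n} then \<Prod>i<n. b (\<phi> i) i else 0)"
  proof (intro sum.cong refl)
    fix \<phi> :: "nat \<Rightarrow> nat" assume "\<phi> \<in> {..<n} \<rightarrow>\<^sub>E {..n}"
    then have "\<phi> i \<le> n" if "i < n" for i using PiE_mem[of \<phi> "{..<n}" "\<lambda>_. {..n}" i] that by auto
    then have "\<phi> ` {..<n} - {n} \<subseteq> {..<n}" by (auto simp: le_less)
    from sum_sign_supersets[OF finite_lessThan this]
    show "(\<Prod>i<n. b (\<phi> i) i) * (\<Sum>T\<in>Pow {..<n}. if \<phi> ` {..<n} - {n} \<subseteq> T then (-1) ^ card ({..<n} - T) else 0)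
        = (if \<phi> ` {..<n} - {n} = {..<n} then \<Prod>i<n. b (\<phi> i) i else 0)"
      by simp
  qed
  also have "\<dots> = (\<Sum>\<phi>\<in>{\<phi> \<in> {..<n} \<rightarrow>\<^sub>E {..n}. \<phi> ` {..<n} - {n} = {..<n}}. \<Prod>i<n. b (\<phi> i) i)"
    by (rule sum.inter_filter[symmetric]) (auto intro!: finite_PiE)
  also have "\<dots> = (\<Sum>\<sigma>\<in>perms n. \<Prod>i<n. b (restrict \<sigma> {..<n} i) i)"
    by (rule sum.reindex_bij_betw[OF bij_betw_permutes_restrict, symmetric])
  also have "\<dots> = (\<Sum>\<sigma>\<in>perms n. \<Prod>i<n. a (\<sigma> i) i)"
  proof (intro sum.cong prod.cong refl)
    fix \<sigma> i assume "\<sigma> \<in> perms n" "i \<in> {..<n}"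
    then have "\<sigma> i < n" using permutes_in_image[of \<sigma> "{..<n}" i] by auto
    then show "b (restrict \<sigma> {..<n} i) i = a (\<sigma> i) i" using \<open>i \<in> {..<n}\<close> by (simp add: b_def)
  qed
  finally show ?thesis .
qed

text \<open>Applied to exchangeable residuals, a version of the conditional expectation given the
  symmetric events, as \<open>cond_exp_average\<close> shows.\<close>

definition average :: "nat \<Rightarrow> ((nat \<Rightarrow> 'a) \<Rightarrow> real) \<Rightarrow> (nat \<Rightarrow> 'a) \<Rightarrow> real" where
  "average n \<psi> z = (\<Sum>\<sigma>\<in>perms n. \<psi> (z \<circ> \<sigma>)) / fact n"

lemma average_permute:
  assumes "\<tau> permutes {..<n}"
  shows "average n \<psi> (z \<circ> \<tau>) = average n \<psi> z"
  unfolding average_def using setum_permutations_compose_left[OF assms, of "\<lambda>\<sigma>. \<psi> (z \<circ> \<sigma>)"]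
  by (simp only: comp_assoc)

lemma average_bounds:
  assumes "\<And>z. 0 \<le> \<psi> z" "\<And>z. \<psi> z \<le> 1"
  shows "0 \<le> average n \<psi> z" "average n \<psi> z \<le> 1"
proof -
  show "0 \<le> average n \<psi> z" using assms unfolding average_def by (intro divide_nonneg_nonneg sum_nonneg) auto
  have "(\<Sum>\<sigma>\<in>perms n. \<psi> (z \<circ> \<sigma>)) \<le> of_nat (card (perms n)) * 1" by (rule sum_bounded_above) (rule assms)
  then show "average n \<psi> z \<le> 1" by (simp add: average_def card_perms)
qed

lemma average_rectangle:
  "average n (\<lambda>z. \<Prod>i<n. indicator (A i) (z i)) z = (\<Sum>\<sigma>\<in>perms n. \<Prod>i<n. indicator (A (\<sigma> i)) (z i)) / fact n"
proof -
  have "(\<Sum>\<sigma>\<in>perms n. \<Prod>i<n. indicator (A i) ((z \<circ> \<sigma>) i) :: real) = (\<Sum>\<sigma>\<in>perms n. \<Prod>i<n. indicator (A i) ((z \<circ> inv \<sigma>) i))"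
    by (rule sum_permutations_inverse)
  also have "\<dots> = (\<Sum>\<sigma>\<in>perms n. \<Prod>i<n. indicator (A (\<sigma> i)) (z i))"
  proof (intro sum.cong refl)
    fix \<sigma> assume "\<sigma> \<in> perms n"
    then have s: "\<sigma> permutes {..<n}" by simp
    show "(\<Prod>i<n. indicator (A i) ((z \<circ> inv \<sigma>) i) :: real) = (\<Prod>i<n. indicator (A (\<sigma> i)) (z i))"
      using prod.permute[OF s, of "\<lambda>i. indicator (A i) ((z \<circ> inv \<sigma>) i) :: real"] permutes_inverses(2)[OF s]
      by (simp add: comp_def)
  qed
  finally show ?thesis by (simp add: average_def)
qed

lemma measurable_average [measurable]:
  assumes [measurable]: "\<psi> \<in> borel_measurable (PiM {..<n} (\<lambda>_. M))"
  shows "average n \<psi> \<in> borel_measurable (PiM {..<n} (\<lambda>_. M))"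
  unfolding average_def
proof (intro borel_measurable_divide borel_measurable_sum borel_measurable_const)
  fix \<sigma> assume "\<sigma> \<in> perms n"
  then have "(\<lambda>z. z \<circ> \<sigma>) \<in> measurable (PiM {..<n} (\<lambda>_. M)) (PiM {..<n} (\<lambda>_. M))" by (intro measurable_permute) simp
  then show "(\<lambda>z. \<psi> (z \<circ> \<sigma>)) \<in> borel_measurable (PiM {..<n} (\<lambda>_. M))" by (rule measurable_compose) measurable
qed

section \<open>Sufficiency of the symmetric events\<close>

context residual_experiment
begin

definition "symmetric_sets = {C\<in>sets (obs_space n). \<forall>\<sigma>\<in>perms n. \<forall>z\<in>space (obs_space n). z \<circ> \<sigma> \<in> C \<longleftrightarrow> z \<in> C}"

text \<open>The \<sigma>-field of the order statistic of the residuals; in higher dimension it is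
  described by permutation invariance instead of an ordering.\<close>

definition "symm = vimage_algebra (space M0) Z (sigma (space (obs_space n)) symmetric_sets)"

lemma permute_space: "\<sigma> \<in> perms n \<Longrightarrow> z \<in> space (obs_space n) \<Longrightarrow> z \<circ> \<sigma> \<in> space (obs_space n)"
  using measurable_space[OF measurable_permute[of \<sigma> n borel]] by simp

lemma sigma_algebra_symmetric: "sigma_algebra (space (obs_space n)) symmetric_sets"
  unfolding sigma_algebra_iff2
proof (intro conjI ballI allI impI)
  show "symmetric_sets \<subseteq> Pow (space (obs_space n))" using sets.sets_into_space by (auto simp: symmetric_sets_def)
  show "{} \<in> symmetric_sets" by (simp add: symmetric_sets_def)
  show "space (obs_space n) - C \<in> symmetric_sets" if "C \<in> symmetric_sets" for C
    using that permute_space unfolding symmetric_sets_def by blast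
  show "(\<Union>i. C i) \<in> symmetric_sets" if "range C \<subseteq> symmetric_sets" for C :: "nat \<Rightarrow> _"
    using that unfolding symmetric_sets_def by (auto simp: image_subset_iff)
qed

lemma sets_symm: "sets symm = pre ` symmetric_sets"
proof -
  have eq: "sets (sigma (space (obs_space n)) symmetric_sets) = symmetric_sets"
    by (rule sigma_algebra.sets_measure_of_eq[OF sigma_algebra_symmetric])
  have "Z \<in> space M0 \<rightarrow> space (sigma (space (obs_space n)) symmetric_sets)"
    using Z_space by (simp add: space_measure_of_conv)
  then have "sets symm = {Z -` C \<inter> space M0 | C. C \<in> symmetric_sets}"
    unfolding symm_def by (simp only: sets_vimage_algebra2 eq)
  also have "\<dots> = pre ` symmetric_sets" unfolding pre_def by (rule Setcompr_eq_image)
  finally show ?thesis .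
qed

lemma space_symm [simp]: "space symm = space M0"
  by (simp add: symm_def)

lemma symmetricD:
  assumes "C \<in> symmetric_sets"
  shows "C \<in> sets (obs_space n)" "\<sigma> \<in> perms n \<Longrightarrow> z \<in> space (obs_space n) \<Longrightarrow> z \<circ> \<sigma> \<in> C \<longleftrightarrow> z \<in> C"
  using assms by (auto simp: symmetric_sets_def)

lemma subalgebra_symm: "P \<in> \<P> \<Longrightarrow> subalgebra P symm"
  unfolding subalgebra_def sets_symm by (simp add: space_P sets image_subset_iff pre_sets symmetricD(1))

lemma measurable_symm_M0: "f \<in> borel_measurable symm \<Longrightarrow> f \<in> borel_measurable M0"
  by (rule measurable_from_subalg[OF subalgebra_symm[OF P0], of f borel, unfolded measurable_P[OF P0]])

lemma measurable_symm:
  assumes k[measurable]: "k \<in> borel_measurable (obs_space n)" and s: "\<And>\<sigma> z. \<sigma> \<in> perms n \<Longrightarrow> k (z \<circ> \<sigma>) = k z"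
  shows "(\<lambda>x. k (Z x)) \<in> borel_measurable symm"
proof -
  have "k -` B \<inter> space (obs_space n) \<in> symmetric_sets" if "B \<in> sets borel" for B :: "'b set"
    using measurable_sets[OF k that] s permute_space by (auto simp: symmetric_sets_def)
  then have "k \<in> borel_measurable (sigma (space (obs_space n)) symmetric_sets)"
    by (intro measurableI) (auto simp: space_measure_of_conv sigma_algebra.sets_measure_of_eq[OF sigma_algebra_symmetric])
  moreover have "Z \<in> measurable symm (sigma (space (obs_space n)) symmetric_sets)"
    unfolding symm_def using Z_space by (intro measurable_vimage_algebra1) (auto simp: space_measure_of_conv)
  ultimately show ?thesis by (rule measurable_compose[rotated])
qed

lemma measurable_average_symm: "\<psi> \<in> borel_measurable (obs_space n) \<Longrightarrow> (\<lambda>x. average n \<psi> (Z x)) \<in> borel_measurable symm"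
  by (rule measurable_symm[where k="average n \<psi>"]) (simp_all add: average_permute measurable_average)

lemma integral_permute:
  assumes P: "P \<in> \<P>" and s: "\<sigma> \<in> perms n" and k[measurable]: "k \<in> borel_measurable (obs_space n)"
  shows "(\<integral>x. k (Z x \<circ> \<sigma>) \<partial>P) = (\<integral>x. (k (Z x) :: real) \<partial>P)"
proof -
  have s': "\<sigma> permutes {..<n}" using s by simp
  have Zm: "Z \<in> measurable P (obs_space n)" unfolding measurable_P[OF P] by (rule Z)
  have Zs: "(\<lambda>x. Z x \<circ> \<sigma>) \<in> measurable P (obs_space n)" by (rule measurable_compose[OF Zm measurable_permute[OF s']])
  interpret P: prob_space P by (rule prob[OF P])
  have "distr P (obs_space n) (\<lambda>x. Z x \<circ> \<sigma>) = distr P (obs_space n) Z"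
  proof (rule measure_eqI)
    fix A assume "A \<in> sets (distr P (obs_space n) (\<lambda>x. Z x \<circ> \<sigma>))"
    then have A: "A \<in> sets (obs_space n)" by simp
    have "(\<lambda>x. Z x \<circ> \<sigma>) -` A \<inter> space P = {x\<in>space M0. Z x \<circ> \<sigma> \<in> A}" "Z -` A \<inter> space P = pre A"
      using space_P[OF P] by (auto simp: pre_def)
    then show "emeasure (distr P (obs_space n) (\<lambda>x. Z x \<circ> \<sigma>)) A = emeasure (distr P (obs_space n) Z) A"
      using prob_permute[OF P s' A] by (simp add: emeasure_distr[OF Zs A] emeasure_distr[OF Zm A] P.emeasure_eq_measure)
  qed simp
  then show ?thesis using integral_distr[OF Zs k] integral_distr[OF Zm k] by simp
qed

lemma integrable_unit:
  assumes "P \<in> \<P>" "f \<in> borel_measurable M0" "\<And>x. x \<in> space M0 \<Longrightarrow> \<bar>f x\<bar> \<le> (B::real)"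
  shows "integrable P f"
proof -
  interpret P: prob_space P by (rule prob[OF assms(1)])
  show ?thesis using assms by (intro P.integrable_const_bound[of _ B]) (auto simp: measurable_P space_P)
qed

text \<open>Over a symmetric event, exchangeability gives each of the n! rearrangements of
  \<open>\<psi>\<close> the same integral. The resulting version depends on the measure only through
  \<open>\<psi>\<close>, which can be chosen in common for the whole experiment.\<close>

lemma cond_exp_average:
  assumes P: "P \<in> \<P>" and f[measurable]: "f \<in> borel_measurable M0" and f01: "\<And>x. 0 \<le> f x" "\<And>x. f x \<le> (1::real)"
    and \<psi>[measurable]: "\<psi> \<in> borel_measurable (obs_space n)" and \<psi>01: "\<And>z. 0 \<le> \<psi> z" "\<And>z. \<psi> z \<le> 1"
    and ae: "AE x in P. f x = \<psi> (Z x)"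
  shows "AE x in P. real_cond_exp P symm f x = average n \<psi> (Z x)"
proof -
  interpret P: prob_space P by (rule prob[OF P])
  interpret S: finite_measure_subalgebra P symm by standard (rule subalgebra_symm[OF P])
  have [measurable_cong]: "sets P = sets M0" by (rule sets[OF P])
  have av: "0 \<le> average n \<psi> z" "average n \<psi> z \<le> 1" for z by (rule average_bounds[OF \<psi>01])+
  show ?thesis
  proof (rule S.real_cond_exp_charact)
    show "integrable P f" "integrable P (\<lambda>x. average n \<psi> (Z x))"
      using f01 av by (auto intro!: integrable_unit[OF P, of _ 1])
    show "(\<lambda>x. average n \<psi> (Z x)) \<in> borel_measurable symm" by (rule measurable_average_symm) measurable
    fix a assume "a \<in> sets symm"
    then obtain C where C: "C \<in> symmetric_sets" "a = pre C" by (auto simp: sets_symm)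
    have Cs[measurable]: "C \<in> sets (obs_space n)" using C by (auto dest: symmetricD)
    have [measurable]: "a \<in> sets M0" using C Cs by auto
    have inv: "(\<integral>x. indicator C (Z x) * \<psi> (Z x \<circ> \<sigma>) \<partial>P) = (\<integral>x. indicator C (Z x) * \<psi> (Z x) \<partial>P)" if s: "\<sigma> \<in> perms n" for \<sigma>
    proof -
      have "(\<integral>x. indicator C (Z x) * \<psi> (Z x \<circ> \<sigma>) \<partial>P) = (\<integral>x. indicator C (Z x \<circ> \<sigma>) * \<psi> (Z x \<circ> \<sigma>) \<partial>P)"
        using symmetricD(2)[OF C(1) s Z_space] by (intro Bochner_Integration.integral_cong refl) (simp add: indicator_def space_P[OF P])
      also have "\<dots> = (\<integral>x. indicator C (Z x) * \<psi> (Z x) \<partial>P)"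
        by (rule integral_permute[OF P s, of "\<lambda>z. indicator C z * \<psi> z"]) measurable
      finally show ?thesis .
    qed
    have int: "integrable P (\<lambda>x. indicator C (Z x) * \<psi> (Z x \<circ> \<sigma>))" if s: "\<sigma> \<in> perms n" for \<sigma>
    proof (rule integrable_unit[OF P, of _ 1])
      have [measurable]: "(\<lambda>x. Z x \<circ> \<sigma>) \<in> measurable M0 (obs_space n)"
        using s by (intro measurable_compose[OF Z measurable_permute]) simp
      show "(\<lambda>x. indicator C (Z x) * \<psi> (Z x \<circ> \<sigma>)) \<in> borel_measurable M0" by measurable
    qed (use \<psi>01 in \<open>auto simp: indicator_def\<close>)
    have "(\<integral>x\<in>a. average n \<psi> (Z x) \<partial>P) = (\<integral>x. (\<Sum>\<sigma>\<in>perms n. indicator C (Z x) * \<psi> (Z x \<circ> \<sigma>)) / fact n \<partial>P)"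
      unfolding set_lebesgue_integral_def average_def
      by (intro Bochner_Integration.integral_cong refl) (auto simp: C pre_def indicator_def sum_distrib_left space_P[OF P])
    also have "\<dots> = (\<Sum>\<sigma>\<in>perms n. \<integral>x. indicator C (Z x) * \<psi> (Z x \<circ> \<sigma>) \<partial>P) / fact n"
      using int by (subst integral_divide_zero, subst Bochner_Integration.integral_sum) auto
    also have "\<dots> = (\<integral>x. indicator C (Z x) * \<psi> (Z x) \<partial>P)"
      using inv by (simp add: card_perms)
    also have "\<dots> = (\<integral>x\<in>a. f x \<partial>P)"
      unfolding set_lebesgue_integral_def
    proof (rule integral_cong_AE)
      show "AE x in P. indicator C (Z x) * \<psi> (Z x) = indicat_real a x *\<^sub>R f x"
        using ae AE_space[of P] by eventually_elim (auto simp: C pre_def indicator_def space_P[OF P])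
    qed measurable
    finally show "(\<integral>x\<in>a. f x \<partial>P) = (\<integral>x\<in>a. average n \<psi> (Z x) \<partial>P)" ..
  qed
qed

lemma sufficient_symm: "sufficient \<P> symm"
  unfolding sufficient_def
proof (intro conjI ballI)
  fix B assume "B \<in> (\<Inter>P\<in>\<P>. sets P)"
  then have B[measurable]: "B \<in> sets M0" using P0 sets by blast
  have m: "(indicator B :: _ \<Rightarrow> real) \<in> borel_measurable M0" by measurable
  obtain \<psi> :: "_ \<Rightarrow> real" where \<psi>: "\<psi> \<in> borel_measurable (obs_space n)" "\<And>z. 0 \<le> \<psi> z" "\<And>z. \<psi> z \<le> 1"
    "\<And>P. P \<in> \<P> \<Longrightarrow> AE x in P. indicator B x = \<psi> (Z x)"
    using function_of_residuals[OF m indicator_pos_le indicator_le_1] by blast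
  show "\<exists>h\<in>borel_measurable symm. \<forall>P\<in>\<P>. AE x in P. real_cond_exp P symm (indicator B) x = h x"
  proof (intro bexI[of _ "\<lambda>x. average n \<psi> (Z x)"] ballI)
    fix P assume P: "P \<in> \<P>"
    show "AE x in P. real_cond_exp P symm (indicator B) x = average n \<psi> (Z x)"
      by (rule cond_exp_average[OF P m _ _ \<psi>(1-3) \<psi>(4)[OF P]]) simp_all
  qed (rule measurable_average_symm[OF \<psi>(1)])
qed (rule subalgebra_symm)

section \<open>Bounded completeness of the symmetric events\<close>

lemma zero_of_zero_integrals:
  assumes h[measurable]: "h \<in> borel_measurable symm" and B: "\<And>x. x \<in> space M0 \<Longrightarrow> \<bar>h x\<bar> \<le> (B::real)"
    and 0: "\<And>W. W \<in> sets (obs_space n) \<Longrightarrow> (\<integral>x. h x * indicator (pre W) x \<partial>P0) = 0"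
  shows "AE x in P0. h x \<le> 0"
proof -
  have hM[measurable]: "h \<in> borel_measurable M0" by (rule measurable_symm_M0[OF h])
  \<comment> \<open>The event where \<open>h\<close> is positive is itself the preimage of an event
    of residuals, so it may be inserted for \<open>W\<close>.\<close>
  have "{x\<in>space symm. 0 < h x} \<in> sets symm" by measurable
  then obtain W where W: "W \<in> symmetric_sets" "{x\<in>space symm. 0 < h x} = pre W" unfolding sets_symm by blast
  have Ws: "W \<in> sets (obs_space n)" using W by (auto dest: symmetricD)
  have [measurable]: "pre W \<in> sets M0" by (rule pre_sets[OF Ws])
  have Wi: "x \<in> pre W \<longleftrightarrow> x \<in> space M0 \<and> 0 < h x" for x unfolding W(2)[symmetric] by simp
  have "integrable P0 (\<lambda>x. h x * indicator (pre W) x)"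
  proof (rule integrable_unit[OF P0, of _ B])
    fix x assume "x \<in> space M0"
    then have "0 \<le> B" "\<bar>h x\<bar> \<le> B" using B[of x] by auto
    then show "\<bar>h x * indicator (pre W) x\<bar> \<le> B" by (auto simp: indicator_def)
  qed measurable
  then have "AE x in P0. h x * indicator (pre W) x = 0"
    using 0[OF Ws] by (subst (asm) integral_nonneg_eq_0_iff_AE) (auto simp: indicator_def Wi intro!: AE_I2)
  then show ?thesis using AE_space[of P0]
  proof eventually_elim
    case (elim x)
    then have "x \<in> space M0" by (simp add: space_P[OF P0])
    then show ?case using elim(1) Wi[of x] by (cases "x \<in> pre W") auto
  qed
qed


lemma pre_rectangle:
  assumes "x \<in> space M0"
  shows "indicator (pre (Pi\<^sub>E {..<n} A)) x = (\<Prod>i<n. indicator (A i) (Z x i) :: real)"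
proof (cases "\<forall>i<n. Z x i \<in> A i")
  case True
  then have "x \<in> pre (Pi\<^sub>E {..<n} A)" using assms Z_space[OF assms] by (auto simp: pre_def space_PiM PiE_iff)
  then show ?thesis using True by simp
next
  case False
  then have "x \<notin> pre (Pi\<^sub>E {..<n} A)" by (auto simp: pre_def PiE_iff)
  then show ?thesis using False by (auto simp: indicator_def)
qed

text \<open>Since \<open>h\<close> is symmetric, the indicator may be replaced by its average over
  permutations, a multiple of a permanent. Each product \<open>H T\<close> in its expansion is a
  multiple of the likelihood ratio of some member of the experiment, under which \<open>h\<close>
  has mean 0.\<close>

lemma zero_on_rectangles:
  assumes h[measurable]: "h \<in> borel_measurable symm" and B: "\<And>x. x \<in> space M0 \<Longrightarrow> \<bar>h x\<bar> \<le> (B::real)"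
    and mean: "\<And>P. P \<in> \<P> \<Longrightarrow> (\<integral>x. h x \<partial>P) = 0" and A[measurable]: "\<And>i. A i \<in> sets borel"
  shows "(\<integral>x. h x * indicator (pre (Pi\<^sub>E {..<n} A)) x \<partial>P0) = 0"
proof -
  interpret P0: prob_space P0 by (rule prob[OF P0])
  interpret S: finite_measure_subalgebra P0 symm by standard (rule subalgebra_symm[OF P0])
  have hM[measurable]: "h \<in> borel_measurable M0" by (rule measurable_symm_M0[OF h])
  have [measurable_cong]: "sets P0 = sets M0" by (rule sets[OF P0])
  have coord[measurable]: "(\<lambda>x. Z x i) \<in> borel_measurable M0" if "i < n" for i
    using measurable_compose[OF Z measurable_component_singleton[of i "{..<n}" "\<lambda>_. borel"]] that by simp
  have [measurable]: "(\<lambda>x. indicator (A j) (Z x i) :: real) \<in> borel_measurable M0" if "i < n" for i j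
    using coord[OF that] by measurable
  define H where "H T x = (\<Prod>i<n. 1 + (\<Sum>j\<in>T. indicator (A j) (Z x i) :: real))" for T x
  have Hm[measurable]: "H T \<in> borel_measurable M0" for T
    unfolding H_def by measurable
  have H0: "0 \<le> H T x" for T x unfolding H_def by (intro prod_nonneg ballI add_nonneg_nonneg sum_nonneg) auto
  have zero: "(\<integral>x. h x * H T x \<partial>P0) = 0" if T: "T \<subseteq> {..<n}" for T
  proof -
    have "\<exists>c>0. density P0 (\<lambda>x. ennreal (H T x / c)) \<in> \<P>"
      unfolding H_def by (rule rich[OF A T])
    then obtain c where c: "c > 0" "density P0 (\<lambda>x. ennreal (H T x / c)) \<in> \<P>" by auto
    have "0 = (\<integral>x. h x \<partial>density P0 (\<lambda>x. ennreal (H T x / c)))" using mean[OF c(2)] by simp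
    also have "\<dots> = (\<integral>x. (H T x / c) *\<^sub>R h x \<partial>P0)"
      using H0 c(1) by (intro integral_density) auto
    also have "\<dots> = (\<integral>x. (h x * H T x) / c \<partial>P0)" by (intro Bochner_Integration.integral_cong refl) simp
    also have "\<dots> = (\<integral>x. h x * H T x \<partial>P0) / c" by simp
    finally show ?thesis using c(1) by simp
  qed
  define q where "q z = (\<Prod>i<n. indicator (A i) (z i) :: real)" for z
  have q: "0 \<le> q z" "q z \<le> 1" for z
    unfolding q_def by (auto intro!: prod_nonneg prod_le_1)
  have qm[measurable]: "q \<in> borel_measurable (obs_space n)" unfolding q_def by measurable
  have average: "h x * average n q (Z x) = (\<Sum>T\<in>Pow {..<n}. (-1) ^ card ({..<n} - T) * (h x * H T x)) / fact n" for x
  proof -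
    have "fact n * average n q (Z x) = (\<Sum>\<sigma>\<in>perms n. \<Prod>i<n. indicator (A (\<sigma> i)) (Z x i))"
      unfolding q_def average_rectangle by simp
    also have "\<dots> = (\<Sum>T\<in>Pow {..<n}. (-1) ^ card ({..<n} - T) * H T x)"
      unfolding H_def by (rule permanent_ryser[symmetric])
    finally have "h x * (fact n * average n q (Z x)) = (\<Sum>T\<in>Pow {..<n}. (-1) ^ card ({..<n} - T) * (h x * H T x))"
      by (simp add: sum_distrib_left mult.left_commute)
    then show ?thesis by (simp add: field_simps)
  qed
  have Hb: "\<bar>H T x\<bar> \<le> (\<Prod>i<n. 1 + real (card T))" for T x
  proof -
    have "(\<Sum>j\<in>T. indicator (A j) (Z x i) :: real) \<le> of_nat (card T) * 1" for i
      by (rule sum_bounded_above) simp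
    then show ?thesis using H0[of T x] unfolding H_def by (simp only: abs_of_nonneg) (intro prod_mono, auto intro!: add_nonneg_nonneg sum_nonneg)
  qed
  have int: "integrable P0 (\<lambda>x. h x * H T x)" for T
  proof (rule integrable_unit[OF P0])
    fix x assume "x \<in> space M0"
    then show "\<bar>h x * H T x\<bar> \<le> B * (\<Prod>i<n. 1 + real (card T))"
      using B[of x] Hb[of T x] by (simp only: abs_mult) (intro mult_mono, auto)
  qed measurable
  have intq: "integrable P0 (\<lambda>x. h x * q (Z x))"
  proof (rule integrable_unit[OF P0])
    fix x assume "x \<in> space M0"
    then show "\<bar>h x * q (Z x)\<bar> \<le> B * 1"
      using B[of x] q[of "Z x"] by (simp only: abs_mult) (intro mult_mono, auto)
  qed measurable
  have "AE x in P0. real_cond_exp P0 symm (\<lambda>x. q (Z x)) x = average n q (Z x)"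
    by (rule cond_exp_average[OF P0 _ _ _ qm]) (use q in auto)
  moreover have "real_cond_exp P0 symm (\<lambda>x. q (Z x)) \<in> borel_measurable P0" by simp
  ultimately have ce: "(\<integral>x. h x * real_cond_exp P0 symm (\<lambda>x. q (Z x)) x \<partial>P0) = (\<integral>x. h x * average n q (Z x) \<partial>P0)"
    by (intro integral_cong_AE) (auto simp: measurable_P[OF P0])
  have "(\<integral>x. h x * indicator (pre (Pi\<^sub>E {..<n} A)) x \<partial>P0) = (\<integral>x. h x * q (Z x) \<partial>P0)"
    unfolding q_def by (intro Bochner_Integration.integral_cong refl) (simp add: pre_rectangle space_P[OF P0])
  also have "\<dots> = (\<integral>x. h x * average n q (Z x) \<partial>P0)"
    unfolding ce[symmetric] by (rule S.real_cond_exp_intg(2)[symmetric, OF intq h]) measurable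
  also have "\<dots> = (\<Sum>T\<in>Pow {..<n}. (-1) ^ card ({..<n} - T) * (\<integral>x. h x * H T x \<partial>P0)) / fact n"
    unfolding average using int by (subst integral_divide_zero, subst Bochner_Integration.integral_sum) auto
  also have "\<dots> = 0" using zero by simp
  finally show ?thesis .
qed

text \<open>Rectangles determine measures on the product space. As \<open>h\<close> is signed, the
  measures with densities \<open>h + B\<close> and \<open>B\<close> are compared.\<close>

lemma zero_on_pre:
  assumes h[measurable]: "h \<in> borel_measurable symm" and B: "\<And>x. x \<in> space M0 \<Longrightarrow> \<bar>h x\<bar> \<le> (B::real)"
    and mean: "\<And>P. P \<in> \<P> \<Longrightarrow> (\<integral>x. h x \<partial>P) = 0" and W: "W \<in> sets (obs_space n)"
  shows "(\<integral>x. h x * indicator (pre W) x \<partial>P0) = 0"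
proof -
  interpret P0: prob_space P0 by (rule prob[OF P0])
  have hM[measurable]: "h \<in> borel_measurable M0" by (rule measurable_symm_M0[OF h])
  have [measurable_cong]: "sets P0 = sets M0" by (rule sets[OF P0])
  have Zm: "Z \<in> measurable P0 (obs_space n)" unfolding measurable_P[OF P0] by (rule Z)
  have hi: "integrable P0 (\<lambda>x. h x * indicator (pre V) x)" if V: "V \<in> sets (obs_space n)" for V
  proof (rule integrable_unit[OF P0])
    have [measurable]: "pre V \<in> sets M0" by (rule pre_sets[OF V])
    show "(\<lambda>x. h x * indicator (pre V) x) \<in> borel_measurable M0" by measurable
    fix x assume "x \<in> space M0"
    then have "0 \<le> B" "\<bar>h x\<bar> \<le> B" using B[of x] by auto
    then show "\<bar>h x * indicator (pre V) x\<bar> \<le> B" by (auto simp: indicator_def)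
  qed
  define \<mu> where "\<mu> k = distr (density P0 (\<lambda>x. ennreal (k x))) (obs_space n) Z" for k
  have e: "emeasure (\<mu> (\<lambda>x. h x + B)) V = ennreal ((\<integral>x. h x * indicator (pre V) x \<partial>P0) + B * P0.prob (pre V))"
    "emeasure (\<mu> (\<lambda>x. B)) V = ennreal (B * P0.prob (pre V))"
    if V: "V \<in> sets (obs_space n)" for V
  proof -
    have [measurable]: "pre V \<in> sets M0" by (rule pre_sets[OF V])
    have em: "emeasure (\<mu> k) V = ennreal (\<integral>x. k x * indicator (pre V) x \<partial>P0)"
      if k[measurable]: "k \<in> borel_measurable M0" "integrable P0 (\<lambda>x. k x * indicator (pre V) x)" "\<And>x. x \<in> space M0 \<Longrightarrow> 0 \<le> k x" for k
    proof -
      have "emeasure (\<mu> k) V = emeasure (density P0 (\<lambda>x. ennreal (k x))) (pre V)"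
        unfolding \<mu>_def using Zm V by (subst emeasure_distr) (auto simp: pre_def space_P[OF P0])
      also have "\<dots> = (\<integral>\<^sup>+x. ennreal (k x * indicator (pre V) x) \<partial>P0)"
        by (subst emeasure_density) (auto intro!: nn_integral_cong simp: indicator_def)
      also have "\<dots> = ennreal (\<integral>x. k x * indicator (pre V) x \<partial>P0)"
        using k(2,3) by (intro nn_integral_eq_integral AE_I2) (auto simp: space_P[OF P0])
      finally show ?thesis .
    qed
    have iB: "integrable P0 (\<lambda>x. B * indicator (pre V) x)" by (intro integrable_mult_right integrable_real_indicator) (auto simp: P0.emeasure_eq_measure)
    have B0: "x \<in> space M0 \<Longrightarrow> 0 \<le> B" for x using B[of x] by auto
    have "(\<integral>x. (h x + B) * indicator (pre V) x \<partial>P0) = (\<integral>x. h x * indicator (pre V) x + B * indicator (pre V) x \<partial>P0)"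
      by (simp add: distrib_right)
    also have "\<dots> = (\<integral>x. h x * indicator (pre V) x \<partial>P0) + B * P0.prob (pre V)"
      by (subst Bochner_Integration.integral_add[OF hi[OF V] iB]) simp
    finally have "(\<integral>x. (h x + B) * indicator (pre V) x \<partial>P0) = (\<integral>x. h x * indicator (pre V) x \<partial>P0) + B * P0.prob (pre V)" .
    moreover have "emeasure (\<mu> (\<lambda>x. h x + B)) V = ennreal (\<integral>x. (h x + B) * indicator (pre V) x \<partial>P0)"
    proof (rule em)
      show "integrable P0 (\<lambda>x. (h x + B) * indicator (pre V) x)"
        unfolding distrib_right by (rule Bochner_Integration.integrable_add[OF hi[OF V] iB])
      show "0 \<le> h x + B" if "x \<in> space M0" for x using B[OF that] by auto
    qed measurable
    ultimately show "emeasure (\<mu> (\<lambda>x. h x + B)) V = ennreal ((\<integral>x. h x * indicator (pre V) x \<partial>P0) + B * P0.prob (pre V))" by simp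
    show "emeasure (\<mu> (\<lambda>x. B)) V = ennreal (B * P0.prob (pre V))"
      using em[of "\<lambda>_. B", OF _ iB B0] by simp
  qed
  have "\<mu> (\<lambda>x. h x + B) = \<mu> (\<lambda>x. B)"
  proof (rule measure_eqI_PiM_finite[where I="{..<n}" and M="\<lambda>_. borel" and A="\<lambda>_. space (obs_space n :: (nat \<Rightarrow> real ^ 'd) measure)"])
    show "range (\<lambda>_::nat. space (obs_space n :: (nat \<Rightarrow> real ^ 'd) measure)) \<subseteq> prod_algebra {..<n} (\<lambda>_. borel)"
      using space_in_prod_algebra[of "{..<n}" "\<lambda>_. borel :: (real ^ 'd) measure"] by (auto simp: space_PiM)
    fix A assume A: "\<And>i. i \<in> {..<n} \<Longrightarrow> A i \<in> sets (borel :: (real ^ 'd) measure)"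
    define A' where "A' i = (if i < n then A i else UNIV)" for i
    have A': "A' i \<in> sets borel" for i using A by (simp add: A'_def)
    have eqA: "Pi\<^sub>E {..<n} A = Pi\<^sub>E {..<n} A'" by (intro PiE_cong) (simp add: A'_def)
    have V: "Pi\<^sub>E {..<n} A' \<in> sets (obs_space n)" using A' by (intro sets_PiM_I_finite) auto
    have "(\<integral>x. h x * indicator (pre (Pi\<^sub>E {..<n} A')) x \<partial>P0) = 0"
      by (rule zero_on_rectangles[OF h _ mean A']) (rule B)
    then show "emeasure (\<mu> (\<lambda>x. h x + B)) (Pi\<^sub>E {..<n} A) = emeasure (\<mu> (\<lambda>x. B)) (Pi\<^sub>E {..<n} A)"
      unfolding eqA e[OF V] by simp
  qed (auto simp: \<mu>_def e[unfolded \<mu>_def])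
  then have "ennreal ((\<integral>x. h x * indicator (pre W) x \<partial>P0) + B * P0.prob (pre W)) = ennreal (B * P0.prob (pre W))"
    using e[OF W] by simp
  moreover have "0 \<le> B * P0.prob (pre W)"
  proof (rule mult_nonneg_nonneg)
    obtain x where "x \<in> space M0" using P0.not_empty space_P[OF P0] by auto
    then show "0 \<le> B" using B[of x] by simp
  qed simp
  moreover have "0 \<le> (\<integral>x. h x * indicator (pre W) x \<partial>P0) + B * P0.prob (pre W)"
  proof -
    have [measurable]: "pre W \<in> sets M0" by (rule pre_sets[OF W])
    have "0 \<le> (\<integral>x. h x * indicator (pre W) x + B * indicator (pre W) x \<partial>P0)"
    proof (intro integral_nonneg_AE AE_I2)
      fix x assume "x \<in> space P0"
      then show "0 \<le> h x * indicator (pre W) x + B * indicator (pre W) x"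
        using B[of x] by (auto simp: space_P[OF P0] indicator_def)
    qed
    also have "\<dots> = (\<integral>x. h x * indicator (pre W) x \<partial>P0) + B * P0.prob (pre W)"
      by (subst Bochner_Integration.integral_add[OF hi[OF W]]) (auto simp: P0.emeasure_eq_measure intro!: integrable_mult_right integrable_real_indicator)
    finally show ?thesis .
  qed
  ultimately show ?thesis by (simp add: ennreal_inj)
qed

lemma boundedly_complete_symm: "boundedly_complete \<P> symm"
  unfolding boundedly_complete_def
proof (intro conjI ballI allI impI)
  show "subalgebra P symm" if "P \<in> \<P>" for P by (rule subalgebra_symm[OF that])
  fix h :: "'a \<Rightarrow> real" and P
  assume a: "h \<in> borel_measurable symm \<and> bounded (h ` space symm) \<and> (\<forall>P\<in>\<P>. (\<integral>x. h x \<partial>P) = 0)" and P: "P \<in> \<P>"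
  obtain B where B: "\<And>x. x \<in> space M0 \<Longrightarrow> \<bar>h x\<bar> \<le> B" using a unfolding bounded_iff by auto
  have h: "h \<in> borel_measurable symm" and mean: "\<And>P. P \<in> \<P> \<Longrightarrow> (\<integral>x. h x \<partial>P) = 0" using a by auto
  have "AE x in P0. h x \<le> 0"
    by (rule zero_of_zero_integrals[OF h B zero_on_pre[OF h B mean]])
  moreover have "AE x in P0. - h x \<le> 0"
  proof (rule zero_of_zero_integrals)
    show h': "(\<lambda>x. - h x) \<in> borel_measurable symm" using h by measurable
    show B': "\<bar>- h x\<bar> \<le> B" if "x \<in> space M0" for x using B[OF that] by simp
    show "(\<integral>x. - h x * indicator (pre W) x \<partial>P0) = 0" if "W \<in> sets (obs_space n)" for W
      using zero_on_pre[OF h B mean that] by simp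
  qed
  ultimately have "AE x in P0. h x = 0" by eventually_elim simp
  then show "AE x in P. h x = 0" by (rule AE_transfer[OF P0 P])
qed


section \<open>Minimal sufficiency and Basu's theorem\<close>

lemma symmetric_difference_null:
  assumes "P \<in> \<P>" "a \<in> sets M0" "b \<in> sets M0" "AE x in P. x \<in> a \<longleftrightarrow> x \<in> b"
  shows "(a - b) \<union> (b - a) \<in> null_sets P"
proof -
  have "(a - b) \<union> (b - a) \<in> sets P" using assms(2,3) by (simp add: sets[OF assms(1)])
  moreover have "AE x in P. x \<notin> (a - b) \<union> (b - a)" using assms(4) by eventually_elim blast
  ultimately show ?thesis by (simp add: AE_iff_null_sets)
qed

lemma symmetric_difference_AE:
  assumes "(a - b) \<union> (b - a) \<in> null_sets P"
  shows "AE x in P. x \<in> a \<longleftrightarrow> x \<in> b"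
  using AE_not_in[OF assms] by eventually_elim blast

lemma AE_eq_of_mean:
  assumes P: "P \<in> \<P>" and h: "h \<in> borel_measurable symm" "\<And>x. x \<in> space M0 \<Longrightarrow> \<bar>h x\<bar> \<le> (B::real)"
    and k: "k \<in> borel_measurable symm" "\<And>x. x \<in> space M0 \<Longrightarrow> \<bar>k x\<bar> \<le> (B::real)"
    and eq: "\<And>Q. Q \<in> \<P> \<Longrightarrow> (\<integral>x. h x \<partial>Q) = (\<integral>x. k x \<partial>Q)"
  shows "AE x in P. h x = k x"
proof -
  have "AE x in P. h x - k x = 0"
  proof (rule boundedly_complete_symm[unfolded boundedly_complete_def, THEN conjunct2, rule_format, OF _ P], intro conjI ballI)
    show "(\<lambda>x. h x - k x) \<in> borel_measurable symm" using h(1) k(1) by measurable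
    show "bounded ((\<lambda>x. h x - k x) ` space symm)"
      unfolding bounded_iff
    proof (intro exI[of _ "B + B"] ballI)
      fix y assume "y \<in> (\<lambda>x. h x - k x) ` space symm"
      then obtain x where "x \<in> space M0" "y = h x - k x" by auto
      then show "norm y \<le> B + B" using h(2)[of x] k(2)[of x] by simp
    qed
    fix Q assume Q: "Q \<in> \<P>"
    have "integrable Q h" "integrable Q k"
      by (rule integrable_unit[OF Q measurable_symm_M0], fact, fact)+
    then show "(\<integral>x. h x - k x \<partial>Q) = 0" using eq[OF Q] by simp
  qed
  then show ?thesis by simp
qed

lemma measurable_subalgebra_M0:
  assumes "P \<in> \<P>" "subalgebra P S" "f \<in> borel_measurable S"
  shows "f \<in> borel_measurable M0"
  by (rule measurable_from_subalg[OF assms(2,3), unfolded measurable_P[OF assms(1)]])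

text \<open>The classical reason why a complete sufficient \<sigma>-field is minimal. The indicator
  of a symmetric event is projected to \<open>S\<close> and then back to \<open>symm\<close>. The
  result has the same means as the indicator and equals it by completeness, which forces the
  projection to \<open>S\<close> to be an indicator already.\<close>

lemma minimal_sufficient_symm: "minimal_sufficient \<P> symm"
  unfolding minimal_sufficient_def
proof (intro conjI allI impI)
  show "sufficient \<P> symm" by (rule sufficient_symm)
  fix S assume S: "sufficient \<P> S"
  have subS: "subalgebra P S" if "P \<in> \<P>" for P using S that by (simp add: sufficient_def)
  show "null_included \<P> symm S"
    unfolding null_included_def
  proof
    fix s assume s: "s \<in> sets symm"
    have sM[measurable]: "s \<in> sets M0"
      using s subalgebra_symm[OF P0] by (auto simp: subalgebra_def sets[OF P0])
    have "s \<in> (\<Inter>P\<in>\<P>. sets P)" using sM by (simp add: sets)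
    then obtain k where k: "k \<in> borel_measurable S" "\<And>P. P \<in> \<P> \<Longrightarrow> AE x in P. real_cond_exp P S (indicator s) x = k x"
      using S unfolding sufficient_def by blast
    \<comment> \<open>One version of the conditional probability of \<open>s\<close> given
      \<open>S\<close> that is valid under all measures, clipped so that its bounds hold
      everywhere.\<close>
    define f where "f x = max 0 (min 1 (k x))" for x
    have fS[measurable]: "f \<in> borel_measurable S" unfolding f_def using k(1) by measurable
    have fM[measurable]: "f \<in> borel_measurable M0" by (rule measurable_subalgebra_M0[OF P0 subS[OF P0] fS])
    have f01: "0 \<le> f x" "f x \<le> 1" for x by (auto simp: f_def)
    have ind: "integrable P (indicator s :: _ \<Rightarrow> real)" if P: "P \<in> \<P>" for P
      by (rule integrable_unit[OF P, of _ 1]) (auto simp: indicator_def)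
    have fi: "integrable P f" if P: "P \<in> \<P>" for P
      by (rule integrable_unit[OF P, of _ 1]) (use f01 in auto)
    have mean_f: "(\<integral>x. f x \<partial>P) = (\<integral>x. indicator s x \<partial>P)" if P: "P \<in> \<P>" for P
    proof -
      interpret P: prob_space P by (rule prob[OF P])
      interpret S: finite_measure_subalgebra P S by standard (rule subS[OF P])
      have [measurable_cong]: "sets P = sets M0" by (rule sets[OF P])
      have "AE x in P. real_cond_exp P S (indicator s) x \<ge> 0" "AE x in P. real_cond_exp P S (indicator s) x \<le> 1"
        by (rule S.real_cond_exp_ge_c[OF ind[OF P]], simp) (rule S.real_cond_exp_le_c[OF ind[OF P]], simp)
      then have "AE x in P. real_cond_exp P S (indicator s) x = f x"
        using k(2)[OF P] by eventually_elim (simp add: f_def)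
      then have "(\<integral>x. real_cond_exp P S (indicator s) x \<partial>P) = (\<integral>x. f x \<partial>P)"
        by (intro integral_cong_AE) auto
      then show ?thesis using S.real_cond_exp_int(2)[OF ind[OF P]] by simp
    qed
    obtain \<psi> :: "_ \<Rightarrow> real" where \<psi>: "\<psi> \<in> borel_measurable (obs_space n)" "\<And>z. 0 \<le> \<psi> z" "\<And>z. \<psi> z \<le> 1"
      "\<And>P. P \<in> \<P> \<Longrightarrow> AE x in P. f x = \<psi> (Z x)"
      using function_of_residuals[OF fM f01] by blast
    have av: "0 \<le> average n \<psi> z" "average n \<psi> z \<le> 1" for z by (rule average_bounds[OF \<psi>(2,3)])+
    have avm: "(\<lambda>x. average n \<psi> (Z x)) \<in> borel_measurable symm" by (rule measurable_average_symm[OF \<psi>(1)])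
    have avM[measurable]: "(\<lambda>x. average n \<psi> (Z x)) \<in> borel_measurable M0" by (rule measurable_symm_M0[OF avm])
    have ce: "AE x in P. real_cond_exp P symm f x = average n \<psi> (Z x)" if P: "P \<in> \<P>" for P
      by (rule cond_exp_average[OF P fM f01 \<psi>(1-3) \<psi>(4)[OF P]])
    have mean_av: "(\<integral>x. average n \<psi> (Z x) \<partial>P) = (\<integral>x. indicator s x \<partial>P)" if P: "P \<in> \<P>" for P
    proof -
      interpret P: prob_space P by (rule prob[OF P])
      interpret S: finite_measure_subalgebra P symm by standard (rule subalgebra_symm[OF P])
      have [measurable_cong]: "sets P = sets M0" by (rule sets[OF P])
      have "(\<integral>x. average n \<psi> (Z x) \<partial>P) = (\<integral>x. real_cond_exp P symm f x \<partial>P)"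
        using ce[OF P] by (intro integral_cong_AE) auto
      also have "\<dots> = (\<integral>x. f x \<partial>P)" by (rule S.real_cond_exp_int(2)[OF fi[OF P]])
      finally show ?thesis using mean_f[OF P] by simp
    qed
    have eq: "AE x in P. average n \<psi> (Z x) = indicator s x" if P: "P \<in> \<P>" for P
    proof (rule AE_eq_of_mean[OF P avm, of 1])
      show "indicator s \<in> borel_measurable symm" using s by measurable
    qed (use av mean_av in \<open>auto simp: indicator_def\<close>)
    show "\<exists>b\<in>sets S. \<forall>P\<in>\<P>. (s - b) \<union> (b - s) \<in> null_sets P"
    proof (intro bexI[of _ "{x\<in>space S. f x = 1}"] ballI)
      show b: "{x\<in>space S. f x = 1} \<in> sets S" by measurable
      fix P assume P: "P \<in> \<P>"
      interpret P: prob_space P by (rule prob[OF P])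
      interpret S: finite_measure_subalgebra P symm by standard (rule subalgebra_symm[OF P])
      have [measurable_cong]: "sets P = sets M0" by (rule sets[OF P])
      have spS: "space S = space P" using subS[OF P] by (simp add: subalgebra_def)
      \<comment> \<open>The integral of \<open>f\<close> over \<open>s\<close> is the probability of
        \<open>s\<close>, so \<open>f = 1\<close> on \<open>s\<close>; the total means agree as
        well, so \<open>f = 0\<close> off \<open>s\<close>.\<close>
      have "(\<integral>x\<in>s. f x \<partial>P) = (\<integral>x\<in>s. real_cond_exp P symm f x \<partial>P)"
        by (rule S.real_cond_exp_intA[OF fi[OF P] s])
      also have "\<dots> = (\<integral>x. indicator s x \<partial>P)"
        unfolding set_lebesgue_integral_def
      proof (rule integral_cong_AE)
        show "AE x in P. indicat_real s x *\<^sub>R real_cond_exp P symm f x = indicator s x"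
          using eq[OF P] ce[OF P] by eventually_elim (simp add: indicator_def)
      qed measurable
      finally have s1: "(\<integral>x. indicator s x * f x \<partial>P) = (\<integral>x. indicator s x \<partial>P)" by (simp add: set_lebesgue_integral_def)
      have i: "integrable P (\<lambda>x. indicator s x * f x)"
        by (rule integrable_unit[OF P, of _ 1]) (use f01 in \<open>auto simp: indicator_def\<close>)
      have "(\<integral>x. indicator s x - indicator s x * f x \<partial>P) = 0"
        using s1 Bochner_Integration.integral_diff[OF ind[OF P] i] by simp
      then have "AE x in P. indicator s x - indicator s x * f x = 0"
        using f01 Bochner_Integration.integrable_diff[OF ind[OF P] i]
        by (subst (asm) integral_nonneg_eq_0_iff_AE) (auto simp: indicator_def intro!: AE_I2)
      moreover have "(\<integral>x. f x - indicator s x * f x \<partial>P) = 0"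
        using s1 mean_f[OF P] Bochner_Integration.integral_diff[OF fi[OF P] i] by simp
      then have "AE x in P. f x - indicator s x * f x = 0"
        using f01 Bochner_Integration.integrable_diff[OF fi[OF P] i]
        by (subst (asm) integral_nonneg_eq_0_iff_AE) (auto simp: indicator_def intro!: AE_I2)
      ultimately have "AE x in P. x \<in> s \<longleftrightarrow> x \<in> {x\<in>space S. f x = 1}"
        using AE_space[of P] unfolding spS
      proof eventually_elim
        case (elim x) then show ?case by (cases "x \<in> s") auto
      qed
      moreover have "{x\<in>space S. f x = 1} \<in> sets M0"
        using b subS[OF P] by (auto simp: subalgebra_def sets[OF P])
      ultimately show "(s - {x\<in>space S. f x = 1}) \<union> ({x\<in>space S. f x = 1} - s) \<in> null_sets P"
        by (intro symmetric_difference_null[OF P sM])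
    qed
  qed
qed

text \<open>The projection of the indicator of \<open>a\<close> to \<open>symm\<close> has mean
  \<open>p\<close> under all measures, hence is the constant \<open>p\<close> by completeness. The
  claim concerns a single event of constant probability, because it will be applied to intersections
  with \<open>{R = r}\<close>.\<close>

lemma basu:
  assumes P: "P \<in> \<P>" and a: "a \<in> sets M0" and c: "\<And>Q. Q \<in> \<P> \<Longrightarrow> measure Q a = p" and s: "s \<in> sets symm"
  shows "measure P (a \<inter> s) = p * measure P s"
proof -
  interpret P: prob_space P by (rule prob[OF P])
  interpret S: finite_measure_subalgebra P symm by standard (rule subalgebra_symm[OF P])
  have [measurable_cong]: "sets P = sets M0" by (rule sets[OF P])
  have sM[measurable]: "s \<in> sets M0"
    using s subalgebra_symm[OF P] by (auto simp: subalgebra_def sets[OF P])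
  note a[measurable]
  have m: "(indicator a :: _ \<Rightarrow> real) \<in> borel_measurable M0" by measurable
  have ia: "integrable Q (indicator a :: _ \<Rightarrow> real)" if Q: "Q \<in> \<P>" for Q
    by (rule integrable_unit[OF Q, of _ 1]) (auto simp: indicator_def)
  have mean_a: "(\<integral>x. indicat_real a x \<partial>Q) = p" if "Q \<in> \<P>" for Q
    using c[OF that] a sets.sets_into_space[OF a] by (simp add: space_P[OF that] Int_absorb2)
  obtain \<psi> :: "_ \<Rightarrow> real" where \<psi>: "\<psi> \<in> borel_measurable (obs_space n)" "\<And>z. 0 \<le> \<psi> z" "\<And>z. \<psi> z \<le> 1"
    "\<And>P. P \<in> \<P> \<Longrightarrow> AE x in P. indicator a x = \<psi> (Z x)"
    using function_of_residuals[OF m indicator_pos_le indicator_le_1] by blast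
  have av: "0 \<le> average n \<psi> z" "average n \<psi> z \<le> 1" for z by (rule average_bounds[OF \<psi>(2,3)])+
  have avm: "(\<lambda>x. average n \<psi> (Z x)) \<in> borel_measurable symm" by (rule measurable_average_symm[OF \<psi>(1)])
  have avM[measurable]: "(\<lambda>x. average n \<psi> (Z x)) \<in> borel_measurable M0" by (rule measurable_symm_M0[OF avm])
  have ce: "AE x in Q. real_cond_exp Q symm (indicator a) x = average n \<psi> (Z x)" if Q: "Q \<in> \<P>" for Q
    by (rule cond_exp_average[OF Q m indicator_pos_le indicator_le_1 \<psi>(1-3) \<psi>(4)[OF Q]])
  have p01: "0 \<le> p" "p \<le> 1" using c[OF P] P.prob_le_1[of a] measure_nonneg[of P a] by auto
  have "AE x in P. average n \<psi> (Z x) = p"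
  proof (rule AE_eq_of_mean[OF P avm, of 1])
    fix Q assume Q: "Q \<in> \<P>"
    interpret Q: prob_space Q by (rule prob[OF Q])
    interpret SQ: finite_measure_subalgebra Q symm by standard (rule subalgebra_symm[OF Q])
    have [measurable_cong]: "sets Q = sets M0" by (rule sets[OF Q])
    have "(\<integral>x. average n \<psi> (Z x) \<partial>Q) = (\<integral>x. real_cond_exp Q symm (indicator a) x \<partial>Q)"
      using ce[OF Q] by (intro integral_cong_AE) auto
    also have "\<dots> = p" using SQ.real_cond_exp_int(2)[OF ia[OF Q]] mean_a[OF Q] by simp
    finally show "(\<integral>x. average n \<psi> (Z x) \<partial>Q) = (\<integral>x. p \<partial>Q)" by (simp add: Q.prob_space)
  qed (use av p01 in auto)
  then have eq: "AE x in P. real_cond_exp P symm (indicator a) x = p" using ce[OF P] by eventually_elim simp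
  have "measure P (a \<inter> s) = (\<integral>x\<in>s. indicator a x \<partial>P)"
    using sets.sets_into_space[OF a] by (simp add: set_lebesgue_integral_def indicator_inter_arith[symmetric] Int_commute space_P[OF P] Int_absorb2 le_infI2 flip: indicator_inter_arith)
  also have "\<dots> = (\<integral>x\<in>s. real_cond_exp P symm (indicator a) x \<partial>P)"
    by (rule S.real_cond_exp_intA[OF ia[OF P] s])
  also have "\<dots> = (\<integral>x. p * indicator s x \<partial>P)"
    unfolding set_lebesgue_integral_def
  proof (rule integral_cong_AE)
    show "AE x in P. indicat_real s x *\<^sub>R real_cond_exp P symm (indicator a) x = p * indicator s x"
      using eq by eventually_elim simp
  qed measurable
  also have "\<dots> = p * measure P s" using sets.sets_into_space[OF sM] by (simp add: space_P[OF P] Int_absorb2)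
  finally show ?thesis .
qed


section \<open>Ranks and maximal ancillarity\<close>

abbreviation "R x \<equiv> assignment n g (Z x)"

definition "ranked r = {x\<in>space M0. R x = r}"

lemma measurable_R [measurable]: "R \<in> measurable M0 (count_space (perms n))"
  by (rule measurable_compose[OF Z measurable_assignment])

lemma rank_event [measurable]: "{x\<in>space M0. R x \<in> T} \<in> sets M0"
proof -
  have "{x\<in>space M0. R x \<in> T} = R -` (T \<inter> perms n) \<inter> space M0" using assignment_perms by auto
  also have "\<dots> \<in> sets M0" by (rule measurable_sets[OF measurable_R]) auto
  finally show ?thesis .
qed

lemma ranked_sets [measurable]: "ranked r \<in> sets M0"
  using rank_event[of "{r}"] by (simp add: ranked_def)

lemma untied_residuals:
  assumes P: "P \<in> \<P>"
  shows "AE x in P. untied n g (Z x)"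
proof -
  obtain \<nu> where \<nu>: "prob_space \<nu>" "sets \<nu> = sets borel" "\<forall>A\<in>null_sets lborel. emeasure \<nu> A = 0"
    and d: "distr P (obs_space n) Z = PiM {..<n} (\<lambda>_. \<nu>)"
    using law[OF P] by blast
  have "AE z in distr P (obs_space n) Z. untied n g z"
    unfolding d using \<nu> by (intro untied_AE[OF g \<nu>(1,2)]) auto
  moreover have "Z \<in> measurable P (obs_space n)" unfolding measurable_P[OF P] by (rule Z)
  ultimately show ?thesis by (rule AE_distrD[rotated])
qed

text \<open>Composing the residuals with \<open>inv r' \<circ> r\<close> preserves their law and
  maps \<open>{R = r'}\<close> to \<open>{R = r}\<close> off the ties. Thus all n! atoms are equally
  likely.\<close>

lemma prob_ranked:
  assumes P: "P \<in> \<P>" and r: "r \<in> perms n"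
  shows "measure P (ranked r) = 1 / fact n"
proof -
  interpret P: prob_space P by (rule prob[OF P])
  have [measurable_cong]: "sets P = sets M0" by (rule sets[OF P])
  have sp: "space P = space M0" by (rule space_P[OF P])
  have eq: "P.prob (ranked r') = P.prob (ranked r)" if r': "r' \<in> perms n" for r'
  proof -
    define \<sigma> where "\<sigma> = inv r' \<circ> r"
    have s: "\<sigma> permutes {..<n}" unfolding \<sigma>_def using r r' by (intro permutes_compose permutes_inv) auto
    define N where "N = {z\<in>space (obs_space n). assignment n g z = r}"
    have "N = assignment n g -` {r} \<inter> space (obs_space n)" by (auto simp: N_def)
    also have "\<dots> \<in> sets (obs_space n)" by (rule measurable_sets[OF measurable_assignment]) (use r in auto)
    finally have N: "N \<in> sets (obs_space n)" .
    have m: "{x\<in>space M0. Z x \<circ> \<sigma> \<in> N} \<in> sets M0"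
      using measurable_sets[OF measurable_compose[OF Z measurable_permute[OF s]] N] by (simp add: vimage_def Int_def conj_commute)
    have "P.prob (ranked r') = P.prob {x\<in>space M0. Z x \<circ> \<sigma> \<in> N}"
    proof (rule P.finite_measure_eq_AE)
      show "AE x in P. x \<in> ranked r' \<longleftrightarrow> x \<in> {x\<in>space M0. Z x \<circ> \<sigma> \<in> N}"
        using untied_residuals[OF P] AE_space[of P]
      proof eventually_elim
        case (elim x)
        have xs: "x \<in> space M0" using elim sp by simp
        have "assignment n g (Z x \<circ> \<sigma>) = R x \<circ> \<sigma>" by (rule assignment_permute[OF s elim(1)])
        moreover have "R x \<circ> \<sigma> = r \<longleftrightarrow> R x = r'"
        proof
          assume "R x = r'"
          then show "R x \<circ> \<sigma> = r" using r' permutes_inv_o(1)[of r' "{..<n}"] by (simp add: \<sigma>_def comp_assoc[symmetric])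
        next
          assume a: "R x \<circ> \<sigma> = r"
          have "\<sigma> \<circ> inv r = inv r'" using r permutes_inv_o(1)[of r "{..<n}"] by (simp add: \<sigma>_def comp_assoc)
          then have "R x \<circ> inv r' = r \<circ> inv r" using a by (metis comp_assoc)
          also have "\<dots> = id" using r permutes_inv_o(1)[of r "{..<n}"] by simp
          finally have "R x \<circ> (inv r' \<circ> r') = r'" by (simp add: comp_assoc[symmetric])
          then show "R x = r'" using r' permutes_inv_o(2)[of r' "{..<n}"] by simp
        qed
        moreover have "Z x \<circ> \<sigma> \<in> space (obs_space n)" using permute_space[OF _ Z_space[OF xs], of \<sigma>] s by simp
        ultimately show ?case using xs by (simp add: ranked_def N_def)
      qed
    qed (use m in \<open>auto simp: sets[OF P]\<close>)
    also have "\<dots> = P.prob (pre N)" by (rule prob_permute[OF P s N])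
    also have "pre N = ranked r" using Z_space by (auto simp: pre_def N_def ranked_def)
    finally show ?thesis .
  qed
  have "1 = P.prob (\<Union>r'\<in>perms n. ranked r')"
  proof -
    have "(\<Union>r'\<in>perms n. ranked r') = space P" using assignment_perms by (auto simp: ranked_def sp)
    then show ?thesis using P.prob_space by simp
  qed
  also have "\<dots> = (\<Sum>r'\<in>perms n. P.prob (ranked r'))"
    by (rule P.finite_measure_finite_Union) (auto simp: finite_perms disjoint_family_on_def ranked_def sets[OF P])
  also have "\<dots> = fact n * P.prob (ranked r)" using eq by (simp add: card_perms)
  finally show ?thesis by (simp add: field_simps)
qed

lemma prob_rank_event:
  assumes P: "P \<in> \<P>" and T: "T \<subseteq> perms n"
  shows "measure P {x\<in>space M0. R x \<in> T} = card T / fact n"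
proof -
  interpret P: prob_space P by (rule prob[OF P])
  have fT: "finite T" by (rule finite_subset[OF T finite_perms])
  have "{x\<in>space M0. R x \<in> T} = (\<Union>r\<in>T. ranked r)" by (auto simp: ranked_def)
  then have "P.prob {x\<in>space M0. R x \<in> T} = P.prob (\<Union>r\<in>T. ranked r)" by simp
  also have "\<dots> = (\<Sum>r\<in>T. P.prob (ranked r))"
    by (rule P.finite_measure_finite_Union) (use ranked_sets in \<open>auto simp: fT disjoint_family_on_def ranked_def sets[OF P]\<close>)
  also have "\<dots> = (\<Sum>r\<in>T. 1 / fact n)" using T by (intro sum.cong prob_ranked[OF P]) auto
  finally show ?thesis by simp
qed

text \<open>On \<open>R = r\<close>, an event \<open>N \<subseteq> {R = r}\<close> is determined by the order statistic.\<close>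

lemma ranked_symmetrized:
  assumes r: "r \<in> perms n" and N: "N \<in> sets (obs_space n)" "\<And>z. z \<in> N \<Longrightarrow> assignment n g z = r"
  obtains C where "C \<in> symmetric_sets" "N \<subseteq> C" "\<And>P. P \<in> \<P> \<Longrightarrow> AE x in P. x \<in> ranked r \<inter> pre C \<longleftrightarrow> x \<in> pre N"
proof
  \<comment> \<open>The union of all rearrangements of \<open>N\<close>, the smallest symmetric
    event that contains it.\<close>
  define C where "C = (\<Union>\<sigma>\<in>perms n. {z\<in>space (obs_space n). z \<circ> \<sigma> \<in> N})"
  have C0: "z \<in> C \<longleftrightarrow> z \<in> space (obs_space n) \<and> (\<exists>\<sigma>\<in>perms n. z \<circ> \<sigma> \<in> N)" for z by (auto simp: C_def)
  have Cs: "C \<in> sets (obs_space n)"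
    unfolding C_def
  proof (intro sets.finite_UN finite_perms)
    fix \<sigma> assume "\<sigma> \<in> perms n"
    then show "{z\<in>space (obs_space n). z \<circ> \<sigma> \<in> N} \<in> sets (obs_space n)"
      using measurable_sets[OF measurable_permute N(1), of \<sigma>] by (simp add: vimage_def Int_def conj_commute)
  qed
  have sub: "z \<in> C" if z: "z \<in> space (obs_space n)" and t: "\<tau> \<in> perms n" and c: "z \<circ> \<tau> \<in> C" for z \<tau>
  proof -
    obtain \<sigma> where "\<sigma> \<in> perms n" "z \<circ> \<tau> \<circ> \<sigma> \<in> N" using c unfolding C0 by auto
    then have "\<tau> \<circ> \<sigma> \<in> perms n" "z \<circ> (\<tau> \<circ> \<sigma>) \<in> N" using t by (auto simp: comp_assoc intro: permutes_compose)
    then show ?thesis using z unfolding C0 by blast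
  qed
  show "C \<in> symmetric_sets"
    unfolding symmetric_sets_def
  proof (intro CollectI conjI ballI iffI Cs)
    fix \<sigma> and z :: "nat \<Rightarrow> real ^ 'd" assume s: "\<sigma> \<in> perms n" and z: "z \<in> space (obs_space n)"
    show "z \<circ> \<sigma> \<in> C \<Longrightarrow> z \<in> C" by (rule sub[OF z s])
    assume "z \<in> C"
    have i: "inv \<sigma> \<in> perms n" using s by (simp add: permutes_inv)
    have "(z \<circ> \<sigma>) \<circ> inv \<sigma> = z" using s permutes_inv_o(1)[of \<sigma> "{..<n}"] by (simp add: comp_assoc)
    then show "z \<circ> \<sigma> \<in> C" using sub[OF permute_space[OF s z] i] \<open>z \<in> C\<close> by simp
  qed
  show NC: "N \<subseteq> C"
  proof
    fix z assume "z \<in> N"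
    then have "z \<in> space (obs_space n)" "z \<circ> id \<in> N" using sets.sets_into_space[OF N(1)] by auto
    then show "z \<in> C" using id_perms unfolding C0 by blast
  qed
  fix P assume P: "P \<in> \<P>"
  show "AE x in P. x \<in> ranked r \<inter> pre C \<longleftrightarrow> x \<in> pre N"
    using untied_residuals[OF P]
  proof eventually_elim
    case (elim x)
    show ?case
    proof
      assume "x \<in> pre N"
      then show "x \<in> ranked r \<inter> pre C" using N(2) NC by (auto simp: pre_def ranked_def)
    next
      assume a: "x \<in> ranked r \<inter> pre C"
      then obtain \<sigma> where s: "\<sigma> permutes {..<n}" "Z x \<circ> \<sigma> \<in> N" by (auto simp: pre_def C0)
      \<comment> \<open>The residuals and their rearrangement by \<open>\<sigma>\<close> have the
        same optimal permutation \<open>r\<close>, so \<open>\<sigma>\<close> is the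
        identity.\<close>
      have "R x \<circ> \<sigma> = r" using N(2)[OF s(2)] assignment_permute[OF s(1) elim] by simp
      moreover have "R x = r" using a by (simp add: ranked_def)
      ultimately have "inv r \<circ> (r \<circ> \<sigma>) = inv r \<circ> r" by simp
      moreover have "inv r \<circ> r = id" using r permutes_inv_o(2)[of r "{..<n}"] by simp
      ultimately have "\<sigma> = id" by (simp only: o_assoc id_comp)
      then show "x \<in> pre N" using s(2) a by (simp add: pre_def)
    qed
  qed
qed

lemma ancillary_ranks:
  assumes A: "space A = space M0" "sets A = {{x\<in>space M0. R x \<in> T} | T. T \<subseteq> perms n}"
  shows "ancillary \<P> A"
  unfolding ancillary_def
proof (intro conjI ballI)
  show "subalgebra P A" if "P \<in> \<P>" for P
    using that by (auto simp: subalgebra_def A space_P sets rank_event)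
  show "measure P a = measure Q a" if "a \<in> sets A" "P \<in> \<P>" "Q \<in> \<P>" for a P Q
    using that by (auto simp: A prob_rank_event)
qed

text \<open>Let \<open>C\<close> be the symmetrization of the event inside \<open>{R = r}\<close>.
  By Basu's theorem for \<open>{R = r}\<close>, the probability of \<open>C\<close> is n! times
  \<open>p\<close>. By Basu's theorem for \<open>a \<inter> ranked r\<close>, which lies in
  \<open>C\<close> up to a null set, \<open>p\<close> equals \<open>p\<close> times that
  probability.\<close>

lemma ancillary_within_rank:
  assumes a: "a \<in> sets M0" "\<And>P. P \<in> \<P> \<Longrightarrow> measure P (a \<inter> ranked r) = p" and r: "r \<in> perms n"
  shows "p = 0 \<or> p = 1 / fact n"
proof -
  note a(1)[measurable]
  interpret P: prob_space P0 by (rule prob[OF P0])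
  have [measurable_cong]: "sets P0 = sets M0" by (rule sets[OF P0])
  have m: "(indicator a :: _ \<Rightarrow> real) \<in> borel_measurable M0" by measurable
  obtain \<psi> :: "_ \<Rightarrow> real" where \<psi>: "\<psi> \<in> borel_measurable (obs_space n)"
    "\<And>P. P \<in> \<P> \<Longrightarrow> AE x in P. indicator a x = \<psi> (Z x)"
    using function_of_residuals[OF m indicator_pos_le indicator_le_1] by blast
  define N where "N = {z\<in>space (obs_space n). \<psi> z = 1} \<inter> (assignment n g -` {r} \<inter> space (obs_space n))"
  have "assignment n g -` {r} \<inter> space (obs_space n) \<in> sets (obs_space n)"
    by (rule measurable_sets[OF measurable_assignment]) (use r in auto)
  moreover have "{z\<in>space (obs_space n). \<psi> z = 1} \<in> sets (obs_space n)" using \<psi>(1) by measurable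
  ultimately have N: "N \<in> sets (obs_space n)" unfolding N_def by (rule sets.Int[rotated])
  obtain C where C: "C \<in> symmetric_sets" "N \<subseteq> C" "\<And>P. P \<in> \<P> \<Longrightarrow> AE x in P. x \<in> ranked r \<inter> pre C \<longleftrightarrow> x \<in> pre N"
    by (rule ranked_symmetrized[OF r N]) (auto simp: N_def)
  have Cs: "pre C \<in> sets symm" using C(1) by (auto simp: sets_symm)
  have [measurable]: "pre C \<in> sets M0" "pre N \<in> sets M0" using pre_sets[OF N] pre_sets[OF symmetricD(1)[OF C(1)]] by auto
  have aN: "AE x in P0. x \<in> a \<inter> ranked r \<longleftrightarrow> x \<in> pre N"
    using \<psi>(2)[OF P0] AE_space[of P0]
  proof eventually_elim
    case (elim x)
    then have "x \<in> space M0" "x \<in> a \<longleftrightarrow> \<psi> (Z x) = 1" by (auto simp: space_P[OF P0] indicator_def split: if_splits)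
    then show ?case using Z_space by (auto simp: pre_def N_def ranked_def)
  qed
  have "p = P.prob (pre N)"
    using a(2)[OF P0] P.finite_measure_eq_AE[OF aN] by simp
  also have "\<dots> = P.prob (ranked r \<inter> pre C)"
    by (rule P.finite_measure_eq_AE[OF C(3)[OF P0], symmetric]) measurable
  also have "\<dots> = 1 / fact n * P.prob (pre C)"
    by (rule basu[OF P0 ranked_sets prob_ranked Cs]) (use r in auto)
  finally have pC: "P.prob (pre C) = fact n * p" by simp
  have "AE x in P0. x \<in> a \<inter> ranked r \<inter> pre C \<longleftrightarrow> x \<in> a \<inter> ranked r"
    using aN by eventually_elim (use C(2) in \<open>auto simp: pre_def\<close>)
  then have "P.prob (a \<inter> ranked r \<inter> pre C) = P.prob (a \<inter> ranked r)"
    by (rule P.finite_measure_eq_AE) measurable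
  moreover have "P.prob (a \<inter> ranked r \<inter> pre C) = p * P.prob (pre C)"
    by (rule basu[OF P0 _ a(2) Cs]) measurable
  ultimately have "p = p * (fact n * p)" using a(2)[OF P0] pC by simp
  then show ?thesis by (auto simp: field_simps)
qed

lemma maximal_ancillary_ranks:
  assumes A: "space A = space M0" "sets A = {{x\<in>space M0. R x \<in> T} | T. T \<subseteq> perms n}"
  shows "maximal_ancillary \<P> A"
  unfolding maximal_ancillary_def
proof (intro conjI allI impI)
  show "ancillary \<P> A" by (rule ancillary_ranks[OF A])
  fix A' assume A': "ancillary \<P> A' \<and> null_included \<P> A A'"
  have subA': "subalgebra P A'" if "P \<in> \<P>" for P using A' that unfolding ancillary_def by blast
  have A'M0: "a \<in> sets M0" if "a \<in> sets A'" for a using that subA'[OF P0] unfolding subalgebra_def sets[OF P0] by blast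
  have const: "measure P a = measure P0 a" if "a \<in> sets A'" "P \<in> \<P>" for a P
    using A' that P0 unfolding ancillary_def by blast
  show "null_included \<P> A' A"
    unfolding null_included_def
  proof
    fix a assume a: "a \<in> sets A'"
    have aM: "a \<in> sets M0" by (rule A'M0[OF a])
    \<comment> \<open>\<open>{R = r}\<close> agrees up to null sets with an event of
      \<open>A'\<close>, so that its intersection with \<open>a\<close> again has constant
      probability.\<close>
    have p: "measure P (a \<inter> ranked r) = measure P0 (a \<inter> ranked r)" if P: "P \<in> \<P>" and r: "r \<in> perms n" for P r
    proof -
      have "ranked r \<in> sets A" unfolding A(2) mem_Collect_eq by (rule exI[of _ "{r}"]) (use r in \<open>simp add: ranked_def\<close>)
      then obtain b where b: "b \<in> sets A'" "\<And>P. P \<in> \<P> \<Longrightarrow> (ranked r - b) \<union> (b - ranked r) \<in> null_sets P"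
        using A' unfolding null_included_def by blast
      have "measure Q (a \<inter> ranked r) = measure Q (a \<inter> b)" if Q: "Q \<in> \<P>" for Q
      proof -
        interpret Q: prob_space Q by (rule prob[OF Q])
        show ?thesis
        proof (rule Q.finite_measure_eq_AE)
          show "AE x in Q. x \<in> a \<inter> ranked r \<longleftrightarrow> x \<in> a \<inter> b"
            using symmetric_difference_AE[OF b(2)[OF Q]] by eventually_elim blast
        qed (use aM A'M0[OF b(1)] in \<open>auto simp: sets[OF Q]\<close>)
      qed
      then show ?thesis using const[OF sets.Int[OF a b(1)] P] P P0 by simp
    qed
    \<comment> \<open>The atoms that \<open>a\<close> fills almost surely. On every other atom it is
      null, by \<open>ancillary_within_rank\<close>.\<close>
    define T where "T = {r\<in>perms n. measure P0 (a \<inter> ranked r) = 1 / fact n}"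
    show "\<exists>b\<in>sets A. \<forall>P\<in>\<P>. (a - b) \<union> (b - a) \<in> null_sets P"
    proof (intro bexI[of _ "{x\<in>space M0. R x \<in> T}"] ballI)
      show "{x\<in>space M0. R x \<in> T} \<in> sets A" unfolding A(2) mem_Collect_eq by (rule exI[of _ T]) (auto simp: T_def)
      fix P assume P: "P \<in> \<P>"
      interpret P: prob_space P by (rule prob[OF P])
      have [measurable_cong]: "sets P = sets M0" by (rule sets[OF P])
      note aM[measurable]
      have r: "AE x in P. x \<in> ranked r \<longrightarrow> (x \<in> a \<longleftrightarrow> r \<in> T)" if r: "r \<in> perms n" for r
      proof (cases "r \<in> T")
        case True
        have "P.prob (ranked r - a \<inter> ranked r) = P.prob (ranked r) - P.prob (a \<inter> ranked r)"
          by (rule P.finite_measure_Diff) (auto simp: sets[OF P] aM)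
        also have "\<dots> = 0" using p[OF P r] prob_ranked[OF P r] True by (simp add: T_def)
        finally have "AE x in P. x \<notin> ranked r - a \<inter> ranked r"
          by (intro AE_not_in) (simp add: null_sets_def P.emeasure_eq_measure)
        then show ?thesis by eventually_elim (use True in auto)
      next
        case False
        have "P.prob (a \<inter> ranked r) = 0"
          using ancillary_within_rank[OF aM p r] p[OF P r] r False by (auto simp: T_def)
        then have "AE x in P. x \<notin> a \<inter> ranked r"
          by (intro AE_not_in) (simp add: null_sets_def P.emeasure_eq_measure)
        then show ?thesis by eventually_elim (use False in auto)
      qed
      have "AE x in P. \<forall>r\<in>perms n. x \<in> ranked r \<longrightarrow> (x \<in> a \<longleftrightarrow> r \<in> T)"
        by (intro AE_finite_allI finite_perms r)
      then have "AE x in P. x \<in> a \<longleftrightarrow> x \<in> {x\<in>space M0. R x \<in> T}"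
        using AE_space[of P]
      proof eventually_elim
        case (elim x)
        then have "x \<in> space M0" by (simp add: space_P[OF P])
        then have "x \<in> ranked (R x)" by (simp add: ranked_def)
        then show ?case using elim(1) assignment_perms[of n g "Z x"] \<open>x \<in> space M0\<close> by auto
      qed
      then show "(a - {x\<in>space M0. R x \<in> T}) \<union> ({x\<in>space M0. R x \<in> T} - a) \<in> null_sets P"
        by (intro symmetric_difference_null[OF P aM rank_event])
    qed
  qed
qed

end

section \<open>Unspecified density experiments\<close>

text \<open>Turns independence and marginal densities into a single equation between laws, in which
  uniqueness and tilts are easy to check. The condition \<open>n \<ge> 1\<close> excludes an empty
  family of variables.\<close>

lemma iid_with_density_iff:
  fixes Z :: "'a \<Rightarrow> nat \<Rightarrow> real ^ 'd" and f :: "real ^ 'd \<Rightarrow> real"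
  assumes n: "n \<ge> 1" and Q: "prob_space Q" and Z[measurable]: "Z \<in> measurable Q (obs_space n)"
    and f[measurable]: "f \<in> borel_measurable borel" and pf: "prob_space (density lborel (\<lambda>x. ennreal (f x)))"
  shows "iid_with_density n Q Z f \<longleftrightarrow> distr Q (obs_space n) Z = PiM {..<n} (\<lambda>_. density lborel (\<lambda>x. ennreal (f x)))"
proof -
  interpret Q: prob_space Q by (rule Q)
  have coord: "(\<lambda>x. Z x i) \<in> borel_measurable Q" if "i < n" for i
    using measurable_compose[OF Z measurable_component_singleton[of i "{..<n}" "\<lambda>_. borel"]] that by simp
  have ne: "{..<n} \<noteq> {}" using n by (metis lessThan_iff empty_iff less_eq_Suc_le One_nat_def)
  have "(\<lambda>i\<in>{..<n}. Z x i) = Z x" if "x \<in> space Q" for x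
    using measurable_space[OF Z that] by (auto simp: space_PiM PiE_def extensional_def fun_eq_iff)
  then have dr: "distr Q (obs_space n) (\<lambda>x. \<lambda>i\<in>{..<n}. Z x i) = distr Q (obs_space n) Z"
    by (intro distr_cong refl)
  have indep: "Q.indep_vars (\<lambda>_. borel) (\<lambda>i x. Z x i) {..<n} \<longleftrightarrow>
      distr Q (obs_space n) Z = PiM {..<n} (\<lambda>i. distr Q borel (\<lambda>x. Z x i))"
    using Q.indep_vars_iff_distr_eq_PiM'[OF ne, where M'="\<lambda>_. borel" and X="\<lambda>i x. Z x i"] coord unfolding dr by simp
  have dist: "distributed Q lborel (\<lambda>x. Z x i) (\<lambda>y. ennreal (f y)) \<longleftrightarrow> distr Q borel (\<lambda>x. Z x i) = density lborel (\<lambda>x. ennreal (f x))"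
    if "i < n" for i
    using coord[OF that] distr_cong[of Q Q lborel borel "\<lambda>x. Z x i" "\<lambda>x. Z x i"] by (simp add: distributed_def)
  show ?thesis
  proof
    assume i: "iid_with_density n Q Z f"
    then have "distr Q (obs_space n) Z = PiM {..<n} (\<lambda>i. distr Q borel (\<lambda>x. Z x i))"
      using indep by (simp add: iid_with_density_def)
    also have "\<dots> = PiM {..<n} (\<lambda>_. density lborel (\<lambda>x. ennreal (f x)))"
      using i dist by (intro PiM_cong refl) (auto simp: iid_with_density_def)
    finally show "distr Q (obs_space n) Z = PiM {..<n} (\<lambda>_. density lborel (\<lambda>x. ennreal (f x)))" .
  next
    assume d: "distr Q (obs_space n) Z = PiM {..<n} (\<lambda>_. density lborel (\<lambda>x. ennreal (f x)))"
    have c: "distr Q borel (\<lambda>x. Z x i) = density lborel (\<lambda>x. ennreal (f x))" if "i < n" for i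
    proof -
      have "distr Q borel (\<lambda>x. Z x i) = distr (distr Q (obs_space n) Z) borel (\<lambda>z. z i)"
        using that by (subst distr_distr) (auto simp: comp_def)
      also have "\<dots> = distr (PiM {..<n} (\<lambda>_. density lborel (\<lambda>x. ennreal (f x)))) (density lborel (\<lambda>x. ennreal (f x))) (\<lambda>z. z i)"
        unfolding d by (intro distr_cong refl) simp
      also have "\<dots> = density lborel (\<lambda>x. ennreal (f x))"
        using pf that by (intro distr_PiM_component[of "{..<n}"]) auto
      finally show ?thesis .
    qed
    have "PiM {..<n} (\<lambda>i. distr Q borel (\<lambda>x. Z x i)) = PiM {..<n} (\<lambda>_. density lborel (\<lambda>x. ennreal (f x)))"
      using c by (intro PiM_cong refl) auto
    then show "iid_with_density n Q Z f" using indep dist c d by (simp add: iid_with_density_def)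
  qed
qed

lemma density_PiM:
  assumes M: "prob_space M" "prob_space (density M h)" and h[measurable]: "h \<in> borel_measurable M" and I: "finite I"
  shows "density (PiM I (\<lambda>_. M)) (\<lambda>z. \<Prod>i\<in>I. h (z i)) = PiM I (\<lambda>_. density M h)"
proof -
  interpret M: prob_space M by (rule M)
  interpret H: prob_space "density M h" by (rule M)
  interpret PM: product_sigma_finite "\<lambda>_. M" by standard
  interpret PH: product_sigma_finite "\<lambda>_. density M h" by standard
  show ?thesis
  proof (rule PH.PiM_eqI[OF I])
    show "sets (density (PiM I (\<lambda>_. M)) (\<lambda>z. \<Prod>i\<in>I. h (z i))) = sets (PiM I (\<lambda>_. density M h))"
      by (simp cong: sets_PiM_cong)
    fix A assume "\<And>i. i \<in> I \<Longrightarrow> A i \<in> sets (density M h)"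
    then have A: "\<And>i. i \<in> I \<Longrightarrow> A i \<in> sets M" by simp
    have R: "Pi\<^sub>E I A \<in> sets (PiM I (\<lambda>_. M))" using A I by (intro sets_PiM_I_finite) auto
    have hm: "(\<lambda>z. \<Prod>i\<in>I. h (z i)) \<in> borel_measurable (PiM I (\<lambda>_. M))" by measurable
    have "emeasure (density (PiM I (\<lambda>_. M)) (\<lambda>z. \<Prod>i\<in>I. h (z i))) (Pi\<^sub>E I A)
       = (\<integral>\<^sup>+z. (\<Prod>i\<in>I. h (z i)) * indicator (Pi\<^sub>E I A) z \<partial>PiM I (\<lambda>_. M))"
      by (rule emeasure_density[OF hm R])
    also have "\<dots> = (\<integral>\<^sup>+z. (\<Prod>i\<in>I. h (z i) * indicator (A i) (z i)) \<partial>PiM I (\<lambda>_. M))"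
    proof (rule nn_integral_cong)
      fix z assume z: "z \<in> space (PiM I (\<lambda>_. M))"
      show "(\<Prod>i\<in>I. h (z i)) * indicator (Pi\<^sub>E I A) z = (\<Prod>i\<in>I. h (z i) * indicator (A i) (z i))"
      proof (cases "z \<in> Pi\<^sub>E I A")
        case True
        then have "(\<Prod>i\<in>I. h (z i) * indicator (A i) (z i)) = (\<Prod>i\<in>I. h (z i))" by (intro prod.cong refl) (auto dest: PiE_mem)
        then show ?thesis using True by simp
      next
        case False
        then obtain i where "i \<in> I" "z i \<notin> A i" using z by (auto simp: space_PiM PiE_iff)
        then have "(\<Prod>i\<in>I. h (z i) * indicator (A i) (z i)) = 0" using I by (intro prod_zero bexI[of _ i]) auto
        then show ?thesis using False by simp
      qed
    qed
    also have "\<dots> = (\<Prod>i\<in>I. \<integral>\<^sup>+x. h x * indicator (A i) x \<partial>M)"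
      using A I by (intro PM.product_nn_integral_prod) auto
    also have "\<dots> = (\<Prod>i\<in>I. emeasure (density M h) (A i))"
      using A by (intro prod.cong refl emeasure_density[symmetric]) auto
    finally show "emeasure (density (PiM I (\<lambda>_. M)) (\<lambda>z. \<Prod>i\<in>I. h (z i))) (Pi\<^sub>E I A) = (\<Prod>i\<in>I. emeasure (density M h) (A i))" .
  qed
qed

text \<open>The grid points are distinct, so the points assigned to the residuals determine the
  permutation. The generated \<sigma>-field is finite, with the nonempty events \<open>R = r\<close>
  as atoms.\<close>

lemma ranks_signs_algebra_sets:
  fixes g :: "nat \<Rightarrow> nat \<Rightarrow> real ^ 'd" and Z :: "nat \<Rightarrow> real ^ 'k \<Rightarrow> (nat \<Rightarrow> real ^ 'd) \<Rightarrow> nat \<Rightarrow> real ^ 'd"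
  assumes g: "inj_on (g n) {..<n}"
  shows "space (ranks_signs_algebra Z \<theta>0 g n) = space (obs_space n)"
    "sets (ranks_signs_algebra Z \<theta>0 g n) = {{x\<in>space (obs_space n). assignment n (g n) (Z n \<theta>0 x) \<in> T} | T. T \<subseteq> perms n}"
proof -
  define W where "W = (space (obs_space n) :: (nat \<Rightarrow> real ^ 'd) set)"
  define R where "R x = assignment n (g n) (Z n \<theta>0 x)" for x
  have Rp: "R x \<in> perms n" for x using assignment_perms by (simp add: R_def)
  have alg: "ranks_signs_algebra Z \<theta>0 g n = generated_algebra W {..<n} (\<lambda>i x. g n (R x i))"
    by (simp add: ranks_signs_algebra_def center_outward_assignment W_def R_def)
  show "space (ranks_signs_algebra Z \<theta>0 g n) = space (obs_space n)" by (simp add: alg W_def)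
  have vs: "sets (vimage_algebra W R (count_space (perms n))) = {{x\<in>W. R x \<in> T} | T. T \<subseteq> perms n}"
    using Rp by (subst sets_vimage_algebra2) (auto simp: vimage_def Int_def conj_commute)
  have "sets (generated_algebra W {..<n} (\<lambda>i x. g n (R x i))) = sets (vimage_algebra W R (count_space (perms n)))"
  proof (rule antisym)
    show "sets (generated_algebra W {..<n} (\<lambda>i x. g n (R x i))) \<subseteq> sets (vimage_algebra W R (count_space (perms n)))"
      unfolding sets_generated_algebra
    proof -
      have "(\<Union>i\<in>{..<n}. (\<lambda>A. (\<lambda>x. g n (R x i)) -` A \<inter> W) ` sets borel) \<subseteq> sets (vimage_algebra W R (count_space (perms n)))"
      proof (intro UN_least image_subsetI)
        fix i A
        have "(\<lambda>x. g n (R x i)) -` A \<inter> W = {x\<in>W. R x \<in> {r\<in>perms n. g n (r i) \<in> A}}" using Rp by auto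
        then show "(\<lambda>x. g n (R x i)) -` A \<inter> W \<in> sets (vimage_algebra W R (count_space (perms n)))"
          unfolding vs mem_Collect_eq by (intro exI[of _ "{r\<in>perms n. g n (r i) \<in> A}"]) auto
      qed
      from sets.sigma_sets_subset[OF this]
      show "sigma_sets W (\<Union>i\<in>{..<n}. (\<lambda>A. (\<lambda>x. g n (R x i)) -` A \<inter> W) ` sets borel) \<subseteq> sets (vimage_algebra W R (count_space (perms n)))"
        by simp
    qed
    show "sets (vimage_algebra W R (count_space (perms n))) \<subseteq> sets (generated_algebra W {..<n} (\<lambda>i x. g n (R x i)))"
    proof
      fix s assume "s \<in> sets (vimage_algebra W R (count_space (perms n)))"
      then obtain T where T: "T \<subseteq> perms n" "s = {x\<in>W. R x \<in> T}" unfolding vs by blast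
      have single: "{x\<in>W. R x = r} \<in> sets (generated_algebra W {..<n} (\<lambda>i x. g n (R x i)))" if r: "r \<in> perms n" for r
      proof -
        have "R x = r \<longleftrightarrow> (\<forall>i\<in>{..<n}. g n (R x i) = g n (r i))" for x
        proof
          assume h: "\<forall>i\<in>{..<n}. g n (R x i) = g n (r i)"
          show "R x = r"
          proof
            fix i
            have R: "R x permutes {..<n}" "r permutes {..<n}" using Rp r by auto
            show "R x i = r i"
            proof (cases "i < n")
              case True
              then have "R x i \<in> {..<n}" "r i \<in> {..<n}" using permutes_in_image[OF R(1), of i] permutes_in_image[OF R(2), of i] by auto
              then show ?thesis using h True g by (auto dest: inj_onD)
            next
              case False
              then show ?thesis using R by (simp add: permutes_def)
            qed
          qed
        qed simp
        then have "{x\<in>W. R x = r} = {x\<in>W. \<forall>i\<in>{..<n}. g n (R x i) = g n (r i)}" by simp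
        also have "\<dots> = {x\<in>space (generated_algebra W {..<n} (\<lambda>i x. g n (R x i))). \<forall>i\<in>{..<n}. g n (R x i) = g n (r i)}" by simp
        also have "\<dots> \<in> sets (generated_algebra W {..<n} (\<lambda>i x. g n (R x i)))"
        proof (rule sets.sets_Collect_finite_All)
          fix i assume "i \<in> {..<n}"
          from measurable_sets[OF measurable_generated_algebra[OF this, of "\<lambda>i x. g n (R x i)" W], of "{g n (r i)}"]
          show "{x\<in>space (generated_algebra W {..<n} (\<lambda>i x. g n (R x i))). g n (R x i) = g n (r i)} \<in> sets (generated_algebra W {..<n} (\<lambda>i x. g n (R x i)))"
            by (simp add: vimage_def Int_def conj_commute)
        qed simp
        finally show ?thesis .
      qed
      have "s = (\<Union>r\<in>T. {x\<in>W. R x = r})" unfolding T(2) by auto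
      also have "\<dots> \<in> sets (generated_algebra W {..<n} (\<lambda>i x. g n (R x i)))"
        using T(1) finite_subset[OF T(1) finite_perms] by (intro sets.finite_UN single) auto
      finally show "s \<in> sets (generated_algebra W {..<n} (\<lambda>i x. g n (R x i)))" .
    qed
  qed
  then show "sets (ranks_signs_algebra Z \<theta>0 g n) = {{x\<in>space (obs_space n). assignment n (g n) (Z n \<theta>0 x) \<in> T} | T. T \<subseteq> perms n}"
    unfolding alg vs by (simp add: W_def R_def)
qed

lemma measurable_rank_function:
  assumes "n \<ge> 1 \<Longrightarrow> inj_on (g n) {..<n}"
  shows "(\<lambda>x. \<phi> (assignment n (g n) (Z n \<theta>0 x))) \<in> borel_measurable (ranks_signs_algebra Z \<theta>0 g n)"
proof -
  \<comment> \<open>Weak convergence asks for measurability at \<open>n = 0\<close> too, where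
    injectivity on the empty set is trivial.\<close>
  have "inj_on (g n) {..<n}" using assms by (cases n) auto
  note A = ranks_signs_algebra_sets[where Z=Z and ?\<theta>0.0=\<theta>0 and g=g and n=n, OF this]
  show ?thesis
  proof (rule measurableI)
    fix B
    have "(\<lambda>x. \<phi> (assignment n (g n) (Z n \<theta>0 x))) -` B \<inter> space (ranks_signs_algebra Z \<theta>0 g n)
       = {x\<in>space (obs_space n). assignment n (g n) (Z n \<theta>0 x) \<in> {r\<in>perms n. \<phi> r \<in> B}}"
      unfolding A(1) using assignment_perms by auto
    then show "(\<lambda>x. \<phi> (assignment n (g n) (Z n \<theta>0 x))) -` B \<inter> space (ranks_signs_algebra Z \<theta>0 g n) \<in> sets (ranks_signs_algebra Z \<theta>0 g n)"
      unfolding A(2) mem_Collect_eq by (intro exI[of _ "{r\<in>perms n. \<phi> r \<in> B}"]) auto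
  qed simp
qed

section \<open>The nuisance class and its bounded tilts\<close>

locale density_experiment =
  fixes P :: "nat \<Rightarrow> real ^ 'k \<Rightarrow> (real ^ 'd \<Rightarrow> real) \<Rightarrow> (nat \<Rightarrow> real ^ 'd) measure"
    and Z :: "nat \<Rightarrow> real ^ 'k \<Rightarrow> (nat \<Rightarrow> real ^ 'd) \<Rightarrow> nat \<Rightarrow> real ^ 'd"
    and F :: "(real ^ 'd \<Rightarrow> real) set" and \<theta>0 :: "real ^ 'k" and f0 :: "real ^ 'd \<Rightarrow> real"
  assumes densities: "unspecified_density_experiments P Z F" and f0: "f0 \<in> F"
    and nuisance: "nuisance_parametrization F f0"
begin

lemma
  assumes "f \<in> F"
  shows F_measurable: "f \<in> borel_measurable borel" and F_nonneg: "0 \<le> f x" and F_integral: "has_bochner_integral lborel f 1"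
  using densities assms unfolding unspecified_density_experiments_def by blast+

lemma
  assumes "n \<ge> 1"
  shows Z_measurable: "Z n \<theta> \<in> measurable (obs_space n) (obs_space n)"
    and P_prob: "f \<in> F \<Longrightarrow> prob_space (P n \<theta> f)" and P_sets: "f \<in> F \<Longrightarrow> sets (P n \<theta> f) = sets (obs_space n)"
    and P_iff: "f \<in> F \<Longrightarrow> prob_space Q \<Longrightarrow> sets Q = sets (obs_space n) \<Longrightarrow> Q = P n \<theta> f \<longleftrightarrow> iid_with_density n Q (Z n \<theta>) f"
    and P_ac: "f \<in> F \<Longrightarrow> f' \<in> F \<Longrightarrow> absolutely_continuous (P n \<theta> f) (P n \<theta>' f')"
  using densities assms unfolding unspecified_density_experiments_def by blast+

abbreviation "law_of f \<equiv> density lborel (\<lambda>x. ennreal (f x))"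

lemma law_of_prob: "f \<in> F \<Longrightarrow> prob_space (law_of f)"
proof (rule prob_spaceI)
  assume f: "f \<in> F"
  have "emeasure (law_of f) (space (law_of f)) = (\<integral>\<^sup>+x. ennreal (f x) \<partial>lborel)"
    using F_measurable[OF f] by (simp add: emeasure_density)
  also have "\<dots> = ennreal (\<integral>x. f x \<partial>lborel)"
    using F_integral[OF f] F_nonneg[OF f] by (intro nn_integral_eq_integral) (auto simp: has_bochner_integral_iff)
  finally show "emeasure (law_of f) (space (law_of f)) = 1" using F_integral[OF f] by (simp add: has_bochner_integral_iff)
qed

lemma P_iff_distr:
  assumes n: "n \<ge> 1" and f: "f \<in> F" and Q: "prob_space Q" "sets Q = sets (obs_space n)"
  shows "Q = P n \<theta> f \<longleftrightarrow> distr Q (obs_space n) (Z n \<theta>) = PiM {..<n} (\<lambda>_. law_of f)"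
proof -
  have "Z n \<theta> \<in> measurable Q (obs_space n)"
    unfolding measurable_cong_sets[OF Q(2) refl] by (rule Z_measurable[OF n])
  then show ?thesis
    unfolding P_iff[OF n f Q] using F_measurable[OF f] law_of_prob[OF f] by (intro iid_with_density_iff n Q)
qed

lemma P_distr: "n \<ge> 1 \<Longrightarrow> f \<in> F \<Longrightarrow> distr (P n \<theta> f) (obs_space n) (Z n \<theta>) = PiM {..<n} (\<lambda>_. law_of f)"
  using P_iff_distr[of n f "P n \<theta> f" \<theta>] P_prob P_sets by blast

lemma local_density_origin: "local_density f0 n (\<lambda>_. 0) = f0"
  by (simp add: local_density_def fun_eq_iff)

lemma origin_local_params: "origin_param \<in> local_params F f0 n"
  by (simp add: local_params_def zero_score local_density_origin f0)

lemma local_experiment_origin: "local_experiment P \<theta>0 f0 n origin_param = P n \<theta>0 f0"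
  by (simp add: local_experiment_def local_density_origin)

lemma nuisance_experiment_eq:
  "nuisance_experiment P F \<theta>0 f0 n = {P n \<theta>0 (local_density f0 n \<eta>) | \<eta>. \<eta> \<in> score_space f0 \<and> local_density f0 n \<eta> \<in> F}"
  by (simp add: nuisance_experiment_def local_experiment_def local_params_def)

lemma nuisance_experiment_cases:
  assumes "Q \<in> nuisance_experiment P F \<theta>0 f0 n"
  obtains f where "f \<in> F" "Q = P n \<theta>0 f"
  using assms unfolding nuisance_experiment_eq by blast

text \<open>The density proportional to \<open>h * f0\<close> is a local density. Its score is
  bounded, hence square integrable, and the lower bound on \<open>h\<close> makes the density
  positive wherever \<open>f0\<close> is.\<close>

lemma bounded_tilt:
  assumes n: "n \<ge> 1" and h[measurable]: "h \<in> borel_measurable borel" and bnd: "\<And>x. 1 \<le> h x" "\<And>x. h x \<le> (B::real)"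
  shows "\<exists>c>0. density (P n \<theta>0 f0) (\<lambda>x. ennreal ((\<Prod>i<n. h (Z n \<theta>0 x i)) / c)) \<in> nuisance_experiment P F \<theta>0 f0 n"
proof -
  note [measurable] = F_measurable[OF f0] Z_measurable[OF n, of \<theta>0]
  have f0i: "integrable lborel f0" "(\<integral>x. f0 x \<partial>lborel) = 1" using F_integral[OF f0] by (auto simp: has_bochner_integral_iff)
  have bi: "integrable lborel (\<lambda>x. k x * f0 x)" if k[measurable]: "k \<in> borel_measurable borel" and K: "\<And>x. \<bar>k x\<bar> \<le> K" for k K
  proof (rule Bochner_Integration.integrable_bound[OF integrable_mult_right[OF f0i(1), of K]])
    show "AE x in lborel. norm (k x * f0 x) \<le> norm (K * f0 x)"
      using K F_nonneg[OF f0] by (intro AE_I2) (auto simp: abs_mult intro!: mult_right_mono order_trans[OF K])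
  qed measurable
  have hb: "\<bar>h x\<bar> \<le> B" "0 < h x" for x using bnd[of x] by auto
  define c where "c = (\<integral>x. h x * f0 x \<partial>lborel)"
  have "(\<integral>x. f0 x \<partial>lborel) \<le> c"
    unfolding c_def using bi[OF h hb(1)] f0i(1) bnd(1) F_nonneg[OF f0] by (intro integral_mono) (use mult_right_mono[of 1] in fastforce)+
  then have c: "c \<ge> 1" using f0i(2) by simp
  \<comment> \<open>The solution of \<open>(1 + \<eta> / sqrt n) * f0 = h * f0 / c\<close>.\<close>
  define \<eta> where "\<eta> x = sqrt (real n) * (h x / c - 1)" for x
  have [measurable]: "\<eta> \<in> borel_measurable borel" unfolding \<eta>_def by measurable
  have \<eta>b: "\<bar>\<eta> x\<bar> \<le> sqrt (real n) * (B + 1)" for x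
  proof -
    have "0 < h x / c" using hb(2)[of x] c by simp
    then have "\<bar>h x / c - 1\<bar> \<le> h x / c + 1" by linarith
    also have "h x / c \<le> B" using c bnd[of x] by (simp add: divide_le_eq) (smt (verit) mult_le_cancel_left1)
    finally show ?thesis by (simp add: \<eta>_def abs_mult mult_left_mono)
  qed
  have "(\<integral>x. \<eta> x * f0 x \<partial>lborel) = (\<integral>x. sqrt (real n) * ((h x * f0 x) / c - f0 x) \<partial>lborel)"
    by (intro Bochner_Integration.integral_cong refl) (simp add: \<eta>_def algebra_simps)
  also have "\<dots> = sqrt (real n) * (c / c - 1)"
    using bi[OF h hb(1)] f0i by (simp add: c_def)
  also have "\<dots> = 0" using c by simp
  finally have mean: "(\<integral>x. \<eta> x * f0 x \<partial>lborel) = 0" .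
  have "\<bar>(\<eta> x)\<^sup>2\<bar> \<le> (sqrt (real n) * (B + 1))\<^sup>2" for x
    using power_mono[OF \<eta>b[of x] abs_ge_zero, of 2] by simp
  then have "integrable lborel (\<lambda>x. (\<eta> x)\<^sup>2 * f0 x)" by (intro bi) measurable
  then have score: "\<eta> \<in> score_space f0"
    using mean bi[of \<eta>, OF _ \<eta>b] by (simp add: score_space_def has_bochner_integral_iff)
  have ld: "local_density f0 n \<eta> = (\<lambda>x. h x / c * f0 x)"
    using n by (auto simp: local_density_def \<eta>_def fun_eq_iff)
  have F1: "local_density f0 n \<eta> \<in> F"
  proof -
    have "0 \<le> local_density f0 n \<eta> x" "0 < f0 x \<Longrightarrow> 0 < local_density f0 n \<eta> x" for x
      using c hb(2)[of x] F_nonneg[OF f0, of x] by (simp_all add: ld)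
    then show ?thesis using nuisance n score unfolding nuisance_parametrization_def by auto
  qed
  define k where "k x = ennreal (h x / c)" for x
  have km: "k \<in> borel_measurable borel" unfolding k_def by measurable
  have dens: "law_of (local_density f0 n \<eta>) = density (law_of f0) k"
  proof -
    have "density (law_of f0) k = density lborel (\<lambda>x. ennreal (f0 x) * k x)"
      using km by (intro density_density_eq) auto
    also have "(\<lambda>x. ennreal (f0 x) * k x) = (\<lambda>x. ennreal (local_density f0 n \<eta> x))"
      using c hb(2) F_nonneg[OF f0] by (auto simp: fun_eq_iff k_def ld ennreal_mult'[symmetric] mult.commute less_imp_le)
    finally show ?thesis ..
  qed
  \<comment> \<open>One factor \<open>c\<close> for each of the \<open>n\<close> residuals.\<close>
  define Q where "Q = density (P n \<theta>0 f0) (\<lambda>x. ennreal ((\<Prod>i<n. h (Z n \<theta>0 x i)) / c ^ n))"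
  have sQ: "sets Q = sets (obs_space n)" by (simp add: Q_def P_sets[OF n f0])
  have ZP: "Z n \<theta>0 \<in> measurable (P n \<theta>0 f0) (obs_space n)"
    unfolding measurable_cong_sets[OF P_sets[OF n f0] refl] by measurable
  have pk: "(\<lambda>z. \<Prod>i<n. k (z i)) \<in> borel_measurable (obs_space n)" using km by measurable
  have "Q = density (P n \<theta>0 f0) (\<lambda>x. \<Prod>i<n. k (Z n \<theta>0 x i))"
    unfolding Q_def k_def using c hb(2)
    by (subst prod_ennreal) (auto simp: prod_dividef intro!: divide_nonneg_nonneg less_imp_le)
  then have "distr Q (obs_space n) (Z n \<theta>0) = density (distr (P n \<theta>0 f0) (obs_space n) (Z n \<theta>0)) (\<lambda>z. \<Prod>i<n. k (z i))"
    using density_distr[OF pk ZP] by simp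
  also have "\<dots> = density (PiM {..<n} (\<lambda>_. law_of f0)) (\<lambda>z. \<Prod>i<n. k (z i))" by (simp only: P_distr[OF n f0])
  also have "\<dots> = PiM {..<n} (\<lambda>_. density (law_of f0) k)"
    using law_of_prob[OF f0] law_of_prob[OF F1] km by (intro density_PiM) (auto simp: dens)
  finally have dQ: "distr Q (obs_space n) (Z n \<theta>0) = PiM {..<n} (\<lambda>_. law_of (local_density f0 n \<eta>))" unfolding dens .
  have "prob_space (PiM {..<n} (\<lambda>_. law_of (local_density f0 n \<eta>)))"
    by (rule prob_space_PiM) (rule law_of_prob[OF F1])
  then have "prob_space (distr Q (obs_space n) (Z n \<theta>0))" unfolding dQ .
  \<comment> \<open>The total mass is read off from the law of the residuals, already known to be a
    product of probability measures.\<close>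
  then have "prob_space Q"
    by (rule prob_space_distrD[rotated]) (use ZP in \<open>simp add: Q_def\<close>)
  then have "Q = P n \<theta>0 (local_density f0 n \<eta>)" using P_iff_distr[OF n F1 _ sQ] dQ by simp
  then have "Q \<in> nuisance_experiment P F \<theta>0 f0 n" unfolding nuisance_experiment_eq using score F1 by blast
  then show ?thesis unfolding Q_def using c by (intro exI[of _ "c ^ n"]) simp
qed

lemma residual_experiment_nuisance:
  assumes n: "n \<ge> 1" and g: "inj_on g {..<n}"
  shows "residual_experiment n g (obs_space n) (Z n \<theta>0) (nuisance_experiment P F \<theta>0 f0 n) (P n \<theta>0 f0)"
proof (rule residual_experiment.intro)
  show "P n \<theta>0 f0 \<in> nuisance_experiment P F \<theta>0 f0 n"
    unfolding nuisance_experiment_eq mem_Collect_eq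
    by (rule exI[of _ "\<lambda>_. 0"]) (simp add: local_density_origin zero_score f0)
  show "Z n \<theta>0 \<in> measurable (obs_space n) (obs_space n)" by (rule Z_measurable[OF n])
  show "inj_on g {..<n}" by (rule g)
next
  fix Q assume Q: "Q \<in> nuisance_experiment P F \<theta>0 f0 n"
  then obtain f where f: "f \<in> F" "Q = P n \<theta>0 f" by (rule nuisance_experiment_cases)
  show "prob_space Q" unfolding f(2) by (rule P_prob[OF n f(1)])
  show "sets Q = sets (obs_space n)" unfolding f(2) by (rule P_sets[OF n f(1)])
  have "\<forall>A\<in>null_sets lborel. emeasure (law_of f) A = 0"
    using absolutely_continuousI_density[of "\<lambda>x. ennreal (f x)" lborel] F_measurable[OF f(1)]
    by (auto simp: absolutely_continuous_def null_sets_def)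
  then show "\<exists>\<nu>. prob_space \<nu> \<and> sets \<nu> = sets borel \<and> (\<forall>A\<in>null_sets lborel. emeasure \<nu> A = 0) \<and>
      distr Q (obs_space n) (Z n \<theta>0) = PiM {..<n} (\<lambda>_. \<nu>)"
    using law_of_prob[OF f(1)] P_distr[OF n f(1), of \<theta>0] unfolding f(2) by (intro exI[of _ "law_of f"]) simp
  fix Q' :: "(nat \<Rightarrow> real ^ 'd) measure" assume Q': "prob_space Q'" "sets Q' = sets Q" "distr Q' (obs_space n) (Z n \<theta>0) = distr Q (obs_space n) (Z n \<theta>0)"
  have "sets Q' = sets (obs_space n)" using Q'(2) P_sets[OF n f(1)] f(2) by simp
  then show "Q' = Q"
    unfolding f(2) P_iff_distr[OF n f(1) Q'(1)] using Q'(3) P_distr[OF n f(1), of \<theta>0] f(2) by (simp add: P_iff_distr[OF n f(1) Q'(1)])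
next
  fix Q Q' assume "Q \<in> nuisance_experiment P F \<theta>0 f0 n" "Q' \<in> nuisance_experiment P F \<theta>0 f0 n"
  then obtain f f' where "f \<in> F" "Q = P n \<theta>0 f" "f' \<in> F" "Q' = P n \<theta>0 f'" by (auto elim!: nuisance_experiment_cases)
  then show "null_sets Q \<subseteq> null_sets Q'" using P_ac[OF n, of f f' \<theta>0 \<theta>0] by (simp add: absolutely_continuous_def)
next
  fix A :: "nat \<Rightarrow> (real ^ 'd) set" and T assume A: "\<And>j. A j \<in> sets borel" and T: "T \<subseteq> {..<n}"
  note A[measurable]
  \<comment> \<open>The tilting function lies between 1 and \<open>1 + card T\<close>, as
    \<open>bounded_tilt\<close> requires.\<close>
  have "(\<Sum>j\<in>T. indicator (A j) x) \<le> of_nat (card T) * (1::real)" for x by (rule sum_bounded_above) simp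
  then show "\<exists>c>0. density (P n \<theta>0 f0) (\<lambda>x. ennreal ((\<Prod>i<n. 1 + (\<Sum>j\<in>T. indicator (A j) (Z n \<theta>0 x i))) / c)) \<in> nuisance_experiment P F \<theta>0 f0 n"
    by (intro bounded_tilt[OF n, of _ "1 + card T"]) (auto intro: sum_nonneg)
qed

end

lemma (in density_experiment) eventual_params_cases:
  assumes "p \<in> eventual_params (local_params F f0)"
  shows "\<forall>\<^sub>F n in sequentially. n \<ge> 1 \<and> (\<exists>\<theta> f. f \<in> F \<and> local_experiment P \<theta>0 f0 n p = P n \<theta> f)"
proof -
  have "\<forall>\<^sub>F n in sequentially. p \<in> local_params F f0 n" using assms by (simp add: eventual_params_def)
  then show ?thesis using eventually_ge_at_top[of 1]
  proof eventually_elim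
    case (elim n)
    then show ?case by (cases p) (auto simp: local_params_def local_experiment_def)
  qed
qed

lemma (in density_experiment) rank_realization_local:
  assumes g: "\<And>n. n \<ge> 1 \<Longrightarrow> inj_on (g n) {..<n}"
    and LAN: "experiments_converge (local_experiment P \<theta>0 f0) (local_params F f0) origin_param D"
    and D: "prob_space (D origin_param)"
  shows "rank_realization (local_experiment P \<theta>0 f0) (local_params F f0) origin_param D
    perms (\<lambda>n x. assignment n (g n) (Z n \<theta>0 x))"
proof (rule rank_realization.intro)
  show j0: "origin_param \<in> eventual_params (local_params F f0)"
    by (simp add: eventual_params_def origin_local_params)
  show "\<forall>\<^sub>F n in sequentially. prob_space (local_experiment P \<theta>0 f0 n j)"
    if "j \<in> eventual_params (local_params F f0)" for j
    using eventual_params_cases[OF that] by eventually_elim (auto simp: P_prob)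
  show "\<forall>\<^sub>F n in sequentially. absolutely_continuous (local_experiment P \<theta>0 f0 n origin_param) (local_experiment P \<theta>0 f0 n j) \<and>
      sets (local_experiment P \<theta>0 f0 n j) = sets (local_experiment P \<theta>0 f0 n origin_param)"
    if "j \<in> eventual_params (local_params F f0)" for j
    using eventual_params_cases[OF that]
    by eventually_elim (auto simp: local_experiment_origin P_sets P_ac f0)
  show "\<forall>\<^sub>F n in sequentially. finite (perms n) \<and>
      (\<lambda>x. assignment n (g n) (Z n \<theta>0 x)) \<in> measurable (local_experiment P \<theta>0 f0 n origin_param) (count_space (perms n)) \<and>
      (\<forall>a\<in>perms n. measure (local_experiment P \<theta>0 f0 n origin_param)
         {w\<in>space (local_experiment P \<theta>0 f0 n origin_param). assignment n (g n) (Z n \<theta>0 w) = a} = 1 / real (card (perms n)))"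
    using eventually_ge_at_top[of 1]
  proof eventually_elim
    case (elim n)
    interpret residual_experiment n "g n" "obs_space n" "Z n \<theta>0" "nuisance_experiment P F \<theta>0 f0 n" "P n \<theta>0 f0"
      by (rule residual_experiment_nuisance[OF elim g[OF elim]])
    show ?case
      unfolding local_experiment_origin measurable_P[OF P0] space_P[OF P0]
      using prob_ranked[OF P0] measurable_R by (simp add: finite_perms card_perms ranked_def)
  qed
  show "filterlim (\<lambda>n. card (perms n)) at_top sequentially"
    unfolding card_perms by (rule filterlim_at_top_mono[OF filterlim_ident]) (simp add: fact_ge_self)
qed (use LAN D in auto)

theorem proposition4p1:
  fixes P :: "nat \<Rightarrow> real ^ 'k \<Rightarrow> (real ^ 'd \<Rightarrow> real) \<Rightarrow> (nat \<Rightarrow> real ^ 'd) measure"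
    and Z :: "nat \<Rightarrow> real ^ 'k \<Rightarrow> (nat \<Rightarrow> real ^ 'd) \<Rightarrow> nat \<Rightarrow> real ^ 'd"
    and F :: "(real ^ 'd \<Rightarrow> real) set"
    and \<theta>0 :: "real ^ 'k"
    and f0 :: "real ^ 'd \<Rightarrow> real"
    and III :: "real ^ 'k ^ 'k"
    and II :: "(real ^ 'd \<Rightarrow> real) \<Rightarrow> real ^ 'k"
    and \<Omega> :: "'w set"
    and D :: "('k, 'd) param \<Rightarrow> 'w measure"
    and \<Delta>int :: "real \<Rightarrow> 'w \<Rightarrow> real ^ 'k"
    and \<Delta>nuis :: "(real ^ 'd \<Rightarrow> real) \<Rightarrow> real \<Rightarrow> 'w \<Rightarrow> real"
    and nR nS n0 :: "nat \<Rightarrow> nat"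
    and g :: "nat \<Rightarrow> nat \<Rightarrow> real ^ 'd"
  assumes "unspecified_density_experiments P Z F"
    and "f0 \<in> F"
    and "nuisance_parametrization F f0"
    and "separable_scores f0"
    and "brownian_drift_experiment f0 III II \<Omega> D \<Delta>int \<Delta>nuis"
    and LAN: "experiments_converge (local_experiment P \<theta>0 f0) (local_params F f0) origin_param D"
    and "\<And>n. n \<ge> 1 \<Longrightarrow> center_outward_grid n (nR n) (nS n) (n0 n) (g n)"
    and "conv_in_dist (\<lambda>n. uniform_count_measure {..<n}) g spherical_uniform (\<lambda>x. x)"
  shows "algebras_weakly_converge (local_experiment P \<theta>0 f0) (local_params F f0) origin_param D
           (ranks_signs_algebra Z \<theta>0 g) (bridge_algebra f0 \<Omega> \<Delta>nuis)
       \<and> strongly_maximal_ancillary (nuisance_experiment P F \<theta>0 f0)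
           (local_experiment P \<theta>0 f0) (local_params F f0) origin_param D
           (ranks_signs_algebra Z \<theta>0 g) (bridge_algebra f0 \<Omega> \<Delta>nuis)"
proof -
  interpret density_experiment P Z F \<theta>0 f0 by standard fact+
  interpret drift: drift_experiment f0 III II \<Omega> D \<Delta>int \<Delta>nuis
    using assms(5) F_measurable[OF f0] F_nonneg[OF f0] by (intro drift_experiment.intro)
  have g: "inj_on (g n) {..<n}" if "n \<ge> 1" for n
    using assms(7)[OF that] unfolding center_outward_grid_def by (auto dest: bij_betw_imp_inj_on)
  interpret realize: rank_realization "local_experiment P \<theta>0 f0" "local_params F f0" origin_param D
      perms "\<lambda>n x. assignment n (g n) (Z n \<theta>0 x)"
    by (rule rank_realization_local[OF g LAN drift.D_prob[OF zero_score]])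
  have sub: "eventual_params (local_params F f0) \<subseteq> drift.params"
  proof
    fix p :: "('k, 'd) param" assume "p \<in> eventual_params (local_params F f0)"
    then obtain n where "p \<in> local_params F f0 n" unfolding eventual_params_def by (auto simp: eventually_at_top_linorder)
    then show "p \<in> drift.params" by (cases p) (auto simp: local_params_def)
  qed
  have lr: "realize.lr = drift.limlik" by (simp add: fun_eq_iff realize.lr_def drift.limlik_def)
  \<comment> \<open>The dense set is chosen among the parameters that are eventually admissible,
    since LAN has to hold for its members.\<close>
  obtain J where J: "countable J" "J \<subseteq> eventual_params (local_params F f0)"
    "\<And>p \<epsilon>. p \<in> eventual_params (local_params F f0) \<Longrightarrow> \<epsilon> > 0 \<Longrightarrow>
       \<exists>p'\<in>J. (\<integral>w. min 1 \<bar>drift.limlik p w - drift.limlik p' w\<bar> \<partial>D origin_param) < \<epsilon>"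
    using drift.limit_separable[OF assms(4) sub] by blast
  have weak: "algebras_weakly_converge (local_experiment P \<theta>0 f0) (local_params F f0) origin_param D
      (ranks_signs_algebra Z \<theta>0 g) (bridge_algebra f0 \<Omega> \<Delta>nuis)"
    unfolding algebras_weakly_converge_def
  proof (intro allI impI)
    fix \<xi> :: "'w \<Rightarrow> real" assume \<xi>: "\<xi> \<in> borel_measurable (bridge_algebra f0 \<Omega> \<Delta>nuis)"
    have "\<exists>\<phi>. rv_weakly_converges (local_experiment P \<theta>0 f0) (local_params F f0) origin_param D
        (\<lambda>n w. \<phi> n (assignment n (g n) (Z n \<theta>0 w))) \<xi>"
    proof (rule realize.realization[OF J(1,2)])
      show "\<exists>p'\<in>J. (\<integral>w. min 1 \<bar>realize.lr p w - realize.lr p' w\<bar> \<partial>D origin_param) < \<epsilon>"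
        if "p \<in> eventual_params (local_params F f0)" "\<epsilon> > 0" for p \<epsilon>
        unfolding lr by (rule J(3)[OF that])
      show "\<xi> \<in> borel_measurable (D origin_param)"
        by (rule measurable_from_subalg[OF drift.bridge_subalgebra \<xi>])
      fix m and js :: "nat \<Rightarrow> ('k, 'd) param" and H :: "(nat \<Rightarrow> real) \<times> real \<Rightarrow> real" and c :: real
      assume js: "\<And>i. i < m \<Longrightarrow> js i \<in> eventual_params (local_params F f0)"
        and H: "H \<in> borel_measurable borel" "\<And>z. \<bar>H z\<bar> \<le> c"
      have "js i \<in> drift.params" if "i < m" for i using js[OF that] sub by blast
      from drift.limit_integral[of m js, OF this \<xi> H]
      show "(\<integral>w. H (realize.V m js w, \<xi> w) \<partial>D origin_param)
          = (\<integral>y. (\<integral>w. H (realize.V m js w, y) \<partial>D origin_param) \<partial>(distr (D origin_param) borel \<xi>))"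
        unfolding realize.V_def lr .
    qed
    then obtain \<phi> where \<phi>: "rv_weakly_converges (local_experiment P \<theta>0 f0) (local_params F f0) origin_param D
        (\<lambda>n w. \<phi> n (assignment n (g n) (Z n \<theta>0 w))) \<xi>" ..
    show "\<exists>\<xi>n. (\<forall>n. \<xi>n n \<in> borel_measurable (ranks_signs_algebra Z \<theta>0 g n)) \<and>
        rv_weakly_converges (local_experiment P \<theta>0 f0) (local_params F f0) origin_param D \<xi>n \<xi>"
      by (intro exI conjI allI, rule measurable_rank_function[OF g]) (assumption, rule \<phi>)
  qed
  moreover have "(\<exists>S. minimal_sufficient (nuisance_experiment P F \<theta>0 f0 n) S \<and> boundedly_complete (nuisance_experiment P F \<theta>0 f0 n) S) \<and>
      maximal_ancillary (nuisance_experiment P F \<theta>0 f0 n) (ranks_signs_algebra Z \<theta>0 g n)" if n: "n \<ge> 1" for n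
  proof -
    interpret residual_experiment n "g n" "obs_space n" "Z n \<theta>0" "nuisance_experiment P F \<theta>0 f0 n" "P n \<theta>0 f0"
      by (rule residual_experiment_nuisance[OF n g[OF n]])
    show ?thesis
      using minimal_sufficient_symm boundedly_complete_symm
        maximal_ancillary_ranks[OF ranks_signs_algebra_sets[where g=g and n=n and Z=Z and ?\<theta>0.0=\<theta>0, OF g]] by blast
  qed
  ultimately show ?thesis unfolding strongly_maximal_ancillary_def by blast
qed

end
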